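(* For each $n$ let $p=p_n$ and let $\mathbf X_1,\ldots,\mathbf X_n$ be i.i.d. $N(\mathbf 0,\boldsymbol\Sigma)$ in $\mathbb R^p$ with $\Sigma_{ii}=1$ for all $i$. Assume (i) $p/n\to y\in(0,\infty)$; (ii) $\|\boldsymbol\Sigma\|\le C$ for a constant $C$ independent of $n$; (iii) the empirical spectral distribution of the matrix $\frac{6}{\pi}\arcsin(\boldsymbol\Sigma/2)=\big(\frac6\pi\arcsin(\Sigma_{ij}/2)\big)_{p\times p}$ converges to a non-random probability distribution $H$. Then, with probability 1, $F^{\boldsymbol\rho_n}$ converges to a probability distribution whose Stieltjes transform $m=m(z)$, $z\in\mathbb C^+$, satisfies $$m=\int\frac{1}{t(1-y-yzm)-z}\,dH(t).$$
   Context: Ranks $r_{ij}=1+\sum_{k\ne i}I(x_{kj}\le x_{ij})$; $\mathbf R=\big(\sqrt{12/(n^2-1)}\,(r_{ij}-\tfrac{n+1}{2})\big)_{n\times p}$; Spearman's rank correlation matrix $\boldsymbol\rho_n=\frac1n\mathbf R^\top\mathbf R$. $F^{\mathbf H}$ denotes the empirical spectral distribution of a Hermitian matrix $\mathbf H$. The Stieltjes transform of a distribution $F$ is $s_F(z)=\int\frac{1}{x-z}dF(x)$, $z\in\mathbb C^+$ (upper half-plane). $\|\cdot\|$ is the spectral norm. *)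

theory Defs
  imports "HOL-Probability.Probability" "Jordan_Normal_Form.Char_Poly"
begin

text \<open>Real p x p matrices are represented as functions nat => nat => real, entries
  with indices below p being relevant.\<close>

text \<open>Gaussian random vector N(0,S) in R^p (coordinates X 0, ..., X (p-1)), defined
  in the standard way: every linear combination a.X is N(0, a^T S a) (a point mass at
  0 when the variance vanishes).\<close>
definition gaussian_vec ::
  "'w measure \<Rightarrow> nat \<Rightarrow> (nat \<Rightarrow> nat \<Rightarrow> real) \<Rightarrow> (nat \<Rightarrow> 'w \<Rightarrow> real) \<Rightarrow> bool" where
  "gaussian_vec M p S X \<longleftrightarrow>
     (\<forall>j<p. X j \<in> borel_measurable M) \<and>
     (\<forall>a :: nat \<Rightarrow> real.
        let v = (\<Sum>i<p. \<Sum>j<p. a i * S i j * a j) in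
        (v > 0 \<and> distributed M lborel (\<lambda>\<omega>. \<Sum>j<p. a j * X j \<omega>)
                    (\<lambda>x. ennreal (normal_density 0 (sqrt v) x)))
        \<or> (v = 0 \<and> (AE \<omega> in M. (\<Sum>j<p. a j * X j \<omega>) = 0)))"

definition spec_norm_le :: "nat \<Rightarrow> (nat \<Rightarrow> nat \<Rightarrow> real) \<Rightarrow> real \<Rightarrow> bool" where
  "spec_norm_le p S C \<longleftrightarrow>
     (\<forall>a :: nat \<Rightarrow> real. sqrt (\<Sum>i<p. (\<Sum>j<p. S i j * a j)\<^sup>2) \<le> C * sqrt (\<Sum>j<p. (a j)\<^sup>2))"

definition cpoly :: "nat \<Rightarrow> (nat \<Rightarrow> nat \<Rightarrow> real) \<Rightarrow> real poly" where
  "cpoly p A = char_poly (mat p p (\<lambda>(i, j). A i j))"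

definition esd :: "nat \<Rightarrow> (nat \<Rightarrow> nat \<Rightarrow> real) \<Rightarrow> real \<Rightarrow> real" where
  "esd p A x = (\<Sum>t\<in>{t. poly (cpoly p A) t = 0 \<and> t \<le> x}. real (order t (cpoly p A))) / real p"

definition rank_of :: "nat \<Rightarrow> (nat \<Rightarrow> nat \<Rightarrow> real) \<Rightarrow> nat \<Rightarrow> nat \<Rightarrow> real" where
  "rank_of n x i j = 1 + real (card {k. k < n \<and> k \<noteq> i \<and> x k j \<le> x i j})"

definition rank_mat :: "nat \<Rightarrow> (nat \<Rightarrow> nat \<Rightarrow> real) \<Rightarrow> nat \<Rightarrow> nat \<Rightarrow> real" where
  "rank_mat n x i j = sqrt (12 / (real n ^ 2 - 1)) * (rank_of n x i j - (real n + 1) / 2)"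

definition spearman :: "nat \<Rightarrow> (nat \<Rightarrow> nat \<Rightarrow> real) \<Rightarrow> nat \<Rightarrow> nat \<Rightarrow> real" where
  "spearman n x j l = (1 / real n) * (\<Sum>i<n. rank_mat n x i j * rank_mat n x i l)"

definition stieltjes :: "real measure \<Rightarrow> complex \<Rightarrow> complex" where
  "stieltjes \<mu> z = (\<integral>t. 1 / (complex_of_real t - z) \<partial>\<mu>)"

end

theory Submission
  imports Defs "HOL-Probability.Probability" "HOL-Real_Asymp.Real_Asymp" "HOL-Complex_Analysis.Complex_Analysis"
begin

text \<open>Everything is done with resolvents at negative reals \<open>- l\<close>. With \<open>\<Phi>\<close> the standard normal
  distribution function, the scaled ranks are close in mean square to the grades
  \<open>sqrt 12 * (\<Phi> (X k j) - 1 / 2)\<close>, so the Spearman matrix may be replaced by the sample covariance matrix of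
  the grade vectors; these are independent over \<open>k\<close> and have covariance \<open>6 / pi * arcsin (\<Sigma> / 2)\<close> by Sheppard's
  formula. The Gaussian Poincare inequality makes quadratic forms in a grade vector concentrate, which is what the
  leave-one-out computation of the expected normalised trace needs: up to \<open>o(1)\<close> it solves the limiting equation,
  whose solution at \<open>- l\<close> is unique by monotonicity. McDiarmid's inequality and Borel-Cantelli give almost sure
  convergence at all negative rationals simultaneously; these values determine a distribution on \<open>[0, \<infinity>)\<close>, so
  tightness yields weak convergence, and the equation extends to the upper half-plane by the identity theorem.\<close>

section \<open>Bounded differences\<close>

text \<open>The grades are bounded nonlinear functions of dependent coordinates, so Marchenko-Pastur
  arguments for linear images of independent entries do not apply. What such arguments require of a
  row, that a quadratic form of order \<open>p\<close> in it has variance \<open>O(p)\<close>, is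
  supplied by the Poincare inequality. \<open>gaussian_vec\<close> gives only the laws of linear
  combinations, possibly degenerate, hence characteristic functions; so the inequality is proved for
  trigonometric polynomials and carried to \<Phi> by approximation. At \<open>- l\<close> the matrix
  \<open>A + l I\<close> is positive definite: estimates become inequalities between real quadratic
  forms, the leave-one-out denominators \<open>1 + a\<close> are at least 1, and the limiting
  equation is monotone. The factor \<open>1 - y - y z m\<close> at \<open>z = - l\<close> is the
  limit of the average of \<open>1 / (1 + a)\<close> over the rows. Ranks involve all rows at once,
  but changing one row moves every other rank by at most 1, so bounded differences handle them too.
  Nothing relates the rows for different \<open>n\<close>; summable tails are what gives almost sure
  statements.\<close>

lemma measurable_PiM_fun_upd:
  assumes "m \<in> I"
  shows "(\<lambda>(x, y). x(m := y)) \<in> Pi\<^sub>M I N \<Otimes>\<^sub>M N m \<rightarrow>\<^sub>M Pi\<^sub>M I N"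
  unfolding case_prod_beta
  by (rule measurable_fun_upd[where J = I]) (use assms in auto)

text \<open>Conditioning on all coordinates but \<open>m\<close>, in a form that stays on the full
  product space: the inner integral ignores the old value of \<open>x m\<close>, so both sides
  reduce to the product over \<open>I - {m}\<close>. It is used to average over one row while the
  leave-one-out resolvent is frozen.\<close>

lemma PiM_resample:
  fixes f :: "('i \<Rightarrow> 'a) \<Rightarrow> real"
  assumes "finite I" "m \<in> I" and prN: "\<And>i. prob_space (N i)"
    and [measurable]: "f \<in> borel_measurable (Pi\<^sub>M I N)"
    and B: "\<And>x. x \<in> space (Pi\<^sub>M I N) \<Longrightarrow> \<bar>f x\<bar> \<le> B"
  shows "(\<integral>x. f x \<partial>Pi\<^sub>M I N) = (\<integral>x. (\<integral>y. f (x(m := y)) \<partial>N m) \<partial>Pi\<^sub>M I N)"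
proof -
  interpret product_sigma_finite N by (simp add: product_sigma_finite_def prob_space_imp_sigma_finite prN)
  interpret PP: prob_space "Pi\<^sub>M I N" by (rule prob_space_PiM) (rule prN)
  interpret Nm: prob_space "N m" by (rule prN)
  let ?J = "I - {m}"
  have I: "I = insert m ?J" using assms by auto
  define g where "g x = (\<integral>y. f (x(m := y)) \<partial>N m)" for x
  have upd[measurable]: "(\<lambda>z. (fst z)(m := snd z)) \<in> Pi\<^sub>M I N \<Otimes>\<^sub>M N m \<rightarrow>\<^sub>M Pi\<^sub>M I N"
    using measurable_PiM_fun_upd[OF \<open>m \<in> I\<close>] by (simp add: case_prod_beta')
  have mg[measurable]: "g \<in> borel_measurable (Pi\<^sub>M I N)"
    unfolding g_def by measurable
  have bg: "\<bar>g x\<bar> \<le> B" if "x \<in> space (Pi\<^sub>M I N)" for x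
  proof -
    have sp: "x(m := y) \<in> space (Pi\<^sub>M I N)" if "y \<in> space (N m)" for y
      using \<open>x \<in> _\<close> that \<open>m \<in> I\<close> by (auto simp: space_PiM PiE_def extensional_def)
    have "(\<lambda>y. (x, y)) \<in> N m \<rightarrow>\<^sub>M Pi\<^sub>M I N \<Otimes>\<^sub>M N m" using that by simp
    from measurable_compose[OF this upd] have [measurable]: "(\<lambda>y. f (x(m := y))) \<in> borel_measurable (N m)" by simp
    have "integrable (N m) (\<lambda>y. f (x(m := y)))"
      by (rule Nm.integrable_const_bound[where B = B]) (use B sp in auto)
    then have "\<bar>g x\<bar> \<le> (\<integral>y. B \<partial>N m)" unfolding g_def
      by (intro integral_abs_bound[THEN order_trans] integral_mono) (use B sp in auto)
    then show ?thesis by (simp add: Nm.prob_space)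
  qed
  have if': "integrable (Pi\<^sub>M I N) f" by (rule PP.integrable_const_bound[where B = B]) (use B in auto)
  have ig: "integrable (Pi\<^sub>M I N) g" by (rule PP.integrable_const_bound[where B = B]) (use bg in auto)
  have "(\<integral>x. f x \<partial>Pi\<^sub>M I N) = (\<integral>x. g x \<partial>Pi\<^sub>M ?J N)"
    unfolding g_def by (subst I, rule product_integral_insert) (use assms if' I in auto)
  moreover have "(\<integral>x. g x \<partial>Pi\<^sub>M I N) = (\<integral>x. (\<integral>z. g (x(m:=z)) \<partial>N m) \<partial>Pi\<^sub>M ?J N)"
    by (subst I, rule product_integral_insert) (use assms ig I in auto)
  moreover have "g (x(m:=z)) = g x" for x z by (simp add: g_def)
  ultimately show ?thesis by (simp add: g_def Nm.prob_space)
qed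

text \<open>Induction over the coordinates. Integrating out \<open>m\<close> gives a function
  \<open>g\<close> with the same bound and the same differences on the remaining coordinates; for
  fixed remaining coordinates Hoeffding's lemma bounds the fluctuation of \<open>f\<close> around
  \<open>g\<close> and contributes one factor
  \<open>exp (s\<^sup>2 * c\<^sup>2 / 8)\<close>.\<close>

lemma mcdiarmid_exp:
  fixes f :: "('i \<Rightarrow> 'a) \<Rightarrow> real"
  assumes "finite I" and prN: "\<And>i. prob_space (N i)"
    and "f \<in> borel_measurable (Pi\<^sub>M I N)"
    and "\<And>x. x \<in> space (Pi\<^sub>M I N) \<Longrightarrow> \<bar>f x\<bar> \<le> B"
    and "\<And>x m y. x \<in> space (Pi\<^sub>M I N) \<Longrightarrow> m \<in> I \<Longrightarrow> y \<in> space (N m) \<Longrightarrow> \<bar>f (x(m := y)) - f x\<bar> \<le> c"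
    and "s > 0" "c \<ge> 0"
  shows "(\<integral>x. exp (s * (f x - (\<integral>x. f x \<partial>Pi\<^sub>M I N))) \<partial>Pi\<^sub>M I N) \<le> exp (s\<^sup>2 * (real (card I) * c\<^sup>2) / 8)"
  using assms(1,3-7)
proof (induction I arbitrary: f)
  case empty
  interpret PP: prob_space "Pi\<^sub>M {} N" by (rule prob_space_PiM) (rule prN)
  have "(\<integral>x. h x \<partial>Pi\<^sub>M {} N) = h (\<lambda>_. undefined)" for h :: "_ \<Rightarrow> real"
  proof -
    have "(\<integral>x. h x \<partial>Pi\<^sub>M {} N) = (\<integral>x. h (\<lambda>_. undefined) \<partial>Pi\<^sub>M {} N)"
      by (rule Bochner_Integration.integral_cong) (auto simp: space_PiM)
    then show ?thesis by (simp add: PP.prob_space)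
  qed
  then show ?case by simp
next
  case (insert m J f)
  note [measurable] = \<open>f \<in> borel_measurable (Pi\<^sub>M (insert m J) N)\<close>
  interpret product_sigma_finite N by (simp add: product_sigma_finite_def prob_space_imp_sigma_finite prN)
  interpret PP: prob_space "Pi\<^sub>M (insert m J) N" by (rule prob_space_PiM) (rule prN)
  interpret PJ: prob_space "Pi\<^sub>M J N" by (rule prob_space_PiM) (rule prN)
  interpret Nm: prob_space "N m" by (rule prN)
  define g where "g x = (\<integral>y. f (x(m := y)) \<partial>N m)" for x
  have upd[measurable]: "(\<lambda>z. (fst z)(m := snd z)) \<in> Pi\<^sub>M J N \<Otimes>\<^sub>M N m \<rightarrow>\<^sub>M Pi\<^sub>M (insert m J) N"
    by (rule measurable_fun_upd[where J = J]) auto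
  have mg[measurable]: "g \<in> borel_measurable (Pi\<^sub>M J N)"
    unfolding g_def by measurable
  have sp: "x(m := y) \<in> space (Pi\<^sub>M (insert m J) N)" if "x \<in> space (Pi\<^sub>M J N)" "y \<in> space (N m)" for x y
    using that by (auto simp: space_PiM PiE_def extensional_def)
  have ms[measurable]: "(\<lambda>y. f (x(m := y))) \<in> borel_measurable (N m)" if "x \<in> space (Pi\<^sub>M J N)" for x
  proof -
    have "(\<lambda>y. (x, y)) \<in> N m \<rightarrow>\<^sub>M Pi\<^sub>M J N \<Otimes>\<^sub>M N m" using that by simp
    from measurable_compose[OF this upd] show ?thesis by simp
  qed
  have isl: "integrable (N m) (\<lambda>y. f (x(m := y)))" if "x \<in> space (Pi\<^sub>M J N)" for x
    by (rule Nm.integrable_const_bound[where B = B]) (use ms that insert.prems(2) sp in auto)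
  have bg: "\<bar>g x\<bar> \<le> B" if "x \<in> space (Pi\<^sub>M J N)" for x
  proof -
    have "\<bar>g x\<bar> \<le> (\<integral>y. B \<partial>N m)" unfolding g_def
      by (rule integral_abs_bound[THEN order_trans], rule integral_mono)
        (use isl that insert.prems(2) sp in auto)
    then show ?thesis by (simp add: Nm.prob_space)
  qed
  have dg: "\<bar>g (x(j := y)) - g x\<bar> \<le> c" if x: "x \<in> space (Pi\<^sub>M J N)" and j: "j \<in> J" and y: "y \<in> space (N j)" for x j y
  proof -
    have x': "x(j := y) \<in> space (Pi\<^sub>M J N)" using x j y by (auto simp: space_PiM PiE_def extensional_def)
    have ne: "j \<noteq> m" using j insert.hyps by auto
    have "\<bar>g (x(j := y)) - g x\<bar> = \<bar>\<integral>z. f ((x(j := y))(m := z)) - f (x(m := z)) \<partial>N m\<bar>"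
      unfolding g_def using isl[OF x] isl[OF x'] by simp
    also have "\<dots> \<le> (\<integral>z. c \<partial>N m)"
      apply (rule integral_abs_bound[THEN order_trans], rule integral_mono)
      using isl[OF x] isl[OF x'] apply (auto)[2]
      using insert.prems(3)[OF sp[OF x], of _ j y] j y ne by (simp add: fun_upd_twist del: fun_upd_apply)
    finally show ?thesis by (simp add: Nm.prob_space)
  qed
  have if': "integrable (Pi\<^sub>M (insert m J) N) f"
    by (rule PP.integrable_const_bound[where B = B]) (use insert.prems(2) in auto)
  have Ef: "(\<integral>x. f x \<partial>Pi\<^sub>M (insert m J) N) = (\<integral>x. g x \<partial>Pi\<^sub>M J N)" (is "?E = ?Eg")
    unfolding g_def by (rule product_integral_insert) (use insert if' in auto)
  define K where "K = exp (s * (B + \<bar>?E\<bar>))"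
  have bexp: "\<bar>exp (s * (t - ?E))\<bar> \<le> K" if "\<bar>t\<bar> \<le> B" for t
    unfolding K_def using that \<open>s > 0\<close> by (auto intro!: mult_left_mono)
  have iexp: "integrable (Pi\<^sub>M (insert m J) N) (\<lambda>x. exp (s * (f x - ?E)))"
    by (rule PP.integrable_const_bound[where B = K]) (use insert.prems(2) bexp in auto)
  have igx: "integrable (Pi\<^sub>M J N) (\<lambda>x. exp (s * (g x - ?Eg)))"
    by (rule PJ.integrable_const_bound[where B = K]) (use bg bexp Ef in auto)
  have hoeff: "(\<integral>y. exp (s * (f (x(m:=y)) - g x)) \<partial>N m) \<le> exp (s\<^sup>2 * c\<^sup>2 / 8)"
    if x: "x \<in> space (Pi\<^sub>M J N)" for x
  proof -
    obtain y0 where y0: "y0 \<in> space (N m)" using Nm.not_empty by auto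
    \<comment> \<open>Any two values of the slice differ by at most \<open>c\<close>, so it lies in
      an interval of length \<open>c\<close> starting at its infimum. An interval centred at one
      value would have length \<open>2 * c\<close> and cost a factor 4 in the exponent.\<close>
    define a where "a = (INF y\<in>space (N m). f (x(m := y)))"
    have bb: "bdd_below ((\<lambda>y. f (x(m := y))) ` space (N m))"
      by (rule bdd_belowI2[where m = "-B"]) (use insert.prems(2)[OF sp[OF x]] abs_le_D2 in \<open>smt (verit)\<close>)
    have "f (x(m := y)) \<in> {a..a + c}" if y: "y \<in> space (N m)" for y
    proof -
      have "a \<le> f (x(m := y))" unfolding a_def by (rule cINF_lower[OF bb y])
      moreover have "f (x(m := y)) - c \<le> a" unfolding a_def
      proof (rule cINF_greatest)
        fix z assume z: "z \<in> space (N m)"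
        show "f (x(m := y)) - c \<le> f (x(m := z))"
          using insert.prems(3)[OF sp[OF x z], of m y] y unfolding fun_upd_upd by fastforce
      qed (use y in auto)
      ultimately show ?thesis by auto
    qed
    then interpret H: interval_bounded_random_variable "N m" "\<lambda>y. f (x(m:=y))" a "a + c"
      by unfold_locales (use ms[OF x] in auto)
    have "(\<integral>\<^sup>+y. ennreal (exp (s * (f (x(m:=y)) - g x))) \<partial>N m) \<le> ennreal (exp (s\<^sup>2 * c\<^sup>2 / 8))"
      using H.Hoeffdings_lemma_nn_integral[OF \<open>s > 0\<close>] by (simp add: g_def)
    then show ?thesis
      by (subst integral_eq_nn_integral) (use ms[OF x] in \<open>auto intro!: enn2real_leI\<close>)
  qed
  have "(\<integral>x. exp (s * (f x - ?E)) \<partial>Pi\<^sub>M (insert m J) N)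
     = (\<integral>x. \<integral>y. exp (s * (f (x(m:=y)) - ?E)) \<partial>N m \<partial>Pi\<^sub>M J N)"
    by (rule product_integral_insert) (use insert iexp in auto)
  also have "\<dots> = (\<integral>x. exp (s * (g x - ?Eg)) * (\<integral>y. exp (s * (f (x(m:=y)) - g x)) \<partial>N m) \<partial>Pi\<^sub>M J N)"
  proof (rule Bochner_Integration.integral_cong[OF refl])
    fix x
    have "exp (s * (f (x(m:=y)) - ?E)) = exp (s * (g x - ?Eg)) * exp (s * (f (x(m:=y)) - g x))" for y
      by (simp add: Ef algebra_simps flip: exp_add)
    then show "(\<integral>y. exp (s * (f (x(m:=y)) - ?E)) \<partial>N m) = exp (s * (g x - ?Eg)) * (\<integral>y. exp (s * (f (x(m:=y)) - g x)) \<partial>N m)"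
      by simp
  qed
  also have "\<dots> \<le> (\<integral>x. exp (s * (g x - ?Eg)) * exp (s\<^sup>2 * c\<^sup>2 / 8) \<partial>Pi\<^sub>M J N)"
    by (rule integral_mono') (use igx hoeff in auto)
  also have "\<dots> = (\<integral>x. exp (s * (g x - ?Eg)) \<partial>Pi\<^sub>M J N) * exp (s\<^sup>2 * c\<^sup>2 / 8)" by simp
  also have "\<dots> \<le> exp (s\<^sup>2 * (real (card J) * c\<^sup>2) / 8) * exp (s\<^sup>2 * c\<^sup>2 / 8)"
    by (intro mult_right_mono insert.IH mg bg dg insert.prems) auto
  also have "\<dots> = exp (s\<^sup>2 * (real (card (insert m J)) * c\<^sup>2) / 8)"
    using insert.hyps by (simp add: algebra_simps add_divide_distrib flip: exp_add)
  finally show ?case .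
qed

lemma mcdiarmid_tail:
  fixes f :: "('i \<Rightarrow> 'a) \<Rightarrow> real"
  assumes "finite I" "I \<noteq> {}" and prN: "\<And>i. prob_space (N i)"
    and [measurable]: "f \<in> borel_measurable (Pi\<^sub>M I N)"
    and B: "\<And>x. x \<in> space (Pi\<^sub>M I N) \<Longrightarrow> \<bar>f x\<bar> \<le> B"
    and D: "\<And>x m y. x \<in> space (Pi\<^sub>M I N) \<Longrightarrow> m \<in> I \<Longrightarrow> y \<in> space (N m) \<Longrightarrow> \<bar>f (x(m := y)) - f x\<bar> \<le> c"
    and c: "c > 0" and e: "\<epsilon> > 0"
  shows "measure (Pi\<^sub>M I N) {x \<in> space (Pi\<^sub>M I N). \<epsilon> \<le> f x - (\<integral>x. f x \<partial>Pi\<^sub>M I N)}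
    \<le> exp (- 2 * \<epsilon>\<^sup>2 / (real (card I) * c\<^sup>2))"
proof -
  interpret PP: prob_space "Pi\<^sub>M I N" by (rule prob_space_PiM) (rule prN)
  let ?E = "\<integral>x. f x \<partial>Pi\<^sub>M I N"
  define V where "V = real (card I) * c\<^sup>2"
  have V: "V > 0" using assms by (auto simp: V_def card_gt_0_iff)
  \<comment> \<open>Minimiser of the Chernoff exponent
    \<open>s\<^sup>2 * V / 8 - s * \<epsilon>\<close>.\<close>
  define s where "s = 4 * \<epsilon> / V"
  have s: "s > 0" using e V by (simp add: s_def)
  have ie: "integrable (Pi\<^sub>M I N) (\<lambda>x. exp (s * (f x - ?E)))"
  proof (rule PP.integrable_const_bound[where B = "exp (s * (B + \<bar>?E\<bar>))"], rule AE_I2)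
    fix x assume "x \<in> space (Pi\<^sub>M I N)"
    then have "f x - ?E \<le> B + \<bar>?E\<bar>" using B[of x] by simp
    then show "norm (exp (s * (f x - ?E))) \<le> exp (s * (B + \<bar>?E\<bar>))" using s by simp
  qed simp
  have "measure (Pi\<^sub>M I N) {x \<in> space (Pi\<^sub>M I N). exp (s * \<epsilon>) \<le> exp (s * (f x - ?E))}
      \<le> (\<integral>x. exp (s * (f x - ?E)) \<partial>Pi\<^sub>M I N) / exp (s * \<epsilon>)"
    by (rule integral_Markov_inequality_measure[where A = "{}"]) (use ie in auto)
  also have "\<dots> \<le> exp (s\<^sup>2 * V / 8) / exp (s * \<epsilon>)"
    unfolding V_def by (intro divide_right_mono mcdiarmid_exp[OF assms(1) prN _ B D s]) (use c in simp_all)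
  also have "\<dots> = exp (- 2 * \<epsilon>\<^sup>2 / V)"
    using V by (simp add: s_def power2_eq_square field_simps flip: exp_diff)
  finally show ?thesis using s by (simp add: V_def mult_le_cancel_left_pos)
qed

text \<open>Turns bounds on the exponential moments at \<open>s\<close> and \<open>- s\<close> into
  a bound on the second moment. Quadratic Taylor bound for \<open>\<bar>x\<bar>\<close>, linear one
  for \<open>- \<bar>x\<bar>\<close>.\<close>

lemma square_le_exp_sum: "x\<^sup>2 / 2 \<le> exp x + exp (- x) - (2::real)"
proof -
  have "exp \<bar>x\<bar> + exp (- \<bar>x\<bar>) \<ge> 2 + x\<^sup>2 / 2"
    using exp_lower_Taylor_quadratic[of "\<bar>x\<bar>"] exp_ge_add_one_self[of "- \<bar>x\<bar>"] by simp
  then show ?thesis by (cases "x \<ge> 0") auto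
qed

text \<open>Read off from the exponential moments of \<open>f\<close> and \<open>- f\<close> at the
  scale \<open>s = 1 / sqrt V\<close>, where each is at most \<open>exp (1 / 8) \<le> 5 / 4\<close>.
  The constant is not sharp; only the order \<open>card I * c\<^sup>2\<close> matters below.\<close>

lemma mcdiarmid_variance:
  fixes f :: "('i \<Rightarrow> 'a) \<Rightarrow> real"
  assumes "finite I" "I \<noteq> {}" and prN: "\<And>i. prob_space (N i)"
    and [measurable]: "f \<in> borel_measurable (Pi\<^sub>M I N)"
    and B: "\<And>x. x \<in> space (Pi\<^sub>M I N) \<Longrightarrow> \<bar>f x\<bar> \<le> B"
    and D: "\<And>x m y. x \<in> space (Pi\<^sub>M I N) \<Longrightarrow> m \<in> I \<Longrightarrow> y \<in> space (N m) \<Longrightarrow> \<bar>f (x(m := y)) - f x\<bar> \<le> c"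
    and c: "c > 0"
  shows "(\<integral>x. (f x - (\<integral>x. f x \<partial>Pi\<^sub>M I N))\<^sup>2 \<partial>Pi\<^sub>M I N) \<le> real (card I) * c\<^sup>2"
proof -
  interpret PP: prob_space "Pi\<^sub>M I N" by (rule prob_space_PiM) (rule prN)
  let ?E = "\<integral>x. f x \<partial>Pi\<^sub>M I N"
  define V where "V = real (card I) * c\<^sup>2"
  have V: "V > 0" using assms by (auto simp: V_def card_gt_0_iff)
  define s where "s = 1 / sqrt V"
  have s: "s > 0" and s2: "s\<^sup>2 * V = 1" using V by (auto simp: s_def power_divide)
  have ie: "integrable (Pi\<^sub>M I N) (\<lambda>x. exp (t * (f x - ?E)))" for t
  proof (rule PP.integrable_const_bound[where B = "exp (\<bar>t\<bar> * (B + \<bar>?E\<bar>))"], rule AE_I2)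
    fix x assume "x \<in> space (Pi\<^sub>M I N)"
    then have "\<bar>f x - ?E\<bar> \<le> B + \<bar>?E\<bar>" using B[of x] by simp
    then have "\<bar>t\<bar> * \<bar>f x - ?E\<bar> \<le> \<bar>t\<bar> * (B + \<bar>?E\<bar>)" by (rule mult_left_mono) simp
    moreover have "t * (f x - ?E) \<le> \<bar>t\<bar> * \<bar>f x - ?E\<bar>" by (simp only: abs_ge_self flip: abs_mult)
    ultimately have "t * (f x - ?E) \<le> \<bar>t\<bar> * (B + \<bar>?E\<bar>)" by linarith
    then show "norm (exp (t * (f x - ?E))) \<le> exp (\<bar>t\<bar> * (B + \<bar>?E\<bar>))" by simp
  qed simp
  have "(\<integral>x. (s * (f x - ?E))\<^sup>2 / 2 \<partial>Pi\<^sub>M I N)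
     \<le> (\<integral>x. exp (s * (f x - ?E)) + exp ((-s) * (f x - ?E)) - 2 \<partial>Pi\<^sub>M I N)"
  proof (rule integral_mono')
    show "integrable (Pi\<^sub>M I N) (\<lambda>x. exp (s * (f x - ?E)) + exp ((-s) * (f x - ?E)) - 2)"
      using ie[of s] ie[of "-s"] by auto
  next
    fix x
    show "(s * (f x - ?E))\<^sup>2 / 2 \<le> exp (s * (f x - ?E)) + exp ((-s) * (f x - ?E)) - 2"
      using square_le_exp_sum[of "s * (f x - ?E)"] by simp
    then show "0 \<le> exp (s * (f x - ?E)) + exp ((-s) * (f x - ?E)) - 2"
      by (rule order_trans[rotated]) simp
  qed
  also have "\<dots> = (\<integral>x. exp (s * (f x - ?E)) \<partial>Pi\<^sub>M I N) + (\<integral>x. exp (s * ((- f x) - (\<integral>x. - f x \<partial>Pi\<^sub>M I N))) \<partial>Pi\<^sub>M I N) - 2"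
  proof -
    have "(\<lambda>x. exp (s * ((- f x) - (\<integral>x. - f x \<partial>Pi\<^sub>M I N)))) = (\<lambda>x. exp ((- s) * (f x - ?E)))"
      by (rule ext) (simp add: right_diff_distrib)
    moreover have "(\<integral>x. exp (s * (f x - ?E)) + exp ((-s) * (f x - ?E)) - 2 \<partial>Pi\<^sub>M I N)
       = (\<integral>x. exp (s * (f x - ?E)) \<partial>Pi\<^sub>M I N) + (\<integral>x. exp ((- s) * (f x - ?E)) \<partial>Pi\<^sub>M I N) - 2"
      by (subst Bochner_Integration.integral_diff[OF Bochner_Integration.integrable_add[OF ie[of s] ie[of "-s"]] PP.integrable_const],
          subst Bochner_Integration.integral_add[OF ie[of s] ie[of "-s"]]) (simp only: lebesgue_integral_const PP.prob_space scaleR_one)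
    ultimately show ?thesis by simp
  qed
  also have "\<dots> \<le> exp (s\<^sup>2 * V / 8) + exp (s\<^sup>2 * V / 8) - 2"
    unfolding V_def
  proof (intro add_mono diff_mono)
    show "(\<integral>x. exp (s * (f x - ?E)) \<partial>Pi\<^sub>M I N) \<le> exp (s\<^sup>2 * (real (card I) * c\<^sup>2) / 8)"
      by (rule mcdiarmid_exp[OF assms(1) prN _ B D s]) (use c in simp_all)
    show "(\<integral>x. exp (s * (- f x - (\<integral>x. - f x \<partial>Pi\<^sub>M I N))) \<partial>Pi\<^sub>M I N) \<le> exp (s\<^sup>2 * (real (card I) * c\<^sup>2) / 8)"
    proof (rule mcdiarmid_exp[OF assms(1) prN])
      show "\<bar>- f (x(m := y)) - - f x\<bar> \<le> c" if "x \<in> space (Pi\<^sub>M I N)" "m \<in> I" "y \<in> space (N m)" for x m y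
        using D[OF that] by linarith
      show "\<bar>- f x\<bar> \<le> B" if "x \<in> space (Pi\<^sub>M I N)" for x using B[OF that] by linarith
    qed (use s c in simp_all)
  qed simp
  also have "\<dots> \<le> 1/2"
  proof -
    have "s\<^sup>2 * V / 8 = 1 / 8" by (simp only: s2)
    moreover have "exp (1/8 :: real) \<le> 5/4" using exp_bound[of "1/8"] by (simp add: power2_eq_square)
    ultimately show ?thesis by simp
  qed
  finally have "(\<integral>x. s\<^sup>2 * (f x - ?E)\<^sup>2 / 2 \<partial>Pi\<^sub>M I N) \<le> 1/2" by (simp only: power_mult_distrib)
  then have "s\<^sup>2 * (\<integral>x. (f x - ?E)\<^sup>2 \<partial>Pi\<^sub>M I N) \<le> s\<^sup>2 * V"
    unfolding s2 by (simp only: integral_mult_right_zero integral_divide_zero)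
  then show ?thesis using s unfolding V_def by (simp only: mult_le_cancel_left_pos zero_less_power)
qed

section \<open>The standard normal distribution function and the arcsine law\<close>

text \<open>Primitives are written as averages \<open>x * f (x * v)\<close> over \<open>v\<close> in
  this probability space. This treats both signs of \<open>x\<close> alike and makes Fubini and
  dominated convergence directly applicable.\<close>

definition U01 :: "real measure" where "U01 = restrict_space lborel {0..1}"

lemma prob_space_U01: "prob_space U01"
  by (rule prob_spaceI) (simp add: U01_def space_restrict_space emeasure_restrict_space)

lemma space_U01[simp]: "space U01 = {0..1}" by (simp add: U01_def space_restrict_space)

lemma borel_measurable_U01[measurable (raw)]: "f \<in> borel_measurable borel \<Longrightarrow> f \<in> borel_measurable U01"
  unfolding U01_def by (intro measurable_restrict_space1) simp

lemma measurable_id_U01[measurable]: "(\<lambda>x. x) \<in> borel_measurable U01"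
  "fst \<in> borel_measurable (U01 \<Otimes>\<^sub>M M)" "snd \<in> borel_measurable (M \<Otimes>\<^sub>M U01)"
proof -
  show id: "(\<lambda>x. x) \<in> borel_measurable U01" by simp
  show "fst \<in> borel_measurable (U01 \<Otimes>\<^sub>M M)" using measurable_compose[OF measurable_fst[of U01 M] id] by simp
  show "snd \<in> borel_measurable (M \<Otimes>\<^sub>M U01)" using measurable_compose[OF measurable_snd[of M U01] id] by simp
qed

lemma integral_U01:
  assumes "\<And>x. 0 \<le> x \<Longrightarrow> x \<le> 1 \<Longrightarrow> (F has_real_derivative f x) (at x)"
    and "\<And>x. 0 \<le> x \<Longrightarrow> x \<le> 1 \<Longrightarrow> isCont f x"
  shows "(\<integral>v. f v \<partial>U01) = F 1 - F 0"
proof -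
  have "(\<integral>v. f v \<partial>U01) = (\<integral>v. f v * indicator {0..1} v \<partial>lborel)"
    unfolding U01_def by (subst integral_restrict_space) (auto simp: mult.commute)
  also have "\<dots> = F 1 - F 0"
    by (rule integral_FTC_Icc_real) (use assms in auto)
  finally show ?thesis .
qed

lemma integral_U01_scale:
  assumes "\<And>y. (F has_real_derivative f y) (at y)" and "\<And>y. isCont f y"
  shows "(\<integral>v. x * f (x * v) \<partial>U01) = F x - F (0 :: real)"
proof -
  have "(\<integral>v. x * f (x * v) \<partial>U01) = F (x * 1) - F (x * 0)"
  proof (rule integral_U01)
    fix a :: real
    have "((\<lambda>v. F (x * v)) has_real_derivative f (x * a) * x) (at a)"
      by (rule DERIV_chain2[OF assms(1)]) (auto intro!: derivative_eq_intros)
    then show "((\<lambda>v. F (x * v)) has_real_derivative x * f (x * a)) (at a)" by (simp only: mult.commute)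
    have "isCont (\<lambda>v. f (x * v)) a"
      by (rule isCont_o2[where g = f]) (auto intro!: continuous_intros assms(2))
    then show "isCont (\<lambda>v. x * f (x * v)) a" by (intro continuous_intros)
  qed
  then show ?thesis by simp
qed

section \<open>The centred normal distribution function\<close>

text \<open>\<open>cPhi x = \<Phi>(x) - 1/2\<close>, see \<open>cPhi_cdf\<close>.\<close>
definition cPhi :: "real \<Rightarrow> real" where "cPhi x = (LBINT v=0..x. std_normal_density v)"

lemma isCont_std_normal_density: "isCont std_normal_density x"
  unfolding std_normal_density_def[abs_def] by (intro continuous_intros) auto

lemma cPhi_deriv: "(cPhi has_real_derivative std_normal_density x) (at x)"
proof -
  define a b where "a = min 0 x - 1" and "b = max 0 x + 1"
  have ab: "a \<le> 0" "0 \<le> b" "a < x" "x < b" by (auto simp: a_def b_def)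
  have "((\<lambda>u. LBINT y=ereal 0..u. std_normal_density y) has_vector_derivative std_normal_density x) (at x within {a..b})"
    by (rule interval_integral_FTC2) (use ab isCont_std_normal_density in \<open>auto intro!: continuous_at_imp_continuous_on\<close>)
  moreover have "at x within {a..b} = at x" using ab by (intro at_within_interior) auto
  ultimately show ?thesis
    by (simp add: cPhi_def[abs_def] zero_ereal_def has_real_derivative_iff_has_vector_derivative)
qed

lemma cPhi_0: "cPhi 0 = 0" by (simp add: cPhi_def flip: zero_ereal_def)

lemma isCont_cPhi: "isCont cPhi x" using cPhi_deriv by (rule DERIV_isCont)

lemma cPhi_measurable[measurable]: "cPhi \<in> borel_measurable borel"
  by (intro borel_measurable_continuous_onI continuous_at_imp_continuous_on ballI isCont_cPhi)

lemma cPhi_odd: "cPhi (- x) = - cPhi x"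
proof -
  have "((\<lambda>x. cPhi x + cPhi (- x)) has_real_derivative 0) (at x)" for x
    by (rule derivative_eq_intros cPhi_deriv DERIV_chain2[OF cPhi_deriv] refl)+ (simp add: std_normal_density_def)
  from DERIV_isconst_all[OF allI[OF this], of x 0] show ?thesis by (simp add: cPhi_0)
qed

text \<open>The distribution function and \<open>cPhi\<close> have equal increments, hence differ by
  a constant. Since \<open>cPhi\<close> is odd, \<open>F x + F (- x)\<close> is constant, and its
  limit 1 at infinity makes the constant \<open>1 / 2\<close>.\<close>

lemma cPhi_cdf: "measure std_normal_distribution {..x} = 1 / 2 + cPhi x"
proof -
  interpret N: real_distribution std_normal_distribution by (rule real_dist_normal_dist)
  define F where "F x = measure std_normal_distribution {..x}" for x :: real
  have FD: "F b - F a = cPhi b - cPhi a" if "a \<le> b" for a b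
  proof -
    have "{..b} = {..a} \<union> {a<..b}" using that by auto
    then have "F b = F a + measure std_normal_distribution {a<..b}"
      unfolding F_def by (simp only:, subst N.finite_measure_Union) auto
    also have "measure std_normal_distribution {a<..b} = (\<integral>x. std_normal_density x * indicator {a<..b} x \<partial>lborel)"
    proof -
      have "measure std_normal_distribution {a<..b} = (\<integral>x. indicator {a<..b} x \<partial>std_normal_distribution)" by simp
      also have "\<dots> = (\<integral>x. std_normal_density x *\<^sub>R indicator {a<..b} x \<partial>lborel)"
        by (rule integral_density) auto
      finally show ?thesis by simp
    qed
    also have "\<dots> = (\<integral>x. std_normal_density x * indicator {a..b} x \<partial>lborel)"
      by (intro integral_cong_AE) (auto intro!: eventually_mono[OF AE_lborel_singleton[of a]] simp: indicator_def)
    also have "\<dots> = cPhi b - cPhi a"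
      by (rule integral_FTC_Icc_real) (use that cPhi_deriv isCont_std_normal_density in auto)
    finally show ?thesis by simp
  qed
  have c: "F x - cPhi x = F 0" for x
    using FD[of 0 x] FD[of x 0] by (cases "0 \<le> x") (auto simp: cPhi_0)
  have lt: "(F \<longlongrightarrow> 1) at_top" and lb: "(F \<longlongrightarrow> 0) at_bot"
    using N.cdf_lim_at_top_prob N.cdf_lim_at_bot by (simp_all add: cdf_def[abs_def] F_def[abs_def])
  have "((\<lambda>x. F x + F (- x)) \<longlongrightarrow> 1 + 0) at_top"
    by (intro tendsto_add lt filterlim_compose[OF lb] filterlim_uminus_at_bot_at_top)
  moreover have "F x + F (- x) = 2 * F 0" for x using c[of x] c[of "- x"] by (simp add: cPhi_odd)
  ultimately have "2 * F 0 = 1" by (simp add: tendsto_const_iff)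
  then show ?thesis using c[of x] by (simp add: F_def)
qed

lemma cPhi_bound: "\<bar>cPhi x\<bar> \<le> 1 / 2"
proof -
  interpret N: real_distribution std_normal_distribution by (rule real_dist_normal_dist)
  have "0 \<le> 1/2 + cPhi x" "1/2 + cPhi x \<le> 1"
    unfolding cPhi_cdf[symmetric] by (auto intro: N.prob_le_1)
  then show ?thesis by linarith
qed

section \<open>Fourier representation of the normal distribution function\<close>

abbreviation "NN \<equiv> std_normal_distribution"

text \<open>Real part of the characteristic function. Read from right to left it writes the Gaussian
  density, up to \<open>sqrt (2 * pi)\<close>, as a Gaussian average of cosines.\<close>

lemma std_normal_cos: "(\<integral>t. cos (t * y) \<partial>NN) = exp (- y\<^sup>2 / 2)"
proof -
  interpret N: real_distribution NN by (rule real_dist_normal_dist)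
  have "(\<integral>t. iexp (y * t) \<partial>NN) = complex_of_real (exp (- y\<^sup>2 / 2))"
    using char_std_normal_distribution by (simp add: char_def fun_eq_iff)
  then have "Re (\<integral>t. iexp (y * t) \<partial>NN) = exp (- y\<^sup>2 / 2)" by (simp only: Re_complex_of_real)
  moreover have "Re (\<integral>t. iexp (y * t) \<partial>NN) = (\<integral>t. Re (iexp (y * t)) \<partial>NN)"
    by (rule integral_Re[symmetric], rule N.integrable_const_bound[where B = 1]) auto
  ultimately show ?thesis by (simp add: Re_exp mult.commute)
qed

text \<open>\<open>sin (t * x) / t\<close>, continuously extended to \<open>t = 0\<close>; \<open>cPhi\<close> is a Gaussian mixture of these functions.\<close>
definition sx :: "real \<Rightarrow> real \<Rightarrow> real" where "sx t x = (\<integral>v. x * cos (t * (x * v)) \<partial>U01)"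

lemma sx_eq: "t \<noteq> 0 \<Longrightarrow> sx t x = sin (t * x) / t"
  unfolding sx_def
  by (subst integral_U01[where F = "\<lambda>v. sin (t * (x * v)) / t"])
    (auto intro!: derivative_eq_intros)

lemma sx_measurable[measurable]: "(\<lambda>z. sx (fst z) (snd z)) \<in> borel_measurable (borel \<Otimes>\<^sub>M borel)"
proof -
  interpret U: prob_space U01 by (rule prob_space_U01)
  show ?thesis unfolding sx_def by measurable
qed

lemma sx_bound: "\<bar>sx t x\<bar> \<le> \<bar>x\<bar>"
proof -
  interpret U: prob_space U01 by (rule prob_space_U01)
  have i: "integrable U01 (\<lambda>v. x * cos (t * (x * v)))"
    by (rule U.integrable_const_bound[where B = "\<bar>x\<bar>"]) (auto simp: abs_mult intro!: mult_left_le)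
  have "\<bar>sx t x\<bar> \<le> (\<integral>v. \<bar>x\<bar> \<partial>U01)" unfolding sx_def
    by (rule order_trans[OF integral_abs_bound], rule integral_mono)
      (use i in \<open>auto simp: abs_mult intro!: mult_left_le\<close>)
  then show ?thesis using U.prob_space by simp
qed

text \<open>The density is its own Fourier transform up to a constant; inserting this into the
  average over \<open>U01\<close> and exchanging the integrals leaves \<open>sx\<close>. Products of
  two values of \<open>cPhi\<close> thereby reduce to expectations of products of sines, which are
  explicit for Gaussian vectors.\<close>

lemma cPhi_fourier: "cPhi x = (\<integral>t. sx t x \<partial>NN) / sqrt (2 * pi)"
proof -
  interpret N: real_distribution NN by (rule real_dist_normal_dist)
  interpret U: prob_space U01 by (rule prob_space_U01)
  interpret UN: pair_prob_space U01 NN ..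
  have "cPhi x = (\<integral>v. x * std_normal_density (x * v) \<partial>U01)"
    using integral_U01_scale[OF cPhi_deriv isCont_std_normal_density, of x] by (simp add: cPhi_0)
  also have "\<dots> = (\<integral>v. (\<integral>t. x * cos (t * (x * v)) \<partial>NN) / sqrt (2 * pi) \<partial>U01)"
    unfolding integral_mult_right_zero std_normal_cos by (simp only: std_normal_density_def) simp
  also have "\<dots> = (\<integral>v. (\<integral>t. x * cos (t * (x * v)) \<partial>NN) \<partial>U01) / sqrt (2 * pi)"
    by (rule integral_divide_zero)
  also have "(\<integral>v. (\<integral>t. x * cos (t * (x * v)) \<partial>NN) \<partial>U01) = (\<integral>t. (\<integral>v. x * cos (t * (x * v)) \<partial>U01) \<partial>NN)"
    by (rule UN.Fubini_integral[symmetric], rule UN.P.integrable_const_bound[where B = "\<bar>x\<bar>"])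
      (auto simp: abs_mult split_beta' intro!: mult_left_le AE_I2)
  finally show ?thesis by (simp add: sx_def)
qed

section \<open>Gaussian integrals behind Sheppard's formula\<close>

lemma integral_exp_quadratic:
  fixes q c :: real
  assumes q: "q > 0"
  shows "integrable lborel (\<lambda>t. exp (- q * t\<^sup>2 + c * t))" (is ?I)
    "(\<integral>t. exp (- q * t\<^sup>2 + c * t) \<partial>lborel) = sqrt (pi / q) * exp (c\<^sup>2 / (4 * q))" (is ?E)
proof -
  define \<sigma> where "\<sigma> = 1 / sqrt (2 * q)"
  have s: "\<sigma> > 0" and s2: "\<sigma>\<^sup>2 = 1 / (2 * q)" using q by (simp_all add: \<sigma>_def power_divide)
  have e: "exp (- q * t\<^sup>2 + c * t) = sqrt (pi / q) * exp (c\<^sup>2 / (4 * q)) * normal_density (c / (2 * q)) \<sigma> t" for t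
  proof -
    have "- (t - c / (2 * q))\<^sup>2 / (2 * \<sigma>\<^sup>2) = - q * (t - c / (2 * q))\<^sup>2"
      unfolding s2 using q by simp
    moreover have "- q * t\<^sup>2 + c * t = c\<^sup>2 / (4 * q) + - q * (t - c / (2 * q))\<^sup>2"
      using q by (simp add: power2_eq_square field_simps)
    ultimately have "- q * t\<^sup>2 + c * t = c\<^sup>2 / (4 * q) + - (t - c / (2 * q))\<^sup>2 / (2 * \<sigma>\<^sup>2)" by (simp only:)
    moreover have "sqrt (2 * pi * \<sigma>\<^sup>2) = sqrt (pi / q)" using q by (simp add: s2)
    ultimately have "exp (- q * t\<^sup>2 + c * t) = exp (c\<^sup>2 / (4 * q)) * exp (- (t - c / (2 * q))\<^sup>2 / (2 * \<sigma>\<^sup>2))"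
      and "sqrt (2 * pi * \<sigma>\<^sup>2) = sqrt (pi / q)" by (simp_all only: exp_add)
    then show ?thesis using q unfolding normal_density_def by simp
  qed
  show ?I unfolding e using integrable_normal_density[OF s] by simp
  show ?E unfolding e using integral_normal_density[OF s] by simp
qed

text \<open>The condition on \<open>q\<close> is integrability: the density contributes another
  \<open>1 / 2\<close> to the quadratic coefficient.\<close>

lemma std_normal_quadratic:
  fixes q c :: real
  assumes q: "q > -1/2"
  shows "(\<integral>t. exp (- q * t\<^sup>2 + c * t) \<partial>NN) = exp (c\<^sup>2 / (4 * (q + 1/2))) / sqrt (2 * q + 1)"
    and "integrable NN (\<lambda>t. exp (- q * t\<^sup>2 + c * t))"
proof -
  have e: "std_normal_density t *\<^sub>R exp (- q * t\<^sup>2 + c * t) = exp (- (q + 1/2) * t\<^sup>2 + c * t) / sqrt (2 * pi)" for t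
    unfolding std_normal_density_def by (simp add: exp_add[symmetric] field_simps)
  have "(\<integral>t. exp (- q * t\<^sup>2 + c * t) \<partial>NN) = (\<integral>t. exp (- (q + 1/2) * t\<^sup>2 + c * t) / sqrt (2 * pi) \<partial>lborel)"
    unfolding e[symmetric] by (rule integral_density) auto
  also have "\<dots> = sqrt (pi / (q + 1/2)) * exp (c\<^sup>2 / (4 * (q + 1/2))) / sqrt (2 * pi)"
    using integral_exp_quadratic[of "q + 1/2" c] q by simp
  also have "sqrt (pi / (q + 1/2)) = sqrt (2 * pi) / sqrt (2 * q + 1)"
    using q by (simp add: real_sqrt_divide[symmetric] field_simps)
  finally show "(\<integral>t. exp (- q * t\<^sup>2 + c * t) \<partial>NN) = exp (c\<^sup>2 / (4 * (q + 1/2))) / sqrt (2 * q + 1)" by simp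
  have "integrable lborel (\<lambda>t. std_normal_density t *\<^sub>R exp (- q * t\<^sup>2 + c * t))"
    unfolding e using integral_exp_quadratic(1)[of "q + 1/2" c] q by simp
  then show "integrable NN (\<lambda>t. exp (- q * t\<^sup>2 + c * t))"
    by (subst integrable_density) auto
qed

text \<open>The value is the derivative of \<open>arcsin (\<rho> / 2)\<close>, which is where the
  arcsine comes from. The inner integral is Gaussian with \<open>q = 1 / 2\<close>, and leaves a
  Gaussian integral in \<open>s\<close> with \<open>q = 1 / 2 - \<rho>\<^sup>2 / 4\<close>.\<close>

lemma integral_cosh_normal:
  assumes r: "\<bar>\<rho>\<bar> \<le> 1"
  shows "(\<integral>s. (\<integral>t. exp (- (s\<^sup>2 + t\<^sup>2) / 2) * cosh (s * t * \<rho>) \<partial>NN) \<partial>NN) = 1 / sqrt (4 - \<rho>\<^sup>2)"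
proof -
  have inner: "(\<integral>t. exp (- (s\<^sup>2 + t\<^sup>2) / 2) * cosh (s * t * \<rho>) \<partial>NN) = exp (- (1/2 - \<rho>\<^sup>2/4) * s\<^sup>2 + 0 * s) / sqrt 2" for s
  proof -
    have e: "exp (- (s\<^sup>2 + t\<^sup>2) / 2) * cosh (s * t * \<rho>)
      = exp (- s\<^sup>2 / 2) / 2 * (exp (- (1/2) * t\<^sup>2 + (s * \<rho>) * t) + exp (- (1/2) * t\<^sup>2 + (- s * \<rho>) * t))" for t
    proof -
      have 1: "exp (- (s\<^sup>2 + t\<^sup>2) / 2) = exp (- s\<^sup>2 / 2) * exp (- (1/2) * t\<^sup>2)"
        by (simp add: exp_add[symmetric] add_divide_distrib)
      have 2: "exp (- (1/2) * t\<^sup>2 + (s * \<rho>) * t) = exp (- (1/2) * t\<^sup>2) * exp (s * t * \<rho>)"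
        "exp (- (1/2) * t\<^sup>2 + (- s * \<rho>) * t) = exp (- (1/2) * t\<^sup>2) * exp (- (s * t * \<rho>))"
        unfolding exp_add[symmetric] by (simp_all add: mult_ac)
      show ?thesis unfolding 1 2 cosh_def by (simp add: field_simps)
    qed
    have "(\<integral>t. exp (- (s\<^sup>2 + t\<^sup>2) / 2) * cosh (s * t * \<rho>) \<partial>NN)
      = exp (- s\<^sup>2 / 2) / 2 * (exp ((s * \<rho>)\<^sup>2 / 4) / sqrt 2 + exp ((- s * \<rho>)\<^sup>2 / 4) / sqrt 2)"
      unfolding e integral_mult_right_zero
      using std_normal_quadratic[of "1/2" "s * \<rho>"] std_normal_quadratic[of "1/2" "- s * \<rho>"] by simp
    also have "\<dots> = exp (- s\<^sup>2 / 2) * exp ((s * \<rho>)\<^sup>2 / 4) / sqrt 2" by (simp add: field_simps)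
    also have "exp (- s\<^sup>2 / 2) * exp ((s * \<rho>)\<^sup>2 / 4) = exp (- (1/2 - \<rho>\<^sup>2/4) * s\<^sup>2 + 0 * s)"
      by (simp add: exp_add[symmetric] power_mult_distrib algebra_simps)
    finally show ?thesis .
  qed
  have r2: "\<rho>\<^sup>2 \<le> 1" using r by (simp add: abs_square_le_1)
  have "(\<integral>s. exp (- (1/2 - \<rho>\<^sup>2/4) * s\<^sup>2 + 0 * s) / sqrt 2 \<partial>NN) = 1 / sqrt (2 * (1/2 - \<rho>\<^sup>2/4) + 1) / sqrt 2"
    using std_normal_quadratic(1)[of "1/2 - \<rho>\<^sup>2/4" 0] r2 by simp
  also have "\<dots> = 1 / sqrt (4 - \<rho>\<^sup>2)" by (simp add: real_sqrt_mult[symmetric] field_simps)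
  finally show ?thesis unfolding inner .
qed

lemma sinh_integral: "s \<noteq> 0 \<Longrightarrow> t \<noteq> 0 \<Longrightarrow> sinh (s * t * r) / (s * t) = (\<integral>v. r * cosh (s * t * (r * v)) \<partial>U01)"
  by (subst integral_U01_scale[where F = "\<lambda>v. sinh (s * t * v) / (s * t)" and f = "\<lambda>v. cosh (s * t * v)"])
    (auto intro!: derivative_eq_intros continuous_intros)

text \<open>The exponent of \<open>cosh\<close> is at most the mean of the squares, so the Gaussian
  weight absorbs it. This is the majorant for the exchanges of integrals in Sheppard's
  formula.\<close>

lemma gauss_cosh_bound: "\<bar>\<rho>\<bar> \<le> 1 \<Longrightarrow> \<bar>exp (- (s\<^sup>2 + t\<^sup>2) / 2) * cosh (s * t * \<rho>)\<bar> \<le> (1 :: real)"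
proof -
  assume r: "\<bar>\<rho>\<bar> \<le> 1"
  have "\<bar>s * t * \<rho>\<bar> \<le> \<bar>s * t\<bar> * 1" unfolding abs_mult[of "s * t"] by (rule mult_left_mono[OF r]) simp
  also have "\<bar>s * t\<bar> * 1 \<le> (s\<^sup>2 + t\<^sup>2) / 2"
    using sum_squares_bound[of "\<bar>s\<bar>" "\<bar>t\<bar>"] by (simp add: abs_mult power2_eq_square)
  finally have b: "s * t * \<rho> \<le> (s\<^sup>2 + t\<^sup>2) / 2" "- (s * t * \<rho>) \<le> (s\<^sup>2 + t\<^sup>2) / 2" by linarith+
  have "cosh (s * t * \<rho>) \<le> exp ((s\<^sup>2 + t\<^sup>2) / 2)" using b
    using add_mono[OF exp_le_cancel_iff[THEN iffD2, OF b(1)] exp_le_cancel_iff[THEN iffD2, OF b(2)]] by (simp add: cosh_def)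
  then have "exp (- (s\<^sup>2 + t\<^sup>2) / 2) * cosh (s * t * \<rho>) \<le> exp (- (s\<^sup>2 + t\<^sup>2) / 2) * exp ((s\<^sup>2 + t\<^sup>2) / 2)"
    by (rule mult_left_mono) simp
  also have "\<dots> = 1" by (simp only: minus_divide_left[symmetric] exp_minus) simp
  finally show ?thesis by (simp add: abs_mult cosh_real_nonneg)
qed

lemma arcsin_integral:
  assumes r: "\<bar>r\<bar> \<le> 1"
  shows "(\<integral>v. r / sqrt (4 - (r * v)\<^sup>2) \<partial>U01) = arcsin (r / 2)"
proof -
  have b: "\<bar>r * v\<bar> \<le> 1" if "0 \<le> v" "v \<le> 1" for v
    using that r by (simp add: abs_mult mult_le_one)
  have b2: "(r * v)\<^sup>2 < 4" if "0 \<le> v" "v \<le> 1" for v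
    using b[OF that] by (metis abs_square_le_1 le_less_trans one_less_numeral_iff semiring_norm(76))
  show ?thesis
  proof (subst integral_U01[where F = "\<lambda>v. arcsin (r * v / 2)"])
    fix v :: real assume v: "0 \<le> v" "v \<le> 1"
    have "sqrt (1 - (r * v / 2)\<^sup>2) = sqrt (4 - (r * v)\<^sup>2) / 2"
      using real_sqrt_divide[of "4 - (r * v)\<^sup>2" 4] by (simp add: power_divide diff_divide_distrib)
    then have "inverse (sqrt (1 - (r * v / 2)\<^sup>2)) * (r / 2) = r / sqrt (4 - (r * v)\<^sup>2)" using b2[OF v]
      by (simp add: field_simps)
    moreover have "((\<lambda>v. arcsin (r * v / 2)) has_real_derivative inverse (sqrt (1 - (r * v / 2)\<^sup>2)) * (r / 2)) (at v)"
      by (rule DERIV_chain2[OF DERIV_arcsin]) (use b[OF v] in \<open>auto intro!: derivative_eq_intros simp: abs_le_iff\<close>)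
    ultimately show "((\<lambda>v. arcsin (r * v / 2)) has_real_derivative r / sqrt (4 - (r * v)\<^sup>2)) (at v)" by simp
    show "isCont (\<lambda>v. r / sqrt (4 - (r * v)\<^sup>2)) v"
      using b2[OF v] by (intro continuous_intros) auto
  qed simp
qed

text \<open>Once the integral over \<open>v\<close> is moved outside, the Gaussian integrals are
  those of \<open>integral_cosh_normal\<close> with correlation \<open>r * v\<close>; what remains
  is the derivative of \<open>arcsin (r * v / 2)\<close> integrated over
  \<open>[0, 1]\<close>.\<close>

lemma sheppard_integral:
  assumes r: "\<bar>r\<bar> \<le> 1"
  shows "(\<integral>s. (\<integral>t. (\<integral>v. r * (exp (- (s\<^sup>2 + t\<^sup>2) / 2) * cosh (s * t * (r * v))) \<partial>U01) \<partial>NN) \<partial>NN) = arcsin (r / 2)"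
proof -
  interpret N: real_distribution NN by (rule real_dist_normal_dist)
  interpret U: prob_space U01 by (rule prob_space_U01)
  interpret UN: pair_prob_space U01 NN ..
  define h where "h s t v = r * (exp (- (s\<^sup>2 + t\<^sup>2) / 2) * cosh (s * t * (r * v)))" for s t v
  have [measurable]: "(cosh :: real \<Rightarrow> real) \<in> borel_measurable borel"
    by (intro borel_measurable_continuous_onI continuous_intros)
  have hb: "\<bar>h s t v\<bar> \<le> 1" if "v \<in> {0..1}" for s t v
  proof -
    have "\<bar>r * v\<bar> \<le> 1" using that r by (simp add: abs_mult mult_le_one)
    from mult_mono[OF r gauss_cosh_bound[OF this, of s t]] show ?thesis by (simp add: h_def abs_mult)
  qed
  have m3: "(\<lambda>z. h (f z) (g z) (k z)) \<in> borel_measurable M"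
    if [measurable]: "f \<in> borel_measurable M" "g \<in> borel_measurable M" "k \<in> borel_measurable M" for f g k and M :: "'m measure"
    unfolding h_def by measurable
  have s1: "(\<integral>t. (\<integral>v. h s t v \<partial>U01) \<partial>NN) = (\<integral>v. (\<integral>t. h s t v \<partial>NN) \<partial>U01)" for s
    by (rule UN.Fubini_integral, rule UN.P.integrable_const_bound[where B = 1])
      (use hb in \<open>auto simp: split_beta' space_pair_measure intro!: AE_I2 m3\<close>)
  have hbi: "\<bar>\<integral>t. h s t v \<partial>NN\<bar> \<le> 1" if "v \<in> {0..1}" for s v
  proof -
    have "integrable NN (\<lambda>t. h s t v)"
      by (rule N.integrable_const_bound[where B = 1]) (use hb[OF that] in \<open>auto intro!: m3\<close>)
    then have "\<bar>\<integral>t. h s t v \<partial>NN\<bar> \<le> (\<integral>t. 1 \<partial>NN)"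
      by (intro order_trans[OF integral_abs_bound integral_mono]) (use hb[OF that] in auto)
    then show ?thesis using N.prob_space by simp
  qed
  have s2: "(\<integral>s. (\<integral>v. (\<integral>t. h s t v \<partial>NN) \<partial>U01) \<partial>NN) = (\<integral>v. (\<integral>s. (\<integral>t. h s t v \<partial>NN) \<partial>NN) \<partial>U01)"
    apply (rule UN.Fubini_integral, rule UN.P.integrable_const_bound[where B = 1])
    subgoal using hbi by (auto simp: split_beta' space_pair_measure intro!: AE_I2)
    subgoal unfolding split_beta' by (rule N.borel_measurable_lebesgue_integral) (auto simp: split_beta' intro!: m3)
    done
  have "(\<integral>s. (\<integral>t. h s t v \<partial>NN) \<partial>NN) = r / sqrt (4 - (r * v)\<^sup>2)" if "v \<in> {0..1}" for v
  proof -
    have "\<bar>r * v\<bar> \<le> 1" using that r by (simp add: abs_mult mult_le_one)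
    then show ?thesis using integral_cosh_normal[of "r * v"] by (simp add: h_def)
  qed
  then have "(\<integral>v. (\<integral>s. (\<integral>t. h s t v \<partial>NN) \<partial>NN) \<partial>U01) = (\<integral>v. r / sqrt (4 - (r * v)\<^sup>2) \<partial>U01)"
    by (intro Bochner_Integration.integral_cong) auto
  also have "\<dots> = arcsin (r / 2)" by (rule arcsin_integral[OF r])
  finally have "(\<integral>s. (\<integral>t. (\<integral>v. h s t v \<partial>U01) \<partial>NN) \<partial>NN) = arcsin (r / 2)" unfolding s1 s2 .
  then show ?thesis by (simp only: h_def)
qed

text \<open>Trigonometric approximations of \<^term>\<open>cPhi\<close>: the Gaussian density is replaced by the characteristic
  function \<open>cos (x / sqrt n) ^ n\<close> of a normalised sum of signs.\<close>
definition gN' :: "nat \<Rightarrow> real \<Rightarrow> real" where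
  "gN' n x = cos (x / sqrt (real n)) ^ n / sqrt (2 * pi)"

definition freqN :: "nat \<Rightarrow> nat \<Rightarrow> real" where
  "freqN n k = (real n - 2 * real k) / sqrt (real n)"

definition coefN :: "nat \<Rightarrow> nat \<Rightarrow> real" where
  "coefN n k = real (n choose k) / 2 ^ n / sqrt (2 * pi)"

definition gN :: "nat \<Rightarrow> real \<Rightarrow> real" where
  "gN n x = (\<Sum>k\<le>n. coefN n k / freqN n k * sin (freqN n k * x))"

text \<open>\<open>n - 2 * k\<close> is odd when \<open>n\<close> is. With no zero frequency,
  termwise integration of \<open>gN'\<close> creates no linear term and \<open>gN\<close> remains a
  finite sum of sines; this is why only odd \<open>n\<close> are used.\<close>

lemma freqN_nonzero: "odd n \<Longrightarrow> freqN n k \<noteq> 0"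
proof
  assume n: "odd n" and "freqN n k = 0"
  then have "real n = real (2 * k)" by (auto simp: freqN_def)
  then have "n = 2 * k" by (simp only: of_nat_eq_iff)
  then show False using n by simp
qed

lemma gN'_sum: "gN' n x = (\<Sum>k\<le>n. coefN n k * cos (freqN n k * x))"
proof -
  define \<theta> where "\<theta> = x / sqrt (real n)"
  have "complex_of_real (cos \<theta>) = cis \<theta> / 2 + cis (- \<theta>) / 2" by (simp add: complex_eq_iff)
  then have "complex_of_real (cos \<theta> ^ n) = (cis \<theta> / 2 + cis (- \<theta>) / 2) ^ n" by (simp only: of_real_power)
  also have "\<dots> = (\<Sum>k\<le>n. of_nat (n choose k) * (cis (- \<theta>) / 2) ^ k * (cis \<theta> / 2) ^ (n - k))"
    by (subst add.commute) (rule binomial_ring)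
  also have "\<dots> = (\<Sum>k\<le>n. of_real (real (n choose k) / 2 ^ n) * cis ((real n - 2 * real k) * \<theta>))"
  proof (rule sum.cong[OF refl])
    fix k assume "k \<in> {..n}"
    then have k: "k \<le> n" by simp
    have p2: "(2::complex) ^ k * 2 ^ (n - k) = 2 ^ n" using k by (simp flip: power_add)
    have "(cis (- \<theta>) / 2) ^ k * (cis \<theta> / 2) ^ (n - k) = cis ((real n - 2 * real k) * \<theta>) / 2 ^ n"
    proof -
      have "cis (- \<theta>) ^ k * cis \<theta> ^ (n - k) = cis (real k * - \<theta> + real (n - k) * \<theta>)"
        by (simp only: Complex.DeMoivre cis_mult)
      also have "real k * - \<theta> + real (n - k) * \<theta> = (real n - 2 * real k) * \<theta>"
        using k by (simp add: of_nat_diff algebra_simps)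
      finally show ?thesis by (simp only: power_divide times_divide_times_eq p2)
    qed
    then show "of_nat (n choose k) * (cis (- \<theta>) / 2) ^ k * (cis \<theta> / 2) ^ (n - k) = of_real (real (n choose k) / 2 ^ n) * cis ((real n - 2 * real k) * \<theta>)"
      by (simp add: mult.assoc)
  qed
  finally have "Re (complex_of_real (cos \<theta> ^ n)) = Re (\<Sum>k\<le>n. of_real (real (n choose k) / 2 ^ n) * cis ((real n - 2 * real k) * \<theta>))"
    by simp
  then have "cos \<theta> ^ n = (\<Sum>k\<le>n. real (n choose k) / 2 ^ n * cos ((real n - 2 * real k) * \<theta>))" by simp
  then show ?thesis
    by (simp add: gN'_def \<theta>_def sum_divide_distrib coefN_def freqN_def)
qed

lemma gN_deriv: "odd n \<Longrightarrow> (gN n has_real_derivative gN' n x) (at x)"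
  unfolding gN_def[abs_def] gN'_sum
  by (auto intro!: derivative_eq_intros simp: freqN_nonzero mult.commute)

lemma gN_0: "gN n 0 = 0" by (simp add: gN_def)

text \<open>Uniform in \<open>n\<close>: this is the gradient bound that survives the limit in the
  Poincare inequality.\<close>

lemma gN'_bound: "\<bar>gN' n x\<bar> \<le> 1 / sqrt (2 * pi)"
  by (auto simp: gN'_def abs_divide power_abs intro!: divide_right_mono power_le_one)

lemma gN_eq_integral: "odd n \<Longrightarrow> gN n x = (\<integral>v. x * gN' n (x * v) \<partial>U01)"
proof -
  assume n: "odd n"
  have [simp]: "isCont (gN' n) y" for y
    unfolding gN'_def[abs_def] using n by (intro continuous_intros) (auto simp: odd_pos)
  show ?thesis
    using integral_U01_scale[OF gN_deriv[OF n], of x] by (simp add: gN_0)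
qed

lemma gN'_measurable[measurable]: "gN' n \<in> borel_measurable borel"
  unfolding gN'_def[abs_def] by measurable

lemma gN_bound: assumes "odd n" shows "\<bar>gN n x\<bar> \<le> \<bar>x\<bar> / sqrt (2 * pi)"
proof -
  interpret U: prob_space U01 by (rule prob_space_U01)
  have b: "\<bar>x * gN' n (x * v)\<bar> \<le> \<bar>x\<bar> / sqrt (2 * pi)" for v
    using mult_left_mono[OF gN'_bound[of n "x * v"], of "\<bar>x\<bar>"] by (simp add: abs_mult)
  have "integrable U01 (\<lambda>v. x * gN' n (x * v))"
    by (rule U.integrable_const_bound[where B = "\<bar>x\<bar> / sqrt (2 * pi)"]) (use b in auto)
  then have "\<bar>gN n x\<bar> \<le> (\<integral>v. \<bar>x\<bar> / sqrt (2 * pi) \<partial>U01)"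
    unfolding gN_eq_integral[OF assms]
    by (intro order_trans[OF integral_abs_bound integral_mono]) (use b in auto)
  then show ?thesis using U.prob_space by simp
qed

lemma cos_power_tendsto: "(\<lambda>n. cos (x / sqrt (real n)) ^ n) \<longlonglongrightarrow> exp (- x\<^sup>2 / 2)"
proof -
  have "(\<lambda>n. cos (x / sqrt (real n)) ^ n) \<longlonglongrightarrow> exp (- x\<^sup>2 / 2)" if "x > 0" for x :: real
  proof -
    have "(\<lambda>n. cos (x / sqrt (real n)) ^ n) \<longlonglongrightarrow> exp (- (x * x / 2))" using that by real_asymp
    then show ?thesis by (simp add: power2_eq_square)
  qed
  from this[of x] this[of "- x"] show ?thesis by (cases x "0::real" rule: linorder_cases) auto
qed

lemma gN_tendsto: "(\<lambda>m. gN (2 * m + 1) x) \<longlonglongrightarrow> cPhi x"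
proof -
  interpret U: prob_space U01 by (rule prob_space_U01)
  have sub: "strict_mono (\<lambda>m::nat. 2 * m + 1)" by (rule strict_monoI) simp
  have lim: "(\<lambda>m. x * gN' (2 * m + 1) (x * v)) \<longlonglongrightarrow> x * std_normal_density (x * v)" for v
  proof -
    have "(\<lambda>n. x * gN' n (x * v)) \<longlonglongrightarrow> x * std_normal_density (x * v)"
      unfolding gN'_def std_normal_density_def
      using tendsto_mult[OF tendsto_const[of x] tendsto_divide[OF cos_power_tendsto[of "x * v"] tendsto_const[of "sqrt (2 * pi)"]]] by simp
    from LIMSEQ_subseq_LIMSEQ[OF this sub] show ?thesis by (simp add: o_def)
  qed
  have "(\<lambda>m. \<integral>v. x * gN' (2 * m + 1) (x * v) \<partial>U01) \<longlonglongrightarrow> (\<integral>v. x * std_normal_density (x * v) \<partial>U01)"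
  proof (rule integral_dominated_convergence[where w = "\<lambda>_. \<bar>x\<bar> / sqrt (2 * pi)"])
    show "AE v in U01. norm (x * gN' (2 * m + 1) (x * v)) \<le> \<bar>x\<bar> / sqrt (2 * pi)" for m
      using mult_left_mono[OF gN'_bound[of "2 * m + 1" "x * v" for v], of "\<bar>x\<bar>"] by (auto simp: abs_mult)
  qed (use lim in auto)
  moreover have "(\<integral>v. x * std_normal_density (x * v) \<partial>U01) = cPhi x"
    using integral_U01_scale[OF cPhi_deriv isCont_std_normal_density, of x] by (simp add: cPhi_0)
  ultimately show ?thesis by (simp add: gN_eq_integral)
qed

declare borel_measurable_U01[measurable del] measurable_id_U01[measurable del]

section \<open>Resolvents of positive semidefinite matrices\<close>

definition dot :: "nat \<Rightarrow> (nat \<Rightarrow> real) \<Rightarrow> (nat \<Rightarrow> real) \<Rightarrow> real" where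
  "dot p x y = (\<Sum>i<p. x i * y i)"

definition mv :: "nat \<Rightarrow> (nat \<Rightarrow> nat \<Rightarrow> real) \<Rightarrow> (nat \<Rightarrow> real) \<Rightarrow> nat \<Rightarrow> real" where
  "mv p A x i = (\<Sum>j<p. A i j * x j)"

definition tr :: "nat \<Rightarrow> (nat \<Rightarrow> nat \<Rightarrow> real) \<Rightarrow> real" where
  "tr p A = (\<Sum>i<p. A i i)"

definition psd :: "nat \<Rightarrow> (nat \<Rightarrow> nat \<Rightarrow> real) \<Rightarrow> bool" where
  "psd p A \<longleftrightarrow> (\<forall>i<p. \<forall>j<p. A i j = A j i) \<and> (\<forall>x. 0 \<le> dot p x (mv p A x))"

definition shift_mat :: "nat \<Rightarrow> (nat \<Rightarrow> nat \<Rightarrow> real) \<Rightarrow> real \<Rightarrow> real mat" where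
  "shift_mat p A l = mat p p (\<lambda>(i, j). A i j + (if i = j then l else 0))"

text \<open>Cramer's rule for the inverse of \<open>A + l I\<close>, the resolvent at the spectral
  parameter \<open>- l\<close>. As an explicit rational function of the entries it is visibly
  measurable in a random matrix. It is a genuine inverse when \<open>A\<close> is positive
  semidefinite and \<open>l > 0\<close>.\<close>

definition res :: "nat \<Rightarrow> (nat \<Rightarrow> nat \<Rightarrow> real) \<Rightarrow> real \<Rightarrow> nat \<Rightarrow> nat \<Rightarrow> real" where
  "res p A l i j = cofactor (shift_mat p A l) j i / Determinant.det (shift_mat p A l)"

lemma shift_mat_carrier[simp]: "shift_mat p A l \<in> carrier_mat p p"
  by (simp add: shift_mat_def)

lemma psd_sym: "psd p A \<Longrightarrow> i < p \<Longrightarrow> j < p \<Longrightarrow> A i j = A j i"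
  by (auto simp: psd_def)

lemma psd_nonneg: "psd p A \<Longrightarrow> 0 \<le> dot p x (mv p A x)"
  by (auto simp: psd_def)

lemma dot_commute: "dot p x y = dot p y x" by (simp add: dot_def mult.commute)

lemma dot_self_nonneg: "0 \<le> dot p x x" by (auto simp: dot_def intro!: sum_nonneg)

lemma dot_self_zero: "dot p x x = 0 \<longleftrightarrow> (\<forall>i<p. x i = 0)"
  unfolding dot_def by (subst sum_nonneg_eq_0_iff) auto

lemma dot_CS: "(dot p x y)\<^sup>2 \<le> dot p x x * dot p y y"
  unfolding dot_def using Cauchy_Schwarz_ineq_sum[of x y "{..<p}"] by (simp add: power2_eq_square)

lemma dot_cong: "(\<And>i. i < p \<Longrightarrow> x i = x' i) \<Longrightarrow> (\<And>i. i < p \<Longrightarrow> y i = y' i) \<Longrightarrow> dot p x y = dot p x' y'"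
  by (simp add: dot_def)

lemma dot_mv_sym:
  assumes "\<And>i j. i < p \<Longrightarrow> j < p \<Longrightarrow> A i j = A j i"
  shows "dot p x (mv p A y) = dot p y (mv p A x)"
proof -
  have "dot p x (mv p A y) = (\<Sum>i<p. \<Sum>j<p. x i * (A i j * y j))"
    by (simp add: dot_def mv_def sum_distrib_left)
  also have "\<dots> = (\<Sum>j<p. \<Sum>i<p. x i * (A i j * y j))" by (rule sum.swap)
  also have "\<dots> = (\<Sum>j<p. \<Sum>i<p. y j * (A j i * x i))"
    using assms by (intro sum.cong refl) auto
  also have "\<dots> = dot p y (mv p A x)" by (simp add: dot_def mv_def sum_distrib_left)
  finally show ?thesis .
qed

lemma dot_add_left: "dot p (\<lambda>i. x i + y i) z = dot p x z + dot p y z"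
  and dot_scale_left: "dot p (\<lambda>i. c * x i) z = c * dot p x z"
  and dot_add_right: "dot p z (\<lambda>i. x i + y i) = dot p z x + dot p z y"
  and dot_scale_right: "dot p z (\<lambda>i. c * x i) = c * dot p z x"
  and dot_diff_left: "dot p (\<lambda>i. x i - y i) z = dot p x z - dot p y z"
  and dot_diff_right: "dot p z (\<lambda>i. x i - y i) = dot p z x - dot p z y"
  by (simp_all add: dot_def algebra_simps sum.distrib sum_distrib_left sum_subtractf)

lemma mv_add: "mv p A (\<lambda>i. x i + y i) i = mv p A x i + mv p A y i"
  and mv_diff: "mv p A (\<lambda>i. x i - y i) i = mv p A x i - mv p A y i"
  and mv_scale: "mv p A (\<lambda>i. c * x i) i = c * mv p A x i"
  by (simp_all add: mv_def algebra_simps sum.distrib sum_distrib_left sum_subtractf)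

lemma psd_CS:
  assumes "psd p A"
  shows "(dot p x (mv p A y))\<^sup>2 \<le> dot p x (mv p A x) * dot p y (mv p A y)"
proof -
  define a b c where "a = dot p x (mv p A x)" and "b = dot p x (mv p A y)" and "c = dot p y (mv p A y)"
  have q: "0 \<le> s\<^sup>2 * a + 2 * s * t * b + t\<^sup>2 * c" for s t
  proof -
    have "0 \<le> dot p (\<lambda>i. s * x i + t * y i) (mv p A (\<lambda>i. s * x i + t * y i))"
      by (rule psd_nonneg[OF assms])
    also have "\<dots> = s * (s * a + t * b) + t * (s * dot p y (mv p A x) + t * c)"
      unfolding mv_add[abs_def] mv_scale by (simp add: dot_add_left dot_add_right dot_scale_left dot_scale_right a_def b_def c_def algebra_simps)
    also have "dot p y (mv p A x) = b" unfolding b_def by (rule dot_mv_sym) (rule psd_sym[OF assms])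
    finally show ?thesis by (simp add: power2_eq_square algebra_simps)
  qed
  have a0: "a \<ge> 0" unfolding a_def by (rule psd_nonneg[OF assms])
  have c0: "c \<ge> 0" unfolding c_def by (rule psd_nonneg[OF assms])
  show ?thesis
  proof (cases "a = 0")
    case True
    have "b = 0"
    proof (rule ccontr)
      assume "b \<noteq> 0"
      \<comment> \<open>For \<open>a = 0\<close> the quadratic form is affine in \<open>s\<close>;
        this choice of \<open>s\<close>, with \<open>t = 1\<close>, gives it the value
        \<open>- 1\<close>.\<close>
      then have "2 * (- (c + 1) / (2 * b)) * 1 * b = - (c + 1)" by (simp add: field_simps)
      then have "0 \<le> - (c + 1) + c" using q[of "- (c + 1) / (2 * b)" 1] unfolding True power_one mult_zero_right by linarith
      then show False by simp
    qed
    then show ?thesis using True by (simp add: a_def b_def c_def)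
  next
    case False
    have "0 \<le> b\<^sup>2 * a - 2 * b * a * b + a\<^sup>2 * c" using q[of "- b" a] by simp
    then have "0 \<le> a * (a * c - b\<^sup>2)" by (simp add: power2_eq_square algebra_simps)
    then have "b\<^sup>2 \<le> a * c" using False a0 by (simp add: zero_le_mult_iff)
    then show ?thesis by (simp add: a_def b_def c_def)
  qed
qed

section \<open>The resolvent: inverse, resolvent identity and norm bounds\<close>

lemma shift_det_nonzero:
  assumes A: "psd p A" and l: "l > 0"
  shows "Determinant.det (shift_mat p A l) \<noteq> 0"
proof
  assume "Determinant.det (shift_mat p A l) = 0"
  then obtain v where v: "v \<in> carrier_vec p" "v \<noteq> 0\<^sub>v p" and e: "shift_mat p A l *\<^sub>v v = 0\<^sub>v p"
    using det_0_iff_vec_prod_zero[OF shift_mat_carrier] by blast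
  define w where "w i = vec_index v i" for i
  have "mv p A w i + l * w i = 0" if i: "i < p" for i
  proof -
    have "0 = vec_index (shift_mat p A l *\<^sub>v v) i" using e i by simp
    also have "\<dots> = (\<Sum>j<p. (A i j + (if i = j then l else 0)) * w j)"
      using i v by (simp add: shift_mat_def scalar_prod_def w_def atLeast0LessThan)
    also have "\<dots> = mv p A w i + l * w i"
      using i by (simp add: distrib_right sum.distrib mv_def if_distrib[of "\<lambda>x. x * _"] sum.delta cong: if_cong)
    finally show ?thesis by simp
  qed
  then have "dot p w (\<lambda>i. mv p A w i + l * w i) = 0" by (simp add: dot_def)
  then have "dot p w (mv p A w) + l * dot p w w = 0" by (simp add: dot_add_right dot_scale_right)
  then have "l * dot p w w \<le> 0" using psd_nonneg[OF A, of w] by linarith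
  then have "dot p w w = 0" using l dot_self_nonneg[of p w] by (simp add: mult_le_0_iff)
  then have "v = 0\<^sub>v p" using v by (intro eq_vecI) (auto simp: dot_self_zero w_def)
  then show False using v by simp
qed

lemma res_right:
  assumes "psd p A" "l > 0" "i < p" "j < p"
  shows "(\<Sum>k<p. (A i k + (if i = k then l else 0)) * res p A l k j) = (if i = j then 1 else 0)"
proof -
  let ?M = "shift_mat p A l"
  have "(?M * adj_mat ?M) $$ (i, j) = Determinant.det ?M * (if i = j then 1 else 0)"
    using adj_mat(2)[of ?M p] assms by simp
  moreover have "(?M * adj_mat ?M) $$ (i, j) = (\<Sum>k<p. (A i k + (if i = k then l else 0)) * cofactor ?M j k)"
    using assms by (simp add: scalar_prod_def adj_mat_def shift_mat_def atLeast0LessThan)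
  ultimately have e: "(\<Sum>k<p. (A i k + (if i = k then l else 0)) * cofactor ?M j k) = Determinant.det ?M * (if i = j then 1 else 0)"
    by simp
  have "(\<Sum>k<p. (A i k + (if i = k then l else 0)) * res p A l k j)
     = (\<Sum>k<p. (A i k + (if i = k then l else 0)) * cofactor ?M j k) / Determinant.det ?M"
    by (simp add: res_def sum_divide_distrib)
  then show ?thesis using e shift_det_nonzero[OF assms(1,2)] by simp
qed

lemma res_left:
  assumes "psd p A" "l > 0" "i < p" "j < p"
  shows "(\<Sum>k<p. res p A l i k * (A k j + (if k = j then l else 0))) = (if i = j then 1 else 0)"
proof -
  let ?M = "shift_mat p A l"
  have "(adj_mat ?M * ?M) $$ (i, j) = Determinant.det ?M * (if i = j then 1 else 0)"
    using adj_mat(3)[of ?M p] assms by simp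
  moreover have "(adj_mat ?M * ?M) $$ (i, j) = (\<Sum>k<p. cofactor ?M k i * (A k j + (if k = j then l else 0)))"
    using assms by (simp add: scalar_prod_def adj_mat_def shift_mat_def atLeast0LessThan)
  ultimately have e: "(\<Sum>k<p. cofactor ?M k i * (A k j + (if k = j then l else 0))) = Determinant.det ?M * (if i = j then 1 else 0)"
    by simp
  have "(\<Sum>k<p. res p A l i k * (A k j + (if k = j then l else 0)))
     = (\<Sum>k<p. cofactor ?M k i * (A k j + (if k = j then l else 0))) / Determinant.det ?M"
    by (simp add: res_def sum_divide_distrib)
  then show ?thesis using e shift_det_nonzero[OF assms(1,2)] by simp
qed

lemma sum_delta_mult:
  fixes f :: "nat \<Rightarrow> real"
  shows "i < p \<Longrightarrow> (\<Sum>k<p. (if i = k then c else 0) * f k) = c * f i"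
    "i < p \<Longrightarrow> (\<Sum>k<p. f k * (if k = i then c else 0)) = f i * c"
  by (simp_all add: if_distrib[of "\<lambda>x. x * _"] if_distrib[of "\<lambda>x. _ * x"] sum.delta sum.delta' cong: if_cong)

text \<open>A right inverse equals the left inverse \<open>res\<close>. Used to recognise transposes
  and rescalings of a resolvent as resolvents.\<close>

lemma res_unique:
  assumes A: "psd p A" "l > 0"
    and Q: "\<And>i j. i < p \<Longrightarrow> j < p \<Longrightarrow> (\<Sum>k<p. (A i k + (if i = k then l else 0)) * Q k j) = (if i = j then 1 else 0)"
    and ij: "i < p" "j < p"
  shows "Q i j = res p A l i j"
proof -
  have "res p A l i j = (\<Sum>k<p. res p A l i k * (\<Sum>m<p. (A k m + (if k = m then l else 0)) * Q m j))"
  proof -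
    have "(\<Sum>m<p. (A k m + (if k = m then l else 0)) * Q m j) = (if k = j then 1 else 0)" if "k < p" for k
      using Q[OF that ij(2)] .
    then show ?thesis using ij by (simp add: sum_delta_mult)
  qed
  also have "\<dots> = (\<Sum>m<p. (\<Sum>k<p. res p A l i k * (A k m + (if k = m then l else 0))) * Q m j)"
    unfolding sum_distrib_left sum_distrib_right by (subst sum.swap) (simp add: mult.assoc)
  also have "\<dots> = (\<Sum>m<p. (if i = m then 1 else 0) * Q m j)"
    using ij by (intro sum.cong refl) (simp only: res_left[OF A] lessThan_iff)
  also have "\<dots> = Q i j" using ij by (simp add: sum_delta_mult)
  finally show ?thesis by simp
qed

lemma res_sym:
  assumes A: "psd p A" "l > 0" and ij: "i < p" "j < p"
  shows "res p A l i j = res p A l j i"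
proof -
  have "(\<lambda>i j. res p A l j i) i j = res p A l i j"
  proof (rule res_unique[OF A _ ij])
    fix i j assume ij: "i < p" "j < p"
    have "(\<Sum>k<p. (A i k + (if i = k then l else 0)) * res p A l j k)
      = (\<Sum>k<p. res p A l j k * (A k i + (if k = i then l else 0)))"
      using ij psd_sym[OF A(1)] by (intro sum.cong refl) auto
    also have "\<dots> = (if i = j then 1 else 0)" using res_left[OF A, of j i] ij by auto
    finally show "(\<Sum>k<p. (A i k + (if i = k then l else 0)) * res p A l j k) = (if i = j then 1 else 0)" .
  qed
  then show ?thesis by simp
qed

text \<open>The second resolvent identity \<open>R_A - R_B = R_A (B - A) R_B\<close>, obtained by
  multiplying out with a left inverse of the shift of \<open>A\<close> and a right inverse of that
  of \<open>B\<close>. Every comparison of traces below starts from it.\<close>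

lemma res_identity:
  assumes A: "psd p A" and B: "psd p B" and l: "l > 0" and ij: "i < p" "j < p"
  shows "res p A l i j - res p B l i j = (\<Sum>k<p. \<Sum>m<p. res p A l i k * (B k m - A k m) * res p B l m j)"
proof -
  let ?d = "\<lambda>k m. if k = m then l else (0::real)"
  have "(\<Sum>k<p. \<Sum>m<p. res p A l i k * (B k m - A k m) * res p B l m j)
    = (\<Sum>k<p. \<Sum>m<p. res p A l i k * ((B k m + ?d k m) * res p B l m j))
    - (\<Sum>k<p. \<Sum>m<p. (res p A l i k * (A k m + ?d k m)) * res p B l m j)"
    unfolding sum_subtractf[symmetric] by (intro sum.cong refl) (simp add: algebra_simps)
  also have "(\<Sum>k<p. \<Sum>m<p. res p A l i k * ((B k m + ?d k m) * res p B l m j)) = res p A l i j"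
    unfolding sum_distrib_left[symmetric] using ij by (simp add: res_right[OF B l] sum_delta_mult)
  also have "(\<Sum>k<p. \<Sum>m<p. (res p A l i k * (A k m + ?d k m)) * res p B l m j) = res p B l i j"
  proof -
    have "(\<Sum>k<p. \<Sum>m<p. (res p A l i k * (A k m + ?d k m)) * res p B l m j)
      = (\<Sum>m<p. (\<Sum>k<p. res p A l i k * (A k m + ?d k m)) * res p B l m j)"
      unfolding sum_distrib_right by (rule sum.swap)
    also have "\<dots> = (\<Sum>m<p. (if i = m then 1 else 0) * res p B l m j)"
      using ij by (intro sum.cong refl) (simp only: res_left[OF A l] lessThan_iff)
    also have "\<dots> = res p B l i j" using ij by (simp add: sum_delta_mult)
    finally show ?thesis .
  qed
  finally show ?thesis by simp
qed

lemma res_apply: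
  assumes A: "psd p A" "l > 0" and i: "i < p"
  shows "mv p A (mv p (res p A l) x) i + l * mv p (res p A l) x i = x i"
proof -
  have "mv p A (mv p (res p A l) x) i + l * mv p (res p A l) x i
      = (\<Sum>k<p. (A i k + (if i = k then l else 0)) * mv p (res p A l) x k)"
    using i by (simp add: distrib_right sum.distrib sum_delta_mult) (simp add: mv_def)
  also have "\<dots> = (\<Sum>j<p. (\<Sum>k<p. (A i k + (if i = k then l else 0)) * res p A l k j) * x j)"
    unfolding mv_def sum_distrib_left sum_distrib_right by (subst sum.swap) (simp add: mult.assoc)
  also have "\<dots> = x i" using i by (simp add: res_right[OF A] sum_delta_mult)
  finally show ?thesis .
qed

text \<open>With \<open>y = R x\<close> one has \<open>x = A y + l y\<close>, and the form of
  \<open>A\<close> at \<open>y\<close> is nonnegative. The operator bound \<open>1 / l\<close> and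
  the positivity of the resolvent both follow from this inequality.\<close>

lemma res_quadratic:
  assumes A: "psd p A" "l > 0"
  shows "l * dot p (mv p (res p A l) x) (mv p (res p A l) x) \<le> dot p x (mv p (res p A l) x)"
proof -
  let ?y = "mv p (res p A l) x"
  have "dot p x ?y = dot p (\<lambda>i. mv p A ?y i + l * ?y i) ?y"
    by (rule dot_cong) (simp_all add: res_apply[OF A])
  also have "\<dots> = dot p ?y (mv p A ?y) + l * dot p ?y ?y"
    by (simp add: dot_add_left dot_scale_left dot_commute)
  finally show ?thesis using psd_nonneg[OF A(1), of ?y] by linarith
qed

lemma res_nonneg:
  assumes A: "psd p A" "l > 0"
  shows "0 \<le> dot p x (mv p (res p A l) x)"
  using res_quadratic[OF A, of x] dot_self_nonneg[of p "mv p (res p A l) x"] A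
  by (meson mult_nonneg_nonneg order_trans less_imp_le)

lemma res_norm:
  assumes A: "psd p A" "l > 0"
  shows "dot p (mv p (res p A l) x) (mv p (res p A l) x) \<le> dot p x x / l\<^sup>2"
proof -
  let ?y = "mv p (res p A l) x"
  have "(l * dot p ?y ?y)\<^sup>2 \<le> (dot p x ?y)\<^sup>2"
    using res_quadratic[OF A, of x] dot_self_nonneg[of p ?y] A by (intro power_mono) auto
  also have "\<dots> \<le> dot p x x * dot p ?y ?y" by (rule dot_CS)
  finally have *: "dot p ?y ?y * (l\<^sup>2 * dot p ?y ?y) \<le> dot p ?y ?y * dot p x x" by (simp add: power2_eq_square mult_ac)
  show ?thesis
  proof (cases "dot p ?y ?y = 0")
    case True then show ?thesis using dot_self_nonneg[of p x] by simp
  next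
    case False
    then have "l\<^sup>2 * dot p ?y ?y \<le> dot p x x" using * dot_self_nonneg[of p ?y] by (simp add: mult_le_cancel_left)
    then show ?thesis using A by (simp add: field_simps)
  qed
qed

lemma res_upper:
  assumes A: "psd p A" "l > 0"
  shows "dot p x (mv p (res p A l) x) \<le> dot p x x / l"
proof -
  let ?y = "mv p (res p A l) x"
  have "(dot p x ?y)\<^sup>2 \<le> dot p x x * dot p ?y ?y" by (rule dot_CS)
  also have "\<dots> \<le> dot p x x * (dot p x x / l\<^sup>2)" by (intro mult_left_mono res_norm A dot_self_nonneg)
  also have "\<dots> = (dot p x x / l)\<^sup>2" by (simp add: power2_eq_square)
  finally show ?thesis by (rule power2_le_imp_le) (use dot_self_nonneg[of p x] A in simp)
qed

definition unit_fun :: "nat \<Rightarrow> nat \<Rightarrow> real" where "unit_fun i = (\<lambda>j. if j = i then 1 else 0)"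

lemma mv_unit: "i < p \<Longrightarrow> mv p A (unit_fun i) k = A k i"
  by (simp add: mv_def unit_fun_def sum_delta_mult)

lemma dot_unit: "i < p \<Longrightarrow> dot p (unit_fun i) x = x i" "i < p \<Longrightarrow> dot p x (unit_fun i) = x i"
  by (simp_all add: dot_def unit_fun_def if_distrib[of "\<lambda>x. x * _"] sum.delta sum_delta_mult cong: if_cong)

lemma res_diag:
  assumes A: "psd p A" "l > 0" and i: "i < p"
  shows "0 \<le> res p A l i i" "res p A l i i \<le> 1 / l"
  using res_nonneg[OF A, of "unit_fun i"] res_upper[OF A, of "unit_fun i"] i
  by (simp_all add: dot_unit mv_unit) (simp_all add: unit_fun_def)

section \<open>Characteristic polynomial, eigenvalues and the trace of the resolvent\<close>

lemma poly_pderiv_linear_factors: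
  fixes es :: "real list"
  assumes "\<forall>e\<in>set es. x \<noteq> e"
  shows "poly (pderiv (\<Prod>e\<leftarrow>es. [:- e, 1:])) x = poly (\<Prod>e\<leftarrow>es. [:- e, 1:]) x * (\<Sum>e\<leftarrow>es. 1 / (x - e))"
  using assms
proof (induction es)
  case (Cons e es)
  let ?P = "\<Prod>e\<leftarrow>es. [:- e, 1:]" and ?S = "\<Sum>e\<leftarrow>es. 1 / (x - e)"
  have ne: "x - e \<noteq> 0" using Cons.prems by simp
  have IH: "poly (pderiv ?P) x = poly ?P x * ?S" using Cons by simp
  have "poly (pderiv (\<Prod>e\<leftarrow>e # es. [:- e, 1:])) x = (x - e) * poly (pderiv ?P) x + poly ?P x"
    by (simp add: pderiv_mult pderiv_pCons del: mult_pCons_left)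
  also have "\<dots> = (x - e) * poly ?P x * (1 / (x - e) + ?S)"
    unfolding IH using ne by (simp add: distrib_left)
  finally show ?case by (simp del: mult_pCons_left)
qed simp

text \<open>Jacobi's formula: the logarithmic derivative of the characteristic polynomial is the trace of
  the resolvent.\<close>
lemma tr_res_eigenvalues:
  assumes A: "psd p A" "l > 0" and p: "p > 0"
    and cp: "cpoly p A = (\<Prod>e\<leftarrow>es. [:- e, 1:])" and pos: "\<forall>e\<in>set es. 0 \<le> e"
  shows "tr p (res p A l) = (\<Sum>e\<leftarrow>es. 1 / (e + l))"
proof -
  define N where "N = mat p p (\<lambda>(i, j). A i j)"
  have N: "N \<in> carrier_mat p p" by (simp add: N_def)
  have cN: "cpoly p A = char_poly N" by (simp add: cpoly_def N_def)
  let ?M = "shift_mat p A l"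
  have MN: "char_matrix N (- l) = ?M"
    by (rule eq_matI) (auto simp: N_def char_matrix_def shift_mat_def)
  have neg: "- (X :: real mat) = (-1) \<cdot>\<^sub>m X" for X by (rule eq_matI) auto
  have ev: "poly (char_poly N) (- l) = (- 1) ^ p * Determinant.det ?M"
    unfolding char_poly_matrix[OF N] MN neg by simp (simp add: shift_mat_def)
  have evi: "poly (char_poly (mat_delete N i i)) (- l) = (- 1) ^ (p - 1) * cofactor ?M i i" if "i < p" for i
  proof -
    have D: "mat_delete N i i \<in> carrier_mat (p - 1) (p - 1)" using N by (simp add: mat_delete_def)
    have "char_matrix (mat_delete N i i) (- l) = mat_delete ?M i i"
      using \<open>i < p\<close> by (intro eq_matI) (auto simp: N_def char_matrix_def shift_mat_def mat_delete_def)
    then show ?thesis unfolding char_poly_matrix[OF D] neg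
      by (simp add: cofactor_def) (simp add: mat_delete_def shift_mat_def)
  qed
  have nz: "Determinant.det ?M \<noteq> 0" by (rule shift_det_nonzero[OF A])
  \<comment> \<open>The derivative of a characteristic polynomial is the sum of those of the
    principal submatrices of size \<open>p - 1\<close>; at \<open>- l\<close> these are, up to sign,
    the diagonal cofactors of the shifted matrix, the numerators in \<open>res\<close>.\<close>
  have "poly (pderiv (char_poly N)) (- l) = (\<Sum>i<p. (- 1) ^ (p - 1) * cofactor ?M i i)"
    unfolding pderiv_char_poly[OF N] poly_sum by (intro sum.cong refl evi) simp
  also have "\<dots> = (- 1) ^ (p - 1) * Determinant.det ?M * tr p (res p A l)"
    using nz by (simp add: tr_def res_def sum_distrib_left)
  finally have 1: "poly (pderiv (char_poly N)) (- l) = (- 1) ^ (p - 1) * Determinant.det ?M * tr p (res p A l)" .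
  have "poly (pderiv (char_poly N)) (- l) = poly (char_poly N) (- l) * (\<Sum>e\<leftarrow>es. 1 / (- l - e))"
    unfolding cN[symmetric] cp
  proof (rule poly_pderiv_linear_factors, intro ballI notI)
    fix e assume "e \<in> set es" "- l = e"
    with pos have "0 \<le> - l" by metis
    then show False using A(2) by simp
  qed
  also have "(\<Sum>e\<leftarrow>es. 1 / (- l - e)) = (\<Sum>e\<leftarrow>es. - (1 / (e + l)))"
    by (intro arg_cong[of _ _ sum_list] map_cong refl) (simp add: minus_divide_right)
  also have "\<dots> = - (\<Sum>e\<leftarrow>es. 1 / (e + l))" by (simp add: uminus_sum_list_map o_def)
  finally have "(- 1) ^ (p - 1) * Determinant.det ?M * tr p (res p A l) = (- 1) ^ p * Determinant.det ?M * - (\<Sum>e\<leftarrow>es. 1 / (e + l))"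
    unfolding 1 ev .
  moreover have "(- 1 :: real) ^ p = - ((- 1) ^ (p - 1))" using p by (cases p) auto
  ultimately show ?thesis using nz by simp
qed

text \<open>Split the eigenvector into real and imaginary parts. Symmetry equates the two mixed
  terms, which forces \<open>Im a = 0\<close>; the two real quadratic forms add up to
  \<open>Re a\<close> times the squared norm.\<close>

lemma complex_eigenvalue_psd:
  assumes A: "psd p A"
    and v: "\<And>i. i < p \<Longrightarrow> (\<Sum>j<p. complex_of_real (A i j) * v j) = a * v i" and nz: "\<exists>i<p. v i \<noteq> 0"
  shows "a \<in> \<real>" "0 \<le> Re a"
proof -
  define x y where "x i = Re (v i)" and "y i = Im (v i)" for i
  have re: "mv p A x i = Re a * x i - Im a * y i" if "i < p" for i
    using arg_cong[OF v[OF that], of Re] by (simp add: x_def y_def mv_def)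
  have im: "mv p A y i = Re a * y i + Im a * x i" if "i < p" for i
    using arg_cong[OF v[OF that], of Im] by (simp add: x_def y_def mv_def)
  define n where "n = dot p x x + dot p y y"
  have n: "n > 0"
  proof -
    have "n \<noteq> 0" unfolding n_def using nz dot_self_nonneg[of p x] dot_self_nonneg[of p y]
      by (auto simp: add_nonneg_eq_0_iff dot_self_zero x_def y_def complex_eq_iff)
    then show ?thesis using dot_self_nonneg[of p x] dot_self_nonneg[of p y] by (simp add: n_def)
  qed
  have c: "dot p y (mv p A x) = dot p y (\<lambda>i. Re a * x i - Im a * y i)"
    "dot p x (mv p A y) = dot p x (\<lambda>i. Re a * y i + Im a * x i)"
    "dot p x (mv p A x) = dot p x (\<lambda>i. Re a * x i - Im a * y i)"
    "dot p y (mv p A y) = dot p y (\<lambda>i. Re a * y i + Im a * x i)"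
    by (rule dot_cong; simp add: re im)+
  have "dot p y (mv p A x) = dot p x (mv p A y)"
    by (rule dot_mv_sym) (rule psd_sym[OF A])
  then have "Im a * n = 0"
    unfolding c by (simp add: dot_add_right dot_diff_right dot_scale_right dot_commute[of p x y] n_def algebra_simps)
  then show "a \<in> \<real>" using n by (simp add: complex_is_Real_iff)
  have "Re a * n = dot p x (mv p A x) + dot p y (mv p A y)"
    unfolding c by (simp add: dot_add_right dot_diff_right dot_scale_right dot_commute[of p x y] n_def algebra_simps)
  also have "\<dots> \<ge> 0" using psd_nonneg[OF A, of x] psd_nonneg[OF A, of y] by simp
  finally show "0 \<le> Re a" using n by (simp add: zero_le_mult_iff)
qed

text \<open>The characteristic polynomial splits over the complex numbers, its roots are real and
  nonnegative, and the factorisation is pulled back along the injective embedding of the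
  reals.\<close>

lemma psd_eigenvalues:
  assumes A: "psd p A"
  obtains es where "length es = p" "cpoly p A = (\<Prod>e\<leftarrow>es. [:- e, 1:])" "\<forall>e\<in>set es. 0 \<le> e"
proof -
  define N where "N = mat p p (\<lambda>(i, j). A i j)"
  have N: "N \<in> carrier_mat p p" by (simp add: N_def)
  define Nc where "Nc = map_mat complex_of_real N"
  have Nc: "Nc \<in> carrier_mat p p" using N by (simp add: Nc_def)
  obtain as where as: "char_poly Nc = (\<Prod>a\<leftarrow>as. [:- a, 1:])" "length as = p"
    using char_poly_factorized[OF Nc] by blast
  have root: "a \<in> \<real> \<and> 0 \<le> Re a" if "a \<in> set as" for a
  proof -
    have "poly (char_poly Nc) a = 0" unfolding as(1) using that by (auto simp: poly_prod_list prod_list_zero_iff)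
    then have "eigenvalue Nc a" using eigenvalue_root_char_poly[OF Nc] by simp
    then obtain v where v: "v \<in> carrier_vec p" "v \<noteq> 0\<^sub>v p" "Nc *\<^sub>v v = a \<cdot>\<^sub>v v"
      using Nc by (auto simp: eigenvalue_def eigenvector_def)
    have "(\<Sum>j<p. complex_of_real (A i j) * vec_index v j) = a * vec_index v i" if i: "i < p" for i
    proof -
      have "vec_index (Nc *\<^sub>v v) i = (\<Sum>j<p. complex_of_real (A i j) * vec_index v j)"
        using i v(1) by (simp add: Nc_def N_def scalar_prod_def atLeast0LessThan)
      then show ?thesis using v i by simp
    qed
    moreover have "\<exists>i<p. vec_index v i \<noteq> 0" using v by (auto simp: vec_eq_iff)
    ultimately show ?thesis using complex_eigenvalue_psd[OF A, of "\<lambda>i. vec_index v i" a] by blast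
  qed
  define es where "es = map Re as"
  have asr: "as = map complex_of_real es" unfolding es_def
    using root by (induction as) (auto simp: complex_is_Real_iff complex_eq_iff)
  interpret rp: map_poly_inj_idom_hom complex_of_real ..
  have "map_poly complex_of_real (char_poly N) = char_poly Nc"
    unfolding Nc_def by (rule of_real_hom.char_poly_hom[OF N, symmetric])
  also have "\<dots> = map_poly complex_of_real (\<Prod>e\<leftarrow>es. [:- e, 1:])"
    unfolding as(1) asr by (simp add: rp.hom_prod_list o_def)
  finally have "char_poly N = (\<Prod>e\<leftarrow>es. [:- e, 1:])"
    by (rule rp.injectivity)
  then show thesis
    using that[of es] as(2) root by (auto simp: es_def cpoly_def N_def)
qed

lemma eigenvalue_upper:
  assumes cp: "cpoly p A = (\<Prod>e\<leftarrow>es. [:- e, 1:])" and e: "e \<in> set es"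
    and c: "\<And>x. dot p x (mv p A x) \<le> c * dot p x x"
  shows "e \<le> c"
proof -
  define N where "N = mat p p (\<lambda>(i, j). A i j)"
  have N: "N \<in> carrier_mat p p" by (simp add: N_def)
  have "poly (char_poly N) e = 0" using e cp by (auto simp: poly_prod_list prod_list_zero_iff cpoly_def N_def)
  then have "eigenvalue N e" using eigenvalue_root_char_poly[OF N] by simp
  then obtain v where v: "v \<in> carrier_vec p" "v \<noteq> 0\<^sub>v p" "N *\<^sub>v v = e \<cdot>\<^sub>v v"
    using N by (auto simp: eigenvalue_def eigenvector_def)
  define x where "x i = vec_index v i" for i
  have "mv p A x i = e * x i" if i: "i < p" for i
  proof -
    have "vec_index (N *\<^sub>v v) i = mv p A x i"
      using i v(1) by (simp add: N_def scalar_prod_def atLeast0LessThan mv_def x_def)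
    then show ?thesis using v i by (simp add: x_def)
  qed
  then have "dot p x (mv p A x) = dot p x (\<lambda>i. e * x i)" by (intro dot_cong) auto
  then have "e * dot p x x \<le> c * dot p x x" using c[of x] by (simp add: dot_scale_right)
  moreover have "dot p x x > 0"
  proof -
    have "\<exists>i<p. x i \<noteq> 0" using v by (auto simp: vec_eq_iff x_def)
    then show ?thesis using dot_self_nonneg[of p x] dot_self_zero[of p x] by (metis less_eq_real_def)
  qed
  ultimately show ?thesis by simp
qed

section \<open>Sample covariance matrices and rank-one updates\<close>

definition cov :: "nat \<Rightarrow> (nat \<Rightarrow> nat \<Rightarrow> real) \<Rightarrow> nat \<Rightarrow> nat \<Rightarrow> real" where
  "cov n u i j = (1 / real n) * (\<Sum>m<n. u m i * u m j)"

lemma spearman_cov: "spearman n x = cov n (rank_mat n x)"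
  by (intro ext) (simp add: spearman_def cov_def)

lemma cov_mv: "mv p (cov n u) x i = (1 / real n) * (\<Sum>m<n. u m i * dot p (u m) x)"
proof -
  have "mv p (cov n u) x i = (\<Sum>j<p. \<Sum>m<n. (1 / real n) * (u m i * (u m j * x j)))"
    unfolding mv_def cov_def sum_distrib_left sum_distrib_right by (simp add: mult_ac)
  also have "\<dots> = (\<Sum>m<n. \<Sum>j<p. (1 / real n) * (u m i * (u m j * x j)))" by (rule sum.swap)
  finally show ?thesis by (simp add: dot_def sum_distrib_left)
qed

lemma dot_sum_right: "dot p x (\<lambda>i. c * (\<Sum>m\<in>S. f m i)) = c * (\<Sum>m\<in>S. dot p x (f m))"
proof -
  have "dot p x (\<lambda>i. c * (\<Sum>m\<in>S. f m i)) = (\<Sum>i<p. \<Sum>m\<in>S. c * (x i * f m i))"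
    by (simp add: dot_def sum_distrib_left mult_ac)
  also have "\<dots> = (\<Sum>m\<in>S. \<Sum>i<p. c * (x i * f m i))" by (rule sum.swap)
  finally show ?thesis by (simp add: dot_def sum_distrib_left)
qed

lemma dot_scale_fun_right: "dot p z (\<lambda>i. x i * c) = c * dot p z x"
  by (simp add: dot_def sum_distrib_left mult_ac)

lemma cov_quadratic: "dot p x (mv p (cov n u) x) = (1 / real n) * (\<Sum>m<n. (dot p (u m) x)\<^sup>2)"
proof -
  have "dot p x (mv p (cov n u) x) = dot p x (\<lambda>i. (1 / real n) * (\<Sum>m<n. u m i * dot p (u m) x))"
    by (rule dot_cong) (simp_all add: cov_mv)
  also have "\<dots> = (1 / real n) * (\<Sum>m<n. dot p x (\<lambda>i. u m i * dot p (u m) x))"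
    by (rule dot_sum_right)
  also have "\<dots> = (1 / real n) * (\<Sum>m<n. (dot p (u m) x)\<^sup>2)"
    by (simp add: dot_scale_fun_right dot_commute[of p x] power2_eq_square)
  finally show ?thesis .
qed

lemma cov_psd: "psd p (cov n u)"
  unfolding psd_def cov_quadratic by (auto simp: cov_def mult.commute intro!: sum_nonneg divide_nonneg_nonneg)

text \<open>An observation is removed by zeroing its row while the normalisation
  \<open>1 / n\<close> is kept, so that the two matrices differ exactly by a rank-one term.\<close>

lemma cov_remove:
  assumes "m < n"
  shows "cov n u i j = cov n (u(m := \<lambda>_. 0)) i j + u m i * u m j / real n"
proof -
  have "(\<Sum>k<n. u k i * u k j) = (\<Sum>k<n. (u(m := \<lambda>_. 0)) k i * (u(m := \<lambda>_. 0)) k j) + u m i * u m j"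
    using assms by (subst (1 2) sum.remove[of _ m]) auto
  then show ?thesis by (simp add: cov_def add_divide_distrib)
qed

text \<open>The Sherman-Morrison situation. Below, \<open>A\<close> is the covariance matrix without
  row \<open>m\<close>, \<open>w\<close> is that row and \<open>\<nu>\<close> is the sample
  size.\<close>

locale rank_one_update =
  fixes p :: nat and A B :: "nat \<Rightarrow> nat \<Rightarrow> real" and w :: "nat \<Rightarrow> real" and l \<nu> :: real
  assumes A: "psd p A" and B: "psd p B" and l: "l > 0" and \<nu>: "\<nu> > 0"
    and upd: "\<And>i j. i < p \<Longrightarrow> j < p \<Longrightarrow> B i j = A i j + w i * w j / \<nu>"
begin

definition "\<alpha> = dot p w (mv p (res p A l) w) / \<nu>"

lemma alpha_nonneg: "0 \<le> \<alpha>"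
  unfolding \<alpha>_def using res_nonneg[OF A l] \<nu> by simp

lemma diff: "i < p \<Longrightarrow> j < p \<Longrightarrow>
  res p A l i j - res p B l i j = mv p (res p A l) w i * mv p (res p B l) w j / \<nu>"
proof -
  assume ij: "i < p" "j < p"
  have "res p A l i j - res p B l i j = (\<Sum>k<p. \<Sum>m<p. res p A l i k * (w k * w m / \<nu>) * res p B l m j)"
    unfolding res_identity[OF A B l ij] by (intro sum.cong refl) (simp add: upd)
  also have "\<dots> = (\<Sum>k<p. \<Sum>m<p. (res p A l i k * w k) * (res p B l j m * w m)) / \<nu>"
    unfolding sum_divide_distrib using ij
    by (intro sum.cong refl) (simp add: res_sym[OF B l, of j])
  also have "\<dots> = mv p (res p A l) w i * mv p (res p B l) w j / \<nu>"
    by (simp add: mv_def sum_product)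
  finally show ?thesis .
qed

text \<open>Applied to \<open>w\<close>, the rank-one difference of the resolvents gives
  \<open>R_A w - R_B w = \<alpha> R_B w\<close>.\<close>

lemma res_vec: "i < p \<Longrightarrow> mv p (res p B l) w i = mv p (res p A l) w i / (1 + \<alpha>)"
proof -
  assume i: "i < p"
  have "mv p (res p A l) w i - mv p (res p B l) w i = (\<Sum>j<p. (res p A l j i - res p B l j i) * w j)"
    using i unfolding mv_def sum_subtractf[symmetric]
    by (intro sum.cong refl) (simp add: res_sym[OF A l, of i] res_sym[OF B l, of i] left_diff_distrib)
  also have "\<dots> = (\<Sum>j<p. (mv p (res p A l) w j * mv p (res p B l) w i / \<nu>) * w j)"
    using i by (intro sum.cong refl) (simp add: diff)
  also have "\<dots> = \<alpha> * mv p (res p B l) w i"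
    by (simp add: \<alpha>_def dot_def sum_distrib_left sum_distrib_right sum_divide_distrib mult_ac)
  finally show ?thesis using alpha_nonneg by (simp add: field_simps)
qed

lemma diff': "i < p \<Longrightarrow> j < p \<Longrightarrow>
  res p A l i j - res p B l i j = mv p (res p A l) w i * mv p (res p A l) w j / (\<nu> * (1 + \<alpha>))"
  by (simp add: diff res_vec mult.commute)

text \<open>Since \<open>l * \<bar>R_A w\<bar>\<^sup>2 \<le> w . R_A w = \<nu> * \<alpha>\<close>,
  the denominator always compensates the numerator. The bound does not involve the size of
  \<open>w\<close>, which is what makes the trace a function of bounded differences.\<close>

lemma norm_bound: "dot p (mv p (res p A l) w) (mv p (res p A l) w) / (\<nu> * (1 + \<alpha>)) \<le> 1 / l"
proof -
  have "l * dot p (mv p (res p A l) w) (mv p (res p A l) w) \<le> \<nu> * \<alpha>"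
    using res_quadratic[OF A l, of w] \<nu> by (simp add: \<alpha>_def)
  also have "\<dots> \<le> \<nu> * (1 + \<alpha>)" using \<nu> by simp
  finally have *: "l * dot p (mv p (res p A l) w) (mv p (res p A l) w) \<le> \<nu> * (1 + \<alpha>)" .
  have "0 < \<nu> * (1 + \<alpha>)" using \<nu> alpha_nonneg by simp
  then show ?thesis using * l by (simp add: divide_le_eq pos_le_divide_eq mult.commute)
qed

lemma norm_pos: "0 < \<nu> * (1 + \<alpha>)" using \<nu> alpha_nonneg by simp

lemma tr_diff: "tr p (res p A l) - tr p (res p B l)
    = dot p (mv p (res p A l) w) (mv p (res p A l) w) / (\<nu> * (1 + \<alpha>))"
  unfolding tr_def sum_subtractf[symmetric] dot_def sum_divide_distrib
  by (intro sum.cong refl) (simp add: diff')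

lemma tr_diff_bounds: "0 \<le> tr p (res p A l) - tr p (res p B l)" "tr p (res p A l) - tr p (res p B l) \<le> 1 / l"
  unfolding tr_diff using norm_bound norm_pos dot_self_nonneg by (auto intro: divide_nonneg_pos)

end

section \<open>Gaussian vectors and the Poincare inequality\<close>

lemma sum_swap4:
  "(\<Sum>j\<in>A. \<Sum>l\<in>B. \<Sum>a\<in>I. \<Sum>b\<in>K. h j l a b) = (\<Sum>a\<in>I. \<Sum>b\<in>K. \<Sum>j\<in>A. \<Sum>l\<in>B. h j l a b)"
proof -
  have "(\<Sum>j\<in>A. \<Sum>l\<in>B. \<Sum>a\<in>I. \<Sum>b\<in>K. h j l a b) = (\<Sum>j\<in>A. \<Sum>a\<in>I. \<Sum>l\<in>B. \<Sum>b\<in>K. h j l a b)"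
    by (rule sum.cong[OF refl], rule sum.swap)
  also have "\<dots> = (\<Sum>a\<in>I. \<Sum>j\<in>A. \<Sum>l\<in>B. \<Sum>b\<in>K. h j l a b)" by (rule sum.swap)
  also have "\<dots> = (\<Sum>a\<in>I. \<Sum>j\<in>A. \<Sum>b\<in>K. \<Sum>l\<in>B. h j l a b)"
    by (rule sum.cong[OF refl], rule sum.cong[OF refl], rule sum.swap)
  also have "\<dots> = (\<Sum>a\<in>I. \<Sum>b\<in>K. \<Sum>j\<in>A. \<Sum>l\<in>B. h j l a b)"
    by (rule sum.cong[OF refl], rule sum.swap)
  finally show ?thesis .
qed

text \<open>The kernel \<open>z * exp z - (exp z - 1)\<close> compares the energy with the variance of the exponentials
  \<open>exp (\<i> a X)\<close>; it is nonnegative definite since its Taylor coefficients are nonnegative.\<close>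
definition pkernel :: "real \<Rightarrow> real" where "pkernel z = z * exp z - exp z + 1"

text \<open>The general term \<open>(k - 1) / k!\<close> would be \<open>- 1\<close> at
  \<open>k = 0\<close>; the constant \<open>+ 1\<close> in \<open>pkernel\<close> cancels exactly
  this negative coefficient.\<close>

definition pcoef :: "nat \<Rightarrow> real" where "pcoef k = (if k = 0 then 0 else (real k - 1) / fact k)"

lemma pcoef_nonneg: "0 \<le> pcoef k" by (auto simp: pcoef_def)

lemma pkernel_sums: "(\<lambda>k. pcoef k * z ^ k) sums pkernel z"
proof -
  have e: "(\<lambda>k. z ^ k / fact k) sums exp z" using exp_converges[of z] by (simp add: divide_inverse mult.commute)
  have "(\<lambda>k. real (Suc k) * z ^ Suc k / fact (Suc k)) sums (z * exp z)"
  proof -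
    have "real (Suc k) * z ^ Suc k / fact (Suc k) = z * (z ^ k / fact k)" for k
      unfolding fact_Suc by (simp del: of_nat_Suc)
    then show ?thesis using sums_mult[OF e, of z] by (simp only:)
  qed
  then have "(\<lambda>k. real k * z ^ k / fact k) sums (z * exp z)"
    using sums_Suc[of "\<lambda>k. real k * z ^ k / fact k" "z * exp z"] by simp
  then have s: "(\<lambda>k. real k * z ^ k / fact k - z ^ k / fact k) sums (z * exp z - exp z)" by (rule sums_diff[OF _ e])
  have "(\<lambda>k. (real k * z ^ k / fact k - z ^ k / fact k) + (if k = 0 then 1 else 0)) sums (z * exp z - exp z + 1)"
    using sums_add[OF s sums_single[of 0 "\<lambda>_. 1"]] by simp
  moreover have "(real k * z ^ k / fact k - z ^ k / fact k) + (if k = 0 then 1 else 0) = pcoef k * z ^ k" for k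
    by (simp add: pcoef_def diff_divide_distrib left_diff_distrib)
  ultimately show ?thesis by (simp only: pkernel_def)
qed

text \<open>Exponentials are indexed by a sign and a frequency index. Multiplying the coefficients
  by the frequencies produces \<open>- \<i>\<close> times the derivative, a phase that disappears in
  the Hermitian energy form.\<close>

lemma trig_exponential_form:
  fixes b t :: "nat \<Rightarrow> real"
  defines "s \<equiv> \<lambda>(\<sigma>, k). complex_of_real ((if \<sigma> then b k else - b k) / 2) * - \<i>"
    and "\<tau> \<equiv> \<lambda>(\<sigma>, k). if \<sigma> then t k else - t k"
  assumes J: "finite J"
  shows "(\<Sum>m\<in>(UNIV :: bool set) \<times> J. s m * cis (\<tau> m * x)) = complex_of_real (\<Sum>k\<in>J. b k * sin (t k * x))"
    and "(\<Sum>m\<in>(UNIV :: bool set) \<times> J. s m * of_real (\<tau> m) * cis (\<tau> m * x)) = - \<i> * complex_of_real (\<Sum>k\<in>J. b k * t k * cos (t k * x))"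
proof -
  have sp: "(\<Sum>m\<in>(UNIV :: bool set) \<times> J. F m) = (\<Sum>k\<in>J. F (True, k) + F (False, k))" for F :: "bool \<times> nat \<Rightarrow> complex"
  proof -
    have "(\<Sum>m\<in>(UNIV :: bool set) \<times> J. F m) = (\<Sum>\<sigma>\<in>(UNIV :: bool set). \<Sum>k\<in>J. F (\<sigma>, k))"
      by (simp add: sum.cartesian_product)
    then show ?thesis by (simp add: UNIV_bool sum.distrib)
  qed
  show "(\<Sum>m\<in>(UNIV :: bool set) \<times> J. s m * cis (\<tau> m * x)) = complex_of_real (\<Sum>k\<in>J. b k * sin (t k * x))"
    unfolding sp of_real_sum by (intro sum.cong refl) (simp add: s_def \<tau>_def complex_eq_iff)
  show "(\<Sum>m\<in>(UNIV :: bool set) \<times> J. s m * of_real (\<tau> m) * cis (\<tau> m * x)) = - \<i> * complex_of_real (\<Sum>k\<in>J. b k * t k * cos (t k * x))"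
    unfolding sp of_real_sum sum_distrib_left by (intro sum.cong refl) (simp add: s_def \<tau>_def complex_eq_iff)
qed

section \<open>Gaussian vectors and their linear functionals\<close>

locale gaussian_vector = prob_space M for M :: "'w measure" +
  fixes p :: nat and S :: "nat \<Rightarrow> nat \<Rightarrow> real" and X :: "nat \<Rightarrow> 'w \<Rightarrow> real" and C :: real
  assumes gauss: "gaussian_vec M p S X"
    and S_sym: "\<And>i j. i < p \<Longrightarrow> j < p \<Longrightarrow> S i j = S j i"
    and S_diag: "\<And>i. i < p \<Longrightarrow> S i i = 1"
    and S_norm: "spec_norm_le p S C"
begin

definition "lin a \<omega> = dot p a (\<lambda>j. X j \<omega>)"
definition "quad a b = dot p a (mv p S b)"

lemma X_measurable[measurable]: "j < p \<Longrightarrow> X j \<in> borel_measurable M"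
  using gauss by (auto simp: gaussian_vec_def)

lemma lin_measurable[measurable]: "lin a \<in> borel_measurable M"
  unfolding lin_def[abs_def] dot_def by (intro borel_measurable_sum borel_measurable_times) auto

lemma quad_expand: "quad a b = (\<Sum>i<p. \<Sum>j<p. a i * S i j * b j)"
  by (simp add: quad_def dot_def mv_def sum_distrib_left mult.assoc)

lemma quad_commute: "quad a b = quad b a"
  unfolding quad_def by (rule dot_mv_sym) (rule S_sym)

text \<open>Merges the two cases of \<open>gaussian_vec\<close>: a scaled standard normal variable
  also covers the point mass at 0, so a singular covariance matrix needs no separate treatment
  afterwards.\<close>

lemma lin_distr: "0 \<le> quad a a \<and> distr M borel (lin a) = distr NN borel (\<lambda>y. sqrt (quad a a) * y)"
proof -
  interpret N: real_distribution NN by (rule real_dist_normal_dist)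
  have l: "(\<lambda>\<omega>. \<Sum>j<p. a j * X j \<omega>) = lin a" by (simp add: lin_def[abs_def] dot_def)
  consider "quad a a > 0" "distributed M lborel (lin a) (\<lambda>x. ennreal (normal_density 0 (sqrt (quad a a)) x))"
    | "quad a a = 0" "AE \<omega> in M. lin a \<omega> = 0"
    using gauss unfolding gaussian_vec_def Let_def quad_expand[symmetric] l
    by (metis (no_types, lifting) l fun_cong AE_cong)
  then show ?thesis
  proof cases
    case 1
    let ?v = "sqrt (quad a a)"
    have v: "?v > 0" using 1 by simp
    have "distributed M lborel (\<lambda>x. (lin a x - 0) / ?v) (\<lambda>x. ennreal (std_normal_density x))"
      using 1(2) normal_standard_normal_convert[OF v, of "lin a" 0] by simp
    then have "distr M lborel (\<lambda>x. (lin a x - 0) / ?v) = NN" by (rule distributed_distr_eq_density)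
    then have d: "distr M borel (\<lambda>x. lin a x / ?v) = NN" by (simp cong: distr_cong)
    have "distr NN borel (\<lambda>y. ?v * y) = distr (distr M borel (\<lambda>x. lin a x / ?v)) borel (\<lambda>y. ?v * y)"
      unfolding d ..
    also have "\<dots> = distr M borel ((\<lambda>y. ?v * y) \<circ> (\<lambda>x. lin a x / ?v))" by (rule distr_distr) auto
    also have "(\<lambda>y. ?v * y) \<circ> (\<lambda>x. lin a x / ?v) = lin a" using v by (auto simp: o_def)
    finally show ?thesis using 1 by simp
  next
    case 2
    have "distr M borel (lin a) = distr M borel (\<lambda>_. 0)"
      by (rule distr_cong_AE) (use 2 in auto)
    also have "\<dots> = return borel 0" by (rule distr_const) simp
    also have "\<dots> = distr NN borel (\<lambda>_. 0)" by (rule N.distr_const[symmetric]) simp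
    finally show ?thesis using 2 by simp
  qed
qed

lemma quad_nonneg: "0 \<le> quad a a" using lin_distr by simp

lemma integral_lin:
  fixes f :: "real \<Rightarrow> 'b::{banach, second_countable_topology}"
  assumes [measurable]: "f \<in> borel_measurable borel"
  shows "(\<integral>\<omega>. f (lin a \<omega>) \<partial>M) = (\<integral>y. f (sqrt (quad a a) * y) \<partial>NN)"
proof -
  have "(\<integral>\<omega>. f (lin a \<omega>) \<partial>M) = (\<integral>y. f y \<partial>distr M borel (lin a))" by (rule integral_distr[symmetric]) auto
  also have "\<dots> = (\<integral>y. f y \<partial>distr NN borel (\<lambda>y. sqrt (quad a a) * y))" using lin_distr by simp
  also have "\<dots> = (\<integral>y. f (sqrt (quad a a) * y) \<partial>NN)" by (rule integral_distr) auto
  finally show ?thesis .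
qed

lemma integrable_lin:
  fixes f :: "real \<Rightarrow> 'b::{banach, second_countable_topology}"
  assumes [measurable]: "f \<in> borel_measurable borel" and i: "integrable NN (\<lambda>y. f (sqrt (quad a a) * y))"
  shows "integrable M (\<lambda>\<omega>. f (lin a \<omega>))"
proof -
  have "integrable (distr NN borel (\<lambda>y. sqrt (quad a a) * y)) f"
    using i by (subst integrable_distr_eq) auto
  then have "integrable (distr M borel (lin a)) f" using lin_distr by simp
  then show ?thesis by (subst (asm) integrable_distr_eq) auto
qed

lemma E_cis_lin: "(\<integral>\<omega>. cis (lin a \<omega>) \<partial>M) = complex_of_real (exp (- quad a a / 2))"
proof -
  have [measurable]: "cis \<in> borel_measurable borel"
    by (intro borel_measurable_continuous_onI continuous_intros)
  have "(\<integral>\<omega>. cis (lin a \<omega>) \<partial>M) = char NN (sqrt (quad a a))"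
    by (subst integral_lin) (auto simp: char_def cis_conv_exp)
  then show ?thesis using quad_nonneg[of a] by (simp add: char_std_normal_distribution)
qed

lemma integrable_lin_power: "integrable M (\<lambda>\<omega>. lin a \<omega> ^ k)"
proof (rule integrable_lin)
  show "integrable NN (\<lambda>y. (sqrt (quad a a) * y) ^ k)"
    unfolding power_mult_distrib by (intro integrable_mult_right integrable_std_normal_distribution_moment)
qed simp

lemma E_lin_square: "(\<integral>\<omega>. (lin a \<omega>)\<^sup>2 \<partial>M) = quad a a"
proof -
  have "(\<integral>\<omega>. (lin a \<omega>)\<^sup>2 \<partial>M) = (\<integral>y. (sqrt (quad a a) * y)\<^sup>2 \<partial>NN)" by (rule integral_lin) simp
  also have "\<dots> = quad a a * (\<integral>y. y ^ (2 * 1) \<partial>NN)" using quad_nonneg[of a] by (simp add: power_mult_distrib)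
  also have "\<dots> = quad a a" by (subst std_normal_distribution_even_moments(1)) simp
  finally show ?thesis .
qed

lemma lin_add: "lin (\<lambda>i. a i + b i) \<omega> = lin a \<omega> + lin b \<omega>"
  and lin_diff: "lin (\<lambda>i. a i - b i) \<omega> = lin a \<omega> - lin b \<omega>"
  and lin_scale: "lin (\<lambda>i. c * a i) \<omega> = c * lin a \<omega>"
  by (simp_all add: lin_def dot_add_left dot_diff_left dot_scale_left)

lemma quad_add: "quad (\<lambda>i. a i + b i) (\<lambda>i. a i + b i) = quad a a + quad b b + 2 * quad a b"
  and quad_diff: "quad (\<lambda>i. a i - b i) (\<lambda>i. a i - b i) = quad a a + quad b b - 2 * quad a b"
  and quad_scale: "quad (\<lambda>i. c * a i) (\<lambda>i. d * b i) = c * d * quad a b"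
  using quad_commute[of a b] unfolding quad_def mv_add[abs_def] mv_diff[abs_def] mv_scale[abs_def]
  by (simp_all add: dot_add_left dot_diff_left dot_scale_left dot_add_right dot_diff_right dot_scale_right)

lemma integrable_lin_prod: "integrable M (\<lambda>\<omega>. lin a \<omega> * lin b \<omega>)"
  and E_lin_prod: "(\<integral>\<omega>. lin a \<omega> * lin b \<omega> \<partial>M) = quad a b"
proof -
  have e: "lin a \<omega> * lin b \<omega> = ((lin (\<lambda>i. a i + b i) \<omega>)\<^sup>2 - (lin a \<omega>)\<^sup>2 - (lin b \<omega>)\<^sup>2) / 2" for \<omega>
    by (simp add: lin_add power2_eq_square algebra_simps)
  show "integrable M (\<lambda>\<omega>. lin a \<omega> * lin b \<omega>)" unfolding e
    by (intro integrable_divide_zero Bochner_Integration.integrable_diff integrable_lin_power)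
  have "(\<integral>\<omega>. lin a \<omega> * lin b \<omega> \<partial>M) = (quad (\<lambda>i. a i + b i) (\<lambda>i. a i + b i) - quad a a - quad b b) / 2"
    unfolding e by (simp add: integrable_lin_power E_lin_square)
  then show "(\<integral>\<omega>. lin a \<omega> * lin b \<omega> \<partial>M) = quad a b" by (simp add: quad_add)
qed

text \<open>The Schur product theorem, with the covariance kernel realised as an expectation.\<close>
lemma quad_power_psd:
  assumes "finite I"
  shows "0 \<le> (\<Sum>a\<in>I. \<Sum>b\<in>I. x a * x b * quad (al a) (al b) ^ k)"
proof (induction k arbitrary: x)
  case 0
  then show ?case by (simp add: sum_product[symmetric])
next
  case (Suc k)
  have "(\<Sum>a\<in>I. \<Sum>b\<in>I. x a * x b * quad (al a) (al b) ^ Suc k)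
    = (\<Sum>a\<in>I. \<Sum>b\<in>I. (\<integral>\<omega>. x a * x b * quad (al a) (al b) ^ k * (lin (al a) \<omega> * lin (al b) \<omega>) \<partial>M))"
    by (intro sum.cong refl) (simp add: E_lin_prod)
  also have "\<dots> = (\<integral>\<omega>. (\<Sum>a\<in>I. \<Sum>b\<in>I. x a * x b * quad (al a) (al b) ^ k * (lin (al a) \<omega> * lin (al b) \<omega>)) \<partial>M)"
    by (simp add: integrable_lin_prod)
  also have "\<dots> \<ge> 0"
  proof (rule integral_nonneg_AE, rule AE_I2)
    fix \<omega>
    \<comment> \<open>The induction hypothesis is used pointwise, with the random values
      \<open>lin (al a) \<omega>\<close> absorbed into the coefficients.\<close>
    show "0 \<le> (\<Sum>a\<in>I. \<Sum>b\<in>I. x a * x b * quad (al a) (al b) ^ k * (lin (al a) \<omega> * lin (al b) \<omega>))"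
      using Suc.IH[of "\<lambda>a. x a * lin (al a) \<omega>"] by (simp add: mult_ac)
  qed
  finally show ?case .
qed

lemma pkernel_psd:
  assumes "finite I"
  shows "0 \<le> (\<Sum>a\<in>I. \<Sum>b\<in>I. x a * x b * pkernel (quad (al a) (al b)))"
proof -
  have "(\<lambda>k. \<Sum>a\<in>I. \<Sum>b\<in>I. x a * x b * (pcoef k * quad (al a) (al b) ^ k))
    sums (\<Sum>a\<in>I. \<Sum>b\<in>I. x a * x b * pkernel (quad (al a) (al b)))"
    by (intro sums_sum sums_mult pkernel_sums)
  moreover have "0 \<le> (\<Sum>a\<in>I. \<Sum>b\<in>I. x a * x b * (pcoef k * quad (al a) (al b) ^ k))" for k
  proof -
    have "(\<Sum>a\<in>I. \<Sum>b\<in>I. x a * x b * (pcoef k * quad (al a) (al b) ^ k)) = pcoef k * (\<Sum>a\<in>I. \<Sum>b\<in>I. x a * x b * quad (al a) (al b) ^ k)"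
      by (simp add: sum_distrib_left mult_ac)
    then show ?thesis using quad_power_psd[OF assms] pcoef_nonneg by simp
  qed
  ultimately show ?thesis by (rule sums_le[OF _ sums_zero, rotated])
qed

lemma cis_measurable[measurable]: "cis \<in> borel_measurable borel"
  by (intro borel_measurable_continuous_onI continuous_intros)

lemma integrable_cis_lin: "integrable M (\<lambda>\<omega>. cis (lin a \<omega>))"
  by (rule integrable_const_bound[where B = 1]) auto

text \<open>The Gaussian Poincare inequality for trigonometric polynomials: both sides are quadratic forms in the
  coefficients, and the difference of the kernels is \<^const>\<open>pkernel\<close> of the covariance.\<close>
lemma poincare_trig:
  fixes c :: "'b \<Rightarrow> complex" and al :: "'b \<Rightarrow> nat \<Rightarrow> real"
  assumes I: "finite I"
  defines "f \<equiv> \<lambda>\<omega>. \<Sum>a\<in>I. c a * cis (lin (al a) \<omega>)"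
    and "D \<equiv> \<lambda>j \<omega>. \<Sum>a\<in>I. c a * of_real (al a j) * cis (lin (al a) \<omega>)"
  shows "Re (\<integral>\<omega>. f \<omega> * cnj (f \<omega>) \<partial>M) - (cmod (\<integral>\<omega>. f \<omega> \<partial>M))\<^sup>2
     \<le> Re (\<integral>\<omega>. (\<Sum>j<p. \<Sum>l<p. of_real (S j l) * (D j \<omega> * cnj (D l \<omega>))) \<partial>M)"
proof -
  \<comment> \<open>The mean of an exponential with frequency vector \<open>al a - al b\<close>
    factors as \<open>e a * e b * exp (G a b)\<close>. The first two factors go into the
    coefficients, so only functions of \<open>G\<close> have to be compared.\<close>
  define e where "e a = exp (- quad (al a) (al a) / 2)" for a
  define G where "G a b = quad (al a) (al b)" for a b
  have cc: "cis (lin (al a) \<omega>) * cnj (cis (lin (al b) \<omega>)) = cis (lin (\<lambda>i. al a i - al b i) \<omega>)" for a b \<omega>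
    by (simp add: lin_diff cis_cnj cis_mult)
  have Ecc: "(\<integral>\<omega>. cis (lin (\<lambda>i. al a i - al b i) \<omega>) \<partial>M) = of_real (e a * e b * exp (G a b))" for a b
    unfolding E_cis_lin quad_diff e_def G_def
    by (simp add: exp_add[symmetric] exp_of_real[symmetric] field_simps del: exp_of_real of_real_exp)
  have ff: "f \<omega> * cnj (f \<omega>) = (\<Sum>a\<in>I. \<Sum>b\<in>I. c a * cnj (c b) * cis (lin (\<lambda>i. al a i - al b i) \<omega>))" for \<omega>
    unfolding f_def cnj_sum sum_product by (intro sum.cong refl) (simp add: cc[symmetric] mult_ac)
  have E1: "(\<integral>\<omega>. f \<omega> * cnj (f \<omega>) \<partial>M) = (\<Sum>a\<in>I. \<Sum>b\<in>I. c a * cnj (c b) * of_real (e a * e b * exp (G a b)))"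
    unfolding ff by (simp add: integrable_cis_lin Ecc)
  have E2: "(\<integral>\<omega>. f \<omega> \<partial>M) = (\<Sum>a\<in>I. c a * of_real (e a))"
    unfolding f_def by (simp add: integrable_cis_lin E_cis_lin e_def)
  have "complex_of_real ((cmod (\<integral>\<omega>. f \<omega> \<partial>M))\<^sup>2) = (\<Sum>a\<in>I. \<Sum>b\<in>I. c a * cnj (c b) * of_real (e a * e b))"
    unfolding complex_norm_square E2 cnj_sum sum_product by (intro sum.cong refl) (simp add: mult_ac)
  then have E2': "(cmod (\<integral>\<omega>. f \<omega> \<partial>M))\<^sup>2 = Re (\<Sum>a\<in>I. \<Sum>b\<in>I. c a * cnj (c b) * of_real (e a * e b))"
    by (metis Re_complex_of_real)
  have DD: "(\<Sum>j<p. \<Sum>l<p. of_real (S j l) * (D j \<omega> * cnj (D l \<omega>)))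
     = (\<Sum>a\<in>I. \<Sum>b\<in>I. c a * cnj (c b) * of_real (G a b) * cis (lin (\<lambda>i. al a i - al b i) \<omega>))" for \<omega>
  proof -
    have "(\<Sum>j<p. \<Sum>l<p. of_real (S j l) * (D j \<omega> * cnj (D l \<omega>)))
      = (\<Sum>j<p. \<Sum>l<p. \<Sum>a\<in>I. \<Sum>b\<in>I. c a * cnj (c b) * cis (lin (\<lambda>i. al a i - al b i) \<omega>) * of_real (al a j * S j l * al b l))"
      unfolding D_def cnj_sum sum_product unfolding sum_distrib_left by (intro sum.cong refl) (simp add: cc[symmetric] mult_ac)
    also have "\<dots> = (\<Sum>a\<in>I. \<Sum>b\<in>I. \<Sum>j<p. \<Sum>l<p. c a * cnj (c b) * cis (lin (\<lambda>i. al a i - al b i) \<omega>) * of_real (al a j * S j l * al b l))"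
      by (rule sum_swap4)
    finally show ?thesis unfolding G_def quad_expand of_real_sum sum_distrib_left sum_distrib_right by (simp add: mult_ac)
  qed
  have E3: "(\<integral>\<omega>. (\<Sum>j<p. \<Sum>l<p. of_real (S j l) * (D j \<omega> * cnj (D l \<omega>))) \<partial>M)
     = (\<Sum>a\<in>I. \<Sum>b\<in>I. c a * cnj (c b) * of_real (G a b * (e a * e b * exp (G a b))))"
    unfolding DD by (simp add: integrable_cis_lin Ecc mult.assoc)
  have "Re (\<integral>\<omega>. (\<Sum>j<p. \<Sum>l<p. of_real (S j l) * (D j \<omega> * cnj (D l \<omega>))) \<partial>M)
      - (Re (\<integral>\<omega>. f \<omega> * cnj (f \<omega>) \<partial>M) - (cmod (\<integral>\<omega>. f \<omega> \<partial>M))\<^sup>2)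
      = Re (\<Sum>a\<in>I. \<Sum>b\<in>I. c a * cnj (c b) * of_real (e a * e b * pkernel (G a b)))"
    unfolding E1 E2' E3 Re_sum sum_subtractf[symmetric]
    by (intro sum.cong refl) (simp add: pkernel_def algebra_simps)
  \<comment> \<open>The kernel is real, so the real part of the Hermitian form is the sum of the
    real forms in the real and the imaginary parts of the coefficients.\<close>
  also have "\<dots> = (\<Sum>a\<in>I. \<Sum>b\<in>I. (Re (c a) * e a) * (Re (c b) * e b) * pkernel (G a b))
     + (\<Sum>a\<in>I. \<Sum>b\<in>I. (Im (c a) * e a) * (Im (c b) * e b) * pkernel (G a b))"
    unfolding Re_sum sum.distrib[symmetric] by (intro sum.cong refl) (simp add: algebra_simps)
  also have "\<dots> \<ge> 0" unfolding G_def by (intro add_nonneg_nonneg pkernel_psd I)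
  finally show ?thesis by linarith
qed

lemma S_upper: "dot p d (mv p S d) \<le> C * dot p d d"
proof -
  have n: "sqrt (dot p (mv p S d) (mv p S d)) \<le> C * sqrt (dot p d d)"
    using S_norm unfolding spec_norm_le_def dot_def mv_def by (simp add: power2_eq_square)
  have "dot p d (mv p S d) \<le> sqrt (dot p d d * dot p (mv p S d) (mv p S d))"
    using dot_CS[of p d "mv p S d"] by (rule real_le_rsqrt)
  also have "\<dots> = sqrt (dot p d d) * sqrt (dot p (mv p S d) (mv p S d))" by (rule real_sqrt_mult)
  also have "\<dots> \<le> sqrt (dot p d d) * (C * sqrt (dot p d d))"
    by (rule mult_left_mono[OF n]) (simp add: dot_self_nonneg)
  also have "\<dots> = C * dot p d d" using dot_self_nonneg[of p d] by simp
  finally show ?thesis .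
qed

lemma C_pos: "p > 0 \<Longrightarrow> C \<ge> 1"
  using S_upper[of "unit_fun 0"] by (simp add: dot_unit mv_unit S_diag) (simp add: unit_fun_def S_diag)

lemma lin_unit: "j < p \<Longrightarrow> lin (unit_fun j) \<omega> = X j \<omega>"
  by (simp add: lin_def dot_unit)

lemma quad_unit: "j < p \<Longrightarrow> l < p \<Longrightarrow> quad (unit_fun j) (unit_fun l) = S j l"
  by (simp add: quad_def dot_unit mv_unit)

lemma X_distr: "j < p \<Longrightarrow> distr M borel (X j) = NN"
proof -
  assume j: "j < p"
  have "distr M borel (X j) = distr M borel (lin (unit_fun j))"
    by (rule distr_cong) (simp_all add: lin_unit[OF j])
  also have "\<dots> = distr NN borel (\<lambda>y. y)"
    using lin_distr[of "unit_fun j"] by (simp add: quad_unit j S_diag)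
  also have "\<dots> = NN" by (rule distr_id2) simp
  finally show ?thesis .
qed

end

section \<open>Poincare inequalities for linear and quadratic forms of the coordinates\<close>

context gaussian_vector begin

lemma integral_X:
  fixes f :: "real \<Rightarrow> 'b::{banach, second_countable_topology}"
  assumes j: "j < p" and [measurable]: "f \<in> borel_measurable borel"
  shows "(\<integral>\<omega>. f (X j \<omega>) \<partial>M) = (\<integral>y. f y \<partial>NN)"
  unfolding X_distr[OF j, symmetric] by (rule integral_distr[symmetric]) (use j in auto)

lemma integrable_X:
  fixes f :: "real \<Rightarrow> 'b::{banach, second_countable_topology}"
  assumes j: "j < p" and [measurable]: "f \<in> borel_measurable borel" and "integrable NN f"
  shows "integrable M (\<lambda>\<omega>. f (X j \<omega>))"
  using assms(3) unfolding X_distr[OF j, symmetric] by (subst (asm) integrable_distr_eq) (use j in auto)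

lemma integrable_X_power: "j < p \<Longrightarrow> integrable M (\<lambda>\<omega>. X j \<omega> ^ k)"
  by (rule integrable_X) (auto intro: integrable_std_normal_distribution_moment)

lemma E_X_square: "j < p \<Longrightarrow> (\<integral>\<omega>. (X j \<omega>)\<^sup>2 \<partial>M) = 1"
  using std_normal_distribution_even_moments(1)[of 1] by (subst integral_X) auto

definition gvec :: "(real \<Rightarrow> real) \<Rightarrow> 'w \<Rightarrow> nat \<Rightarrow> real" where "gvec g \<omega> j = g (X j \<omega>)"

lemma gvec_measurable[measurable]:
  "g \<in> borel_measurable borel \<Longrightarrow> j < p \<Longrightarrow> (\<lambda>\<omega>. gvec g \<omega> j) \<in> borel_measurable M"
  unfolding gvec_def by (rule measurable_compose[OF X_measurable])

lemma dot_gvec_measurable: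
  assumes [measurable]: "g \<in> borel_measurable borel"
  shows "(\<lambda>\<omega>. dot p a (gvec g \<omega>)) \<in> borel_measurable M"
    "(\<lambda>\<omega>. dot p (gvec g \<omega>) (mv p B (gvec g \<omega>))) \<in> borel_measurable M"
  unfolding dot_def mv_def by (intro borel_measurable_sum borel_measurable_times gvec_measurable assms; simp)+

text \<open>An instance of \<open>poincare_trig\<close> whose frequency vectors are multiples of
  unit vectors, so the \<open>i\<close>-th partial derivative retains only the terms of coordinate
  \<open>i\<close>.\<close>

lemma poincare_linear:
  fixes b t :: "nat \<Rightarrow> real"
  assumes J: "finite J"
  defines "g \<equiv> \<lambda>x. \<Sum>k\<in>J. b k * sin (t k * x)" and "g' \<equiv> \<lambda>x. \<Sum>k\<in>J. b k * t k * cos (t k * x)"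
  shows "(\<integral>\<omega>. (dot p a (gvec g \<omega>))\<^sup>2 \<partial>M) - (\<integral>\<omega>. dot p a (gvec g \<omega>) \<partial>M)\<^sup>2
     \<le> (\<integral>\<omega>. dot p (\<lambda>j. a j * gvec g' \<omega> j) (mv p S (\<lambda>j. a j * gvec g' \<omega> j)) \<partial>M)"
proof -
  define s where "s = (\<lambda>(\<sigma>, k). complex_of_real ((if \<sigma> then b k else - b k) / 2) * - \<i>)"
  define \<tau> where "\<tau> = (\<lambda>(\<sigma>, k). if \<sigma> then t k else - t k)"
  define J2 where "J2 = (UNIV :: bool set) \<times> J"
  have fJ: "finite J2" using J by (simp add: J2_def)
  have g1: "(\<Sum>m\<in>J2. s m * cis (\<tau> m * x)) = complex_of_real (g x)"
    and g2: "(\<Sum>m\<in>J2. s m * of_real (\<tau> m) * cis (\<tau> m * x)) = - \<i> * complex_of_real (g' x)" for x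
    using trig_exponential_form[OF J, of b t x] by (simp_all add: s_def \<tau>_def J2_def g_def g'_def)
  define al where "al = (\<lambda>(j, m). \<lambda>i. \<tau> m * unit_fun j i)"
  define c where "c = (\<lambda>(j, m). complex_of_real (a j) * s m)"
  define I where "I = {..<p} \<times> J2"
  have I: "finite I" using fJ by (simp add: I_def)
  have l: "lin (al (j, m)) \<omega> = \<tau> m * X j \<omega>" if "j < p" for j m \<omega>
    using that by (simp add: al_def lin_scale lin_unit)
  have alx: "al (j, m) i = \<tau> m * unit_fun j i" for j m i by (simp add: al_def)
  have f: "(\<Sum>x\<in>I. c x * cis (lin (al x) \<omega>)) = complex_of_real (dot p a (gvec g \<omega>))" for \<omega>
  proof -
    have "(\<Sum>x\<in>I. c x * cis (lin (al x) \<omega>)) = (\<Sum>j<p. \<Sum>m\<in>J2. c (j, m) * cis (lin (al (j, m)) \<omega>))"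
      unfolding I_def by (simp add: sum.cartesian_product)
    also have "\<dots> = (\<Sum>j<p. complex_of_real (a j) * (\<Sum>m\<in>J2. s m * cis (\<tau> m * X j \<omega>)))"
      unfolding sum_distrib_left by (intro sum.cong refl) (simp add: l c_def)
    finally show ?thesis by (simp add: g1 dot_def gvec_def)
  qed
  have D: "(\<Sum>x\<in>I. c x * of_real (al x i) * cis (lin (al x) \<omega>)) = - \<i> * complex_of_real (a i * gvec g' \<omega> i)" if i: "i < p" for \<omega> i
  proof -
    have "(\<Sum>x\<in>I. c x * of_real (al x i) * cis (lin (al x) \<omega>)) = (\<Sum>j<p. \<Sum>m\<in>J2. c (j, m) * of_real (al (j, m) i) * cis (lin (al (j, m)) \<omega>))"
      unfolding I_def by (simp add: sum.cartesian_product)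
    also have "\<dots> = (\<Sum>j<p. (if i = j then complex_of_real (a j) * (\<Sum>m\<in>J2. s m * of_real (\<tau> m) * cis (\<tau> m * X j \<omega>)) else 0))"
      unfolding sum_distrib_left by (intro sum.cong refl) (auto simp: l c_def alx unit_fun_def mult_ac)
    also have "\<dots> = complex_of_real (a i) * (- \<i> * complex_of_real (g' (X i \<omega>)))" using i by (simp add: g2)
    finally show ?thesis by (simp add: gvec_def)
  qed
  have q: "(\<Sum>j<p. \<Sum>l<p. of_real (S j l) * ((- \<i> * complex_of_real (d j)) * cnj (- \<i> * complex_of_real (d l)))) = complex_of_real (dot p d (mv p S d))" for d
    unfolding dot_def mv_def of_real_sum sum_distrib_left of_real_mult
    by (intro sum.cong refl) (simp add: mult_ac)
  have D': "(\<Sum>j<p. \<Sum>l<p. of_real (S j l) * ((\<Sum>x\<in>I. c x * of_real (al x j) * cis (lin (al x) \<omega>)) * cnj (\<Sum>x\<in>I. c x * of_real (al x l) * cis (lin (al x) \<omega>))))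
     = complex_of_real (dot p (\<lambda>j. a j * gvec g' \<omega> j) (mv p S (\<lambda>j. a j * gvec g' \<omega> j)))" for \<omega>
    unfolding q[symmetric] by (intro sum.cong refl) (simp only: D lessThan_iff)
  show ?thesis
    using poincare_trig[OF I, of c al] unfolding f D'
    by (simp add: power2_eq_square flip: of_real_mult)
qed

text \<open>Here the frequency vectors are combinations of two unit vectors, one for each factor
  \<open>g (X j) * g (X l)\<close>. The product rule yields two sums, which symmetry of
  \<open>B\<close> merges into the factor 2 in \<open>d\<close>.\<close>

lemma poincare_quadratic:
  fixes b t :: "nat \<Rightarrow> real"
  assumes J: "finite J" and B: "\<And>i j. i < p \<Longrightarrow> j < p \<Longrightarrow> B i j = B j i"
  defines "g \<equiv> \<lambda>x. \<Sum>k\<in>J. b k * sin (t k * x)" and "g' \<equiv> \<lambda>x. \<Sum>k\<in>J. b k * t k * cos (t k * x)"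
  defines "d \<equiv> \<lambda>\<omega> i. 2 * gvec g' \<omega> i * mv p B (gvec g \<omega>) i"
  shows "(\<integral>\<omega>. (dot p (gvec g \<omega>) (mv p B (gvec g \<omega>)))\<^sup>2 \<partial>M) - (\<integral>\<omega>. dot p (gvec g \<omega>) (mv p B (gvec g \<omega>)) \<partial>M)\<^sup>2
     \<le> (\<integral>\<omega>. dot p (d \<omega>) (mv p S (d \<omega>)) \<partial>M)"
proof -
  define s where "s = (\<lambda>(\<sigma>, k). complex_of_real ((if \<sigma> then b k else - b k) / 2) * - \<i>)"
  define \<tau> where "\<tau> = (\<lambda>(\<sigma>, k). if \<sigma> then t k else - t k)"
  define J2 where "J2 = (UNIV :: bool set) \<times> J"
  have fJ: "finite J2" using J by (simp add: J2_def)
  have g1: "(\<Sum>m\<in>J2. s m * cis (\<tau> m * x)) = complex_of_real (g x)"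
    and g2: "(\<Sum>m\<in>J2. s m * of_real (\<tau> m) * cis (\<tau> m * x)) = - \<i> * complex_of_real (g' x)" for x
    using trig_exponential_form[OF J, of b t x] by (simp_all add: s_def \<tau>_def J2_def g_def g'_def)
  define al where "al = (\<lambda>((j, l), (m, n)). \<lambda>i. \<tau> m * unit_fun j i + \<tau> n * unit_fun l i)"
  define c where "c = (\<lambda>((j, l), (m, n)). complex_of_real (B j l) * s m * s n)"
  define I where "I = ({..<p} \<times> {..<p}) \<times> (J2 \<times> J2)"
  have I: "finite I" using fJ by (simp add: I_def)
  have l: "lin (al ((j, l), (m, n))) \<omega> = \<tau> m * X j \<omega> + \<tau> n * X l \<omega>" if "j < p" "l < p" for j l m n \<omega>
    using that by (simp add: al_def lin_scale lin_add lin_unit)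
  have alx: "al ((j, l), (m, n)) i = \<tau> m * unit_fun j i + \<tau> n * unit_fun l i" for j l m n i by (simp add: al_def)
  have sI: "(\<Sum>x\<in>I. F x) = (\<Sum>j<p. \<Sum>l<p. \<Sum>m\<in>J2. \<Sum>n\<in>J2. F ((j, l), (m, n)))" for F :: "_ \<Rightarrow> complex"
  proof -
    have "(\<Sum>x\<in>I. F x) = (\<Sum>jl\<in>{..<p} \<times> {..<p}. \<Sum>mn\<in>J2 \<times> J2. F (jl, mn))"
      unfolding I_def by (simp add: sum.cartesian_product)
    also have "\<dots> = (\<Sum>jl\<in>{..<p} \<times> {..<p}. \<Sum>m\<in>J2. \<Sum>n\<in>J2. F (jl, (m, n)))"
      by (intro sum.cong refl) (simp add: sum.cartesian_product)
    also have "\<dots> = (\<Sum>j<p. \<Sum>l<p. \<Sum>m\<in>J2. \<Sum>n\<in>J2. F ((j, l), (m, n)))"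
      by (simp add: sum.cartesian_product[of "\<lambda>j l. \<Sum>m\<in>J2. \<Sum>n\<in>J2. F ((j, l), (m, n))"] split_beta')
    finally show ?thesis .
  qed
  let ?G = "\<lambda>j \<omega>. \<Sum>m\<in>J2. s m * cis (\<tau> m * X j \<omega>)"
  let ?G' = "\<lambda>j \<omega>. \<Sum>m\<in>J2. s m * of_real (\<tau> m) * cis (\<tau> m * X j \<omega>)"
  have f: "(\<Sum>x\<in>I. c x * cis (lin (al x) \<omega>)) = complex_of_real (dot p (gvec g \<omega>) (mv p B (gvec g \<omega>)))" for \<omega>
  proof -
    have "(\<Sum>x\<in>I. c x * cis (lin (al x) \<omega>)) = (\<Sum>j<p. \<Sum>l<p. complex_of_real (B j l) * (?G j \<omega> * ?G l \<omega>))"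
      unfolding sI sum_product unfolding sum_distrib_left
      by (intro sum.cong refl) (simp add: l c_def cis_mult[symmetric] mult_ac)
    then show ?thesis unfolding g1
      by (simp add: dot_def mv_def gvec_def sum_distrib_left mult_ac)
  qed
  have D: "(\<Sum>x\<in>I. c x * of_real (al x i) * cis (lin (al x) \<omega>)) = - \<i> * complex_of_real (d \<omega> i)" if i: "i < p" for \<omega> i
  proof -
    have "(\<Sum>x\<in>I. c x * of_real (al x i) * cis (lin (al x) \<omega>))
      = (\<Sum>j<p. \<Sum>l<p. complex_of_real (B j l) * of_real (unit_fun j i) * (?G' j \<omega> * ?G l \<omega>)
          + complex_of_real (B j l) * of_real (unit_fun l i) * (?G j \<omega> * ?G' l \<omega>))"
      unfolding sI sum_product unfolding sum_distrib_left sum.distrib[symmetric]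
      by (intro sum.cong refl) (simp add: l c_def alx cis_mult[symmetric] algebra_simps)
    also have "\<dots> = (\<Sum>j<p. \<Sum>l<p. (if i = j then complex_of_real (B j l) * (?G' j \<omega> * ?G l \<omega>) else 0))
        + (\<Sum>j<p. \<Sum>l<p. (if i = l then complex_of_real (B j l) * (?G j \<omega> * ?G' l \<omega>) else 0))"
      unfolding sum.distrib[symmetric] by (intro sum.cong refl) (auto simp: unit_fun_def)
    also have "(\<Sum>j<p. \<Sum>l<p. (if i = j then complex_of_real (B j l) * (?G' j \<omega> * ?G l \<omega>) else 0))
       = (\<Sum>l<p. complex_of_real (B i l) * (?G' i \<omega> * ?G l \<omega>))"
    proof -
      have "(\<Sum>l<p. (if i = j then complex_of_real (B j l) * (?G' j \<omega> * ?G l \<omega>) else 0))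
        = (if i = j then (\<Sum>l<p. complex_of_real (B j l) * (?G' j \<omega> * ?G l \<omega>)) else 0)" for j by simp
      then show ?thesis using i by (simp add: sum.delta)
    qed
    also have "(\<Sum>j<p. \<Sum>l<p. (if i = l then complex_of_real (B j l) * (?G j \<omega> * ?G' l \<omega>) else 0))
       = (\<Sum>j<p. complex_of_real (B i j) * (?G' i \<omega> * ?G j \<omega>))"
      using i B by (intro sum.cong refl) (simp add: sum.delta mult_ac)
    finally show ?thesis unfolding g1 g2
      by (simp add: d_def gvec_def mv_def sum_distrib_left sum_distrib_right mult_ac)
  qed
  have q: "(\<Sum>j<p. \<Sum>l<p. of_real (S j l) * ((- \<i> * complex_of_real (d j)) * cnj (- \<i> * complex_of_real (d l)))) = complex_of_real (dot p d (mv p S d))" for d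
    unfolding dot_def mv_def of_real_sum sum_distrib_left of_real_mult
    by (intro sum.cong refl) (simp add: mult_ac)
  have D': "(\<Sum>j<p. \<Sum>l<p. of_real (S j l) * ((\<Sum>x\<in>I. c x * of_real (al x j) * cis (lin (al x) \<omega>)) * cnj (\<Sum>x\<in>I. c x * of_real (al x l) * cis (lin (al x) \<omega>))))
     = complex_of_real (dot p (d \<omega>) (mv p S (d \<omega>)))" for \<omega>
    unfolding q[symmetric] by (intro sum.cong refl) (simp only: D lessThan_iff)
  show ?thesis
    using poincare_trig[OF I, of c al] unfolding f D'
    by (simp add: power2_eq_square flip: of_real_mult)
qed

lemma E_sin_prod:
  assumes "j < p" "l < p"
  shows "(\<integral>\<omega>. sin (s * X j \<omega>) * sin (t * X l \<omega>) \<partial>M) = exp (- (s\<^sup>2 + t\<^sup>2) / 2) * sinh (s * t * S j l)"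
proof -
  let ?a = "\<lambda>i. s * unit_fun j i" and ?b = "\<lambda>i. t * unit_fun l i"
  have Ec: "(\<integral>\<omega>. cos (lin a \<omega>) \<partial>M) = exp (- quad a a / 2)" and ic: "integrable M (\<lambda>\<omega>. cos (lin a \<omega>))" for a
  proof -
    have "(\<integral>\<omega>. Re (cis (lin a \<omega>)) \<partial>M) = Re (\<integral>\<omega>. cis (lin a \<omega>) \<partial>M)"
      by (rule integral_Re[OF integrable_cis_lin])
    then show "(\<integral>\<omega>. cos (lin a \<omega>) \<partial>M) = exp (- quad a a / 2)" by (simp add: E_cis_lin)
    show "integrable M (\<lambda>\<omega>. cos (lin a \<omega>))" by (rule integrable_const_bound[where B = 1]) auto
  qed
  have e: "sin (s * X j \<omega>) * sin (t * X l \<omega>) = (cos (lin (\<lambda>i. ?a i - ?b i) \<omega>) - cos (lin (\<lambda>i. ?a i + ?b i) \<omega>)) / 2" for \<omega>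
    using assms by (simp add: lin_diff lin_add lin_scale lin_unit cos_diff cos_add)
  have q: "quad ?a ?a = s\<^sup>2" "quad ?b ?b = t\<^sup>2" "quad ?a ?b = s * t * S j l"
    using assms by (simp_all add: quad_scale quad_unit S_diag power2_eq_square)
  have "(\<integral>\<omega>. sin (s * X j \<omega>) * sin (t * X l \<omega>) \<partial>M)
     = (exp (- (s\<^sup>2 + t\<^sup>2 - 2 * (s * t * S j l)) / 2) - exp (- (s\<^sup>2 + t\<^sup>2 + 2 * (s * t * S j l)) / 2)) / 2"
    unfolding e by (simp add: ic Ec quad_diff quad_add q)
  also have "exp (- (s\<^sup>2 + t\<^sup>2 - 2 * (s * t * S j l)) / 2) = exp (- (s\<^sup>2 + t\<^sup>2) / 2) * exp (s * t * S j l)"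
    unfolding exp_add[symmetric] by (rule arg_cong[of _ _ exp]) (simp add: field_simps)
  also have "exp (- (s\<^sup>2 + t\<^sup>2 + 2 * (s * t * S j l)) / 2) = exp (- (s\<^sup>2 + t\<^sup>2) / 2) * exp (- (s * t * S j l))"
    unfolding exp_add[symmetric] by (rule arg_cong[of _ _ exp]) (simp add: field_simps)
  finally show ?thesis by (simp add: sinh_def right_diff_distrib)
qed

lemma E_sin: "j < p \<Longrightarrow> (\<integral>\<omega>. sin (t * X j \<omega>) \<partial>M) = 0"
proof -
  assume j: "j < p"
  have "(\<integral>\<omega>. Im (cis (lin (\<lambda>i. t * unit_fun j i) \<omega>)) \<partial>M) = Im (\<integral>\<omega>. cis (lin (\<lambda>i. t * unit_fun j i) \<omega>) \<partial>M)"
    by (rule integral_Im[OF integrable_cis_lin])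
  also have "\<dots> = 0" by (simp add: E_cis_lin)
  finally show ?thesis using j by (simp add: lin_scale lin_unit)
qed

lemma S_bound: "j < p \<Longrightarrow> l < p \<Longrightarrow> \<bar>S j l\<bar> \<le> 1"
  using quad_nonneg[of "\<lambda>i. unit_fun j i + unit_fun l i"] quad_nonneg[of "\<lambda>i. unit_fun j i - unit_fun l i"]
  by (simp add: quad_add quad_diff quad_unit S_diag)

end

section \<open>Passage from trigonometric sums to the distribution function\<close>

lemma sum_abs_power4:
  fixes x :: "nat \<Rightarrow> real"
  shows "(\<Sum>j<p. \<bar>x j\<bar>) ^ 4 \<le> real p ^ 3 * (\<Sum>j<p. x j ^ 4)"
proof -
  have 1: "(\<Sum>j<p. \<bar>x j\<bar>)\<^sup>2 \<le> real p * (\<Sum>j<p. (x j)\<^sup>2)"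
    using Cauchy_Schwarz_ineq_sum[of "\<lambda>_. 1" "\<lambda>j. \<bar>x j\<bar>" "{..<p}"] by simp
  have 2: "(\<Sum>j<p. (x j)\<^sup>2)\<^sup>2 \<le> real p * (\<Sum>j<p. x j ^ 4)"
    using Cauchy_Schwarz_ineq_sum[of "\<lambda>_. 1" "\<lambda>j. (x j)\<^sup>2" "{..<p}"] by simp
  have "(\<Sum>j<p. \<bar>x j\<bar>) ^ 4 = ((\<Sum>j<p. \<bar>x j\<bar>)\<^sup>2)\<^sup>2" by simp
  also have "\<dots> \<le> (real p * (\<Sum>j<p. (x j)\<^sup>2))\<^sup>2" by (rule power_mono[OF 1]) simp
  also have "\<dots> = (real p)\<^sup>2 * (\<Sum>j<p. (x j)\<^sup>2)\<^sup>2" by (rule power_mult_distrib)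
  also have "\<dots> \<le> (real p)\<^sup>2 * (real p * (\<Sum>j<p. x j ^ 4))" by (rule mult_left_mono[OF 2]) simp
  also have "\<dots> = real p ^ 3 * (\<Sum>j<p. x j ^ 4)" by (simp add: power2_eq_square power3_eq_cube)
  finally show ?thesis .
qed

lemma abs_quadratic_bound:
  assumes "\<And>i j. i < p \<Longrightarrow> j < p \<Longrightarrow> \<bar>B i j\<bar> \<le> K" and "\<And>j. j < p \<Longrightarrow> \<bar>g j\<bar> \<le> \<bar>x j\<bar>"
  shows "\<bar>dot p g (mv p B g)\<bar> \<le> K * (\<Sum>j<p. \<bar>x j\<bar>)\<^sup>2"
proof -
  have "\<bar>dot p g (mv p B g)\<bar> \<le> (\<Sum>i<p. \<Sum>j<p. \<bar>g i * (B i j * g j)\<bar>)"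
    unfolding dot_def mv_def sum_distrib_left by (rule order_trans[OF sum_abs sum_mono[OF sum_abs]])
  also have "\<dots> \<le> (\<Sum>i<p. \<Sum>j<p. \<bar>x i\<bar> * (K * \<bar>x j\<bar>))"
    unfolding abs_mult using assms by (intro sum_mono mult_mono) (auto intro: order_trans[OF abs_ge_zero])
  also have "\<dots> = K * (\<Sum>j<p. \<bar>x j\<bar>)\<^sup>2"
    by (simp add: power2_eq_square sum_product sum_distrib_left mult_ac)
  finally show ?thesis .
qed

lemma sqrt_2pi: "sqrt (2 * pi) > 1" "(1 / sqrt (2 * pi))\<^sup>2 \<le> 1 / 2" "2 * pi > 6"
  using pi_gt3 by (auto simp: power_divide field_simps)

context gaussian_vector begin

lemma gN_measurable[measurable]: "gN n \<in> borel_measurable borel"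
  unfolding gN_def[abs_def] by measurable

lemma abs_gN_le: "odd n \<Longrightarrow> \<bar>gN n x\<bar> \<le> \<bar>x\<bar>"
  using gN_bound[of n x] sqrt_2pi(1) by (smt (verit) abs_ge_zero divide_le_eq_1 mult_left_le times_divide_eq_right mult_cancel_left1 divide_right_mono div_by_1 frac_le)

lemma gN_square_le: "odd n \<Longrightarrow> (gN n x)\<^sup>2 \<le> x\<^sup>2 / 2"
proof -
  assume "odd n"
  then have "\<bar>gN n x\<bar>\<^sup>2 \<le> (\<bar>x\<bar> / sqrt (2 * pi))\<^sup>2" by (intro power_mono gN_bound) auto
  also have "\<dots> = x\<^sup>2 * (1 / sqrt (2 * pi))\<^sup>2" by (simp add: power_divide)
  also have "\<dots> \<le> x\<^sup>2 * (1 / 2)" by (intro mult_left_mono sqrt_2pi) simp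
  finally show ?thesis by simp
qed

lemma gN'_square_le: "(gN' n x)\<^sup>2 \<le> 1 / 2"
  using power_mono[OF gN'_bound[of n x], of 2] sqrt_2pi(2) by simp

lemma gN_trig:
  assumes "odd n"
  shows "gN n = (\<lambda>x. \<Sum>k\<in>{..n}. coefN n k / freqN n k * sin (freqN n k * x))"
    "gN' n = (\<lambda>x. \<Sum>k\<in>{..n}. coefN n k / freqN n k * freqN n k * cos (freqN n k * x))"
  using freqN_nonzero[OF assms] by (simp_all add: gN_def[abs_def] gN'_sum fun_eq_iff)

text \<open>A majorant independent of \<open>g\<close> with finite mean, for dominated convergence
  along the approximations at fixed \<open>p\<close>. Its powers of \<open>p\<close> are crude, but
  they do not enter the resulting variance bound.\<close>

lemma dominating:
  assumes B: "\<And>i j. i < p \<Longrightarrow> j < p \<Longrightarrow> \<bar>B i j\<bar> \<le> K" and g: "\<And>x. \<bar>g x\<bar> \<le> \<bar>x\<bar>"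
  shows "(dot p (gvec g \<omega>) (mv p B (gvec g \<omega>)))\<^sup>2 \<le> K\<^sup>2 * (real p ^ 3 * (\<Sum>j<p. X j \<omega> ^ 4))"
proof -
  have "\<bar>dot p (gvec g \<omega>) (mv p B (gvec g \<omega>))\<bar>\<^sup>2 \<le> (K * (\<Sum>j<p. \<bar>X j \<omega>\<bar>)\<^sup>2)\<^sup>2"
    by (intro power_mono abs_quadratic_bound) (auto simp: B g gvec_def)
  also have "\<dots> = K\<^sup>2 * (\<Sum>j<p. \<bar>X j \<omega>\<bar>) ^ 4" by (simp add: power_mult_distrib)
  also have "\<dots> \<le> K\<^sup>2 * (real p ^ 3 * (\<Sum>j<p. X j \<omega> ^ 4))" by (intro mult_left_mono sum_abs_power4) simp
  finally show ?thesis by simp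
qed

lemma entries_bounded: "\<exists>K. \<forall>i<p. \<forall>j<p. \<bar>B i j\<bar> \<le> (K :: real)"
proof -
  have "\<bar>B i j\<bar> \<le> Max (insert 0 ((\<lambda>(i, j). \<bar>B i j\<bar>) ` ({..<p} \<times> {..<p})))" if "i < p" "j < p" for i j
    using that by (intro Max_ge) force+
  then show ?thesis by blast
qed

lemma integrable_dominating: "integrable M (\<lambda>\<omega>. K\<^sup>2 * (real p ^ 3 * (\<Sum>j<p. X j \<omega> ^ 4)))"
  by (intro integrable_mult_right Bochner_Integration.integrable_sum integrable_X_power) simp

lemma square_integrable_quadratic:
  assumes [measurable]: "g \<in> borel_measurable borel" and g: "\<And>x. \<bar>g x\<bar> \<le> \<bar>x\<bar>"
  shows "integrable M (\<lambda>\<omega>. (dot p (gvec g \<omega>) (mv p B (gvec g \<omega>)))\<^sup>2)"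
    "integrable M (\<lambda>\<omega>. dot p (gvec g \<omega>) (mv p B (gvec g \<omega>)))"
proof -
  obtain K where K: "\<And>i j. i < p \<Longrightarrow> j < p \<Longrightarrow> \<bar>B i j\<bar> \<le> K" using entries_bounded by blast
  note [measurable] = dot_gvec_measurable(2)[OF assms(1)]
  show 1: "integrable M (\<lambda>\<omega>. (dot p (gvec g \<omega>) (mv p B (gvec g \<omega>)))\<^sup>2)"
    by (rule Bochner_Integration.integrable_bound[OF integrable_dominating[of K]]) (auto intro!: AE_I2 order_trans[OF dominating[OF K g] abs_ge_self])
  show "integrable M (\<lambda>\<omega>. dot p (gvec g \<omega>) (mv p B (gvec g \<omega>)))"
    by (rule square_integrable_imp_integrable[OF _ 1]) measurable
qed

text \<open>In the Poincare gradient \<open>2 g' (X i) (B g)_i\<close> the factor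
  \<open>4 g'\<^sup>2\<close> is at most 2, and \<open>g\<^sup>2 \<le> x\<^sup>2 / 2\<close>. The
  energy is therefore at most \<open>C * b\<close> times the sum of the squared coordinates, whose
  mean is \<open>p\<close>.\<close>

lemma gN_variance:
  assumes n: "odd n" and p: "p > 0"
    and B: "\<And>i j. i < p \<Longrightarrow> j < p \<Longrightarrow> B i j = B j i"
    and Bn: "\<And>x. dot p (mv p B x) (mv p B x) \<le> b * dot p x x" and b: "b \<ge> 0"
  shows "(\<integral>\<omega>. (dot p (gvec (gN n) \<omega>) (mv p B (gvec (gN n) \<omega>)))\<^sup>2 \<partial>M)
     - (\<integral>\<omega>. dot p (gvec (gN n) \<omega>) (mv p B (gvec (gN n) \<omega>)) \<partial>M)\<^sup>2 \<le> C * b * real p"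
proof -
  define d where "d \<omega> i = 2 * gvec (gN' n) \<omega> i * mv p B (gvec (gN n) \<omega>) i" for \<omega> i
  have C: "C \<ge> 0" using C_pos[OF p] by simp
  have pt: "dot p (d \<omega>) (mv p S (d \<omega>)) \<le> C * (b * (\<Sum>j<p. (X j \<omega>)\<^sup>2))" for \<omega>
  proof -
    have "dot p (d \<omega>) (d \<omega>) \<le> 2 * dot p (mv p B (gvec (gN n) \<omega>)) (mv p B (gvec (gN n) \<omega>))"
      unfolding dot_def sum_distrib_left
    proof (rule sum_mono)
      fix i
      have "d \<omega> i * d \<omega> i = 4 * (gN' n (X i \<omega>))\<^sup>2 * (mv p B (gvec (gN n) \<omega>) i)\<^sup>2"
        by (simp add: d_def gvec_def power2_eq_square)
      also have "\<dots> \<le> 2 * (mv p B (gvec (gN n) \<omega>) i)\<^sup>2"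
        by (rule mult_right_mono) (use gN'_square_le[of n "X i \<omega>"] in auto)
      finally show "d \<omega> i * d \<omega> i \<le> 2 * (mv p B (gvec (gN n) \<omega>) i * mv p B (gvec (gN n) \<omega>) i)"
        by (simp add: power2_eq_square)
    qed
    also have "\<dots> \<le> 2 * (b * dot p (gvec (gN n) \<omega>) (gvec (gN n) \<omega>))" using Bn by simp
    also have "\<dots> \<le> 2 * (b * (\<Sum>j<p. (X j \<omega>)\<^sup>2 / 2))"
      unfolding dot_def gvec_def using b n gN_square_le
      by (intro mult_left_mono sum_mono) (auto simp: power2_eq_square)
    also have "\<dots> = b * (\<Sum>j<p. (X j \<omega>)\<^sup>2)" by (simp add: sum_divide_distrib[symmetric])
    finally have "C * dot p (d \<omega>) (d \<omega>) \<le> C * (b * (\<Sum>j<p. (X j \<omega>)\<^sup>2))" using C by (rule mult_left_mono)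
    then show ?thesis using S_upper[of "d \<omega>"] by linarith
  qed
  have "(\<integral>\<omega>. (dot p (gvec (gN n) \<omega>) (mv p B (gvec (gN n) \<omega>)))\<^sup>2 \<partial>M)
     - (\<integral>\<omega>. dot p (gvec (gN n) \<omega>) (mv p B (gvec (gN n) \<omega>)) \<partial>M)\<^sup>2 \<le> (\<integral>\<omega>. dot p (d \<omega>) (mv p S (d \<omega>)) \<partial>M)"
    using poincare_quadratic[of "{..n}" B "\<lambda>k. coefN n k / freqN n k" "freqN n"] B
    unfolding gN_trig[OF n, symmetric] by (simp add: d_def[abs_def])
  also have "\<dots> \<le> (\<integral>\<omega>. C * (b * (\<Sum>j<p. (X j \<omega>)\<^sup>2)) \<partial>M)"
  proof (rule integral_mono')
    show "integrable M (\<lambda>\<omega>. C * (b * (\<Sum>j<p. (X j \<omega>)\<^sup>2)))"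
      by (intro integrable_mult_right Bochner_Integration.integrable_sum integrable_X_power) simp
    show "0 \<le> C * (b * (\<Sum>j<p. (X j \<omega>)\<^sup>2))" for \<omega> using C b by (intro mult_nonneg_nonneg sum_nonneg) auto
  qed (rule pt)
  also have "\<dots> = C * b * real p"
    by (simp add: integrable_X_power E_X_square)
  finally show ?thesis .
qed

lemma cPhi_variance:
  assumes p: "p > 0"
    and B: "\<And>i j. i < p \<Longrightarrow> j < p \<Longrightarrow> B i j = B j i"
    and Bn: "\<And>x. dot p (mv p B x) (mv p B x) \<le> b * dot p x x" and b: "b \<ge> 0"
  shows "(\<integral>\<omega>. (dot p (gvec cPhi \<omega>) (mv p B (gvec cPhi \<omega>)))\<^sup>2 \<partial>M)
     - (\<integral>\<omega>. dot p (gvec cPhi \<omega>) (mv p B (gvec cPhi \<omega>)) \<partial>M)\<^sup>2 \<le> C * b * real p"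
proof -
  obtain K where K: "\<And>i j. i < p \<Longrightarrow> j < p \<Longrightarrow> \<bar>B i j\<bar> \<le> K" using entries_bounded by blast
  let ?w = "\<lambda>\<omega>. K\<^sup>2 * (real p ^ 3 * (\<Sum>j<p. X j \<omega> ^ 4))"
  let ?q = "\<lambda>g \<omega>. dot p (gvec g \<omega>) (mv p B (gvec g \<omega>))"
  have odd: "odd (2 * m + 1)" for m :: nat by simp
  note [measurable] = dot_gvec_measurable(2)[OF cPhi_measurable] dot_gvec_measurable(2)[OF gN_measurable]
  have lim: "(\<lambda>m. ?q (gN (2 * m + 1)) \<omega>) \<longlonglongrightarrow> ?q cPhi \<omega>" for \<omega>
    unfolding dot_def mv_def gvec_def by (intro tendsto_sum tendsto_mult tendsto_const gN_tendsto)
  have dom: "(?q (gN (2 * m + 1)) \<omega>)\<^sup>2 \<le> ?w \<omega>" for m \<omega>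
    by (rule dominating[OF K]) (use abs_gN_le[OF odd] in auto)
  have l2: "(\<lambda>m. \<integral>\<omega>. (?q (gN (2 * m + 1)) \<omega>)\<^sup>2 \<partial>M) \<longlonglongrightarrow> (\<integral>\<omega>. (?q cPhi \<omega>)\<^sup>2 \<partial>M)"
  proof (rule integral_dominated_convergence[where w = ?w])
    show "integrable M ?w" by (rule integrable_dominating)
    show "AE \<omega> in M. (\<lambda>m. (?q (gN (2 * m + 1)) \<omega>)\<^sup>2) \<longlonglongrightarrow> (?q cPhi \<omega>)\<^sup>2"
      by (intro AE_I2 tendsto_power lim)
    show "AE \<omega> in M. norm ((?q (gN (2 * m + 1)) \<omega>)\<^sup>2) \<le> ?w \<omega>" for m using dom by (auto intro!: AE_I2)
  qed measurable
  have l1: "(\<lambda>m. \<integral>\<omega>. ?q (gN (2 * m + 1)) \<omega> \<partial>M) \<longlonglongrightarrow> (\<integral>\<omega>. ?q cPhi \<omega> \<partial>M)"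
  proof (rule integral_dominated_convergence[where w = "\<lambda>\<omega>. 1 + ?w \<omega>"])
    show "integrable M (\<lambda>\<omega>. 1 + ?w \<omega>)" using integrable_dominating by (intro Bochner_Integration.integrable_add) auto
    show "AE \<omega> in M. (\<lambda>m. ?q (gN (2 * m + 1)) \<omega>) \<longlonglongrightarrow> ?q cPhi \<omega>" by (intro AE_I2 lim)
    have "\<bar>t\<bar> \<le> 1 + t\<^sup>2" for t :: real
      using sum_power2_ge_zero[of "\<bar>t\<bar> - 1" 0] zero_le_power2[of t] by (simp add: power2_eq_square algebra_simps)
    then have "\<bar>?q (gN (2 * m + 1)) \<omega>\<bar> \<le> 1 + ?w \<omega>" for m \<omega> using dom[of m \<omega>] by (smt (verit))
    then show "AE \<omega> in M. norm (?q (gN (2 * m + 1)) \<omega>) \<le> 1 + ?w \<omega>" for m by (auto intro!: AE_I2)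
  qed measurable
  show ?thesis
    by (rule LIMSEQ_le_const2[OF tendsto_diff[OF l2 tendsto_power[OF l1]]])
      (use gN_variance[OF odd p B Bn b] in blast)
qed

text \<open>Sines of centred Gaussians have mean zero, so the variance controlled by the Poincare
  inequality is the second moment.\<close>

lemma gN_linear:
  assumes n: "odd n" and p: "p > 0"
  shows "(\<integral>\<omega>. (dot p a (gvec (gN n) \<omega>))\<^sup>2 \<partial>M) \<le> C * dot p a a"
proof -
  have C: "C \<ge> 0" using C_pos[OF p] by simp
  define d where "d \<omega> j = a j * gvec (gN' n) \<omega> j" for \<omega> j
  have pt: "dot p (d \<omega>) (mv p S (d \<omega>)) \<le> C * dot p a a" for \<omega>
  proof -
    have "dot p (d \<omega>) (d \<omega>) \<le> dot p a a"
      unfolding dot_def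
    proof (rule sum_mono)
      fix i
      have "d \<omega> i * d \<omega> i = (a i)\<^sup>2 * (gN' n (X i \<omega>))\<^sup>2" by (simp add: d_def gvec_def power2_eq_square)
      also have "\<dots> \<le> (a i)\<^sup>2 * 1" by (rule mult_left_mono) (use gN'_square_le[of n "X i \<omega>"] in auto)
      finally show "d \<omega> i * d \<omega> i \<le> a i * a i" by (simp add: power2_eq_square)
    qed
    from mult_left_mono[OF this C] S_upper[of "d \<omega>"] show ?thesis by linarith
  qed
  have s0: "(\<integral>\<omega>. gvec (gN n) \<omega> j \<partial>M) = 0" and sI: "integrable M (\<lambda>\<omega>. gvec (gN n) \<omega> j)" if j: "j < p" for j
  proof -
    have [simp]: "integrable M (\<lambda>\<omega>. sin (t * X j \<omega>))" for t
      by (rule integrable_const_bound[where B = 1]) (use j in auto)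
    show "(\<integral>\<omega>. gvec (gN n) \<omega> j \<partial>M) = 0" unfolding gvec_def gN_def by (simp add: E_sin j)
    show "integrable M (\<lambda>\<omega>. gvec (gN n) \<omega> j)" unfolding gvec_def gN_def by simp
  qed
  have E0: "(\<integral>\<omega>. dot p a (gvec (gN n) \<omega>) \<partial>M) = 0"
    unfolding dot_def by (simp add: s0 sI)
  have "(\<integral>\<omega>. (dot p a (gvec (gN n) \<omega>))\<^sup>2 \<partial>M) \<le> (\<integral>\<omega>. dot p (d \<omega>) (mv p S (d \<omega>)) \<partial>M)"
    using poincare_linear[of "{..n}" a "\<lambda>k. coefN n k / freqN n k" "freqN n"]
    unfolding gN_trig[OF n, symmetric] E0 by (simp add: d_def[abs_def])
  also have "\<dots> \<le> (\<integral>\<omega>. C * dot p a a \<partial>M)"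
    by (rule integral_mono') (use pt C dot_self_nonneg in auto)
  finally show ?thesis by (simp add: prob_space)
qed

text \<open>Carries the spectral norm bound from \<Sigma> over to the covariance of the transformed
  vector, that is, to the entrywise arcsine.\<close>

lemma cPhi_linear:
  assumes p: "p > 0"
  shows "(\<integral>\<omega>. (dot p a (gvec cPhi \<omega>))\<^sup>2 \<partial>M) \<le> C * dot p a a"
proof -
  have odd: "odd (2 * m + 1)" for m :: nat by simp
  let ?w = "\<lambda>\<omega>. dot p a a * (\<Sum>j<p. (X j \<omega>)\<^sup>2)"
  note [measurable] = dot_gvec_measurable(1)[OF cPhi_measurable] dot_gvec_measurable(1)[OF gN_measurable]
  have dom: "(dot p a (gvec (gN (2 * m + 1)) \<omega>))\<^sup>2 \<le> ?w \<omega>" for m \<omega>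
  proof -
    have "(dot p a (gvec (gN (2 * m + 1)) \<omega>))\<^sup>2 \<le> dot p a a * dot p (gvec (gN (2 * m + 1)) \<omega>) (gvec (gN (2 * m + 1)) \<omega>)"
      by (rule dot_CS)
    also have "\<dots> \<le> ?w \<omega>"
      unfolding dot_def[of p "gvec (gN (2 * m + 1)) \<omega>"] gvec_def using abs_gN_le[OF odd]
      by (intro mult_left_mono sum_mono dot_self_nonneg) (simp add: abs_le_square_iff power2_eq_square[symmetric])
    finally show ?thesis .
  qed
  have "(\<lambda>m. \<integral>\<omega>. (dot p a (gvec (gN (2 * m + 1)) \<omega>))\<^sup>2 \<partial>M) \<longlonglongrightarrow> (\<integral>\<omega>. (dot p a (gvec cPhi \<omega>))\<^sup>2 \<partial>M)"
  proof (rule integral_dominated_convergence[where w = ?w])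
    show "integrable M ?w" by (intro integrable_mult_right Bochner_Integration.integrable_sum integrable_X_power) simp
    show "AE \<omega> in M. (\<lambda>m. (dot p a (gvec (gN (2 * m + 1)) \<omega>))\<^sup>2) \<longlonglongrightarrow> (dot p a (gvec cPhi \<omega>))\<^sup>2"
      unfolding dot_def gvec_def by (intro AE_I2 tendsto_power tendsto_sum tendsto_mult tendsto_const gN_tendsto)
    show "AE \<omega> in M. norm ((dot p a (gvec (gN (2 * m + 1)) \<omega>))\<^sup>2) \<le> ?w \<omega>" for m using dom by (auto intro!: AE_I2)
  qed measurable
  then show ?thesis
    by (rule LIMSEQ_le_const2) (use gN_linear[OF odd p] in blast)
qed

text \<open>Exchange of the mean with the Fourier integral of one factor;
  \<open>\<bar>sx t x\<bar> \<le> \<bar>x\<bar>\<close> provides a majorant independent of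
  \<open>t\<close>.\<close>

lemma E_mult_cPhi:
  assumes l: "l < p" and [measurable]: "Z \<in> borel_measurable M" and i: "integrable M (\<lambda>\<omega>. Z \<omega> * X l \<omega>)"
  shows "(\<integral>\<omega>. Z \<omega> * cPhi (X l \<omega>) \<partial>M) = (\<integral>t. (\<integral>\<omega>. Z \<omega> * sx t (X l \<omega>) \<partial>M) \<partial>NN) / sqrt (2 * pi)"
proof -
  interpret N: real_distribution NN by (rule real_dist_normal_dist)
  interpret MN: pair_prob_space M NN ..
  note [measurable] = X_measurable[OF l]
  have m: "(\<lambda>x. Z (fst x) * sx (snd x) (X l (fst x))) \<in> borel_measurable (M \<Otimes>\<^sub>M NN)"
  proof -
    have "(\<lambda>x. (snd x, X l (fst x))) \<in> M \<Otimes>\<^sub>M NN \<rightarrow>\<^sub>M borel \<Otimes>\<^sub>M borel" by measurable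
    from measurable_compose[OF this sx_measurable]
    have [measurable]: "(\<lambda>x. sx (snd x) (X l (fst x))) \<in> borel_measurable (M \<Otimes>\<^sub>M NN)" by simp
    show ?thesis by measurable
  qed
  have bd: "\<bar>Z \<omega> * sx t (X l \<omega>)\<bar> \<le> \<bar>Z \<omega> * X l \<omega>\<bar>" for \<omega> t
    using sx_bound[of t "X l \<omega>"] by (simp add: abs_mult mult_left_mono)
  have "integrable (M \<Otimes>\<^sub>M NN) (\<lambda>x. Z (fst x) * X l (fst x))"
  proof (rule MN.Fubini_integrable)
    show "integrable M (\<lambda>x. \<integral>y. norm (Z (fst (x, y)) * X l (fst (x, y))) \<partial>NN)"
      using i N.prob_space by simp
  qed auto
  then have "integrable (M \<Otimes>\<^sub>M NN) (\<lambda>x. Z (fst x) * sx (snd x) (X l (fst x)))"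
    by (rule Bochner_Integration.integrable_bound) (use m bd in auto)
  then have F: "(\<integral>t. (\<integral>\<omega>. Z \<omega> * sx t (X l \<omega>) \<partial>M) \<partial>NN) = (\<integral>\<omega>. (\<integral>t. Z \<omega> * sx t (X l \<omega>) \<partial>NN) \<partial>M)"
    by (intro MN.Fubini_integral) (simp add: split_beta')
  show ?thesis unfolding F cPhi_fourier by simp
qed

text \<open>Sheppard's formula. Both factors are expanded one after the other, the mean of the
  product of sines is a \<open>sinh\<close> divided by \<open>s * t\<close>, and this is the average
  over \<open>v\<close> evaluated in \<open>sheppard_integral\<close>. The two Fourier constants
  multiply to \<open>1 / (2 * pi)\<close>.\<close>

lemma cPhi_cov:
  assumes jl: "j < p" "l < p"
  shows "(\<integral>\<omega>. cPhi (X j \<omega>) * cPhi (X l \<omega>) \<partial>M) = arcsin (S j l / 2) / (2 * pi)"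
proof -
  interpret N: real_distribution NN by (rule real_dist_normal_dist)
  interpret MN: pair_prob_space M NN ..
  interpret U: prob_space U01 by (rule prob_space_U01)
  interpret NU: pair_prob_space NN U01 ..
  note [measurable] = X_measurable[OF jl(1)] X_measurable[OF jl(2)] measurable_id_U01
  have [measurable]: "(cosh :: real \<Rightarrow> real) \<in> borel_measurable borel" "(sinh :: real \<Rightarrow> real) \<in> borel_measurable borel"
    by (intro borel_measurable_continuous_onI continuous_intros)+
  have sxm: "(\<lambda>\<omega>. sx s (X i \<omega>)) \<in> borel_measurable M" if "i < p" for s i
  proof -
    have "(\<lambda>\<omega>. (s, X i \<omega>)) \<in> M \<rightarrow>\<^sub>M borel \<Otimes>\<^sub>M borel" using that by measurable
    from measurable_compose[OF this sx_measurable] show ?thesis by simp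
  qed
  have XX: "integrable M (\<lambda>\<omega>. X j \<omega> * X l \<omega>)"
    using integrable_lin_prod[of "unit_fun j" "unit_fun l"] jl by (simp add: lin_unit)
  have 1: "(\<integral>\<omega>. cPhi (X j \<omega>) * cPhi (X l \<omega>) \<partial>M) = (\<integral>t. (\<integral>\<omega>. cPhi (X j \<omega>) * sx t (X l \<omega>) \<partial>M) \<partial>NN) / sqrt (2 * pi)"
  proof (rule E_mult_cPhi[OF jl(2)])
    show "integrable M (\<lambda>\<omega>. cPhi (X j \<omega>) * X l \<omega>)"
    proof (rule Bochner_Integration.integrable_bound)
      show "integrable M (X l)" using integrable_X_power[OF jl(2), of 1] by simp
      have "\<bar>cPhi (X j \<omega>)\<bar> \<le> 1" for \<omega> using cPhi_bound[of "X j \<omega>"] by simp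
      then show "AE \<omega> in M. norm (cPhi (X j \<omega>) * X l \<omega>) \<le> norm (X l \<omega>)"
        by (auto simp: abs_mult intro!: AE_I2 mult_left_le_one_le)
    qed measurable
  qed measurable
  have 2: "(\<integral>\<omega>. cPhi (X j \<omega>) * sx t (X l \<omega>) \<partial>M) = (\<integral>s. (\<integral>\<omega>. sx t (X l \<omega>) * sx s (X j \<omega>) \<partial>M) \<partial>NN) / sqrt (2 * pi)" for t
  proof -
    have "(\<integral>\<omega>. cPhi (X j \<omega>) * sx t (X l \<omega>) \<partial>M) = (\<integral>\<omega>. sx t (X l \<omega>) * cPhi (X j \<omega>) \<partial>M)" by (simp only: mult.commute)
    also have "\<dots> = (\<integral>s. (\<integral>\<omega>. sx t (X l \<omega>) * sx s (X j \<omega>) \<partial>M) \<partial>NN) / sqrt (2 * pi)"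
    proof (rule E_mult_cPhi[OF jl(1)])
      show "integrable M (\<lambda>\<omega>. sx t (X l \<omega>) * X j \<omega>)"
        by (rule Bochner_Integration.integrable_bound[OF XX])
          (use sxm[OF jl(2)] sx_bound in \<open>auto simp: abs_mult mult.commute[of _ "\<bar>X j _\<bar>"] intro!: AE_I2 mult_left_mono\<close>)
    qed (rule sxm[OF jl(2)])
    finally show ?thesis .
  qed
  define h where "h t s v = S j l * (exp (- (t\<^sup>2 + s\<^sup>2) / 2) * cosh (t * s * (S j l * v)))" for t s v
  have 3: "(\<integral>\<omega>. sx t (X l \<omega>) * sx s (X j \<omega>) \<partial>M) = (\<integral>v. h t s v \<partial>U01)" if st: "s \<noteq> 0" "t \<noteq> 0" for s t
  proof -
    have "(\<integral>\<omega>. sx t (X l \<omega>) * sx s (X j \<omega>) \<partial>M) = (\<integral>\<omega>. sin (t * X l \<omega>) * sin (s * X j \<omega>) / (t * s) \<partial>M)"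
      using st by (simp add: sx_eq)
    also have "\<dots> = exp (- (t\<^sup>2 + s\<^sup>2) / 2) * (sinh (t * s * S j l) / (t * s))"
      using E_sin_prod[OF jl(2,1), of t s] S_sym[OF jl] by simp
    also have "\<dots> = exp (- (t\<^sup>2 + s\<^sup>2) / 2) * (\<integral>v. S j l * cosh (t * s * (S j l * v)) \<partial>U01)"
      using sinh_integral[of t s "S j l"] st by simp
    also have "\<dots> = (\<integral>v. h t s v \<partial>U01)" by (simp add: h_def mult_ac)
    finally show ?thesis .
  qed
  \<comment> \<open>The quotient form of \<open>sx\<close> holds away from 0; the exceptional
    frequencies form a null set, so the integrands have to be compared almost everywhere, which is
    why their measurability is established next.\<close>
  have nz: "AE t in NN. t \<noteq> 0"
    by (subst AE_density) (auto intro!: eventually_mono[OF AE_lborel_singleton[of 0]])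
  have ms: "(\<lambda>s. \<integral>\<omega>. sx t (X l \<omega>) * sx s (X j \<omega>) \<partial>M) \<in> borel_measurable NN" for t
  proof (rule borel_measurable_lebesgue_integral)
    have "(\<lambda>x. (fst x, X j (snd x))) \<in> NN \<Otimes>\<^sub>M M \<rightarrow>\<^sub>M borel \<Otimes>\<^sub>M borel" by measurable
    from measurable_compose[OF this sx_measurable]
    have [measurable]: "(\<lambda>x. sx (fst x) (X j (snd x))) \<in> borel_measurable (NN \<Otimes>\<^sub>M M)" by simp
    have [measurable]: "(\<lambda>x. sx t (X l (snd x))) \<in> borel_measurable (NN \<Otimes>\<^sub>M M)"
      by (rule measurable_compose[OF measurable_snd sxm[OF jl(2)]])
    show "(\<lambda>(s, \<omega>). sx t (X l \<omega>) * sx s (X j \<omega>)) \<in> borel_measurable (NN \<Otimes>\<^sub>M M)"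
      unfolding split_beta' by measurable
  qed
  have mh: "(\<lambda>s. \<integral>v. h t s v \<partial>U01) \<in> borel_measurable NN" for t
    by (rule U.borel_measurable_lebesgue_integral) (simp add: split_beta' h_def)
  have 4: "(\<integral>s. (\<integral>\<omega>. sx t (X l \<omega>) * sx s (X j \<omega>) \<partial>M) \<partial>NN) = (\<integral>s. (\<integral>v. h t s v \<partial>U01) \<partial>NN)" if "t \<noteq> 0" for t
    by (rule integral_cong_AE[OF ms mh]) (use nz 3 that in auto)
  have mt: "(\<lambda>t. \<integral>s. (\<integral>v. h t s v \<partial>U01) \<partial>NN) \<in> borel_measurable NN"
  proof (rule N.borel_measurable_lebesgue_integral)
    show "(\<lambda>(t, s). \<integral>v. h t s v \<partial>U01) \<in> borel_measurable (NN \<Otimes>\<^sub>M NN)"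
      unfolding split_beta'
    proof (rule U.borel_measurable_lebesgue_integral)
      have [measurable]: "(\<lambda>x. snd x) \<in> borel_measurable ((NN \<Otimes>\<^sub>M NN) \<Otimes>\<^sub>M U01)"
        using measurable_id_U01(3) .
      show "(\<lambda>(x, v). h (fst x) (snd x) v) \<in> borel_measurable ((NN \<Otimes>\<^sub>M NN) \<Otimes>\<^sub>M U01)"
        unfolding split_beta' h_def by measurable
    qed
  qed
  have mt': "(\<lambda>t. \<integral>\<omega>. cPhi (X j \<omega>) * sx t (X l \<omega>) \<partial>M) \<in> borel_measurable NN"
  proof (rule borel_measurable_lebesgue_integral)
    have "(\<lambda>x. (fst x, X l (snd x))) \<in> NN \<Otimes>\<^sub>M M \<rightarrow>\<^sub>M borel \<Otimes>\<^sub>M borel" by measurable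
    from measurable_compose[OF this sx_measurable]
    have [measurable]: "(\<lambda>x. sx (fst x) (X l (snd x))) \<in> borel_measurable (NN \<Otimes>\<^sub>M M)" by simp
    show "(\<lambda>(s, \<omega>). cPhi (X j \<omega>) * sx s (X l \<omega>)) \<in> borel_measurable (NN \<Otimes>\<^sub>M M)"
      unfolding split_beta' by measurable
  qed
  have "(\<integral>t. (\<integral>\<omega>. cPhi (X j \<omega>) * sx t (X l \<omega>) \<partial>M) \<partial>NN) = (\<integral>t. (\<integral>s. (\<integral>v. h t s v \<partial>U01) \<partial>NN) / sqrt (2 * pi) \<partial>NN)"
    by (rule integral_cong_AE[OF mt']) (use mt nz 2 4 in auto)
  also have "\<dots> = arcsin (S j l / 2) / sqrt (2 * pi)"
    unfolding integral_divide_zero h_def sheppard_integral[OF S_bound[OF jl]] ..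
  finally have "(\<integral>\<omega>. cPhi (X j \<omega>) * cPhi (X l \<omega>) \<partial>M) = arcsin (S j l / 2) / sqrt (2 * pi) / sqrt (2 * pi)"
    unfolding 1 by simp
  moreover have "sqrt (2 * pi) * sqrt (2 * pi) = 2 * pi" by simp
  ultimately show ?thesis by (simp only: divide_divide_eq_left)
qed

end

section \<open>The deterministic equivalent of the grade covariance matrix\<close>

lemma det_measurable:
  assumes "\<And>x. F x \<in> carrier_mat k k"
    and "\<And>i j. i < k \<Longrightarrow> j < k \<Longrightarrow> (\<lambda>x. (F x $$ (i, j) :: real)) \<in> borel_measurable M"
  shows "(\<lambda>x. Determinant.det (F x)) \<in> borel_measurable M"
  unfolding det_def'[OF assms(1)]
proof (intro borel_measurable_sum borel_measurable_times borel_measurable_const borel_measurable_prod assms(2))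
  fix \<pi> i assume "\<pi> \<in> {\<pi>. \<pi> permutes {0..<k}}" "i \<in> {0..<k}"
  then show "i < k" "\<pi> i < k" using permutes_in_image[of \<pi> "{0..<k}" i] by auto
qed

lemma res_measurable:
  assumes A: "\<And>i j. i < p \<Longrightarrow> j < p \<Longrightarrow> (\<lambda>x. A x i j) \<in> borel_measurable M" and ij: "i < p" "j < p"
  shows "(\<lambda>x. res p (A x) l i j) \<in> borel_measurable M"
  unfolding res_def cofactor_def
proof (intro borel_measurable_divide borel_measurable_times borel_measurable_const det_measurable)
  fix x show "mat_delete (shift_mat p (A x) l) j i \<in> carrier_mat (p - 1) (p - 1)"
    by (simp add: mat_delete_def shift_mat_def)
next
  fix a b assume "a < p - 1" "b < p - 1"
  then have "(\<lambda>x. mat_delete (shift_mat p (A x) l) j i $$ (a, b))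
     = (\<lambda>x. A x (if a < j then a else Suc a) (if b < i then b else Suc b)
        + (if (if a < j then a else Suc a) = (if b < i then b else Suc b) then l else 0))"
    by (auto simp: mat_delete_def shift_mat_def fun_eq_iff)
  also have "\<dots> \<in> borel_measurable M"
    using \<open>a < p - 1\<close> \<open>b < p - 1\<close> by (intro borel_measurable_add A borel_measurable_const) auto
  finally show "(\<lambda>x. mat_delete (shift_mat p (A x) l) j i $$ (a, b)) \<in> borel_measurable M" .
next
  fix a b assume "a < p" "b < p"
  then show "(\<lambda>x. shift_mat p (A x) l $$ (a, b)) \<in> borel_measurable M"
    using A by (simp add: shift_mat_def)
qed simp

lemma res_entry_bound:
  assumes A: "psd p A" "l > 0" and ij: "i < p" "j < p"
  shows "\<bar>res p A l i j\<bar> \<le> 1 / l"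
proof -
  have "(res p A l i j)\<^sup>2 \<le> (\<Sum>k<p. (res p A l k j)\<^sup>2)"
    using ij by (intro member_le_sum) auto
  also have "\<dots> = dot p (mv p (res p A l) (unit_fun j)) (mv p (res p A l) (unit_fun j))"
    unfolding dot_def using ij by (intro sum.cong refl) (simp add: mv_unit power2_eq_square)
  also have "\<dots> \<le> dot p (unit_fun j) (unit_fun j) / l\<^sup>2" by (rule res_norm[OF A])
  also have "dot p (unit_fun j) (unit_fun j) = 1" using ij by (simp add: dot_unit) (simp add: unit_fun_def)
  finally have "\<bar>res p A l i j\<bar>\<^sup>2 \<le> (1 / l)\<^sup>2" by (simp add: power_divide)
  then show ?thesis by (rule power2_le_imp_le) (use A(2) in simp)
qed

lemma (in prob_space) abs_le_sqrt_second_moment: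
  assumes [measurable]: "Z \<in> borel_measurable M" and i: "integrable M (\<lambda>x. (Z x)\<^sup>2)" and V: "(\<integral>x. (Z x)\<^sup>2 \<partial>M) \<le> V" "V > 0"
  shows "(\<integral>x. \<bar>Z x\<bar> \<partial>M) \<le> sqrt V"
proof -
  \<comment> \<open>The scale that balances the two terms of the Young inequality
    \<open>b\<close>.\<close>
  define e where "e = sqrt V"
  have e: "e > 0" "e * e = V" using V by (auto simp: e_def)
  have b: "\<bar>z\<bar> \<le> z\<^sup>2 / (2 * e) + e / 2" for z :: real
  proof -
    have "0 \<le> (\<bar>z\<bar> - e)\<^sup>2" by simp
    then have "2 * e * \<bar>z\<bar> \<le> z\<^sup>2 + e * e" by (simp add: power2_eq_square algebra_simps)
    then show ?thesis using e(1) by (simp add: field_simps)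
  qed
  have "(\<integral>x. \<bar>Z x\<bar> \<partial>M) \<le> (\<integral>x. (Z x)\<^sup>2 / (2 * e) + e / 2 \<partial>M)"
    by (rule integral_mono') (use i b e in \<open>auto intro: order_trans[OF abs_ge_zero b]\<close>)
  also have "\<dots> = (\<integral>x. (Z x)\<^sup>2 \<partial>M) / (2 * e) + e / 2" using i by (simp add: prob_space)
  also have "\<dots> \<le> V / (2 * e) + e / 2" using V e by (intro add_right_mono divide_right_mono) auto
  also have "\<dots> = e" using e by (simp add: field_simps flip: e(2))
  finally show ?thesis by (simp add: e_def)
qed

text \<open>Boundedness is required at every point, so it persists when a coordinate is replaced.
  The closure rules then settle the integrability of all the polynomial expressions below.\<close>

definition bm :: "'a measure \<Rightarrow> ('a \<Rightarrow> real) \<Rightarrow> bool" where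
  "bm M f \<longleftrightarrow> f \<in> borel_measurable M \<and> (\<exists>B. \<forall>x. \<bar>f x\<bar> \<le> B)"

lemma bmI: "f \<in> borel_measurable M \<Longrightarrow> (\<And>x. \<bar>f x\<bar> \<le> B) \<Longrightarrow> bm M f"
  by (auto simp: bm_def)

lemma bm_measurable: "bm M f \<Longrightarrow> f \<in> borel_measurable M" by (simp add: bm_def)

lemma bm_const: "bm M (\<lambda>_. c)" by (rule bmI[where B = "\<bar>c\<bar>"]) auto

lemma bm_add: assumes "bm M f" "bm M g" shows "bm M (\<lambda>x. f x + g x)"
proof -
  obtain B C where "\<And>x. \<bar>f x\<bar> \<le> B" "\<And>x. \<bar>g x\<bar> \<le> C" using assms by (auto simp: bm_def)
  then have "\<bar>f x + g x\<bar> \<le> B + C" for x by (rule order_trans[OF abs_triangle_ineq add_mono])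
  then show ?thesis using assms by (intro bmI[where B = "B + C"]) (auto simp: bm_def)
qed

lemma bm_mult: assumes "bm M f" "bm M g" shows "bm M (\<lambda>x. f x * g x)"
proof -
  obtain B C where b: "\<And>x. \<bar>f x\<bar> \<le> B" "\<And>x. \<bar>g x\<bar> \<le> C" using assms by (auto simp: bm_def)
  then have "\<bar>f x * g x\<bar> \<le> B * C" for x
    unfolding abs_mult using order_trans[OF abs_ge_zero b(1)] by (intro mult_mono) auto
  then show ?thesis using assms by (intro bmI[where B = "B * C"]) (auto simp: bm_def)
qed

lemma bm_sum: "(\<And>i. i \<in> I \<Longrightarrow> bm M (f i)) \<Longrightarrow> bm M (\<lambda>x. \<Sum>i\<in>I. f i x)"
  by (induction I rule: infinite_finite_induct) (auto intro: bm_const bm_add)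

lemma bm_uminus: "bm M f \<Longrightarrow> bm M (\<lambda>x. - f x)"
  using bm_mult[OF bm_const[of M "-1"]] by fastforce

lemma bm_diff: "bm M f \<Longrightarrow> bm M g \<Longrightarrow> bm M (\<lambda>x. f x - g x)"
  using bm_add[OF _ bm_uminus] by fastforce

lemma bm_abs: "bm M f \<Longrightarrow> bm M (\<lambda>x. \<bar>f x\<bar>)" by (auto simp: bm_def)

lemma bm_divide: "bm M f \<Longrightarrow> bm M (\<lambda>x. f x / c)"
  using bm_mult[OF _ bm_const[of M "inverse c"]] by (simp add: divide_inverse)

lemma bm_power2: "bm M f \<Longrightarrow> bm M (\<lambda>x. (f x)\<^sup>2)"
  unfolding power2_eq_square by (rule bm_mult)

lemma (in prob_space) bm_integrable: "bm M f \<Longrightarrow> integrable M f"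
  by (auto simp: bm_def intro!: integrable_const_bound AE_I2)

lemmas bm_intros = bm_const bm_add bm_mult bm_sum bm_diff bm_divide bm_abs bm_power2 bm_uminus

text \<open>A uniform variable on \<open>[0, 1]\<close> has variance \<open>1 / 12\<close>, so
  \<open>sqrt 12\<close> normalises the grade to variance 1, in line with the scaling of the
  ranks.\<close>

definition grade :: "(nat \<Rightarrow> real) \<Rightarrow> nat \<Rightarrow> real" where "grade y j = sqrt 12 * cPhi (y j)"

definition arcsin_cov :: "(nat \<Rightarrow> nat \<Rightarrow> real) \<Rightarrow> nat \<Rightarrow> nat \<Rightarrow> real" where
  "arcsin_cov S i j = 6 / pi * arcsin (S i j / 2)"

definition grades :: "(nat \<Rightarrow> nat \<Rightarrow> real) \<Rightarrow> nat \<Rightarrow> nat \<Rightarrow> real" where "grades x k = grade (x k)"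

lemma grade_bound: "\<bar>grade y j\<bar> \<le> sqrt 3"
proof -
  have "\<bar>grade y j\<bar> \<le> sqrt 12 * (1/2)" unfolding grade_def abs_mult using cPhi_bound by (intro mult_mono) auto
  also have "sqrt 12 = 2 * sqrt (3::real)" using real_sqrt_mult[of 4 3] by simp
  finally show ?thesis by simp
qed

lemma grade_square: "(grade y j)\<^sup>2 \<le> 3"
  using power_mono[OF grade_bound, of y j 2] by simp

lemma grade_norm: "dot p (grade y) (grade y) \<le> 3 * real p"
proof -
  have "dot p (grade y) (grade y) \<le> (\<Sum>j<p. 3)" unfolding dot_def
    by (rule sum_mono) (use grade_square in \<open>simp add: power2_eq_square\<close>)
  then show ?thesis by simp
qed

section \<open>Moments of the grade vector\<close>

context gaussian_vector begin

lemma dot_grade: "dot p (grade (\<lambda>j. X j \<omega>)) (mv p B (grade (\<lambda>j. X j \<omega>))) = 12 * dot p (gvec cPhi \<omega>) (mv p B (gvec cPhi \<omega>))"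
  "dot p a (grade (\<lambda>j. X j \<omega>)) = sqrt 12 * dot p a (gvec cPhi \<omega>)"
proof -
  have e: "grade (\<lambda>j. X j \<omega>) = (\<lambda>j. sqrt 12 * gvec cPhi \<omega> j)" by (simp add: grade_def gvec_def fun_eq_iff)
  show "dot p (grade (\<lambda>j. X j \<omega>)) (mv p B (grade (\<lambda>j. X j \<omega>))) = 12 * dot p (gvec cPhi \<omega>) (mv p B (gvec cPhi \<omega>))"
    unfolding e mv_scale[abs_def] dot_scale_left dot_scale_right by simp
  show "dot p a (grade (\<lambda>j. X j \<omega>)) = sqrt 12 * dot p a (gvec cPhi \<omega>)"
    unfolding e dot_scale_right ..
qed

lemma integrable_grade_prod:
  "i < p \<Longrightarrow> j < p \<Longrightarrow> integrable M (\<lambda>\<omega>. grade (\<lambda>j. X j \<omega>) i * grade (\<lambda>j. X j \<omega>) j)"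
proof (rule integrable_const_bound[where B = "sqrt 3 * sqrt 3"])
  show "AE \<omega> in M. norm (grade (\<lambda>j. X j \<omega>) i * grade (\<lambda>j. X j \<omega>) j) \<le> sqrt 3 * sqrt 3"
    unfolding real_norm_def abs_mult using grade_bound by (intro AE_I2 mult_mono) auto
qed (auto simp: grade_def intro!: borel_measurable_times measurable_compose[OF X_measurable])

lemma E_grade_prod:
  "i < p \<Longrightarrow> j < p \<Longrightarrow> (\<integral>\<omega>. grade (\<lambda>j. X j \<omega>) i * grade (\<lambda>j. X j \<omega>) j \<partial>M) = arcsin_cov S i j"
proof -
  assume ij: "i < p" "j < p"
  have "(\<integral>\<omega>. grade (\<lambda>j. X j \<omega>) i * grade (\<lambda>j. X j \<omega>) j \<partial>M) = (\<integral>\<omega>. 12 * (cPhi (X i \<omega>) * cPhi (X j \<omega>)) \<partial>M)"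
    by (intro Bochner_Integration.integral_cong refl) (simp add: grade_def)
  also have "\<dots> = 12 * (arcsin (S i j / 2) / (2 * pi))" using cPhi_cov[OF ij] by simp
  finally show ?thesis by (simp add: arcsin_cov_def)
qed

lemma E_grade_form:
  "(\<integral>\<omega>. (\<Sum>i<p. \<Sum>j<p. F i j * (grade (\<lambda>j. X j \<omega>) i * grade (\<lambda>j. X j \<omega>) j)) \<partial>M) = (\<Sum>i<p. \<Sum>j<p. F i j * arcsin_cov S i j)"
proof -
  have i: "integrable M (\<lambda>\<omega>. \<Sum>j<p. F i j * (grade (\<lambda>j. X j \<omega>) i * grade (\<lambda>j. X j \<omega>) j))" if "i < p" for i
    using that by (intro Bochner_Integration.integrable_sum integrable_mult_right integrable_grade_prod) auto
  have "(\<integral>\<omega>. (\<Sum>i<p. \<Sum>j<p. F i j * (grade (\<lambda>j. X j \<omega>) i * grade (\<lambda>j. X j \<omega>) j)) \<partial>M)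
    = (\<Sum>i<p. (\<integral>\<omega>. (\<Sum>j<p. F i j * (grade (\<lambda>j. X j \<omega>) i * grade (\<lambda>j. X j \<omega>) j)) \<partial>M))"
    by (rule Bochner_Integration.integral_sum) (use i in auto)
  also have "\<dots> = (\<Sum>i<p. \<Sum>j<p. F i j * arcsin_cov S i j)"
    by (intro sum.cong refl) (simp add: integrable_grade_prod E_grade_prod)
  finally show ?thesis .
qed

lemma arcsin_cov_quadratic: "dot p a (mv p (arcsin_cov S) a) = (\<integral>\<omega>. (dot p a (grade (\<lambda>j. X j \<omega>)))\<^sup>2 \<partial>M)"
proof -
  have "(\<integral>\<omega>. (dot p a (grade (\<lambda>j. X j \<omega>)))\<^sup>2 \<partial>M)
     = (\<integral>\<omega>. (\<Sum>i<p. \<Sum>j<p. (a i * a j) * (grade (\<lambda>j. X j \<omega>) i * grade (\<lambda>j. X j \<omega>) j)) \<partial>M)"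
    by (intro Bochner_Integration.integral_cong refl) (simp add: dot_def power2_eq_square sum_product mult_ac)
  also have "\<dots> = dot p a (mv p (arcsin_cov S) a)"
    unfolding E_grade_form by (simp add: dot_def mv_def sum_distrib_left mult_ac)
  finally show ?thesis by simp
qed

lemma arcsin_cov_psd: "psd p (arcsin_cov S)"
  unfolding psd_def arcsin_cov_quadratic using S_sym by (auto simp: arcsin_cov_def)

lemma arcsin_cov_upper: "p > 0 \<Longrightarrow> dot p a (mv p (arcsin_cov S) a) \<le> 12 * C * dot p a a"
  unfolding arcsin_cov_quadratic dot_grade using cPhi_linear[of a] by (simp add: power_mult_distrib)

text \<open>The subtracted double sum is the exact mean, by Sheppard's formula. A quadratic form in
  the grades is 12 times the one in \<open>cPhi\<close>, whence
  \<open>144 = 12\<^sup>2\<close>.\<close>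

lemma grade_variance:
  assumes p: "p > 0"
    and B: "\<And>i j. i < p \<Longrightarrow> j < p \<Longrightarrow> B i j = B j i"
    and Bn: "\<And>x. dot p (mv p B x) (mv p B x) \<le> b * dot p x x" and b: "b \<ge> 0"
  shows "(\<integral>\<omega>. (dot p (grade (\<lambda>j. X j \<omega>)) (mv p B (grade (\<lambda>j. X j \<omega>))) - (\<Sum>i<p. \<Sum>j<p. B i j * arcsin_cov S i j))\<^sup>2 \<partial>M)
    \<le> 144 * C * b * real p"
proof -
  let ?q = "\<lambda>\<omega>. dot p (gvec cPhi \<omega>) (mv p B (gvec cPhi \<omega>))"
  have gqx: "\<bar>cPhi x\<bar> \<le> \<bar>x\<bar>" for x
    by (rule LIMSEQ_le_const2[OF tendsto_rabs[OF gN_tendsto]]) (use abs_gN_le in auto)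
  note i = square_integrable_quadratic[OF cPhi_measurable gqx, of B]
  have "dot p (grade (\<lambda>j. X j \<omega>)) (mv p B (grade (\<lambda>j. X j \<omega>))) = (\<Sum>i<p. \<Sum>j<p. B i j * (grade (\<lambda>j. X j \<omega>) i * grade (\<lambda>j. X j \<omega>) j))" for \<omega>
    by (simp add: dot_def mv_def sum_distrib_left mult_ac)
  then have "(\<Sum>i<p. \<Sum>j<p. B i j * arcsin_cov S i j) = (\<integral>\<omega>. 12 * ?q \<omega> \<partial>M)"
    unfolding dot_grade E_grade_form[symmetric] by simp
  then have m: "(\<Sum>i<p. \<Sum>j<p. B i j * arcsin_cov S i j) = 12 * (\<integral>\<omega>. ?q \<omega> \<partial>M)" by simp
  have "(\<integral>\<omega>. (12 * ?q \<omega> - 12 * (\<integral>\<omega>. ?q \<omega> \<partial>M))\<^sup>2 \<partial>M) = (\<integral>\<omega>. 144 * (?q \<omega> - (\<integral>\<omega>. ?q \<omega> \<partial>M))\<^sup>2 \<partial>M)"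
    by (intro Bochner_Integration.integral_cong refl) (simp add: power2_eq_square algebra_simps)
  also have "\<dots> = 144 * ((\<integral>\<omega>. (?q \<omega>)\<^sup>2 \<partial>M) - (\<integral>\<omega>. ?q \<omega> \<partial>M)\<^sup>2)"
    using variance_eq[OF i(2,1)] by simp
  also have "\<dots> \<le> 144 * (C * b * real p)" using cPhi_variance[OF p B Bn b] by simp
  finally show ?thesis unfolding dot_grade m by simp
qed

end

text \<open>The rows are coordinates on a product measure rather than random variables on some
  space: replacing a row is then a function update, as bounded differences and
  \<open>PiM_resample\<close> require.\<close>

locale gaussian_sample =
  fixes N :: "nat \<Rightarrow> (nat \<Rightarrow> real) measure" and p n :: nat and S :: "nat \<Rightarrow> nat \<Rightarrow> real" and C :: real
  assumes prob_N: "\<And>k. prob_space (N k)"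
    and sets_N: "\<And>k. sets (N k) = sets (Pi\<^sub>M {..<p} (\<lambda>_. borel))"
    and rows: "\<And>k. k < n \<Longrightarrow> gaussian_vector (N k) p S (\<lambda>j x. x j) C"
    and p: "p > 0" and n: "n > 0"
begin

abbreviation "P \<equiv> Pi\<^sub>M {..<n} N"

lemma prob_P: "prob_space P" by (rule prob_space_PiM) (rule prob_N)

sublocale PS: prob_space P by (rule prob_P)

lemma coord_measurable_row: "j < p \<Longrightarrow> (\<lambda>y. y j) \<in> borel_measurable (N k)"
  by (subst measurable_cong_sets[OF sets_N refl]) (rule measurable_component_singleton, simp)

lemma coord_measurable: "k < n \<Longrightarrow> j < p \<Longrightarrow> (\<lambda>x. x k j) \<in> borel_measurable P"
  by (rule measurable_compose[of "\<lambda>x. x k" _ "N k" "\<lambda>y. y j"])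
    (auto intro: measurable_component_singleton coord_measurable_row)

lemma bm_grades: "k < n \<Longrightarrow> j < p \<Longrightarrow> bm P (\<lambda>x. grades x k j)"
proof (rule bmI[where B = "sqrt 3"])
  assume "k < n" "j < p"
  then show "(\<lambda>x. grades x k j) \<in> borel_measurable P"
    unfolding grades_def grade_def
    by (intro borel_measurable_times borel_measurable_const measurable_compose[OF coord_measurable cPhi_measurable])
qed (simp add: grades_def grade_bound)

lemma grades_upd: "grades (x(m := y)) m = grade y" "(grades (x(m := y)))(m := z) = (grades x)(m := z)"
  by (auto simp: grades_def)

lemma C_pos: "C \<ge> 1"
proof -
  interpret G: gaussian_vector "N 0" p S "\<lambda>j x. x j" C using rows n by simp
  show ?thesis using G.C_pos p by simp
qed

abbreviation "T \<equiv> arcsin_cov S"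

lemma T_psd: "psd p T" and T_upper: "dot p v (mv p T v) \<le> 12 * C * dot p v v"
proof -
  interpret G: gaussian_vector "N 0" p S "\<lambda>j x. x j" C using rows n by simp
  show "psd p T" by (rule G.arcsin_cov_psd)
  show "dot p v (mv p T v) \<le> 12 * C * dot p v v" by (rule G.arcsin_cov_upper[OF p])
qed

lemma resample:
  assumes "m < n" "bm P f"
  shows "(\<integral>x. f x \<partial>P) = (\<integral>x. (\<integral>y. f (x(m := y)) \<partial>N m) \<partial>P)"
proof -
  obtain B where B: "\<And>x. \<bar>f x\<bar> \<le> B" using assms(2) by (auto simp: bm_def)
  show ?thesis
    by (rule PiM_resample[where B = B]) (use assms B prob_N in \<open>auto simp: bm_measurable\<close>)
qed

end

section \<open>Leave-one-out analysis of the grade resolvent\<close>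

locale gaussian_resolvent = gaussian_sample N p n S C for N p n S C +
  fixes l :: real
  assumes l: "l > 0"
begin

definition "Q x = res p (cov n (grades x)) l"
text \<open>Does not depend on row \<open>m\<close>; given the other rows, it is a fixed matrix to
  which that row is independent.\<close>

definition "Qm m x = res p (cov n ((grades x)(m := \<lambda>_. 0))) l"
definition "a m x = dot p (grades x m) (mv p (Qm m x) (grades x m)) / real n"

lemma rank1: "m < n \<Longrightarrow> rank_one_update p (cov n ((grades x)(m := \<lambda>_. 0))) (cov n (grades x)) (grades x m) l (real n)"
  by unfold_locales (use l n in \<open>auto simp: cov_psd intro: cov_remove\<close>)

lemma a_eq: "rank_one_update.\<alpha> p (cov n ((grades x)(m := \<lambda>_. 0))) (grades x m) l (real n) = a m x" if "m < n"
proof -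
  interpret R: rank_one_update p "cov n ((grades x)(m := \<lambda>_. 0))" "cov n (grades x)" "grades x m" l "real n"
    by (rule rank1[OF that])
  show ?thesis by (simp add: R.\<alpha>_def a_def Qm_def)
qed

lemma a_nonneg: "m < n \<Longrightarrow> 0 \<le> a m x"
  using rank_one_update.alpha_nonneg[OF rank1] by (simp add: a_eq)

lemma Q_vec: "m < n \<Longrightarrow> i < p \<Longrightarrow> mv p (Q x) (grades x m) i = mv p (Qm m x) (grades x m) i / (1 + a m x)"
  using rank_one_update.res_vec[OF rank1] by (simp add: a_eq Q_def Qm_def)

lemma tr_remove: "m < n \<Longrightarrow> 0 \<le> tr p (Qm m x) - tr p (Q x)" "m < n \<Longrightarrow> tr p (Qm m x) - tr p (Q x) \<le> 1 / l"
  using rank_one_update.tr_diff_bounds[OF rank1] by (simp_all add: Q_def Qm_def)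

text \<open>The trace of the product \<open>A F\<close>.\<close>

definition "form A F = (\<Sum>i<p. \<Sum>k<p. A i k * F k i)" for A F :: "nat \<Rightarrow> nat \<Rightarrow> real"

text \<open>The difference of the resolvents is a rank-one matrix, so only the quadratic form of
  \<open>F\<close> along one vector occurs. Hence the bound also serves the non-symmetric matrix
  \<open>T K\<close> used later.\<close>

lemma form_remove:
  assumes m: "m < n" and F: "\<And>v. \<bar>dot p v (mv p F v)\<bar> \<le> c * dot p v v" and c: "c \<ge> 0"
  shows "\<bar>form (Qm m x) F - form (Q x) F\<bar> \<le> c / l"
proof -
  interpret R: rank_one_update p "cov n ((grades x)(m := \<lambda>_. 0))" "cov n (grades x)" "grades x m" l "real n"
    by (rule rank1[OF m])
  define v where "v = mv p (Qm m x) (grades x m)"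
  define D where "D = real n * (1 + a m x)"
  have D: "D > 0" using R.norm_pos by (simp add: D_def a_eq m)
  have "form (Qm m x) F - form (Q x) F = (\<Sum>i<p. \<Sum>k<p. (Qm m x i k - Q x i k) * F k i)"
    by (simp add: form_def sum_subtractf left_diff_distrib)
  also have "\<dots> = (\<Sum>i<p. \<Sum>k<p. (v i * v k / D) * F k i)"
    using R.diff' by (intro sum.cong refl) (simp add: Qm_def Q_def v_def D_def a_eq m)
  also have "\<dots> = (\<Sum>k<p. \<Sum>i<p. (v i * v k / D) * F k i)" by (rule sum.swap)
  also have "\<dots> = dot p v (mv p F v) / D"
    by (simp add: dot_def mv_def sum_distrib_left sum_divide_distrib mult_ac)
  finally have e: "form (Qm m x) F - form (Q x) F = dot p v (mv p F v) / D" .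
  have "\<bar>dot p v (mv p F v) / D\<bar> \<le> c * dot p v v / D"
    using F[of v] D by (simp add: divide_right_mono)
  also have "\<dots> = c * (dot p v v / D)" by simp
  also have "\<dots> \<le> c * (1 / l)"
    using R.norm_bound c by (intro mult_left_mono) (simp_all add: v_def Qm_def D_def a_eq m)
  finally show ?thesis unfolding e by simp
qed

text \<open>Take the trace of \<open>Q (cov + l I) = I\<close>: by Sherman-Morrison row
  \<open>m\<close> contributes \<open>a / (1 + a) = 1 - 1 / (1 + a)\<close>. After division by
  \<open>n\<close> the right hand side becomes the finite-sample counterpart of
  \<open>1 - y - y z m\<close> at \<open>z = - l\<close>.\<close>

lemma trace_identity: "(\<Sum>m<n. 1 / (1 + a m x)) = real n - real p + l * tr p (Q x)"
proof -
  have psd: "psd p (cov n (grades x))" by (rule cov_psd)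
  have "real p = (\<Sum>i<p. \<Sum>k<p. Q x i k * (cov n (grades x) k i + (if k = i then l else 0)))"
    using res_left[OF psd l] by (simp add: Q_def)
  also have "\<dots> = (\<Sum>i<p. \<Sum>k<p. Q x i k * cov n (grades x) k i) + (\<Sum>i<p. \<Sum>k<p. Q x i k * (if k = i then l else 0))"
    by (simp add: distrib_left sum.distrib)
  also have "(\<Sum>i<p. \<Sum>k<p. Q x i k * (if k = i then l else 0)) = l * tr p (Q x)"
    unfolding tr_def sum_distrib_left by (intro sum.cong refl, subst sum_delta_mult(2)) simp_all
  also have "(\<Sum>i<p. \<Sum>k<p. Q x i k * cov n (grades x) k i) = (\<Sum>m<n. a m x / (1 + a m x))"
  proof -
    have "(\<Sum>i<p. \<Sum>k<p. Q x i k * cov n (grades x) k i)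
      = (\<Sum>i<p. \<Sum>k<p. \<Sum>m<n. grades x m i * (Q x i k * grades x m k) / real n)"
    proof (intro sum.cong refl)
      fix i k
      have "Q x i k * cov n (grades x) k i = (\<Sum>m<n. Q x i k * (grades x m k * grades x m i) / real n)"
        by (simp add: cov_def sum_distrib_left sum_divide_distrib)
      then show "Q x i k * cov n (grades x) k i = (\<Sum>m<n. grades x m i * (Q x i k * grades x m k) / real n)"
        by (simp only: mult_ac)
    qed
    also have "\<dots> = (\<Sum>i<p. \<Sum>m<n. \<Sum>k<p. grades x m i * (Q x i k * grades x m k) / real n)"
      by (rule sum.cong[OF refl], rule sum.swap)
    also have "\<dots> = (\<Sum>m<n. \<Sum>i<p. \<Sum>k<p. grades x m i * (Q x i k * grades x m k) / real n)" by (rule sum.swap)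
    also have "\<dots> = (\<Sum>m<n. dot p (grades x m) (mv p (Q x) (grades x m)) / real n)"
      by (simp add: dot_def mv_def sum_distrib_left sum_divide_distrib)
    also have "\<dots> = (\<Sum>m<n. a m x / (1 + a m x))"
    proof (rule sum.cong[OF refl])
      fix m assume "m \<in> {..<n}" then have m: "m < n" by simp
      have "dot p (grades x m) (mv p (Q x) (grades x m)) = dot p (grades x m) (\<lambda>i. 1 / (1 + a m x) * mv p (Qm m x) (grades x m) i)"
        by (rule dot_cong) (simp_all add: Q_vec[OF m])
      then show "dot p (grades x m) (mv p (Q x) (grades x m)) / real n = a m x / (1 + a m x)"
        unfolding dot_scale_right by (simp add: a_def)
    qed
    finally show ?thesis .
  qed
  finally have e: "real p = (\<Sum>m<n. a m x / (1 + a m x)) + l * tr p (Q x)" .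
  have "(\<Sum>m<n. a m x / (1 + a m x)) = (\<Sum>m<n. 1 - 1 / (1 + a m x))"
  proof (rule sum.cong[OF refl])
    fix m assume "m \<in> {..<n}"
    then have "1 + a m x > 0" using a_nonneg[of m x] by simp
    then show "a m x / (1 + a m x) = 1 - 1 / (1 + a m x)" by (simp add: field_simps)
  qed
  then show ?thesis using e by (simp add: sum_subtractf)
qed

lemma bm_Q: "i < p \<Longrightarrow> k < p \<Longrightarrow> bm P (\<lambda>x. Q x i k)"
  unfolding Q_def
  by (rule bmI[OF res_measurable res_entry_bound[OF cov_psd l]])
    (auto simp: cov_def intro!: bm_measurable bm_intros bm_grades)

lemma bm_Qm: "m < n \<Longrightarrow> i < p \<Longrightarrow> k < p \<Longrightarrow> bm P (\<lambda>x. Qm m x i k)"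
  unfolding Qm_def
proof (rule bmI[OF res_measurable res_entry_bound[OF cov_psd l]])
  fix i j assume ij: "i < p" "j < p"
  have "bm P (\<lambda>x. ((grades x)(m := \<lambda>_. 0)) k j)" if "k < n" "j < p" for k j
    using that by (cases "k = m") (auto intro: bm_grades bm_const)
  then show "(\<lambda>x. cov n ((grades x)(m := \<lambda>_. 0)) i j) \<in> borel_measurable P"
    unfolding cov_def using ij by (intro bm_measurable bm_intros) auto
qed auto

lemma bm_tr: "bm P (\<lambda>x. tr p (Q x))" unfolding tr_def by (intro bm_intros bm_Q) auto

lemma bm_form: "bm P (\<lambda>x. form (Q x) F)" "m < n \<Longrightarrow> bm P (\<lambda>x. form (Qm m x) F)"
  unfolding form_def by (intro bm_intros bm_Q bm_Qm; simp)+

lemma bm_a: "m < n \<Longrightarrow> bm P (a m)"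
  unfolding a_def[abs_def] dot_def mv_def by (intro bm_intros bm_Qm bm_grades) auto

lemma bm_beta: "m < n \<Longrightarrow> bm P (\<lambda>x. 1 / (1 + a m x))"
proof (rule bmI[where B = 1])
  assume m: "m < n"
  show "(\<lambda>x. 1 / (1 + a m x)) \<in> borel_measurable P"
    using bm_measurable[OF bm_a[OF m]] by measurable
  show "\<bar>1 / (1 + a m x)\<bar> \<le> 1" for x using a_nonneg[OF m, of x] by simp
qed

text \<open>Both traces lie within \<open>1 / l\<close> below the trace of the same leave-one-out
  resolvent, hence within \<open>1 / l\<close> of each other.\<close>

lemma tr_bounded_difference: "m < n \<Longrightarrow> \<bar>tr p (Q (x(m := y))) - tr p (Q x)\<bar> \<le> 1 / l"
proof -
  assume m: "m < n"
  have "Qm m (x(m := y)) = Qm m x" by (simp add: Qm_def grades_upd)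
  then show ?thesis using tr_remove[OF m, of x] tr_remove[OF m, of "x(m := y)"] by simp
qed

definition "tmean = (\<integral>x. tr p (Q x) \<partial>P)"

lemma tr_variance: "(\<integral>x. (tr p (Q x) - tmean)\<^sup>2 \<partial>P) \<le> real n / l\<^sup>2"
proof -
  obtain B where B: "\<And>x. \<bar>tr p (Q x)\<bar> \<le> B" using bm_tr by (auto simp: bm_def)
  have "(\<integral>x. (tr p (Q x) - tmean)\<^sup>2 \<partial>P) \<le> real (card {..<n}) * (1 / l)\<^sup>2"
    unfolding tmean_def
    by (rule mcdiarmid_variance[where B = B])
      (use n l B prob_N tr_bounded_difference bm_measurable[OF bm_tr] in auto)
  then show ?thesis by (simp add: power_divide)
qed

lemma tr_tail:
  assumes "\<epsilon> > 0"
  shows "PS.prob {x \<in> space P. \<epsilon> \<le> \<bar>tr p (Q x) - tmean\<bar>} \<le> 2 * exp (- 2 * \<epsilon>\<^sup>2 * l\<^sup>2 / real n)"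
proof -
  obtain B where B: "\<And>x. \<bar>tr p (Q x)\<bar> \<le> B" using bm_tr by (auto simp: bm_def)
  note [measurable] = bm_measurable[OF bm_tr]
  have e: "- 2 * \<epsilon>\<^sup>2 / (real (card {..<n}) * (1 / l)\<^sup>2) = - 2 * \<epsilon>\<^sup>2 * l\<^sup>2 / real n"
    using l by (simp add: power_divide)
  have 1: "PS.prob {x \<in> space P. \<epsilon> \<le> tr p (Q x) - tmean} \<le> exp (- 2 * \<epsilon>\<^sup>2 * l\<^sup>2 / real n)"
    unfolding e[symmetric] tmean_def
    by (rule mcdiarmid_tail[where B = B])
      (use n l B prob_N assms tr_bounded_difference in auto)
  have "PS.prob {x \<in> space P. \<epsilon> \<le> - tr p (Q x) - (\<integral>x. - tr p (Q x) \<partial>P)} \<le> exp (- 2 * \<epsilon>\<^sup>2 * l\<^sup>2 / real n)"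
    unfolding e[symmetric]
  proof (rule mcdiarmid_tail[where B = B])
    fix x m y assume "m \<in> {..<n}"
    then show "\<bar>- tr p (Q (x(m := y))) - - tr p (Q x)\<bar> \<le> 1 / l"
      using tr_bounded_difference[of m x y] by simp
  qed (use n l B prob_N assms in auto)
  then have 2: "PS.prob {x \<in> space P. \<epsilon> \<le> tmean - tr p (Q x)} \<le> exp (- 2 * \<epsilon>\<^sup>2 * l\<^sup>2 / real n)"
    by (simp add: tmean_def)
  have "{x \<in> space P. \<epsilon> \<le> \<bar>tr p (Q x) - tmean\<bar>}
     \<subseteq> {x \<in> space P. \<epsilon> \<le> tr p (Q x) - tmean} \<union> {x \<in> space P. \<epsilon> \<le> tmean - tr p (Q x)}" by auto
  then have "PS.prob {x \<in> space P. \<epsilon> \<le> \<bar>tr p (Q x) - tmean\<bar>}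
     \<le> PS.prob ({x \<in> space P. \<epsilon> \<le> tr p (Q x) - tmean} \<union> {x \<in> space P. \<epsilon> \<le> tmean - tr p (Q x)})"
    by (rule PS.finite_measure_mono) measurable
  also have "\<dots> \<le> PS.prob {x \<in> space P. \<epsilon> \<le> tr p (Q x) - tmean} + PS.prob {x \<in> space P. \<epsilon> \<le> tmean - tr p (Q x)}"
    by (rule measure_Un_le) measurable
  finally show ?thesis using 1 2 by simp
qed

text \<open>The common value that approximates every \<open>a m\<close>; random, but independent of
  the choice of \<open>m\<close>.\<close>

definition "\<tau> x = form (Q x) T / real n"

text \<open>Given the other rows, \<open>a m\<close> is a quadratic form in a grade vector with a
  frozen matrix of norm at most \<open>1 / l\<close>, so its conditional variance is of order
  \<open>p / n\<^sup>2\<close>. Passing from \<open>Qm\<close> to \<open>Q\<close> in the centring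
  costs one rank-one perturbation, the second term of the bound.\<close>

lemma a_concentration:
  assumes m: "m < n"
  shows "(\<integral>x. \<bar>a m x - \<tau> x\<bar> \<partial>P) \<le> (12 * sqrt (C * real p) + 12 * C) / (l * real n)"
proof -
  interpret G: gaussian_vector "N m" p S "\<lambda>j x. x j" C by (rule rows[OF m])
  define f where "f x = a m x - form (Qm m x) T / real n" for x
  have bf: "bm P f" unfolding f_def[abs_def] using m by (intro bm_intros bm_a bm_form)
  define V where "V = 144 * C * (1 / l\<^sup>2) * real p / (real n)\<^sup>2"
  have V: "V > 0" using C_pos l p n by (simp add: V_def)
  have inner: "(\<integral>y. (f (x(m := y)))\<^sup>2 \<partial>N m) \<le> V" for x
  proof -
    let ?B = "Qm m x"
    have e: "f (x(m := y)) = (dot p (grade (\<lambda>j. y j)) (mv p ?B (grade (\<lambda>j. y j))) - (\<Sum>i<p. \<Sum>j<p. ?B i j * arcsin_cov S i j)) / real n" for y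
    proof -
      have "(\<Sum>i<p. \<Sum>j<p. ?B i j * arcsin_cov S i j) = form ?B T"
        unfolding form_def using psd_sym[OF T_psd] by (intro sum.cong refl) auto
      then show ?thesis by (simp add: f_def a_def Qm_def grades_upd diff_divide_distrib)
    qed
    have "(\<integral>y. (f (x(m := y)))\<^sup>2 \<partial>N m)
       = (\<integral>y. (dot p (grade (\<lambda>j. y j)) (mv p ?B (grade (\<lambda>j. y j))) - (\<Sum>i<p. \<Sum>j<p. ?B i j * arcsin_cov S i j))\<^sup>2 \<partial>N m) / (real n)\<^sup>2"
      unfolding e power_divide by simp
    also have "\<dots> \<le> (144 * C * (1 / l\<^sup>2) * real p) / (real n)\<^sup>2"
    proof (intro divide_right_mono G.grade_variance p)
      show "?B i j = ?B j i" if "i < p" "j < p" for i j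
        unfolding Qm_def using res_sym[OF cov_psd l that] .
      show "dot p (mv p ?B x) (mv p ?B x) \<le> 1 / l\<^sup>2 * dot p x x" for x
        using res_norm[OF cov_psd l] unfolding Qm_def by simp
    qed auto
    finally show ?thesis by (simp add: V_def)
  qed
  have "(\<integral>x. (f x)\<^sup>2 \<partial>P) = (\<integral>x. (\<integral>y. (f (x(m := y)))\<^sup>2 \<partial>N m) \<partial>P)"
    by (rule resample[OF m bm_power2[OF bf]])
  also have "\<dots> \<le> (\<integral>x. V \<partial>P)" by (rule integral_mono') (use inner V in auto)
  finally have "(\<integral>x. (f x)\<^sup>2 \<partial>P) \<le> V" by (simp add: PS.prob_space)
  then have "(\<integral>x. \<bar>f x\<bar> \<partial>P) \<le> sqrt V"
    by (intro PS.abs_le_sqrt_second_moment bm_measurable[OF bf] PS.bm_integrable bm_power2 bf V)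
  also have "sqrt V = 12 * sqrt (C * real p) / (l * real n)"
  proof -
    have "V = (12 * sqrt (C * real p) / (l * real n))\<^sup>2"
      using C_pos p by (simp add: V_def power_divide power_mult_distrib)
    then show ?thesis using C_pos l n p by (simp only: real_sqrt_abs) simp
  qed
  finally have 1: "(\<integral>x. \<bar>f x\<bar> \<partial>P) \<le> 12 * sqrt (C * real p) / (l * real n)" .
  have 2: "\<bar>a m x - \<tau> x\<bar> \<le> \<bar>f x\<bar> + 12 * C / (l * real n)" for x
  proof -
    have "\<bar>form (Qm m x) T - form (Q x) T\<bar> \<le> 12 * C / l"
    proof (rule form_remove[OF m])
      show "\<bar>dot p v (mv p T v)\<bar> \<le> 12 * C * dot p v v" for v
        using T_upper[of v] psd_nonneg[OF T_psd, of v] by simp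
    qed (use C_pos in simp)
    then have "\<bar>form (Qm m x) T - form (Q x) T\<bar> / real n \<le> 12 * C / l / real n" by (rule divide_right_mono) simp
    then have "\<bar>form (Qm m x) T / real n - \<tau> x\<bar> \<le> 12 * C / (l * real n)"
      using n by (simp add: \<tau>_def diff_divide_distrib[symmetric] divide_divide_eq_left abs_divide)
    then show ?thesis unfolding f_def by linarith
  qed
  have bt: "bm P \<tau>" unfolding \<tau>_def[abs_def] by (intro bm_intros bm_form)
  have "(\<integral>x. \<bar>a m x - \<tau> x\<bar> \<partial>P) \<le> (\<integral>x. \<bar>f x\<bar> + 12 * C / (l * real n) \<partial>P)"
    by (rule integral_mono) (use 2 m in \<open>auto intro!: PS.bm_integrable bm_intros bf bt bm_a\<close>)
  also have "\<dots> = (\<integral>x. \<bar>f x\<bar> \<partial>P) + 12 * C / (l * real n)"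
    using PS.bm_integrable[OF bm_abs[OF bf]] by (simp add: PS.prob_space)
  finally show ?thesis using 1 by (simp add: add_divide_distrib)
qed

text \<open>By the trace identity this is the average of \<open>1 / (1 + a m)\<close>. Expressing it
  through the trace lets the variance bound for the trace control it directly.\<close>

definition "bbar x = 1 - real p / real n + l / real n * tr p (Q x)"
definition "b = 1 - real p / real n + l / real n * tmean"

lemma bbar_mean: "bbar x = (\<Sum>m<n. 1 / (1 + a m x)) / real n"
  unfolding trace_identity bbar_def using n by (simp add: field_simps)

lemma bbar_bounds: "0 < bbar x" "bbar x \<le> 1"
proof -
  have "0 < (\<Sum>m<n. 1 / (1 + a m x))"
    using n a_nonneg by (intro sum_pos) (auto intro!: divide_pos_pos add_pos_nonneg)
  then show "0 < bbar x" using n by (simp add: bbar_mean)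
  have "(\<Sum>m<n. 1 / (1 + a m x)) \<le> (\<Sum>m<n. 1)"
  proof (rule sum_mono)
    fix m assume "m \<in> {..<n}"
    then have "0 \<le> a m x" using a_nonneg by simp
    then show "1 / (1 + a m x) \<le> 1" by simp
  qed
  then show "bbar x \<le> 1" using n by (simp add: bbar_mean field_simps)
qed

lemma bm_bbar: "bm P bbar" unfolding bbar_def[abs_def] by (intro bm_intros bm_tr)

lemma b_mean: "b = (\<integral>x. bbar x \<partial>P)"
  unfolding b_def bbar_def tmean_def using PS.bm_integrable[OF bm_tr] by (simp add: PS.prob_space)

lemma b_bounds: "0 < b" "b \<le> 1"
proof -
  show "b \<le> 1"
    unfolding b_mean using integral_mono[OF PS.bm_integrable[OF bm_bbar] PS.bm_integrable[OF bm_const[of _ 1]]] bbar_bounds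
    by (simp add: PS.prob_space)
  have "(\<integral>x. bbar x \<partial>P) \<noteq> 0"
  proof
    assume "(\<integral>x. bbar x \<partial>P) = 0"
    then have "AE x in P. bbar x = 0"
      using integral_nonneg_eq_0_iff_AE[OF PS.bm_integrable[OF bm_bbar]] bbar_bounds by (simp add: less_imp_le)
    then have "AE x in P. False" using bbar_bounds(1) by (auto elim!: eventually_mono simp: less_le)
    then show False using PS.AE_False by simp
  qed
  moreover have "0 \<le> (\<integral>x. bbar x \<partial>P)" using bbar_bounds by (intro integral_nonneg_AE AE_I2) (simp add: less_imp_le)
  ultimately show "0 < b" by (simp add: b_mean)
qed

lemma bbar_concentration: "(\<integral>x. \<bar>bbar x - b\<bar> \<partial>P) \<le> 1 / sqrt (real n)"
proof -
  have e: "\<bar>bbar x - b\<bar> = l / real n * \<bar>tr p (Q x) - tmean\<bar>" for x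
  proof -
    have "bbar x - b = l / real n * (tr p (Q x) - tmean)" by (simp add: bbar_def b_def right_diff_distrib)
    then show ?thesis using l n by (simp only: abs_mult) simp
  qed
  have bt: "bm P (\<lambda>x. tr p (Q x) - tmean)" by (intro bm_intros bm_tr)
  have "(\<integral>x. \<bar>tr p (Q x) - tmean\<bar> \<partial>P) \<le> sqrt (real n / l\<^sup>2)"
    by (rule PS.abs_le_sqrt_second_moment) (use tr_variance n l bm_measurable[OF bt] PS.bm_integrable[OF bm_power2[OF bt]] in auto)
  then have "l / real n * (\<integral>x. \<bar>tr p (Q x) - tmean\<bar> \<partial>P) \<le> l / real n * (sqrt (real n) / l)"
    using l n by (intro mult_left_mono) (auto simp: real_sqrt_divide)
  also have "\<dots> = 1 / sqrt (real n)" using l n by (simp add: field_simps)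
  finally show ?thesis unfolding e by simp
qed

definition "\<delta> = (12 * sqrt (C * real p) + 12 * C) / (l * real n)"

lemma inverse_lipschitz: "0 \<le> s \<Longrightarrow> 0 \<le> t \<Longrightarrow> \<bar>1 / (1 + s) - 1 / (1 + t)\<bar> \<le> \<bar>s - t :: real\<bar>"
proof -
  assume st: "0 \<le> s" "0 \<le> t"
  have "1 / (1 + s) - 1 / (1 + t) = (t - s) / ((1 + s) * (1 + t))" using st by (simp add: field_simps)
  also have "\<bar>\<dots>\<bar> = \<bar>s - t\<bar> / ((1 + s) * (1 + t))" using st by (simp add: abs_divide abs_mult)
  also have "\<dots> \<le> \<bar>s - t\<bar> / 1"
  proof (rule divide_left_mono)
    show "1 \<le> (1 + s) * (1 + t)" using mult_mono[of 1 "1 + s" 1 "1 + t"] st by simp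
  qed (use st in auto)
  finally show ?thesis by simp
qed

text \<open>The trace of \<open>Q T\<close> is the mean of the nonnegative form of \<open>Q\<close>
  over an independent grade vector.\<close>

lemma tau_nonneg: "0 \<le> \<tau> x"
proof -
  have "form (Q x) T = (\<Sum>i<p. \<Sum>j<p. Q x i j * T i j)"
    unfolding form_def using psd_sym[OF T_psd] by (intro sum.cong refl) auto
  also have "\<dots> = (\<integral>y. (\<Sum>i<p. \<Sum>j<p. Q x i j * (grade (\<lambda>j. y j) i * grade (\<lambda>j. y j) j)) \<partial>N 0)"
    using gaussian_vector.E_grade_form[OF rows[OF n], of "Q x"] by simp
  also have "\<dots> \<ge> 0"
  proof (rule integral_nonneg_AE, rule AE_I2)
    fix y :: "nat \<Rightarrow> real"
    have "(\<Sum>i<p. \<Sum>j<p. Q x i j * (grade (\<lambda>j. y j) i * grade (\<lambda>j. y j) j)) = dot p (grade y) (mv p (Q x) (grade y))"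
      by (simp add: dot_def mv_def sum_distrib_left mult_ac)
    also have "\<dots> \<ge> 0" unfolding Q_def by (rule res_nonneg[OF cov_psd l])
    finally show "0 \<le> (\<Sum>i<p. \<Sum>j<p. Q x i j * (grade (\<lambda>j. y j) i * grade (\<lambda>j. y j) j))" .
  qed
  finally show ?thesis by (simp add: \<tau>_def)
qed

text \<open>Every \<open>1 / (1 + a k)\<close> is close to \<open>1 / (1 + \<tau>)\<close>, so their
  average \<open>bbar\<close> is too, and \<open>bbar\<close> is close to its mean \<open>b\<close>.
  The value \<open>\<tau>\<close> is only an intermediary; going through it costs
  \<open>\<delta>\<close> twice.\<close>

lemma beta_concentration:
  assumes m: "m < n"
  shows "(\<integral>x. \<bar>1 / (1 + a m x) - b\<bar> \<partial>P) \<le> 2 * \<delta> + 1 / sqrt (real n)"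
proof -
  have bt: "bm P \<tau>" unfolding \<tau>_def[abs_def] by (intro bm_intros bm_form)
  have pt: "\<bar>1 / (1 + a m x) - b\<bar> \<le> \<bar>a m x - \<tau> x\<bar> + (\<Sum>k<n. \<bar>a k x - \<tau> x\<bar>) / real n + \<bar>bbar x - b\<bar>" for x
  proof -
    have L: "\<bar>1 / (1 + a k x) - 1 / (1 + \<tau> x)\<bar> \<le> \<bar>a k x - \<tau> x\<bar>" if "k < n" for k
      by (rule inverse_lipschitz) (use a_nonneg that tau_nonneg in auto)
    have "bbar x - 1 / (1 + \<tau> x) = (\<Sum>k<n. 1 / (1 + a k x) - 1 / (1 + \<tau> x)) / real n"
      using n by (simp add: bbar_mean sum_subtractf diff_divide_distrib)
    also have "\<bar>\<dots>\<bar> \<le> (\<Sum>k<n. \<bar>a k x - \<tau> x\<bar>) / real n"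
      unfolding abs_divide using L by (auto intro!: divide_right_mono order_trans[OF sum_abs] sum_mono)
    finally show ?thesis using L[OF m] by linarith
  qed
  have "(\<integral>x. \<bar>1 / (1 + a m x) - b\<bar> \<partial>P) \<le> (\<integral>x. \<bar>a m x - \<tau> x\<bar> + (\<Sum>k<n. \<bar>a k x - \<tau> x\<bar>) / real n + \<bar>bbar x - b\<bar> \<partial>P)"
    by (rule integral_mono) (use pt m in \<open>auto intro!: PS.bm_integrable bm_intros bm_beta bt bm_a bm_bbar simp del: divide_const_simps\<close>)
  also have "\<dots> = (\<integral>x. \<bar>a m x - \<tau> x\<bar> \<partial>P) + (\<Sum>k<n. (\<integral>x. \<bar>a k x - \<tau> x\<bar> \<partial>P)) / real n + (\<integral>x. \<bar>bbar x - b\<bar> \<partial>P)"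
  proof -
    have i: "integrable P (\<lambda>x. \<bar>a k x - \<tau> x\<bar>)" if "k < n" for k
      using that by (intro PS.bm_integrable bm_intros bm_a bt)
    have i2: "integrable P (\<lambda>x. (\<Sum>k<n. \<bar>a k x - \<tau> x\<bar>) / real n)"
      by (intro PS.bm_integrable bm_intros bm_a bt) auto
    have i3: "integrable P (\<lambda>x. \<bar>bbar x - b\<bar>)" by (intro PS.bm_integrable bm_intros bm_bbar)
    have "(\<integral>x. (\<Sum>k<n. \<bar>a k x - \<tau> x\<bar>) / real n \<partial>P) = (\<Sum>k<n. (\<integral>x. \<bar>a k x - \<tau> x\<bar> \<partial>P)) / real n"
      using i by simp
    then show ?thesis using i[OF m] i2 i3 by simp
  qed
  also have "\<dots> \<le> \<delta> + (\<Sum>k<n. \<delta>) / real n + 1 / sqrt (real n)"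
    using a_concentration m bbar_concentration unfolding \<delta>_def[symmetric]
    by (intro add_mono divide_right_mono sum_mono) auto
  finally show ?thesis using n by simp
qed

text \<open>\<open>K\<close> is the deterministic equivalent of \<open>Q\<close>, and \<open>F = T K\<close> enters through
  \<open>Q - K = Q (b T - cov) K\<close>.\<close>
definition "K = res p (\<lambda>i j. b * T i j) l"
definition "F k i = (\<Sum>j<p. T k j * K j i)"

lemma bT_psd: "psd p (\<lambda>i j. b * T i j)"
proof -
  have "mv p (\<lambda>i j. b * T i j) x = (\<lambda>i. b * mv p T x i)" for x
    by (simp add: mv_def sum_distrib_left mult.assoc fun_eq_iff)
  then show ?thesis using T_psd b_bounds by (auto simp: psd_def dot_scale_right)
qed

lemma K_sym: "i < p \<Longrightarrow> j < p \<Longrightarrow> K i j = K j i"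
  unfolding K_def by (rule res_sym[OF bT_psd l])

text \<open>Cauchy-Schwarz in the semidefinite form of \<open>T\<close>, applied to \<open>v\<close>
  and \<open>K v\<close>; then \<open>T\<close> contributes \<open>12 * C\<close> and the resolvent
  \<open>K\<close> contributes \<open>1 / l\<close>.\<close>

lemma F_bound: "\<bar>dot p v (mv p F v)\<bar> \<le> 12 * C / l * dot p v v"
proof -
  let ?w = "mv p K v"
  have "mv p F v i = mv p T ?w i" for i
  proof -
    have "mv p F v i = (\<Sum>j<p. \<Sum>k<p. T i k * (K k j * v j))"
      by (simp add: mv_def F_def sum_distrib_right mult.assoc)
    also have "\<dots> = (\<Sum>k<p. \<Sum>j<p. T i k * (K k j * v j))" by (rule sum.swap)
    finally show ?thesis by (simp add: mv_def sum_distrib_left)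
  qed
  then have e: "dot p v (mv p F v) = dot p v (mv p T ?w)" by (simp add: dot_def)
  have C0: "C \<ge> 0" using C_pos by simp
  have "(dot p v (mv p T ?w))\<^sup>2 \<le> dot p v (mv p T v) * dot p ?w (mv p T ?w)" by (rule psd_CS[OF T_psd])
  also have "\<dots> \<le> (12 * C * dot p v v) * (12 * C * dot p ?w ?w)"
    using C0 by (intro mult_mono T_upper psd_nonneg[OF T_psd]) (simp add: dot_self_nonneg)
  also have "\<dots> \<le> (12 * C * dot p v v) * (12 * C * (dot p v v / l\<^sup>2))"
    using C0 res_norm[OF bT_psd l, of v] unfolding K_def by (intro mult_left_mono) (auto simp: dot_self_nonneg)
  also have "\<dots> = (12 * C / l * dot p v v)\<^sup>2" by (simp add: power2_eq_square)
  finally have "\<bar>dot p v (mv p T ?w)\<bar>\<^sup>2 \<le> (12 * C / l * dot p v v)\<^sup>2" by simp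
  then show ?thesis unfolding e
    by (rule power2_le_imp_le) (use C0 l dot_self_nonneg[of p v] in simp)
qed

text \<open>The contribution of row \<open>m\<close> to the trace of \<open>Q cov K\<close>, up to
  the factor \<open>1 / n\<close> and freed of the Sherman-Morrison factor
  \<open>1 / (1 + a m)\<close>.\<close>

definition "g m x = dot p (mv p K (grades x m)) (mv p (Qm m x) (grades x m))"

lemma g_bound: "\<bar>g m x\<bar> \<le> 3 * real p / l\<^sup>2"
proof -
  let ?u = "grades x m"
  have u: "dot p ?u ?u \<le> 3 * real p" unfolding grades_def by (rule grade_norm)
  have "(g m x)\<^sup>2 \<le> dot p (mv p K ?u) (mv p K ?u) * dot p (mv p (Qm m x) ?u) (mv p (Qm m x) ?u)"
    unfolding g_def by (rule dot_CS)
  also have "\<dots> \<le> (dot p ?u ?u / l\<^sup>2) * (dot p ?u ?u / l\<^sup>2)"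
    unfolding K_def Qm_def
    by (intro mult_mono res_norm bT_psd l cov_psd dot_self_nonneg divide_nonneg_nonneg) auto
  also have "\<dots> \<le> (3 * real p / l\<^sup>2) * (3 * real p / l\<^sup>2)"
    using u by (intro mult_mono divide_right_mono divide_nonneg_nonneg dot_self_nonneg) auto
  finally have "\<bar>g m x\<bar>\<^sup>2 \<le> (3 * real p / l\<^sup>2)\<^sup>2" by (simp add: power2_eq_square)
  then show ?thesis by (rule power2_le_imp_le) simp
qed

lemma bm_g: "m < n \<Longrightarrow> bm P (g m)"
  unfolding g_def[abs_def] dot_def mv_def by (intro bm_intros bm_Qm bm_grades) auto

text \<open>Averaging over row \<open>m\<close> with the other rows fixed replaces the outer product
  of the grade vector by \<open>T\<close>.\<close>

lemma E_g:
  assumes m: "m < n"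
  shows "(\<integral>x. g m x \<partial>P) = (\<integral>x. form (Qm m x) F \<partial>P)"
proof -
  interpret G: gaussian_vector "N m" p S "\<lambda>j x. x j" C by (rule rows[OF m])
  have "(\<integral>y. g m (x(m := y)) \<partial>N m) = form (Qm m x) F" for x
  proof -
    have gy: "g m (x(m := y)) = (\<Sum>i<p. \<Sum>k<p. (\<Sum>r<p. K r i * Qm m x r k) * (grade (\<lambda>j. y j) i * grade (\<lambda>j. y j) k))" for y
    proof -
      have "g m (x(m := y)) = (\<Sum>r<p. \<Sum>i<p. \<Sum>k<p. K r i * Qm m x r k * (grade y i * grade y k))"
        by (simp add: g_def Qm_def grades_upd dot_def mv_def sum_product mult_ac)
      also have "\<dots> = (\<Sum>i<p. \<Sum>r<p. \<Sum>k<p. K r i * Qm m x r k * (grade y i * grade y k))" by (rule sum.swap)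
      also have "\<dots> = (\<Sum>i<p. \<Sum>k<p. \<Sum>r<p. K r i * Qm m x r k * (grade y i * grade y k))"
        by (rule sum.cong[OF refl], rule sum.swap)
      finally show ?thesis by (simp add: sum_distrib_right)
    qed
    have "(\<integral>y. g m (x(m := y)) \<partial>N m) = (\<Sum>i<p. \<Sum>k<p. (\<Sum>r<p. K r i * Qm m x r k) * T i k)"
      unfolding gy by (rule G.E_grade_form)
    also have "\<dots> = (\<Sum>i<p. \<Sum>k<p. \<Sum>r<p. Qm m x r k * (T k i * K i r))"
      unfolding sum_distrib_right using psd_sym[OF T_psd] K_sym by (intro sum.cong refl) auto
    also have "\<dots> = (\<Sum>i<p. \<Sum>r<p. \<Sum>k<p. Qm m x r k * (T k i * K i r))"
      by (rule sum.cong[OF refl], rule sum.swap)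
    also have "\<dots> = (\<Sum>r<p. \<Sum>i<p. \<Sum>k<p. Qm m x r k * (T k i * K i r))" by (rule sum.swap)
    also have "\<dots> = (\<Sum>r<p. \<Sum>k<p. \<Sum>i<p. Qm m x r k * (T k i * K i r))"
      by (rule sum.cong[OF refl], rule sum.swap)
    also have "\<dots> = form (Qm m x) F" by (simp add: form_def F_def sum_distrib_left)
    finally show ?thesis .
  qed
  then show ?thesis by (subst resample[OF m bm_g[OF m]]) simp
qed

text \<open>Trace of the resolvent identity for \<open>Q\<close> and \<open>K\<close>.
  Sherman-Morrison turns \<open>Q u\<close> into \<open>Qm u / (1 + a)\<close>, after which the row
  \<open>u\<close> is independent of the matrices it is tested against.\<close>

lemma trace_difference:
  "tr p (Q x) - tr p K = b * form (Q x) F - (\<Sum>m<n. 1 / (1 + a m x) * g m x) / real n"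
proof -
  have "tr p (Q x) - tr p K = (\<Sum>i<p. \<Sum>k<p. \<Sum>j<p. Q x i k * (b * T k j - cov n (grades x) k j) * K j i)"
    unfolding tr_def sum_subtractf[symmetric] Q_def K_def
    by (intro sum.cong refl) (simp add: res_identity[OF cov_psd bT_psd l])
  also have "\<dots> = (\<Sum>i<p. \<Sum>k<p. \<Sum>j<p. b * (Q x i k * (T k j * K j i)))
       - (\<Sum>i<p. \<Sum>k<p. \<Sum>j<p. Q x i k * cov n (grades x) k j * K j i)"
    unfolding sum_subtractf[symmetric] by (intro sum.cong refl) (simp add: algebra_simps)
  also have "(\<Sum>i<p. \<Sum>k<p. \<Sum>j<p. b * (Q x i k * (T k j * K j i))) = b * form (Q x) F"
    by (simp add: form_def F_def sum_distrib_left)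
  also have "(\<Sum>i<p. \<Sum>k<p. \<Sum>j<p. Q x i k * cov n (grades x) k j * K j i)
     = (\<Sum>m<n. dot p (mv p K (grades x m)) (mv p (Q x) (grades x m))) / real n"
  proof -
    have "(\<Sum>i<p. \<Sum>k<p. \<Sum>j<p. Q x i k * cov n (grades x) k j * K j i)
       = (\<Sum>i<p. \<Sum>m<n. \<Sum>k<p. \<Sum>j<p. (Q x i k * grades x m k) * (K i j * grades x m j) / real n)"
    proof (rule sum.cong[OF refl])
      fix i assume i: "i \<in> {..<p}"
      have "(\<Sum>k<p. \<Sum>j<p. Q x i k * cov n (grades x) k j * K j i)
         = (\<Sum>k<p. \<Sum>j<p. \<Sum>m<n. (Q x i k * grades x m k) * (K i j * grades x m j) / real n)"
      proof (intro sum.cong refl)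
        fix k j assume "j \<in> {..<p}"
        then have "K j i = K i j" using i K_sym by auto
        have "Q x i k * cov n (grades x) k j * K j i = (\<Sum>m<n. Q x i k * (grades x m k * grades x m j) / real n * K j i)"
          by (simp add: cov_def sum_distrib_left sum_distrib_right)
        also have "\<dots> = (\<Sum>m<n. (Q x i k * grades x m k) * (K i j * grades x m j) / real n)"
          unfolding \<open>K j i = K i j\<close> by (intro sum.cong refl) simp
        finally show "Q x i k * cov n (grades x) k j * K j i = (\<Sum>m<n. (Q x i k * grades x m k) * (K i j * grades x m j) / real n)" .
      qed
      also have "\<dots> = (\<Sum>k<p. \<Sum>m<n. \<Sum>j<p. (Q x i k * grades x m k) * (K i j * grades x m j) / real n)"
        by (rule sum.cong[OF refl], rule sum.swap)
      also have "\<dots> = (\<Sum>m<n. \<Sum>k<p. \<Sum>j<p. (Q x i k * grades x m k) * (K i j * grades x m j) / real n)" by (rule sum.swap)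
      finally show "(\<Sum>k<p. \<Sum>j<p. Q x i k * cov n (grades x) k j * K j i)
         = (\<Sum>m<n. \<Sum>k<p. \<Sum>j<p. (Q x i k * grades x m k) * (K i j * grades x m j) / real n)" .
    qed
    also have "\<dots> = (\<Sum>m<n. \<Sum>i<p. \<Sum>k<p. \<Sum>j<p. (Q x i k * grades x m k) * (K i j * grades x m j) / real n)" by (rule sum.swap)
    also have "\<dots> = (\<Sum>m<n. dot p (mv p K (grades x m)) (mv p (Q x) (grades x m))) / real n"
    proof -
      have "(\<Sum>k<p. \<Sum>j<p. (Q x i k * grades x m k) * (K i j * grades x m j) / real n)
         = mv p (Q x) (grades x m) i * mv p K (grades x m) i / real n" for m i
        unfolding mv_def sum_product sum_divide_distrib ..
      then show ?thesis by (simp add: dot_def sum_divide_distrib mult.commute)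
    qed
    finally show ?thesis .
  qed
  also have "(\<Sum>m<n. dot p (mv p K (grades x m)) (mv p (Q x) (grades x m))) = (\<Sum>m<n. 1 / (1 + a m x) * g m x)"
  proof (rule sum.cong[OF refl])
    fix m assume "m \<in> {..<n}"
    then have "dot p (mv p K (grades x m)) (mv p (Q x) (grades x m))
       = dot p (mv p K (grades x m)) (\<lambda>i. 1 / (1 + a m x) * mv p (Qm m x) (grades x m) i)"
      by (intro dot_cong) (simp_all add: Q_vec)
    then show "dot p (mv p K (grades x m)) (mv p (Q x) (grades x m)) = 1 / (1 + a m x) * g m x"
      unfolding dot_scale_right g_def .
  qed
  finally show ?thesis .
qed

text \<open>Once \<open>1 / (1 + a m)\<close> is replaced by \<open>b\<close>, the two terms of
  \<open>trace_difference\<close> cancel in mean up to the change from \<open>Qm\<close> to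
  \<open>Q\<close>. The latter gives the first error term, by \<open>form_remove\<close> and
  \<open>F_bound\<close>; the replacement gives the second, because \<open>g\<close> is at most of
  order \<open>p\<close>, which the division by \<open>p\<close> absorbs.\<close>

theorem deterministic_equivalent:
  "\<bar>tmean / real p - tr p K / real p\<bar>
     \<le> 12 * C / (l\<^sup>2 * real p) + 3 / l\<^sup>2 * (2 * \<delta> + 1 / sqrt (real n))"
proof -
  let ?E = "\<lambda>f. \<integral>x. f x \<partial>P"
  have ib: "integrable P (\<lambda>x. (1 / (1 + a m x) - b) * g m x)" "integrable P (\<lambda>x. form (Qm m x) F)" "integrable P (g m)"
    "integrable P (\<lambda>x. 1 / (1 + a m x) * g m x)" if "m < n" for m
    using that by (auto intro!: PS.bm_integrable bm_mult[OF bm_beta bm_g] bm_mult[OF bm_diff[OF bm_beta bm_const] bm_g] bm_form bm_g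
        simp del: times_divide_eq_left mult_1)
  have iQ: "integrable P (\<lambda>x. form (Q x) F)" by (intro PS.bm_integrable bm_form)
  have it: "integrable P (\<lambda>x. tr p (Q x))" by (intro PS.bm_integrable bm_tr)
  have "tmean - tr p K = ?E (\<lambda>x. tr p (Q x) - tr p K)"
    using it by (simp add: tmean_def PS.prob_space)
  also have "\<dots> = b * ?E (\<lambda>x. form (Q x) F) - (\<Sum>m<n. ?E (\<lambda>x. 1 / (1 + a m x) * g m x)) / real n"
  proof -
    have s: "integrable P (\<lambda>x. (\<Sum>m<n. 1 / (1 + a m x) * g m x) / real n)"
      using ib(4) by (intro integrable_divide_zero Bochner_Integration.integrable_sum) auto
    have "?E (\<lambda>x. (\<Sum>m<n. 1 / (1 + a m x) * g m x) / real n) = (\<Sum>m<n. ?E (\<lambda>x. 1 / (1 + a m x) * g m x)) / real n"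
      unfolding integral_divide_zero
      by (subst Bochner_Integration.integral_sum) (use ib(4) in \<open>simp_all only: lessThan_iff\<close>)
    then show ?thesis unfolding trace_difference
      using Bochner_Integration.integral_diff[OF integrable_mult_right[OF iQ] s, of b] by (simp only: integral_mult_right_zero)
  qed
  also have "(\<Sum>m<n. ?E (\<lambda>x. 1 / (1 + a m x) * g m x))
     = (\<Sum>m<n. ?E (\<lambda>x. (1 / (1 + a m x) - b) * g m x) + b * ?E (\<lambda>x. form (Qm m x) F))"
  proof (rule sum.cong[OF refl])
    fix m assume "m \<in> {..<n}" then have m: "m < n" by simp
    have "?E (\<lambda>x. 1 / (1 + a m x) * g m x) = ?E (\<lambda>x. (1 / (1 + a m x) - b) * g m x + b * g m x)"
      by (intro Bochner_Integration.integral_cong refl) (simp add: left_diff_distrib)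
    also have "\<dots> = ?E (\<lambda>x. (1 / (1 + a m x) - b) * g m x) + ?E (\<lambda>x. b * g m x)"
      by (rule Bochner_Integration.integral_add[OF ib(1)[OF m] integrable_mult_right[OF ib(3)[OF m]]])
    finally show "?E (\<lambda>x. 1 / (1 + a m x) * g m x) = ?E (\<lambda>x. (1 / (1 + a m x) - b) * g m x) + b * ?E (\<lambda>x. form (Qm m x) F)"
      by (simp only: integral_mult_right_zero E_g[OF m])
  qed
  finally have e: "tmean - tr p K = b * ?E (\<lambda>x. form (Q x) F)
      - (\<Sum>m<n. ?E (\<lambda>x. (1 / (1 + a m x) - b) * g m x) + b * ?E (\<lambda>x. form (Qm m x) F)) / real n" .
  \<comment> \<open>The term \<open>b * form (Q x) F\<close> is distributed evenly over the
    \<open>n\<close> rows, so that the cancellation takes place row by row.\<close>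
  have e2: "tmean - tr p K = (\<Sum>m<n. b * (?E (\<lambda>x. form (Q x) F) - ?E (\<lambda>x. form (Qm m x) F)) - ?E (\<lambda>x. (1 / (1 + a m x) - b) * g m x)) / real n"
    unfolding e using n
    by (simp add: sum.distrib sum_subtractf right_diff_distrib diff_divide_distrib add_divide_distrib)
  have h1: "\<bar>b * (?E (\<lambda>x. form (Q x) F) - ?E (\<lambda>x. form (Qm m x) F))\<bar> \<le> 12 * C / l\<^sup>2" if m: "m < n" for m
  proof -
    have "\<bar>?E (\<lambda>x. form (Q x) F) - ?E (\<lambda>x. form (Qm m x) F)\<bar> = \<bar>?E (\<lambda>x. form (Q x) F - form (Qm m x) F)\<bar>"
      using iQ ib(2)[OF m] by simp
    also have "\<dots> \<le> ?E (\<lambda>x. \<bar>form (Q x) F - form (Qm m x) F\<bar>)" by (rule integral_abs_bound)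
    also have "\<dots> \<le> ?E (\<lambda>x. 12 * C / l / l)"
    proof (rule integral_mono')
      show "\<bar>form (Q x) F - form (Qm m x) F\<bar> \<le> 12 * C / l / l" for x
        using form_remove[OF m F_bound, of x] C_pos l by (simp add: abs_minus_commute)
    qed (use C_pos l in auto)
    finally have "\<bar>?E (\<lambda>x. form (Q x) F) - ?E (\<lambda>x. form (Qm m x) F)\<bar> \<le> 12 * C / l\<^sup>2"
      by (simp add: PS.prob_space power2_eq_square)
    then have "\<bar>b\<bar> * \<bar>?E (\<lambda>x. form (Q x) F) - ?E (\<lambda>x. form (Qm m x) F)\<bar> \<le> 1 * (12 * C / l\<^sup>2)"
      using b_bounds by (intro mult_mono) auto
    then show ?thesis by (simp add: abs_mult)
  qed
  have h2: "\<bar>?E (\<lambda>x. (1 / (1 + a m x) - b) * g m x)\<bar> \<le> (2 * \<delta> + 1 / sqrt (real n)) * (3 * real p / l\<^sup>2)" if m: "m < n" for m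
  proof -
    have bi: "bm P (\<lambda>x. \<bar>1 / (1 + a m x) - b\<bar>)" using m by (intro bm_intros bm_beta)
    have "\<bar>?E (\<lambda>x. (1 / (1 + a m x) - b) * g m x)\<bar> \<le> ?E (\<lambda>x. \<bar>(1 / (1 + a m x) - b) * g m x\<bar>)" by (rule integral_abs_bound)
    also have "\<dots> \<le> ?E (\<lambda>x. \<bar>1 / (1 + a m x) - b\<bar> * (3 * real p / l\<^sup>2))"
    proof (rule integral_mono)
      show "integrable P (\<lambda>x. \<bar>(1 / (1 + a m x) - b) * g m x\<bar>)" using ib(1)[OF m] by (rule integrable_abs)
      show "integrable P (\<lambda>x. \<bar>1 / (1 + a m x) - b\<bar> * (3 * real p / l\<^sup>2))"
        using PS.bm_integrable[OF bi] by (rule integrable_mult_left)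
      show "\<bar>(1 / (1 + a m x) - b) * g m x\<bar> \<le> \<bar>1 / (1 + a m x) - b\<bar> * (3 * real p / l\<^sup>2)" for x
        unfolding abs_mult[of "1 / (1 + a m x) - b"] by (intro mult_left_mono g_bound) simp
    qed
    also have "\<dots> = ?E (\<lambda>x. \<bar>1 / (1 + a m x) - b\<bar>) * (3 * real p / l\<^sup>2)" by (rule integral_mult_left_zero)
    also have "\<dots> \<le> (2 * \<delta> + 1 / sqrt (real n)) * (3 * real p / l\<^sup>2)"
      by (intro mult_right_mono beta_concentration m) simp
    finally show ?thesis .
  qed
  have "\<bar>tmean - tr p K\<bar> = \<bar>\<Sum>m<n. b * (?E (\<lambda>x. form (Q x) F) - ?E (\<lambda>x. form (Qm m x) F)) - ?E (\<lambda>x. (1 / (1 + a m x) - b) * g m x)\<bar> / real n"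
    unfolding e2 abs_divide by simp
  also have "\<dots> \<le> (\<Sum>m<n. 12 * C / l\<^sup>2 + (2 * \<delta> + 1 / sqrt (real n)) * (3 * real p / l\<^sup>2)) / real n"
  proof (intro divide_right_mono order_trans[OF sum_abs sum_mono])
    fix m assume "m \<in> {..<n}" then have m: "m < n" by simp
    show "\<bar>b * (?E (\<lambda>x. form (Q x) F) - ?E (\<lambda>x. form (Qm m x) F)) - ?E (\<lambda>x. (1 / (1 + a m x) - b) * g m x)\<bar>
       \<le> 12 * C / l\<^sup>2 + (2 * \<delta> + 1 / sqrt (real n)) * (3 * real p / l\<^sup>2)"
      using h1[OF m] h2[OF m] by linarith
  qed simp
  also have "\<dots> = 12 * C / l\<^sup>2 + (2 * \<delta> + 1 / sqrt (real n)) * (3 * real p / l\<^sup>2)" using n by simp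
  finally have "\<bar>tmean - tr p K\<bar> / real p \<le> (12 * C / l\<^sup>2 + (2 * \<delta> + 1 / sqrt (real n)) * (3 * real p / l\<^sup>2)) / real p"
    by (rule divide_right_mono) simp
  also have "\<dots> = 12 * C / (l\<^sup>2 * real p) + 3 / l\<^sup>2 * (2 * \<delta> + 1 / sqrt (real n))"
    using p by (simp add: add_divide_distrib)
  finally show ?thesis by (simp add: diff_divide_distrib[symmetric] abs_divide)
qed

end

section \<open>Ranks versus grades\<close>

lemma dot_young: "e > 0 \<Longrightarrow> \<bar>dot p x y\<bar> \<le> (dot p x x / e + e * dot p y y) / 2"
proof -
  assume e: "e > 0"
  have "2 * \<bar>x i * y i\<bar> \<le> x i * x i / e + e * (y i * y i)" for i
  proof -
    have "0 \<le> (\<bar>x i\<bar> - e * \<bar>y i\<bar>)\<^sup>2" by simp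
    then have "2 * e * \<bar>x i * y i\<bar> \<le> x i * x i + e * e * (y i * y i)"
      by (simp add: power2_eq_square algebra_simps abs_mult)
    then show ?thesis using e by (simp add: field_simps)
  qed
  then have "(\<Sum>i<p. 2 * \<bar>x i * y i\<bar>) \<le> (\<Sum>i<p. x i * x i / e + e * (y i * y i))" by (rule sum_mono)
  also have "\<dots> = dot p x x / e + e * dot p y y"
    by (simp add: dot_def sum.distrib sum_divide_distrib sum_distrib_left)
  finally have "2 * (\<Sum>i<p. \<bar>x i * y i\<bar>) \<le> dot p x x / e + e * dot p y y" by (simp only: sum_distrib_left)
  moreover have "\<bar>dot p x y\<bar> \<le> (\<Sum>i<p. \<bar>x i * y i\<bar>)" unfolding dot_def by (rule sum_abs)
  moreover define Z where "Z = dot p x x / e + e * dot p y y"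
  ultimately show ?thesis unfolding Z_def[symmetric] by linarith
qed

text \<open>The resolvent identity reduces the difference to bilinear expressions in the rows, which
  are telescoped into terms linear in \<open>u m - w m\<close>; Young's inequality with a free
  \<open>e\<close> then separates the mean square distance from the bounded row norms. Hence only
  closeness on average is required of the rows.\<close>

lemma tr_res_cov_difference:
  assumes l: "l > 0" and n: "n > 0" and p: "p > 0" and e: "e > 0"
    and u: "\<And>m. m < n \<Longrightarrow> dot p (u m) (u m) \<le> c * real p" and w: "\<And>m. m < n \<Longrightarrow> dot p (w m) (w m) \<le> c * real p"
    and c: "c \<ge> 0"
  shows "\<bar>tr p (res p (cov n w) l) - tr p (res p (cov n u) l)\<bar> / real p
    \<le> ((\<Sum>m<n. \<Sum>j<p. (w m j - u m j)\<^sup>2) / (real n * real p) / e + c * e) / l\<^sup>2"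
proof -
  let ?A = "res p (cov n w) l" and ?B = "res p (cov n u) l"
  note A = cov_psd[of p n w] and B = cov_psd[of p n u]
  have t: "tr p ?A - tr p ?B = (\<Sum>m<n. dot p (mv p ?A (u m)) (mv p ?B (u m)) - dot p (mv p ?A (w m)) (mv p ?B (w m))) / real n"
  proof -
    have s: "(\<Sum>i<p. \<Sum>k<p. \<Sum>j<p. ?A i k * cov n v k j * ?B j i) = (\<Sum>m<n. dot p (mv p ?A (v m)) (mv p ?B (v m))) / real n" for v
    proof -
      have "(\<Sum>i<p. \<Sum>k<p. \<Sum>j<p. ?A i k * cov n v k j * ?B j i)
         = (\<Sum>i<p. \<Sum>m<n. \<Sum>k<p. \<Sum>j<p. (?A i k * v m k) * (?B i j * v m j) / real n)"
      proof (rule sum.cong[OF refl])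
        fix i assume i: "i \<in> {..<p}"
        have "(\<Sum>k<p. \<Sum>j<p. ?A i k * cov n v k j * ?B j i)
           = (\<Sum>k<p. \<Sum>j<p. \<Sum>m<n. (?A i k * v m k) * (?B i j * v m j) / real n)"
        proof (intro sum.cong refl)
          fix k j assume "j \<in> {..<p}"
          then have sy: "?B j i = ?B i j" using i res_sym[OF B l] by auto
          have "?A i k * cov n v k j * ?B j i = (\<Sum>m<n. ?A i k * (v m k * v m j) / real n * ?B j i)"
            by (simp add: cov_def sum_distrib_left sum_distrib_right)
          also have "\<dots> = (\<Sum>m<n. (?A i k * v m k) * (?B i j * v m j) / real n)"
            unfolding sy by (intro sum.cong refl) simp
          finally show "?A i k * cov n v k j * ?B j i = (\<Sum>m<n. (?A i k * v m k) * (?B i j * v m j) / real n)" .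
        qed
        also have "\<dots> = (\<Sum>k<p. \<Sum>m<n. \<Sum>j<p. (?A i k * v m k) * (?B i j * v m j) / real n)"
          by (rule sum.cong[OF refl], rule sum.swap)
        also have "\<dots> = (\<Sum>m<n. \<Sum>k<p. \<Sum>j<p. (?A i k * v m k) * (?B i j * v m j) / real n)" by (rule sum.swap)
        finally show "(\<Sum>k<p. \<Sum>j<p. ?A i k * cov n v k j * ?B j i)
           = (\<Sum>m<n. \<Sum>k<p. \<Sum>j<p. (?A i k * v m k) * (?B i j * v m j) / real n)" .
      qed
      also have "\<dots> = (\<Sum>m<n. \<Sum>i<p. \<Sum>k<p. \<Sum>j<p. (?A i k * v m k) * (?B i j * v m j) / real n)" by (rule sum.swap)
      also have "\<dots> = (\<Sum>m<n. dot p (mv p ?A (v m)) (mv p ?B (v m))) / real n"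
      proof -
        have "(\<Sum>k<p. \<Sum>j<p. (?A i k * v m k) * (?B i j * v m j) / real n)
           = mv p ?A (v m) i * mv p ?B (v m) i / real n" for m i
          unfolding mv_def sum_product sum_divide_distrib ..
        then show ?thesis by (simp add: dot_def sum_divide_distrib)
      qed
      finally show ?thesis .
    qed
    have "tr p ?A - tr p ?B = (\<Sum>i<p. \<Sum>k<p. \<Sum>j<p. ?A i k * (cov n u k j - cov n w k j) * ?B j i)"
      unfolding tr_def sum_subtractf[symmetric] by (intro sum.cong refl) (simp add: res_identity[OF A B l])
    also have "\<dots> = (\<Sum>i<p. \<Sum>k<p. \<Sum>j<p. ?A i k * cov n u k j * ?B j i) - (\<Sum>i<p. \<Sum>k<p. \<Sum>j<p. ?A i k * cov n w k j * ?B j i)"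
      unfolding sum_subtractf[symmetric] by (intro sum.cong refl) (simp add: algebra_simps)
    finally show ?thesis unfolding s by (simp add: sum_subtractf diff_divide_distrib)
  qed
  let ?d = "\<lambda>m j. u m j - w m j"
  have pm: "\<bar>dot p (mv p ?A (u m)) (mv p ?B (u m)) - dot p (mv p ?A (w m)) (mv p ?B (w m))\<bar>
     \<le> (dot p (?d m) (?d m) / e + e * (c * real p)) / l\<^sup>2" if m: "m < n" for m
  proof -
    have b: "\<bar>dot p (mv p X (?d m)) (mv p Y v)\<bar> \<le> (dot p (?d m) (?d m) / e + e * (c * real p)) / l\<^sup>2 / 2"
      if XY: "\<And>x. dot p (mv p X x) (mv p X x) \<le> dot p x x / l\<^sup>2" "\<And>x. dot p (mv p Y x) (mv p Y x) \<le> dot p x x / l\<^sup>2"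
        and v: "dot p v v \<le> c * real p" for X Y v
    proof -
      have "\<bar>dot p (mv p X (?d m)) (mv p Y v)\<bar> \<le> (dot p (mv p X (?d m)) (mv p X (?d m)) / e + e * dot p (mv p Y v) (mv p Y v)) / 2"
        by (rule dot_young[OF e])
      also have "\<dots> \<le> ((dot p (?d m) (?d m) / l\<^sup>2) / e + e * (c * real p / l\<^sup>2)) / 2"
        using e order_trans[OF XY(2) divide_right_mono[OF v]] XY(1)
        by (intro divide_right_mono add_mono mult_left_mono) auto
      also have "\<dots> = (dot p (?d m) (?d m) / e + e * (c * real p)) / l\<^sup>2 / 2"
        using e l by (simp add: field_simps)
      finally show ?thesis .
    qed
    have "dot p (mv p ?A (u m)) (mv p ?B (u m)) - dot p (mv p ?A (w m)) (mv p ?B (w m))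
       = dot p (mv p ?A (?d m)) (mv p ?B (u m)) + dot p (mv p ?B (?d m)) (mv p ?A (w m))"
      unfolding mv_diff[abs_def] dot_diff_left
      by (simp add: dot_commute[of p "mv p ?B _"])
    moreover define Z where "Z = (dot p (?d m) (?d m) / e + e * (c * real p)) / l\<^sup>2"
    ultimately show ?thesis
      using b[of ?A ?B "u m", OF res_norm[OF A l] res_norm[OF B l] u[OF m], folded Z_def]
        b[of ?B ?A "w m", OF res_norm[OF B l] res_norm[OF A l] w[OF m], folded Z_def]
      unfolding Z_def[symmetric] by linarith
  qed
  have "\<bar>tr p ?A - tr p ?B\<bar> = \<bar>\<Sum>m<n. dot p (mv p ?A (u m)) (mv p ?B (u m)) - dot p (mv p ?A (w m)) (mv p ?B (w m))\<bar> / real n"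
    unfolding t by simp
  also have "\<dots> \<le> (\<Sum>m<n. (dot p (?d m) (?d m) / e + e * (c * real p)) / l\<^sup>2) / real n"
    using pm by (intro divide_right_mono order_trans[OF sum_abs sum_mono]) auto
  also have "\<dots> = ((\<Sum>m<n. dot p (?d m) (?d m)) / real n / e + e * (c * real p)) / l\<^sup>2"
    using n by (simp add: sum.distrib sum_divide_distrib[symmetric] add_divide_distrib)
  finally have "\<bar>tr p ?A - tr p ?B\<bar> / real p \<le> ((\<Sum>m<n. dot p (?d m) (?d m)) / real n / e + e * (c * real p)) / l\<^sup>2 / real p"
    by (rule divide_right_mono) simp
  also have "\<dots> = ((\<Sum>m<n. dot p (?d m) (?d m)) / (real n * real p) / e + c * e) / l\<^sup>2"
  proof -
    have "(s / real n / e + e * (c * real p)) / l\<^sup>2 / real p = (s / (real n * real p) / e + c * e) / l\<^sup>2" for s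
    proof -
      have "(s / real n / e + e * (c * real p)) / real p = s / (real n * real p) / e + c * e"
        using p by (simp add: add_divide_distrib)
      then show ?thesis by (simp only: divide_divide_eq_left mult.commute[of "l\<^sup>2"]) (simp only: divide_divide_eq_left[symmetric])
    qed
    then show ?thesis .
  qed
  also have "(\<Sum>m<n. dot p (?d m) (?d m)) = (\<Sum>m<n. \<Sum>j<p. (w m j - u m j)\<^sup>2)"
    unfolding dot_def by (intro sum.cong refl) (simp add: power2_eq_square algebra_simps)
  finally show ?thesis .
qed

section \<open>Ranks and their scaling\<close>

definition rank_scale :: "nat \<Rightarrow> real" where "rank_scale n = sqrt (12 / (real n ^ 2 - 1))"

lemma rank_scale_bounds:
  assumes n: "n \<ge> 2"
  shows "0 < rank_scale n" "rank_scale n \<le> 4 / real n" "rank_scale n * (real n - 1) \<le> sqrt 12"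
    "(rank_scale n)\<^sup>2 = 12 / (real n ^ 2 - 1)"
    "\<bar>rank_scale n * (real n - 1) - sqrt 12\<bar> \<le> sqrt 12 * (2 / (real n + 1))"
proof -
  have r: "real n \<ge> 2" using n by simp
  have n2: "real n ^ 2 \<ge> 4" using power_mono[of 2 "real n" 2] r by simp
  then have d: "real n ^ 2 - 1 > 0" by simp
  show "0 < rank_scale n" using d by (simp add: rank_scale_def)
  show s2: "(rank_scale n)\<^sup>2 = 12 / (real n ^ 2 - 1)" using d by (simp add: rank_scale_def)
  have "(rank_scale n)\<^sup>2 \<le> (4 / real n)\<^sup>2"
    unfolding s2 power_divide using d n2 r by (simp add: field_simps)
  then show "rank_scale n \<le> 4 / real n" by (rule power2_le_imp_le) simp
  \<comment> \<open>\<open>12 * q\<close> is the square of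
    \<open>rank_scale n * (real n - 1)\<close>, the scaled range of the ranks. As
    \<open>q \<le> sqrt q \<le> 1\<close>, its distance to \<open>sqrt 12\<close> is controlled by
    \<open>1 - q = 2 / (n + 1)\<close>.\<close>
  define q where "q = (real n - 1) / (real n + 1)"
  have q: "0 \<le> q" "q \<le> 1" using r by (auto simp: q_def)
  have "rank_scale n * (real n - 1) = sqrt 12 * sqrt q"
  proof -
    have "(rank_scale n * (real n - 1))\<^sup>2 = (sqrt 12 * sqrt q)\<^sup>2"
    proof -
      have "(rank_scale n * (real n - 1))\<^sup>2 = 12 / (real n ^ 2 - 1) * (real n - 1)\<^sup>2" by (simp add: power_mult_distrib s2)
      also have "real n ^ 2 - 1 = (real n - 1) * (real n + 1)" by (simp add: power2_eq_square algebra_simps)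
      also have "12 / ((real n - 1) * (real n + 1)) * (real n - 1)\<^sup>2 = 12 * q"
      proof -
        have "12 / (a * c) * a\<^sup>2 = 12 * (a / c)" if "a \<noteq> 0" for a c :: real
          using that by (simp add: power2_eq_square)
        then show ?thesis using r by (simp add: q_def)
      qed
      also have "12 * q = (sqrt 12 * sqrt q)\<^sup>2" using q by (simp add: power_mult_distrib)
      finally show ?thesis .
    qed
    then show ?thesis by (rule power2_eq_imp_eq) (use q r d in \<open>auto simp: rank_scale_def\<close>)
  qed
  moreover have "q \<le> sqrt q" using q by (simp add: real_le_rsqrt power2_eq_square mult_left_le)
  moreover have "sqrt q \<le> 1" using q by simp
  moreover have "1 - q = 2 / (real n + 1)" using r by (simp add: q_def field_simps)
  ultimately have e: "rank_scale n * (real n - 1) = sqrt 12 * sqrt q" "1 - sqrt q \<le> 2 / (real n + 1)" "sqrt q \<le> 1" by linarith+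
  show "rank_scale n * (real n - 1) \<le> sqrt 12" unfolding e(1) using e(3) q by (simp add: mult_left_le)
  have "\<bar>rank_scale n * (real n - 1) - sqrt 12\<bar> = sqrt 12 * (1 - sqrt q)"
    unfolding e(1) using e(3) by (simp add: abs_if algebra_simps)
  also have "\<dots> \<le> sqrt 12 * (2 / (real n + 1))" using e(2) by (intro mult_left_mono) auto
  finally show "\<bar>rank_scale n * (real n - 1) - sqrt 12\<bar> \<le> sqrt 12 * (2 / (real n + 1))" .
qed

lemma rank_of_eq: "rank_of n x i j = 1 + (\<Sum>k\<in>{..<n} - {i}. if x k j \<le> x i j then 1 else 0)"
proof -
  have "{k. k < n \<and> k \<noteq> i \<and> x k j \<le> x i j} = {k \<in> {..<n} - {i}. x k j \<le> x i j}" by auto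
  then show ?thesis by (simp add: rank_of_def sum.If_cases Int_def)
qed

lemma rank_of_bounds:
  assumes "i < n"
  shows "1 \<le> rank_of n x i j" "rank_of n x i j \<le> real n"
proof -
  show "1 \<le> rank_of n x i j" by (simp add: rank_of_def)
  have "(\<Sum>k\<in>{..<n} - {i}. if x k j \<le> x i j then 1 else (0::real)) \<le> (\<Sum>k\<in>{..<n} - {i}. 1)" by (rule sum_mono) auto
  also have "\<dots> = real n - 1" using assms by (simp add: of_nat_diff)
  finally show "rank_of n x i j \<le> real n" by (simp add: rank_of_eq)
qed

lemma rank_mat_bound:
  assumes "i < n" "n \<ge> 2"
  shows "\<bar>rank_mat n x i j\<bar> \<le> sqrt 3"
proof -
  have "\<bar>rank_of n x i j - (real n + 1) / 2\<bar> \<le> (real n - 1) / 2"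
    using rank_of_bounds[OF assms(1), of x j] by (auto simp: abs_le_iff field_simps)
  then have "rank_scale n * \<bar>rank_of n x i j - (real n + 1) / 2\<bar> \<le> rank_scale n * ((real n - 1) / 2)"
    using rank_scale_bounds(1)[OF assms(2)] by (intro mult_left_mono) auto
  also have "\<dots> \<le> sqrt 12 / 2" using rank_scale_bounds(3)[OF assms(2)] by simp
  also have "sqrt 12 = 2 * sqrt (3::real)" using real_sqrt_mult[of 4 3] by simp
  finally show ?thesis using rank_scale_bounds(1)[OF assms(2)]
    by (simp add: rank_mat_def rank_scale_def[symmetric] abs_mult)
qed

text \<open>A rank is a sum of indicators, one for each other row; when row \<open>m\<close> is
  replaced, only one of them can change.\<close>

lemma rank_of_upd:
  assumes "i \<noteq> m" "m < n"
  shows "\<bar>rank_of n (x(m := y)) i j - rank_of n x i j\<bar> \<le> 1"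
proof -
  have m: "m \<in> {..<n} - {i}" using assms by simp
  have e: "rank_of n z i j = 1 + ((if z m j \<le> z i j then 1 else 0) + (\<Sum>k\<in>{..<n} - {i} - {m}. if z k j \<le> z i j then 1 else 0))" for z
    unfolding rank_of_eq by (subst sum.remove[OF _ m]) simp_all
  have "(\<Sum>k\<in>{..<n} - {i} - {m}. if (x(m := y)) k j \<le> (x(m := y)) i j then 1 else (0::real)) = (\<Sum>k\<in>{..<n} - {i} - {m}. if x k j \<le> x i j then 1 else 0)"
    using assms by (intro sum.cong refl) simp
  then show ?thesis unfolding e[of "x(m := y)"] e[of x] by simp
qed

lemma rank_mat_norm:
  assumes "i < n" "n \<ge> 2"
  shows "dot p (rank_mat n x i) (rank_mat n x i) \<le> 3 * real p"
proof -
  have "dot p (rank_mat n x i) (rank_mat n x i) \<le> (\<Sum>j<p. 3)" unfolding dot_def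
  proof (rule sum_mono)
    fix j show "rank_mat n x i j * rank_mat n x i j \<le> 3"
      using power_mono[OF rank_mat_bound[OF assms, of x j], of 2] by (simp add: power2_eq_square)
  qed
  then show ?thesis by simp
qed

definition rank_error :: "nat \<Rightarrow> nat \<Rightarrow> (nat \<Rightarrow> nat \<Rightarrow> real) \<Rightarrow> real" where
  "rank_error n p x = (\<Sum>i<n. \<Sum>j<p. (rank_mat n x i j - grades x i j)\<^sup>2) / (real n * real p)"

section \<open>Mean square distance between ranks and grades\<close>

context gaussian_sample begin

lemma row_prob: "k < n \<Longrightarrow> j < p \<Longrightarrow> (\<integral>y. (if y j \<le> c then 1 else 0) \<partial>N k) = 1 / 2 + cPhi c"
proof -
  assume k: "k < n" and j: "j < p"
  have "(\<integral>y. (if y j \<le> c then 1 else 0 :: real) \<partial>N k) = (\<integral>y. indicator {..c} (y j) \<partial>N k)"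
    by (rule Bochner_Integration.integral_cong[OF refl]) (simp split: split_indicator)
  also have "\<dots> = (\<integral>z. indicator {..c} z \<partial>NN)"
    by (rule gaussian_vector.integral_X[OF rows[OF k] j]) simp
  also have "\<dots> = measure NN {..c}" by simp
  also have "\<dots> = 1 / 2 + cPhi c" by (rule cPhi_cdf)
  finally show ?thesis .
qed

text \<open>Given row \<open>i\<close>, the variables \<open>eta i j k\<close> with \<open>k \<noteq> i\<close> are independent and centred, so their sum is of
  order \<open>sqrt n\<close> in mean square.\<close>
definition "eta i j k x = (if x k j \<le> x i j then 1 else 0) - (1 / 2 + cPhi (x i j))" for x :: "nat \<Rightarrow> nat \<Rightarrow> real"

lemma eta_bound: "\<bar>eta i j k x\<bar> \<le> 1"
  using cPhi_bound[of "x i j"] by (auto simp: eta_def abs_le_iff)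

lemma bm_eta: "i < n \<Longrightarrow> k < n \<Longrightarrow> j < p \<Longrightarrow> bm P (eta i j k)"
proof (rule bmI[OF _ eta_bound])
  assume "i < n" "k < n" "j < p"
  then have [measurable]: "(\<lambda>x. x k j) \<in> borel_measurable P" "(\<lambda>x. x i j) \<in> borel_measurable P"
    by (simp_all only: coord_measurable)
  have [measurable]: "(\<lambda>x. cPhi (x i j)) \<in> borel_measurable P"
    by (rule measurable_compose[OF _ cPhi_measurable]) simp
  show "eta i j k \<in> borel_measurable P" unfolding eta_def[abs_def] by measurable
qed

text \<open>Row \<open>k\<close> occurs only in the comparison \<open>x k j \<le> x i j\<close> of
  the first factor; averaging over it turns the indicator into its conditional probability, which
  \<open>eta\<close> subtracts.\<close>

lemma E_eta:
  assumes "i < n" "k < n" "k' < n" "j < p" "k \<noteq> i" "k \<noteq> k'"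
  shows "(\<integral>x. eta i j k x * eta i j k' x \<partial>P) = 0"
proof -
  have "(\<integral>y. eta i j k (x(k := y)) * eta i j k' (x(k := y)) \<partial>N k) = 0" for x
  proof -
    interpret Nk: prob_space "N k" by (rule prob_N)
    have i: "integrable (N k) (\<lambda>y. (if y j \<le> x i j then 1 else 0 :: real))"
    proof (rule Nk.integrable_const_bound[where B = 1])
      have "(\<lambda>z. if z \<le> x i j then 1 else 0 :: real) \<in> borel_measurable borel" by measurable
      from measurable_compose[OF coord_measurable_row[OF assms(4)] this]
      show "(\<lambda>y. (if y j \<le> x i j then 1 else 0 :: real)) \<in> borel_measurable (N k)" .
    qed simp
    have "(\<integral>y. eta i j k (x(k := y)) * eta i j k' (x(k := y)) \<partial>N k)
       = (\<integral>y. ((if y j \<le> x i j then 1 else 0) - (1 / 2 + cPhi (x i j))) * eta i j k' x \<partial>N k)"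
      using assms by (intro Bochner_Integration.integral_cong refl) (simp add: eta_def)
    also have "\<dots> = (\<integral>y. (if y j \<le> x i j then 1 else 0) - (1 / 2 + cPhi (x i j)) \<partial>N k) * eta i j k' x"
      by (rule integral_mult_left_zero)
    also have "(\<integral>y. (if y j \<le> x i j then 1 else 0) - (1 / 2 + cPhi (x i j)) \<partial>N k) = 0"
      using i row_prob[OF assms(2,4), of "x i j"] by (simp add: Nk.prob_space)
    finally show ?thesis unfolding mult_zero_left .
  qed
  moreover have "bm P (\<lambda>x. eta i j k x * eta i j k' x)" using assms by (intro bm_mult bm_eta)
  ultimately show ?thesis unfolding resample[OF assms(2) \<open>bm P _\<close>] by (simp del: fun_upd_apply)
qed

lemma eta_sum_square:
  assumes i: "i < n" and j: "j < p"
  shows "(\<integral>x. (\<Sum>k\<in>{..<n} - {i}. eta i j k x)\<^sup>2 \<partial>P) \<le> real n - 1"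
proof -
  let ?K = "{..<n} - {i}"
  have int: "integrable P (\<lambda>x. eta i j k x * eta i j k' x)" if "k \<in> ?K" "k' \<in> ?K" for k k'
    using that i j by (intro PS.bm_integrable bm_mult bm_eta) auto
  have int2: "integrable P (\<lambda>x. \<Sum>k'\<in>?K. eta i j k x * eta i j k' x)" if "k \<in> ?K" for k
    using that by (intro Bochner_Integration.integrable_sum int)
  have "(\<integral>x. (\<Sum>k\<in>?K. eta i j k x)\<^sup>2 \<partial>P) = (\<integral>x. (\<Sum>k\<in>?K. \<Sum>k'\<in>?K. eta i j k x * eta i j k' x) \<partial>P)"
    by (simp add: power2_eq_square sum_product)
  also have "\<dots> = (\<Sum>k\<in>?K. \<Sum>k'\<in>?K. (\<integral>x. eta i j k x * eta i j k' x \<partial>P))"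
    using int int2 by simp
  also have "\<dots> \<le> (\<Sum>k\<in>?K. 1)"
  proof (rule sum_mono)
    fix k assume k: "k \<in> ?K"
    have "(\<Sum>k'\<in>?K. (\<integral>x. eta i j k x * eta i j k' x \<partial>P)) = (\<Sum>k'\<in>?K. if k' = k then (\<integral>x. eta i j k x * eta i j k x \<partial>P) else 0)"
      using k i j E_eta[of i k _ j] by (intro sum.cong refl) auto
    also have "\<dots> = (\<integral>x. eta i j k x * eta i j k x \<partial>P)" using k by simp
    also have "\<dots> \<le> (\<integral>x. 1 \<partial>P)"
    proof (rule integral_mono')
      show "eta i j k x * eta i j k x \<le> 1" for x
        using power_mono[OF eta_bound[of i j k x], of 2] by (simp add: power2_eq_square)
    qed auto
    finally show "(\<Sum>k'\<in>?K. (\<integral>x. eta i j k x * eta i j k' x \<partial>P)) \<le> 1" by (simp add: PS.prob_space)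
  qed
  also have "\<dots> = real n - 1" using i by (simp add: of_nat_diff)
  finally show ?thesis .
qed

text \<open>The first term is the fluctuation of the empirical distribution function around \<Phi>.
  The second is the bias from the rank scaling, which matches \<open>sqrt 12\<close> only
  asymptotically.\<close>

lemma rank_mat_decomp:
  assumes i: "i < n"
  shows "rank_mat n x i j - grades x i j
    = rank_scale n * (\<Sum>k\<in>{..<n} - {i}. eta i j k x) + cPhi (x i j) * (rank_scale n * (real n - 1) - sqrt 12)"
proof -
  have "(\<Sum>k\<in>{..<n} - {i}. eta i j k x) = rank_of n x i j - 1 - (real n - 1) * (1 / 2 + cPhi (x i j))"
    using i by (simp add: eta_def sum_subtractf rank_of_eq of_nat_diff)
  then have "rank_of n x i j - (real n + 1) / 2 = (\<Sum>k\<in>{..<n} - {i}. eta i j k x) + (real n - 1) * cPhi (x i j)"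
    by (simp add: field_simps)
  then show ?thesis unfolding rank_mat_def rank_scale_def[symmetric]
    by (simp only: grades_def grade_def) (simp add: algebra_simps)
qed

lemma bm_rank: "i < n \<Longrightarrow> j < p \<Longrightarrow> bm P (\<lambda>x. rank_mat n x i j - grades x i j)"
  unfolding rank_mat_decomp
proof (intro bm_intros bm_eta)
  assume "i < n" "j < p"
  then have "(\<lambda>x. cPhi (x i j)) \<in> borel_measurable P" by (intro measurable_compose[OF coord_measurable cPhi_measurable])
  then show "bm P (\<lambda>x. cPhi (x i j))" by (rule bmI[OF _ cPhi_bound])
qed auto

lemma bm_rank_error: "bm P (rank_error n p)"
  unfolding rank_error_def[abs_def] by (intro bm_intros bm_rank) auto

text \<open>By \<open>(A + B)\<^sup>2 \<le> 2 A\<^sup>2 + 2 B\<^sup>2\<close>, fluctuation and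
  scaling bias contribute at most \<open>24 / n\<close> each.\<close>

lemma rank_error_mean:
  assumes n2: "n \<ge> 2"
  shows "(\<integral>x. rank_error n p x \<partial>P) \<le> 48 / real n"
proof -
  have one: "(\<integral>x. (rank_mat n x i j - grades x i j)\<^sup>2 \<partial>P) \<le> 48 / real n" if i: "i < n" and j: "j < p" for i j
  proof -
    let ?s = "\<lambda>x. \<Sum>k\<in>{..<n} - {i}. eta i j k x"
    have bs: "bm P (\<lambda>x. (?s x)\<^sup>2)" using i j by (intro bm_intros bm_eta) auto
    have pt: "(rank_mat n x i j - grades x i j)\<^sup>2 \<le> 24 / (real n ^ 2 - 1) * (?s x)\<^sup>2 + 24 / (real n + 1)\<^sup>2" for x
    proof -
      define A where "A = rank_scale n * ?s x"
      define B where "B = cPhi (x i j) * (rank_scale n * (real n - 1) - sqrt 12)"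
      have "\<bar>B\<bar> \<le> 1 / 2 * (sqrt 12 * (2 / (real n + 1)))"
        unfolding B_def abs_mult by (intro mult_mono cPhi_bound rank_scale_bounds n2) auto
      then have "\<bar>B\<bar>\<^sup>2 \<le> (sqrt 12 / (real n + 1))\<^sup>2" by (intro power_mono) auto
      then have B2: "B\<^sup>2 \<le> 12 / (real n + 1)\<^sup>2" by (simp add: power_divide)
      have A2: "A\<^sup>2 = 12 / (real n ^ 2 - 1) * (?s x)\<^sup>2"
        unfolding A_def power_mult_distrib rank_scale_bounds(4)[OF n2] ..
      have "(A + B)\<^sup>2 \<le> 2 * A\<^sup>2 + 2 * B\<^sup>2"
        using zero_le_power2[of "A - B"] by (simp add: power2_eq_square algebra_simps)
      then show ?thesis unfolding rank_mat_decomp[OF i] A_def[symmetric] B_def[symmetric]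
        using A2 B2 by simp
    qed
    have d: "real n ^ 2 - 1 = (real n - 1) * (real n + 1)" by (simp add: power2_eq_square algebra_simps)
    have r: "real n \<ge> 2" using n2 by simp
    have "(\<integral>x. (rank_mat n x i j - grades x i j)\<^sup>2 \<partial>P) \<le> (\<integral>x. 24 / (real n ^ 2 - 1) * (?s x)\<^sup>2 + 24 / (real n + 1)\<^sup>2 \<partial>P)"
      by (rule integral_mono[OF _ _ pt]) (use i j bs in \<open>auto intro!: PS.bm_integrable bm_power2 bm_rank bm_add bm_mult[OF bm_const bs] bm_const
           simp del: divide_const_simps times_divide_eq_left\<close>)
    also have "\<dots> = 24 / (real n ^ 2 - 1) * (\<integral>x. (?s x)\<^sup>2 \<partial>P) + 24 / (real n + 1)\<^sup>2"
      using PS.bm_integrable[OF bs] by (simp add: PS.prob_space)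
    also have "\<dots> \<le> 24 / (real n ^ 2 - 1) * (real n - 1) + 24 / (real n + 1)\<^sup>2"
      using eta_sum_square[OF i j] r by (intro add_right_mono mult_left_mono) (auto simp: d)
    also have "\<dots> \<le> 24 / real n + 24 / real n"
    proof (rule add_mono)
      have c: "24 / (a * c) * a = 24 / c" if "a \<noteq> 0" for a c :: real using that by simp
      have "real n - 1 \<noteq> 0" using r by simp
      from c[OF this, of "real n + 1"] have "24 / (real n ^ 2 - 1) * (real n - 1) = 24 / (real n + 1)" unfolding d .
      also have "24 / (real n + 1) \<le> 24 / real n" by (rule divide_left_mono) (use r in simp_all)
      finally show "24 / (real n ^ 2 - 1) * (real n - 1) \<le> 24 / real n" .
      have "real n \<le> (real n + 1)\<^sup>2" by (simp add: power2_eq_square algebra_simps)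
      then show "24 / (real n + 1)\<^sup>2 \<le> 24 / real n"
        by (rule divide_left_mono) (use r in simp_all)
    qed
    finally show ?thesis by simp
  qed
  have "(\<integral>x. rank_error n p x \<partial>P) = (\<Sum>i<n. \<Sum>j<p. (\<integral>x. (rank_mat n x i j - grades x i j)\<^sup>2 \<partial>P)) / (real n * real p)"
  proof -
    have i1: "integrable P (\<lambda>x. (rank_mat n x i j - grades x i j)\<^sup>2)" if "i < n" "j < p" for i j
      using that by (intro PS.bm_integrable bm_power2 bm_rank)
    have i2: "integrable P (\<lambda>x. \<Sum>j<p. (rank_mat n x i j - grades x i j)\<^sup>2)" if "i < n" for i
      using that by (intro Bochner_Integration.integrable_sum i1) auto
    show ?thesis unfolding rank_error_def integral_divide_zero
      using i1 i2 by simp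
  qed
  also have "\<dots> \<le> (\<Sum>i<n. \<Sum>j<p. 48 / real n) / (real n * real p)"
    by (intro divide_right_mono sum_mono one) auto
  also have "\<dots> = 48 / real n" using n p by simp
  finally show ?thesis .
qed

text \<open>Every entry outside row \<open>m\<close> changes its squared error by at most
  \<open>32 / n\<close>, since its rank moves by at most 1. The entries of row \<open>m\<close> may
  change by 12, but that row has weight \<open>1 / n\<close>. Together this is
  \<open>44 / n\<close>.\<close>

lemma rank_error_bounded_difference:
  assumes n2: "n \<ge> 2" and m: "m < n"
  shows "\<bar>rank_error n p (x(m := y)) - rank_error n p x\<bar> \<le> 44 / real n"
proof -
  let ?x = "x(m := y)"
  let ?d = "\<lambda>x i j. rank_mat n x i j - grades x i j"
  have s3: "sqrt 3 * sqrt 3 = (3::real)" by simp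
  have s32: "sqrt 3 \<le> (2::real)" by (simp add: real_le_lsqrt)
  have db: "\<bar>?d x i j\<bar> \<le> 2 * sqrt 3" if "i < n" for i j and x :: "nat \<Rightarrow> nat \<Rightarrow> real"
    using rank_mat_bound[OF that n2, of x j] grade_bound[of "x i" j] unfolding grades_def by linarith
  have d1: "\<bar>(?d ?x i j)\<^sup>2 - (?d x i j)\<^sup>2\<bar> \<le> 32 / real n" if i: "i < n" "i \<noteq> m" for i j
  proof -
    have "?d ?x i j - ?d x i j = rank_scale n * (rank_of n ?x i j - rank_of n x i j)"
      using i by (simp add: rank_mat_def rank_scale_def[symmetric] grades_def algebra_simps)
    then have "\<bar>?d ?x i j - ?d x i j\<bar> \<le> rank_scale n * 1"
      using rank_of_upd[OF i(2) m, of x y j] rank_scale_bounds(1)[OF n2] by (simp add: abs_mult)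
    then have 1: "\<bar>?d ?x i j - ?d x i j\<bar> \<le> 4 / real n" using rank_scale_bounds(2)[OF n2] by linarith
    have 2: "\<bar>?d ?x i j + ?d x i j\<bar> \<le> 8" using db[OF i(1), of ?x j] db[OF i(1), of x j] s32 by linarith
    have "(?d ?x i j)\<^sup>2 - (?d x i j)\<^sup>2 = (?d ?x i j - ?d x i j) * (?d ?x i j + ?d x i j)"
      by (simp add: power2_eq_square algebra_simps)
    then have "\<bar>(?d ?x i j)\<^sup>2 - (?d x i j)\<^sup>2\<bar> = \<bar>?d ?x i j - ?d x i j\<bar> * \<bar>?d ?x i j + ?d x i j\<bar>"
      by (simp only: abs_mult)
    also have "\<dots> \<le> 4 / real n * 8" by (rule mult_mono[OF 1 2]) auto
    finally show ?thesis by simp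
  qed
  have d2: "\<bar>(?d ?x m j)\<^sup>2 - (?d x m j)\<^sup>2\<bar> \<le> 12" for j
  proof -
    have b: "(?d x m j)\<^sup>2 \<le> 12" for x :: "nat \<Rightarrow> nat \<Rightarrow> real"
      using power_mono[OF db[OF m, of x j], of 2] by (simp add: power_mult_distrib)
    show ?thesis using b[of x] b[of ?x] zero_le_power2[of "?d x m j"] zero_le_power2[of "?d ?x m j"] unfolding abs_le_iff by linarith
  qed
  have "rank_error n p ?x - rank_error n p x = (\<Sum>i<n. \<Sum>j<p. (?d ?x i j)\<^sup>2 - (?d x i j)\<^sup>2) / (real n * real p)"
    by (simp add: rank_error_def sum_subtractf diff_divide_distrib)
  then have "\<bar>rank_error n p ?x - rank_error n p x\<bar> = \<bar>(\<Sum>i<n. \<Sum>j<p. (?d ?x i j)\<^sup>2 - (?d x i j)\<^sup>2) / (real n * real p)\<bar>"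
    by (rule arg_cong)
  also have "\<dots> \<le> (\<Sum>i<n. \<Sum>j<p. (if i = m then 12 else 32 / real n)) / (real n * real p)"
  proof -
    have "\<bar>\<Sum>i<n. \<Sum>j<p. (?d ?x i j)\<^sup>2 - (?d x i j)\<^sup>2\<bar> \<le> (\<Sum>i<n. \<Sum>j<p. (if i = m then 12 else 32 / real n))"
    proof (rule order_trans[OF sum_abs sum_mono])
      fix i assume i: "i \<in> {..<n}"
      show "\<bar>\<Sum>j<p. (?d ?x i j)\<^sup>2 - (?d x i j)\<^sup>2\<bar> \<le> (\<Sum>j<p. (if i = m then 12 else 32 / real n))"
        by (rule order_trans[OF sum_abs sum_mono]) (use i d1 d2 in auto)
    qed
    then show ?thesis using n p by (simp add: abs_divide divide_right_mono)
  qed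
  also have "\<dots> = (\<Sum>i<n. (if i = m then 12 else 32 / real n)) / real n"
  proof -
    have "(\<Sum>j<p. (if i = m then 12 else 32 / real n)) = real p * (if i = m then 12 else 32 / real n)" for i
      by (simp only: sum_constant card_lessThan)
    then show ?thesis using p by (simp only: sum_distrib_left[symmetric]) simp
  qed
  also have "\<dots> \<le> (\<Sum>i<n. (if i = m then 12 else 0) + 32 / real n) / real n"
    by (intro divide_right_mono sum_mono) auto
  also have "\<dots> = 44 / real n" using m n by (simp add: sum.distrib)
  finally show ?thesis .
qed

text \<open>The summand \<open>48 / n\<close> covers the mean, and
  \<open>968 = 44\<^sup>2 / 2\<close> comes from the bounded differences.\<close>

lemma rank_error_tail:
  assumes n2: "n \<ge> 2" and e: "\<epsilon> > 0"
  shows "PS.prob {x \<in> space P. \<epsilon> + 48 / real n \<le> rank_error n p x} \<le> exp (- \<epsilon>\<^sup>2 * real n / 968)"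
proof -
  obtain B where B: "\<And>x. \<bar>rank_error n p x\<bar> \<le> B" using bm_rank_error by (auto simp: bm_def)
  note [measurable] = bm_measurable[OF bm_rank_error]
  have "PS.prob {x \<in> space P. \<epsilon> + 48 / real n \<le> rank_error n p x}
     \<le> PS.prob {x \<in> space P. \<epsilon> \<le> rank_error n p x - (\<integral>x. rank_error n p x \<partial>P)}"
    using rank_error_mean[OF n2] by (intro PS.finite_measure_mono) auto
  also have "\<dots> \<le> exp (- 2 * \<epsilon>\<^sup>2 / (real (card {..<n}) * (44 / real n)\<^sup>2))"
    by (rule mcdiarmid_tail[where B = B])
      (use n B prob_N e rank_error_bounded_difference[OF n2] in auto)
  also have "- 2 * \<epsilon>\<^sup>2 / (real (card {..<n}) * (44 / real n)\<^sup>2) = - \<epsilon>\<^sup>2 * real n / 968"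
    using n by (simp add: power_divide power2_eq_square field_simps)
  finally show ?thesis .
qed

end

section \<open>Empirical spectral distributions\<close>

text \<open>The uniform law sits on the positions of the list, so a repeated eigenvalue is counted
  with its multiplicity.\<close>

definition emp :: "real list \<Rightarrow> real measure" where
  "emp es = distr (measure_pmf (pmf_of_set {..<length es})) borel (\<lambda>i. es ! i)"

lemma real_distribution_emp: "real_distribution (emp es)"
  unfolding emp_def by (rule prob_space.real_distribution_distr[OF prob_space_measure_pmf]) simp

lemma integral_emp:
  fixes f :: "real \<Rightarrow> real"
  assumes "es \<noteq> []" "f \<in> borel_measurable borel"
  shows "(\<integral>t. f t \<partial>emp es) = (\<Sum>e\<leftarrow>es. f e) / real (length es)"
proof -
  have ne: "{..<length es} \<noteq> {}" using assms(1) by auto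
  have "(\<integral>t. f t \<partial>emp es) = (\<integral>i. f (es ! i) \<partial>measure_pmf (pmf_of_set {..<length es}))"
    unfolding emp_def by (rule integral_distr) (use assms(2) in auto)
  also have "\<dots> = (\<Sum>i<length es. f (es ! i)) / real (length es)"
    using ne by (subst integral_pmf_of_set) auto
  also have "(\<Sum>i<length es. f (es ! i)) = (\<Sum>e\<leftarrow>es. f e)"
    by (simp add: sum_list_sum_nth atLeast0LessThan)
  finally show ?thesis .
qed

lemma AE_emp:
  assumes "es \<noteq> []" "\<And>e. e \<in> set es \<Longrightarrow> Pr e" "{x. Pr x} \<in> sets borel"
  shows "AE t in emp es. Pr t"
proof -
  have ne: "{..<length es} \<noteq> {}" using assms(1) by auto
  have "AE i in measure_pmf (pmf_of_set {..<length es}). Pr (es ! i)"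
    unfolding AE_measure_pmf_iff using ne assms(2) by (auto simp: set_pmf_of_set)
  then show ?thesis unfolding emp_def
    by (subst AE_distr_iff) (use assms(3) in auto)
qed

section \<open>Root multiplicities and the spectral distribution function\<close>

lemma order_linear_factors: "order t (\<Prod>e\<leftarrow>es. [:- e, 1:]) = count_list es (t :: real)"
proof (induction es)
  case Nil then show ?case by (simp add: order_0I)
next
  case (Cons e es)
  have nz: "[:- e, 1:] * (\<Prod>e\<leftarrow>es. [:- e, 1:]) \<noteq> 0"
    by (auto simp: prod_list_zero_iff simp del: mult_pCons_left)
  have "order t [:- e, 1:] = (if e = t then 1 else 0)"
    using order_power_n_n[of t 1] by (auto intro: order_0I)
  then show ?case using Cons.IH order_mult[OF nz, of t] by (simp del: mult_pCons_left)
qed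

lemma sum_count_list:
  assumes "finite F"
  shows "(\<Sum>t\<in>F. real (count_list es t)) = (\<Sum>e\<leftarrow>es. if e \<in> F then 1 else 0)"
proof (induction es)
  case (Cons e es)
  have "(\<Sum>t\<in>F. real (count_list (e # es) t)) = (\<Sum>t\<in>F. real (count_list es t) + (if t = e then 1 else 0))"
    by (intro sum.cong refl) auto
  also have "\<dots> = (\<Sum>t\<in>F. real (count_list es t)) + (if e \<in> F then 1 else 0)"
    using assms by (simp add: sum.distrib)
  finally show ?case using Cons.IH by simp
qed simp

lemma esd_eq_cdf:
  assumes cp: "cpoly p A = (\<Prod>e\<leftarrow>es. [:- e, 1:])" and len: "length es = p" and p: "p > 0"
  shows "esd p A x = cdf (emp es) x"
proof -
  interpret E: real_distribution "emp es" by (rule real_distribution_emp)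
  have ne: "es \<noteq> []" using len p by auto
  have roots: "{t. poly (cpoly p A) t = 0 \<and> t \<le> x} = {t \<in> set es. t \<le> x}"
    unfolding cp by (auto simp: poly_prod_list prod_list_zero_iff)
  have "esd p A x = (\<Sum>t\<in>{t \<in> set es. t \<le> x}. real (count_list es t)) / real p"
    unfolding esd_def roots unfolding cp order_linear_factors ..
  also have "(\<Sum>t\<in>{t \<in> set es. t \<le> x}. real (count_list es t)) = (\<Sum>e\<leftarrow>es. indicator {..x} e)"
    by (subst sum_count_list) (auto intro!: arg_cong[of _ _ sum_list] map_cong simp: indicator_def)
  also have "\<dots> / real p = (\<integral>t. indicator {..x} t \<partial>emp es)"
    using integral_emp[OF ne, of "indicator {..x}"] len by simp
  also have "\<dots> = cdf (emp es) x" by (simp add: cdf_def)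
  finally show ?thesis .
qed

lemma res_cong:
  assumes "\<And>i j. i < p \<Longrightarrow> j < p \<Longrightarrow> A i j = B i j"
  shows "res p A l = res p B l"
proof -
  have "shift_mat p A l = shift_mat p B l"
    unfolding shift_mat_def by (rule cong_mat) (use assms in auto)
  then show ?thesis by (intro ext) (simp add: res_def)
qed

text \<open>\<open>(b A + l I)\<close> is \<open>b\<close> times \<open>A + (l / b) I\<close>, so
  the resolvent of the scaled matrix is that of \<open>A\<close> at \<open>l / b\<close>, divided by
  \<open>b\<close>.\<close>

lemma tr_res_scaled_eigenvalues:
  assumes A: "psd p A" and l: "l > 0" and b: "b > 0" and p: "p > 0"
    and cp: "cpoly p A = (\<Prod>e\<leftarrow>es. [:- e, 1:])" and pos: "\<forall>e\<in>set es. 0 \<le> e"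
  shows "tr p (res p (\<lambda>i j. b * A i j) l) = (\<Sum>e\<leftarrow>es. 1 / (b * e + l))"
proof -
  have lb: "l / b > 0" using l b by simp
  have "mv p (\<lambda>i j. b * A i j) x = (\<lambda>i. b * mv p A x i)" for x
    by (simp add: mv_def sum_distrib_left mult.assoc fun_eq_iff)
  then have bA: "psd p (\<lambda>i j. b * A i j)"
    using A b by (auto simp: psd_def dot_scale_right)
  have "(\<lambda>i j. res p A (l / b) i j / b) i j = res p (\<lambda>i j. b * A i j) l i j" if ij: "i < p" "j < p" for i j
  proof (rule res_unique[OF bA l _ ij])
    fix i j assume ij: "i < p" "j < p"
    have "(\<Sum>k<p. (b * A i k + (if i = k then l else 0)) * (res p A (l / b) k j / b))
       = (\<Sum>k<p. (A i k + (if i = k then l / b else 0)) * res p A (l / b) k j)"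
      using b by (intro sum.cong refl) (auto simp: field_simps)
    also have "\<dots> = (if i = j then 1 else 0)" by (rule res_right[OF A lb ij])
    finally show "(\<Sum>k<p. (b * A i k + (if i = k then l else 0)) * (res p A (l / b) k j / b)) = (if i = j then 1 else 0)" .
  qed
  then have "tr p (res p (\<lambda>i j. b * A i j) l) = (\<Sum>i<p. res p A (l / b) i i / b)"
    unfolding tr_def by (intro sum.cong refl) auto
  also have "\<dots> = tr p (res p A (l / b)) / b" by (simp add: tr_def sum_divide_distrib)
  also have "\<dots> = (\<Sum>e\<leftarrow>es. 1 / (e + l / b)) / b" by (simp only: tr_res_eigenvalues[OF A lb p cp pos])
  also have "\<dots> = (\<Sum>e\<leftarrow>es. 1 / (b * e + l))"
  proof -
    have "(\<Sum>e\<leftarrow>es. 1 / (b * e + l)) = (\<Sum>e\<leftarrow>es. inverse b * (1 / (e + l / b)))"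
    proof (intro arg_cong[of _ _ sum_list] map_cong refl)
      fix e
      have "b * e + l = b * (e + l / b)" using b by (simp add: distrib_left)
      then show "1 / (b * e + l) = inverse b * (1 / (e + l / b))" by (simp add: divide_inverse)
    qed
    then show ?thesis by (simp only: sum_list_const_mult) (simp add: divide_inverse)
  qed
  finally show ?thesis .
qed

lemma integral_emp_resolvent:
  assumes A: "psd p A" and l: "l > 0" and b: "b > 0" and p: "p > 0"
    and cp: "cpoly p A = (\<Prod>e\<leftarrow>es. [:- e, 1:])" and pos: "\<forall>e\<in>set es. 0 \<le> e" and len: "length es = p"
  shows "(\<integral>t. 1 / (b * t + l) \<partial>emp es) = tr p (res p (\<lambda>i j. b * A i j) l) / real p"
  using integral_emp[of es "\<lambda>t. 1 / (b * t + l)"] tr_res_scaled_eigenvalues[OF A l b p cp pos] len p by auto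

lemma cov_trace_bound:
  assumes l: "l > 0" and n: "n > 0" and p: "p > 0"
    and w: "\<And>m. m < n \<Longrightarrow> dot p (w m) (w m) \<le> 3 * real p"
  shows "real p - l * tr p (res p (cov n w) l) \<le> 3 * real p / l"
proof -
  note psd = cov_psd[of p n w]
  let ?Q = "res p (cov n w) l"
  have "real p = (\<Sum>i<p. \<Sum>k<p. ?Q i k * (cov n w k i + (if k = i then l else 0)))"
    using res_left[OF psd l] by simp
  also have "\<dots> = (\<Sum>i<p. \<Sum>k<p. ?Q i k * cov n w k i) + (\<Sum>i<p. \<Sum>k<p. ?Q i k * (if k = i then l else 0))"
    by (simp add: distrib_left sum.distrib)
  also have "(\<Sum>i<p. \<Sum>k<p. ?Q i k * (if k = i then l else 0)) = l * tr p ?Q"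
    unfolding tr_def sum_distrib_left by (intro sum.cong refl, subst sum_delta_mult(2)) simp_all
  also have "(\<Sum>i<p. \<Sum>k<p. ?Q i k * cov n w k i) = (\<Sum>m<n. dot p (w m) (mv p ?Q (w m)) / real n)"
  proof -
    have "(\<Sum>i<p. \<Sum>k<p. ?Q i k * cov n w k i) = (\<Sum>i<p. \<Sum>k<p. \<Sum>m<n. w m i * (?Q i k * w m k) / real n)"
    proof (intro sum.cong refl)
      fix i k
      have "?Q i k * cov n w k i = (\<Sum>m<n. ?Q i k * (w m k * w m i) / real n)"
        by (simp add: cov_def sum_distrib_left sum_divide_distrib)
      then show "?Q i k * cov n w k i = (\<Sum>m<n. w m i * (?Q i k * w m k) / real n)"
        by (simp only: mult_ac)
    qed
    also have "\<dots> = (\<Sum>i<p. \<Sum>m<n. \<Sum>k<p. w m i * (?Q i k * w m k) / real n)"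
      by (rule sum.cong[OF refl], rule sum.swap)
    also have "\<dots> = (\<Sum>m<n. \<Sum>i<p. \<Sum>k<p. w m i * (?Q i k * w m k) / real n)" by (rule sum.swap)
    finally show ?thesis by (simp add: dot_def mv_def sum_distrib_left sum_divide_distrib)
  qed
  finally have "real p - l * tr p ?Q = (\<Sum>m<n. dot p (w m) (mv p ?Q (w m)) / real n)" by simp
  also have "\<dots> \<le> (\<Sum>m<n. 3 * real p / l / real n)"
  proof (intro sum_mono divide_right_mono)
    fix m assume "m \<in> {..<n}"
    then have "dot p (w m) (w m) / l \<le> 3 * real p / l" using w l by (intro divide_right_mono) auto
    then show "dot p (w m) (mv p ?Q (w m)) \<le> 3 * real p / l"
      using res_upper[OF psd l, of "w m"] by linarith
  qed simp
  also have "\<dots> = 3 * real p / l" using n by simp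
  finally show ?thesis .
qed

text \<open>For nonnegative \<open>e\<close> the indicator of \<open>e \<le> L\<close> is at least
  \<open>2 L / (e + L) - 1\<close>, so the trace at \<open>L\<close> bounds the mass from below;
  \<open>6 / L\<close> is twice the bound of \<open>cov_trace_bound\<close>. The left endpoint
  \<open>- 1\<close> keeps an atom at 0 inside the half-open interval.\<close>

lemma emp_cov_tail:
  assumes L: "L > 0" and n: "n > 0" and p: "p > 0"
    and w: "\<And>m. m < n \<Longrightarrow> dot p (w m) (w m) \<le> 3 * real p"
    and cp: "cpoly p (cov n w) = (\<Prod>e\<leftarrow>es. [:- e, 1:])" and pos: "\<forall>e\<in>set es. 0 \<le> e" and len: "length es = p"
  shows "measure (emp es) {-1<..L} \<ge> 1 - 6 / L"
proof -
  interpret E: real_distribution "emp es" by (rule real_distribution_emp)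
  have ne: "es \<noteq> []" using len p by auto
  have "measure (emp es) {-1<..L} = (\<integral>t. indicator {-1<..L} t \<partial>emp es)" by simp
  also have "\<dots> = (\<Sum>e\<leftarrow>es. indicator {-1<..L} e) / real p"
    using integral_emp[OF ne, of "indicator {-1<..L}"] len by simp
  also have "\<dots> \<ge> (\<Sum>e\<leftarrow>es. 2 * L * (1 / (e + L)) - 1) / real p"
  proof (intro divide_right_mono sum_list_mono)
    fix e assume "e \<in> set es"
    then have e: "0 \<le> e" using pos by simp
    show "2 * L * (1 / (e + L)) - 1 \<le> indicator {-1<..L} e"
    proof (cases "e \<le> L")
      case True
      then show ?thesis using e L by (simp add: field_simps)
    next
      case False
      then show ?thesis using e L by (simp add: field_simps)
    qed
  qed simp
  also have "(\<Sum>e\<leftarrow>es. 2 * L * (1 / (e + L)) - 1) = 2 * L * tr p (res p (cov n w) L) - real p"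
    unfolding tr_res_eigenvalues[OF cov_psd L p cp pos]
    by (simp only: sum_list_subtractf sum_list_const_mult) (simp add: sum_list_triv len)
  finally have 1: "(2 * L * tr p (res p (cov n w) L) - real p) / real p \<le> measure (emp es) {-1<..L}" .
  have "real p - L * tr p (res p (cov n w) L) \<le> 3 * real p / L"
    by (rule cov_trace_bound[OF L n p w])
  then have "real p - 6 * real p / L \<le> 2 * L * tr p (res p (cov n w) L) - real p" by simp
  then have "(real p - 6 * real p / L) / real p \<le> (2 * L * tr p (res p (cov n w) L) - real p) / real p"
    by (rule divide_right_mono) simp
  moreover have "(real p - 6 * real p / L) / real p = 1 - 6 / L" using p by (simp add: diff_divide_distrib)
  ultimately show ?thesis using 1 by linarith
qed

text \<open>Extends \<open>1 / (\<beta> t + l)\<close> from the support to a bounded continuous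
  function on the line, as testing weak convergence demands.\<close>

definition clamp :: "real \<Rightarrow> real \<Rightarrow> real" where "clamp c t = max 0 (min t c)"

lemma clamp_id: "0 \<le> t \<Longrightarrow> t \<le> c \<Longrightarrow> clamp c t = t" by (simp add: clamp_def)

lemma clamp_bounds: "0 \<le> c \<Longrightarrow> 0 \<le> clamp c t" "0 \<le> c \<Longrightarrow> clamp c t \<le> c" by (auto simp: clamp_def)

lemma clamp_measurable[measurable]: "clamp c \<in> borel_measurable borel"
  unfolding clamp_def[abs_def] by measurable

lemma isCont_clamp: "isCont (clamp c) t" unfolding clamp_def[abs_def] by (intro continuous_intros)

text \<open>The truncated distance to \<open>S\<close> is a bounded continuous function that
  vanishes exactly on the closed set \<open>S\<close>; its integrals are 0 along the sequence, hence
  in the limit.\<close>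

lemma weak_limit_support:
  assumes F: "\<And>n. real_distribution (F n)" and H: "real_distribution H" and w: "weak_conv_m F H"
    and S: "closed S" and AE: "\<And>n. AE t in F n. t \<in> S" and ne: "S \<noteq> {}"
  shows "AE t in H. t \<in> S"
proof -
  interpret H: real_distribution H by (rule H)
  define d where "d t = min 1 (infdist t S)" for t
  have c: "isCont d t" for t unfolding d_def[abs_def] by (intro continuous_intros)
  have b: "norm (d t) \<le> 1" for t by (auto simp: d_def infdist_nonneg min_def)
  have [measurable]: "d \<in> borel_measurable borel"
    by (intro borel_measurable_continuous_onI continuous_at_imp_continuous_on ballI c)
  have "(\<lambda>n. integral\<^sup>L (F n) d) \<longlonglongrightarrow> integral\<^sup>L H d"
    by (rule weak_conv_imp_integral_bdd_continuous_conv[OF F H w c b])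
  moreover have "integral\<^sup>L (F n) d = 0" for n
  proof -
    have "integral\<^sup>L (F n) d = integral\<^sup>L (F n) (\<lambda>_. 0)"
    proof (rule integral_cong_AE)
      show "d \<in> borel_measurable (F n)"
        using F[of n] by (simp add: real_distribution_def real_distribution_axioms_def cong: measurable_cong_sets)
      show "AE t in F n. d t = 0" using AE[of n] by eventually_elim (simp add: d_def)
    qed simp
    then show ?thesis by simp
  qed
  ultimately have "integral\<^sup>L H d = 0" by (simp add: LIMSEQ_const_iff)
  moreover have i: "integrable H d" by (rule H.integrable_const_bound[where B = 1]) (use b in auto)
  moreover have "0 \<le> d t" for t by (simp add: d_def infdist_nonneg)
  ultimately have "AE t in H. d t = 0" using integral_nonneg_eq_0_iff_AE[OF i] by simp
  then show ?thesis
  proof eventually_elim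
    case (elim t)
    then have "infdist t S = 0" by (auto simp: d_def min_def split: if_splits)
    then show ?case using in_closed_iff_infdist_zero[OF S ne] by simp
  qed
qed

text \<open>Every subsequential limit of \<open>b\<close> solves the limiting equation. The solution is unique because the right
  hand side is decreasing in \<open>\<beta>\<close>.\<close>
lemma fixed_point_convergence:
  fixes F :: "nat \<Rightarrow> real measure" and b \<kappa> :: "nat \<Rightarrow> real"
  assumes F: "\<And>n. real_distribution (F n)" and H: "real_distribution H" and w: "weak_conv_m F H"
    and AEF: "\<And>n. AE t in F n. t \<in> {0..c}" and c: "c \<ge> 0"
    and \<kappa>: "\<kappa> \<longlonglongrightarrow> y" and y: "y > 0" and l: "l > 0"
    and b: "\<And>n. b n \<in> {0..1}"
    and fp: "(\<lambda>n. b n - (1 - \<kappa> n + \<kappa> n * l * (\<integral>t. 1 / (b n * t + l) \<partial>F n))) \<longlonglongrightarrow> 0"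
  obtains \<beta> where "\<beta> \<in> {0..1}" "b \<longlonglongrightarrow> \<beta>" "\<beta> = 1 - y + y * l * (\<integral>t. 1 / (\<beta> * t + l) \<partial>H)"
    "(\<lambda>n. \<integral>t. 1 / (b n * t + l) \<partial>F n) \<longlonglongrightarrow> (\<integral>t. 1 / (\<beta> * t + l) \<partial>H)"
proof -
  have AEH: "AE t in H. t \<in> {0..c}"
    by (rule weak_limit_support[OF F H w _ AEF]) (use c in auto)
  define g where "g \<beta> t = 1 / (\<beta> * clamp c t + l)" for \<beta> t
  have den: "l \<le> \<beta> * clamp c t + l" if "0 \<le> \<beta>" for \<beta> t
    using that clamp_bounds(1)[OF c] by simp
  have gb: "0 \<le> g \<beta> t" "g \<beta> t \<le> 1 / l" if "0 \<le> \<beta>" for \<beta> t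
    using den[OF that, of t] l unfolding g_def by (auto intro!: divide_left_mono mult_pos_pos)
  have gm[measurable]: "g \<beta> \<in> borel_measurable borel" for \<beta> unfolding g_def[abs_def] by measurable
  have gi: "integrable M (g \<beta>)" if "0 \<le> \<beta>" "real_distribution M" for M \<beta>
  proof -
    interpret real_distribution M by fact
    show ?thesis by (rule integrable_const_bound[where B = "1 / l"]) (use gb[OF that(1)] in auto)
  qed
  have geq: "(\<integral>t. 1 / (\<beta> * t + l) \<partial>M) = integral\<^sup>L M (g \<beta>)" if M: "real_distribution M" and AE: "AE t in M. t \<in> {0..c}" for M \<beta>
  proof -
    interpret real_distribution M by (rule M)
    show ?thesis
    proof (rule integral_cong_AE)
      show "AE t in M. 1 / (\<beta> * t + l) = g \<beta> t" using AE by eventually_elim (simp add: g_def clamp_id)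
    qed measurable
  qed
  \<comment> \<open>A Lipschitz bound in \<beta> uniform in \<open>t\<close>: it allows the moving
    parameter \<open>b n\<close> to be replaced by its limit while the measure moves as
    well.\<close>
  have gL: "\<bar>g \<beta> t - g \<beta>' t\<bar> \<le> \<bar>\<beta> - \<beta>'\<bar> * (c / l\<^sup>2)" if "0 \<le> \<beta>" "0 \<le> \<beta>'" for \<beta> \<beta>' t
  proof -
    define d d' where "d = \<beta> * clamp c t + l" and "d' = \<beta>' * clamp c t + l"
    have d: "l \<le> d" "l \<le> d'" using den that by (auto simp: d_def d'_def)
    have "g \<beta> t - g \<beta>' t = (d' - d) / (d * d')" unfolding g_def d_def[symmetric] d'_def[symmetric]
      using d l by (simp add: field_simps)
    also have "d' - d = (\<beta>' - \<beta>) * clamp c t" by (simp add: d_def d'_def left_diff_distrib)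
    finally have "\<bar>g \<beta> t - g \<beta>' t\<bar> = \<bar>\<beta> - \<beta>'\<bar> * clamp c t / (d * d')"
      using d l clamp_bounds(1)[OF c, of t] by (simp add: abs_mult abs_minus_commute)
    also have "\<dots> \<le> \<bar>\<beta> - \<beta>'\<bar> * c / (l * l)"
      using d l clamp_bounds[OF c, of t] by (intro frac_le mult_mono mult_left_mono mult_nonneg_nonneg mult_pos_pos) auto
    finally show ?thesis by (simp add: power2_eq_square)
  qed
  have gcont: "isCont (g \<beta>) t" if "0 \<le> \<beta>" for \<beta> t
    unfolding g_def[abs_def] using den[OF that, of t] l by (intro continuous_intros isCont_clamp) auto
  have lim: "(\<lambda>n. integral\<^sup>L (F (r n)) (g (b (r n)))) \<longlonglongrightarrow> integral\<^sup>L H (g \<beta>)"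
    if r: "strict_mono r" and br: "(\<lambda>n. b (r n)) \<longlonglongrightarrow> \<beta>" and \<beta>: "0 \<le> \<beta>" for r :: "nat \<Rightarrow> nat" and \<beta>
  proof -
    have wl: "(\<lambda>n. integral\<^sup>L (F n) (g \<beta>)) \<longlonglongrightarrow> integral\<^sup>L H (g \<beta>)"
      by (rule weak_conv_imp_integral_bdd_continuous_conv[OF F H w gcont[OF \<beta>], where B = "1 / l"]) (use gb[OF \<beta>] in auto)
    have "(\<lambda>n. integral\<^sup>L (F (r n)) (g (b (r n))) - integral\<^sup>L (F (r n)) (g \<beta>)) \<longlonglongrightarrow> 0"
    proof (rule Lim_null_comparison)
      show "\<forall>\<^sub>F n in sequentially. norm (integral\<^sup>L (F (r n)) (g (b (r n))) - integral\<^sup>L (F (r n)) (g \<beta>)) \<le> \<bar>b (r n) - \<beta>\<bar> * (c / l\<^sup>2)"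
      proof (intro always_eventually allI)
        fix n
        interpret Fn: real_distribution "F (r n)" by (rule F)
        have b0: "0 \<le> b (r n)" using b by auto
        have "norm (integral\<^sup>L (F (r n)) (g (b (r n))) - integral\<^sup>L (F (r n)) (g \<beta>)) = \<bar>\<integral>t. g (b (r n)) t - g \<beta> t \<partial>F (r n)\<bar>"
          using gi[OF b0 F] gi[OF \<beta> F] by simp
        also have "\<dots> \<le> (\<integral>t. \<bar>b (r n) - \<beta>\<bar> * (c / l\<^sup>2) \<partial>F (r n))"
          by (rule order_trans[OF integral_abs_bound], rule integral_mono)
            (use gL[OF b0 \<beta>] gi[OF b0 F] gi[OF \<beta> F] in auto)
        finally show "norm (integral\<^sup>L (F (r n)) (g (b (r n))) - integral\<^sup>L (F (r n)) (g \<beta>)) \<le> \<bar>b (r n) - \<beta>\<bar> * (c / l\<^sup>2)"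
          using Fn.prob_space by simp
      qed
      have "(\<lambda>n. \<bar>b (r n) - \<beta>\<bar> * (c / l\<^sup>2)) \<longlonglongrightarrow> \<bar>\<beta> - \<beta>\<bar> * (c / l\<^sup>2)"
        by (intro tendsto_mult tendsto_rabs tendsto_diff br tendsto_const)
      then show "(\<lambda>n. \<bar>b (r n) - \<beta>\<bar> * (c / l\<^sup>2)) \<longlonglongrightarrow> 0" by simp
    qed
    from tendsto_add[OF this LIMSEQ_subseq_LIMSEQ[OF wl r, unfolded o_def]] show ?thesis by simp
  qed
  have fixp: "\<beta> = 1 - y + y * l * integral\<^sup>L H (g \<beta>)"
    if r: "strict_mono r" and br: "(\<lambda>n. b (r n)) \<longlonglongrightarrow> \<beta>" and \<beta>: "0 \<le> \<beta>" for r :: "nat \<Rightarrow> nat" and \<beta>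
  proof -
    have "(\<lambda>n. b (r n) - (1 - \<kappa> (r n) + \<kappa> (r n) * l * integral\<^sup>L (F (r n)) (g (b (r n))))) \<longlonglongrightarrow> 0"
      using LIMSEQ_subseq_LIMSEQ[OF fp r] by (simp add: o_def geq[OF F AEF])
    moreover have "(\<lambda>n. b (r n) - (1 - \<kappa> (r n) + \<kappa> (r n) * l * integral\<^sup>L (F (r n)) (g (b (r n)))))
       \<longlonglongrightarrow> \<beta> - (1 - y + y * l * integral\<^sup>L H (g \<beta>))"
      by (intro tendsto_intros br lim[OF r br \<beta>] LIMSEQ_subseq_LIMSEQ[OF \<kappa> r, unfolded o_def])
    ultimately have "\<beta> - (1 - y + y * l * integral\<^sup>L H (g \<beta>)) = 0" by (rule LIMSEQ_unique[rotated])
    then show ?thesis by simp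
  qed
  have uniq: False if f: "\<beta> = 1 - y + y * l * integral\<^sup>L H (g \<beta>)" "\<beta>' = 1 - y + y * l * integral\<^sup>L H (g \<beta>')"
    and lt: "\<beta> < \<beta>'" and \<beta>: "0 \<le> \<beta>" for \<beta> \<beta>'
  proof -
    have "integral\<^sup>L H (g \<beta>') \<le> integral\<^sup>L H (g \<beta>)"
    proof (rule integral_mono)
      show "g \<beta>' t \<le> g \<beta> t" for t
      proof -
        have "0 < \<beta> * clamp c t + l" "0 < \<beta>' * clamp c t + l"
          using den[of \<beta> t] den[of \<beta>' t] \<beta> lt l by linarith+
        then show ?thesis
          unfolding g_def using lt clamp_bounds(1)[OF c, of t]
          by (intro divide_left_mono mult_pos_pos add_right_mono mult_right_mono) auto
      qed
    qed (use gi H \<beta> lt in auto)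
    then have "y * l * integral\<^sup>L H (g \<beta>') \<le> y * l * integral\<^sup>L H (g \<beta>)" using y l by (intro mult_left_mono) auto
    then show False using f lt by linarith
  qed
  obtain r \<beta> where r: "strict_mono r" and \<beta>: "\<beta> \<in> {0..1}" and br: "(b \<circ> r) \<longlonglongrightarrow> \<beta>"
    using seq_compactE[OF compact_imp_seq_compact[OF compact_Icc[of 0 "1::real"]], of b] b by blast
  have f\<beta>: "\<beta> = 1 - y + y * l * integral\<^sup>L H (g \<beta>)"
    using fixp[OF r] br \<beta> by (auto simp: o_def)
  have conv: "b \<longlonglongrightarrow> \<beta>"
  proof (rule ccontr)
    assume "\<not> b \<longlonglongrightarrow> \<beta>"
    then obtain e where e: "e > 0" and inf: "\<exists>\<^sub>F n in sequentially. \<not> dist (b n) \<beta> < e"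
      by (auto simp: tendsto_iff not_eventually)
    have "infinite {n. \<not> dist (b n) \<beta> < e}"
      using inf by (simp add: frequently_cofinite[symmetric] cofinite_eq_sequentially)
    \<comment> \<open>A subsequence staying away from \<beta> would by compactness have a further
      limit point; that point solves the same equation, so it equals \<beta>.\<close>
    then obtain s :: "nat \<Rightarrow> nat" where s: "strict_mono s" "\<And>n. s n \<in> {n. \<not> dist (b n) \<beta> < e}"
      using infinite_enumerate by blast
    obtain r' \<beta>' where r': "strict_mono r'" and \<beta>': "\<beta>' \<in> {0..1}" and br': "((\<lambda>n. b (s n)) \<circ> r') \<longlonglongrightarrow> \<beta>'"
      using seq_compactE[OF compact_imp_seq_compact[OF compact_Icc[of 0 "1::real"]], of "\<lambda>n. b (s n)"] b by blast
    have "\<beta>' = 1 - y + y * l * integral\<^sup>L H (g \<beta>')"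
      using fixp[OF strict_mono_o[OF s(1) r']] br' \<beta>' by (auto simp: o_def)
    then have "\<beta>' = \<beta>" using uniq[of \<beta> \<beta>'] uniq[of \<beta>' \<beta>] f\<beta> \<beta> \<beta>' by (cases \<beta> \<beta>' rule: linorder_cases) auto
    then have "\<forall>\<^sub>F n in sequentially. dist (b (s (r' n))) \<beta> < e"
      using br' e by (auto simp: tendsto_iff o_def)
    then show False using s(2) by (auto dest: eventually_happens)
  qed
  have "strict_mono (\<lambda>n::nat. n)" by (simp add: strict_mono_def)
  from lim[OF this conv] \<beta> have "(\<lambda>n. integral\<^sup>L (F n) (g (b n))) \<longlonglongrightarrow> integral\<^sup>L H (g \<beta>)" by auto
  then show thesis
    using that[of \<beta>] \<beta> conv f\<beta> by (simp add: geq[OF F AEF] geq[OF H AEH])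
qed

section \<open>Uniqueness and analytic continuation\<close>

text \<open>Differentiation under the integral sign: Cauchy's estimate turns the local bound into a
  Lipschitz constant uniform in \<open>t\<close>, which dominates the difference quotients.
  \<open>A\<close> carries the full mass, and the integrand is unrestricted outside it.\<close>

lemma holomorphic_integral:
  fixes f :: "real \<Rightarrow> complex \<Rightarrow> complex"
  assumes M: "prob_space M" and S: "open S" and A: "A \<in> sets M"
    and hol: "\<And>t. t \<in> A \<Longrightarrow> f t holomorphic_on S" and AE: "AE t in M. t \<in> A"
    and meas: "\<And>z. z \<in> S \<Longrightarrow> (\<lambda>t. f t z) \<in> borel_measurable M"
    and bd: "\<And>z. z \<in> S \<Longrightarrow> \<exists>r>0. \<exists>B. cball z r \<subseteq> S \<and> (\<forall>t\<in>A. \<forall>w\<in>cball z r. norm (f t w) \<le> B)"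
  shows "(\<lambda>z. \<integral>t. f t z \<partial>M) holomorphic_on S"
  unfolding holomorphic_on_open[OF S]
proof
  fix z assume z: "z \<in> S"
  interpret prob_space M by (rule M)
  obtain r B where r: "r > 0" and sub: "cball z r \<subseteq> S" and B: "\<And>t w. t \<in> A \<Longrightarrow> w \<in> cball z r \<Longrightarrow> norm (f t w) \<le> B"
    using bd[OF z] by blast
  define K where "K = B / (r / 2)"
  have r2: "r / 2 > 0" using r by simp
  have lip: "norm (f t w - f t z) \<le> K * norm (w - z)" if t: "t \<in> A" and w: "w \<in> ball z (r / 2)" for t w
  proof (rule field_differentiable_bound[where S = "ball z (r / 2)" and f' = "deriv (f t)"])
    fix x assume x: "x \<in> ball z (r / 2)"
    have cx: "cball x (r / 2) \<subseteq> cball z r"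
    proof
      fix u assume "u \<in> cball x (r / 2)"
      then show "u \<in> cball z r" using x dist_triangle[of z u x] by (simp add: dist_commute)
    qed
    have "x \<in> cball x (r / 2)" using r2 by simp
    then have xS: "x \<in> S" using cx sub by blast
    show "(f t has_field_derivative deriv (f t) x) (at x within ball z (r / 2))"
      using holomorphic_derivI[OF hol[OF t] S xS] by (rule has_field_derivative_at_within)
    have "norm ((deriv ^^ 1) (f t) x) \<le> fact 1 * B / (r / 2) ^ 1"
    proof (rule Cauchy_inequality)
      show "f t holomorphic_on ball x (r / 2)"
        using hol[OF t] by (rule holomorphic_on_subset) (meson ball_subset_cball cx sub subset_trans)
      show "continuous_on (cball x (r / 2)) (f t)"
        by (rule continuous_on_subset[OF holomorphic_on_imp_continuous_on[OF hol[OF t]]]) (rule subset_trans[OF cx sub])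
      show "norm (f t u) \<le> B" if "norm (x - u) = r / 2" for u
        by (rule B[OF t]) (use cx that in \<open>auto simp: dist_norm\<close>)
    qed (rule r2)
    then show "norm (deriv (f t) x) \<le> K" by (simp add: K_def)
  qed (use w r2 in auto)
  define D where "D = (\<integral>t. indicator A t *\<^sub>R deriv (f t) z \<partial>M)"
  have "((\<lambda>w. ((\<integral>t. f t w \<partial>M) - (\<integral>t. f t z \<partial>M)) / (w - z)) \<longlongrightarrow> D) (at z)"
    unfolding tendsto_at_iff_sequentially
  proof (intro allI impI)
    fix X :: "nat \<Rightarrow> complex" assume Xz: "\<forall>i. X i \<in> UNIV - {z}" and X: "X \<longlonglongrightarrow> z"
    have "\<forall>\<^sub>F i in sequentially. X i \<in> ball z (r / 2)"
      using tendstoD[OF X r2] by eventually_elim (simp add: dist_commute)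
    \<comment> \<open>Difference quotients are controlled only inside the half-radius ball, so an
      initial segment of the sequence is dropped.\<close>
    then obtain N where N: "\<And>i. i \<ge> N \<Longrightarrow> X i \<in> ball z (r / 2)" by (auto simp: eventually_sequentially)
    define Y where "Y i = X (i + N)" for i
    have Yb: "Y i \<in> ball z (r / 2)" for i using N by (simp add: Y_def)
    have Yz: "Y i \<noteq> z" for i using Xz by (simp add: Y_def)
    have YS: "Y i \<in> S" for i using Yb[of i] sub r2 by auto
    have Y: "Y \<longlonglongrightarrow> z" unfolding Y_def using X by (rule LIMSEQ_ignore_initial_segment)
    define q where "q i t = indicator A t *\<^sub>R ((f t (Y i) - f t z) / (Y i - z))" for i t
    have qm[measurable]: "q i \<in> borel_measurable M" for i
      unfolding q_def[abs_def] using A meas[OF YS[of i]] meas[OF z] by measurable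
    have ql: "(\<lambda>i. q i t) \<longlonglongrightarrow> indicator A t *\<^sub>R deriv (f t) z" for t
    proof (cases "t \<in> A")
      case True
      have "((\<lambda>w. (f t w - f t z) / (w - z)) \<longlongrightarrow> deriv (f t) z) (at z)"
        using holomorphic_derivI[OF hol[OF True] S z] by (simp add: has_field_derivative_iff)
      then have "((\<lambda>w. (f t w - f t z) / (w - z)) \<circ> Y) \<longlonglongrightarrow> deriv (f t) z"
        unfolding tendsto_at_iff_sequentially using Y Yz by auto
      then show ?thesis using True by (simp add: q_def o_def)
    qed (simp add: q_def)
    have gm: "(\<lambda>t. indicator A t *\<^sub>R deriv (f t) z) \<in> borel_measurable M"
      by (rule borel_measurable_LIMSEQ_metric[OF qm]) (rule ql)
    have lim: "(\<lambda>i. \<integral>t. q i t \<partial>M) \<longlonglongrightarrow> D"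
      unfolding D_def
    proof (rule integral_dominated_convergence[OF gm qm, where w = "\<lambda>_. \<bar>K\<bar>"])
      show "AE t in M. (\<lambda>i. q i t) \<longlonglongrightarrow> indicator A t *\<^sub>R deriv (f t) z" using ql by simp
      show "AE t in M. norm (q i t) \<le> \<bar>K\<bar>" for i
      proof (rule AE_I2)
        fix t
        show "norm (q i t) \<le> \<bar>K\<bar>"
        proof (cases "t \<in> A")
          case True
          have "norm (f t (Y i) - f t z) \<le> \<bar>K\<bar> * norm (Y i - z)"
            using lip[OF True Yb[of i]] by (rule order_trans) (simp add: mult_right_mono)
          then show ?thesis using True Yz[of i] by (simp add: q_def norm_divide divide_le_eq)
        qed (simp add: q_def)
      qed
    qed simp
    have eq: "(\<integral>t. q i t \<partial>M) = ((\<integral>t. f t (Y i) \<partial>M) - (\<integral>t. f t z \<partial>M)) / (Y i - z)" for i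
    proof -
      have i1: "integrable M (\<lambda>t. f t w)" if w: "w \<in> cball z r" for w
        by (rule integrable_const_bound[where B = B]) (use AE B w sub meas in \<open>auto elim!: eventually_mono\<close>)
      have i2: "integrable M (\<lambda>t. f t (Y i))" "integrable M (\<lambda>t. f t z)"
        using Yb[of i] r by (auto intro!: i1)
      have "(\<integral>t. q i t \<partial>M) = (\<integral>t. (f t (Y i) - f t z) / (Y i - z) \<partial>M)"
      proof (rule integral_cong_AE[OF qm])
        show "(\<lambda>t. (f t (Y i) - f t z) / (Y i - z)) \<in> borel_measurable M"
          using meas[OF YS[of i]] meas[OF z] by measurable
        show "AE t in M. q i t = (f t (Y i) - f t z) / (Y i - z)"
          using AE by eventually_elim (simp add: q_def)
      qed
      then show ?thesis using i2 by simp
    qed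
    have "(\<lambda>i. ((\<lambda>w. ((\<integral>t. f t w \<partial>M) - (\<integral>t. f t z \<partial>M)) / (w - z)) \<circ> X) (i + N)) \<longlonglongrightarrow> D"
      using lim unfolding eq by (simp add: Y_def o_def)
    then show "((\<lambda>w. ((\<integral>t. f t w \<partial>M) - (\<integral>t. f t z \<partial>M)) / (w - z)) \<circ> X) \<longlonglongrightarrow> D"
      by (rule LIMSEQ_offset)
  qed
  then show "\<exists>f'. ((\<lambda>z. \<integral>t. f t z \<partial>M) has_field_derivative f') (at z)"
    unfolding has_field_derivative_iff by blast
qed

text \<open>The change of variables \<open>v = 1 / (1 + x)\<close> turns the resolvent near \<open>q = 1\<close> into the generating function
  of the moments of \<open>v\<close>, which lives on \<open>[0, 1]\<close>.\<close>
definition cayley :: "real \<Rightarrow> real" where "cayley x = 1 / (1 + max 0 x)"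

lemma cayley_bounds: "0 < cayley x" "cayley x \<le> 1"
  by (auto simp: cayley_def intro!: divide_pos_pos)

lemma cayley_measurable[measurable]: "cayley \<in> borel_measurable borel"
  unfolding cayley_def[abs_def] by measurable

text \<open>With \<open>v = cayley x\<close> the integrand is \<open>v / (1 + v * \<delta>)\<close>;
  its geometric series is dominated by the powers of \<open>\<bar>\<delta>\<bar>\<close>, since
  \<open>v\<close> is at most 1.\<close>

lemma resolvent_power_series:
  assumes \<nu>: "real_distribution \<nu>" and AE: "AE x in \<nu>. 0 \<le> x" and d: "\<bar>\<delta>\<bar> < 1"
  shows "(\<lambda>k. (\<integral>x. cayley x ^ (k + 1) \<partial>\<nu>) * (- 1) ^ k * \<delta> ^ k) sums (\<integral>x. 1 / (x + (1 + \<delta>)) \<partial>\<nu>)"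
proof -
  interpret real_distribution \<nu> by (rule \<nu>)
  define h where "h k x = cayley x ^ (k + 1) * (- 1) ^ k * \<delta> ^ k" for k x
  have hb: "norm (h k x) \<le> \<bar>\<delta>\<bar> ^ k" for k x
  proof -
    have "cayley x ^ (k + 1) \<le> 1" using cayley_bounds[of x] by (intro power_le_one) auto
    then show ?thesis using cayley_bounds[of x] unfolding h_def norm_mult
      by (simp add: power_abs mult_left_le_one_le)
  qed
  have hi: "integrable \<nu> (h k)" for k
    by (rule integrable_const_bound[where B = "\<bar>\<delta>\<bar> ^ k"]) (use hb in \<open>auto simp: h_def[abs_def]\<close>)
  have sd: "summable (\<lambda>k. \<bar>\<delta>\<bar> ^ k)" using d by (simp add: summable_geometric)
  have "(\<lambda>k. integral\<^sup>L \<nu> (h k)) sums (\<integral>x. (\<Sum>k. h k x) \<partial>\<nu>)"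
  proof (rule sums_integral[OF hi])
    show "AE x in \<nu>. summable (\<lambda>k. norm (h k x))"
      by (intro AE_I2 summable_comparison_test'[OF sd]) (use hb in auto)
    have "(\<integral>x. norm (h k x) \<partial>\<nu>) \<le> \<bar>\<delta>\<bar> ^ k" for k
    proof -
      have "(\<integral>x. norm (h k x) \<partial>\<nu>) \<le> (\<integral>x. \<bar>\<delta>\<bar> ^ k \<partial>\<nu>)"
        by (rule integral_mono) (use hb hi in auto)
      then show ?thesis using prob_space by simp
    qed
    then show "summable (\<lambda>k. \<integral>x. norm (h k x) \<partial>\<nu>)"
      by (intro summable_comparison_test'[OF sd]) (auto simp: integral_nonneg_AE)
  qed
  moreover have "(\<integral>x. (\<Sum>k. h k x) \<partial>\<nu>) = (\<integral>x. 1 / (x + (1 + \<delta>)) \<partial>\<nu>)"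
  proof (rule integral_cong_AE)
    show "AE x in \<nu>. (\<Sum>k. h k x) = 1 / (x + (1 + \<delta>))"
      using AE
    proof eventually_elim
      case (elim x)
      have c: "cayley x = 1 / (1 + x)" using elim by (simp add: cayley_def)
      have "\<bar>- (cayley x * \<delta>)\<bar> < 1"
        using mult_left_le_one_le[of "\<bar>\<delta>\<bar>" "cayley x"] cayley_bounds[of x] d by (simp add: abs_mult)
      then have "(\<lambda>k. (- (cayley x * \<delta>)) ^ k) sums (1 / (1 - - (cayley x * \<delta>)))"
        by (intro geometric_sums) simp
      then have "(\<lambda>k. cayley x * (- (cayley x * \<delta>)) ^ k) sums (cayley x * (1 / (1 - - (cayley x * \<delta>))))"
        by (rule sums_mult)
      moreover have "cayley x * (- (cayley x * \<delta>)) ^ k = h k x" for k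
        unfolding h_def power_minus[of "cayley x * \<delta>"] by (simp add: power_mult_distrib)
      moreover have "cayley x * (1 / (1 - - (cayley x * \<delta>))) = 1 / (x + (1 + \<delta>))"
      proof -
        have "1 + x > 0" "1 + x + \<delta> > 0" using elim d by (auto simp: abs_less_iff)
        then show ?thesis unfolding c by (simp add: field_simps)
      qed
      ultimately have "(\<lambda>k. h k x) sums (1 / (x + (1 + \<delta>)))" by (simp only:)
      then show ?case by (rule sums_unique[symmetric])
    qed
  qed (simp_all add: h_def)
  ultimately have "(\<lambda>k. integral\<^sup>L \<nu> (h k)) sums (\<integral>x. 1 / (x + (1 + \<delta>)) \<partial>\<nu>)" by simp
  moreover have "integral\<^sup>L \<nu> (h k) = (\<integral>x. cayley x ^ (k + 1) \<partial>\<nu>) * (- 1) ^ k * \<delta> ^ k" for k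
    unfolding h_def[abs_def] by simp
  ultimately show ?thesis by (simp only:)
qed

text \<open>The exponential series may be integrated termwise because \<open>cayley\<close> is
  bounded by 1. Hence the moments determine the characteristic function.\<close>

lemma char_cayley:
  assumes \<nu>: "real_distribution \<nu>"
  shows "char (distr \<nu> borel cayley) t = (\<Sum>k. (\<i> * complex_of_real t) ^ k /\<^sub>R fact k * complex_of_real (\<integral>x. cayley x ^ k \<partial>\<nu>))"
proof -
  interpret real_distribution \<nu> by (rule \<nu>)
  define h where "h k x = (\<i> * complex_of_real t) ^ k /\<^sub>R fact k * complex_of_real (cayley x ^ k)" for k x
  have hb: "norm (h k x) \<le> \<bar>t\<bar> ^ k / fact k" for k x
  proof -
    have "cayley x ^ k \<le> 1" using cayley_bounds[of x] by (intro power_le_one) auto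
    then have "\<bar>t\<bar> ^ k / fact k * \<bar>cayley x ^ k\<bar> \<le> \<bar>t\<bar> ^ k / fact k * 1"
      using cayley_bounds[of x] by (intro mult_left_mono) auto
    then show ?thesis unfolding h_def norm_mult norm_scaleR norm_power
      by (simp add: norm_mult norm_power divide_inverse mult_ac power_mult_distrib power_abs)
  qed
  have hi: "integrable \<nu> (h k)" for k
    by (rule integrable_const_bound[where B = "\<bar>t\<bar> ^ k / fact k"]) (use hb in \<open>auto simp: h_def[abs_def]\<close>)
  have sd: "summable (\<lambda>k. \<bar>t\<bar> ^ k / fact k)" using summable_exp[of "\<bar>t\<bar>"] by (simp add: divide_inverse mult.commute)
  have "(\<lambda>k. integral\<^sup>L \<nu> (h k)) sums (\<integral>x. (\<Sum>k. h k x) \<partial>\<nu>)"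
  proof (rule sums_integral[OF hi])
    show "AE x in \<nu>. summable (\<lambda>k. norm (h k x))"
      by (intro AE_I2 summable_comparison_test'[OF sd]) (use hb in auto)
    have "(\<integral>x. norm (h k x) \<partial>\<nu>) \<le> \<bar>t\<bar> ^ k / fact k" for k
    proof -
      have "(\<integral>x. norm (h k x) \<partial>\<nu>) \<le> (\<integral>x. \<bar>t\<bar> ^ k / fact k \<partial>\<nu>)"
        by (rule integral_mono) (use hb hi in auto)
      then show ?thesis using prob_space by simp
    qed
    then show "summable (\<lambda>k. \<integral>x. norm (h k x) \<partial>\<nu>)"
      by (intro summable_comparison_test'[OF sd]) (auto simp: integral_nonneg_AE)
  qed
  moreover have "(\<Sum>k. h k x) = iexp (t * cayley x)" for x
  proof -
    have "h k x = (\<i> * complex_of_real (t * cayley x)) ^ k /\<^sub>R fact k" for k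
      by (simp add: h_def power_mult_distrib scaleR_conv_of_real mult_ac)
    then show ?thesis using exp_converges[of "\<i> * complex_of_real (t * cayley x)"]
      by (simp add: sums_iff)
  qed
  moreover have "char (distr \<nu> borel cayley) t = (\<integral>x. iexp (t * cayley x) \<partial>\<nu>)"
    unfolding char_def by (rule integral_distr) auto
  moreover have "integral\<^sup>L \<nu> (h k) = (\<i> * complex_of_real t) ^ k /\<^sub>R fact k * complex_of_real (\<integral>x. cayley x ^ k \<partial>\<nu>)" for k
    unfolding h_def[abs_def] by (simp del: of_real_power)
  ultimately show ?thesis by (simp add: sums_iff)
qed

text \<open>The difference of the two power series around \<open>q = 1\<close> vanishes at rationals
  accumulating at the centre, so all coefficients agree, and with them the moments of
  \<open>cayley\<close>. Levy's theorem identifies the image laws, and \<open>1 / v - 1\<close>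
  inverts the change of variables on the half-line.\<close>

theorem real_distribution_eq_of_resolvents:
  assumes \<nu>: "real_distribution \<nu>" "AE x in \<nu>. 0 \<le> x" and \<mu>: "real_distribution \<mu>" "AE x in \<mu>. 0 \<le> x"
    and eq: "\<And>q. q \<in> \<rat> \<Longrightarrow> q > 0 \<Longrightarrow> (\<integral>x. 1 / (x + q) \<partial>\<nu>) = (\<integral>x. 1 / (x + q) \<partial>\<mu>)"
  shows "\<nu> = \<mu>"
proof -
  interpret N: real_distribution \<nu> by (rule \<nu>)
  interpret Mu: real_distribution \<mu> by (rule \<mu>)
  define a where "a k = ((\<integral>x. cayley x ^ (k + 1) \<partial>\<nu>) - (\<integral>x. cayley x ^ (k + 1) \<partial>\<mu>)) * (- 1) ^ k" for k
  define f where "f \<delta> = (\<integral>x. 1 / (x + (1 + \<delta>)) \<partial>\<nu>) - (\<integral>x. 1 / (x + (1 + \<delta>)) \<partial>\<mu>)" for \<delta>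
  have sm: "(\<lambda>k. a k * \<delta> ^ k) sums f \<delta>" if "norm \<delta> < 1" for \<delta> :: real
    using sums_diff[OF resolvent_power_series[OF \<nu>] resolvent_power_series[OF \<mu>], of \<delta>] that
    by (simp add: a_def f_def left_diff_distrib)
  have f0: "f \<delta> = 0" if "\<delta> \<in> \<rat>" "1 + \<delta> > 0" for \<delta>
    using eq[of "1 + \<delta>"] that by (simp add: f_def)
  have a0: "a k = 0" for k
  \<comment> \<open>The isolation of zeros is applied to a nonzero coefficient of positive index,
    given \<open>f 0 = 0\<close>; the constant coefficient is read off at 0.\<close>
  proof (cases "k = 0")
    case True
    have "(\<lambda>k. a k * 0 ^ k) sums a 0" by (rule powser_sums_zero)
    moreover have "(\<lambda>k. a k * 0 ^ k) sums f 0" by (rule sm) simp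
    ultimately show ?thesis using True f0[of 0] by (simp add: sums_unique2)
  next
    case False
    show ?thesis
    proof (rule ccontr)
      assume "a k \<noteq> 0"
      then obtain s where s: "0 < s" "\<And>z. z \<in> cball 0 s - {0} \<Longrightarrow> f z \<noteq> 0"
        using powser_0_nonzero[where a = a and f = f and m = k and r = 1 and \<xi> = 0] sm f0[of 0] False by auto
      obtain q where q: "q \<in> \<rat>" "0 < q" "q < min s 1" using Rats_dense_in_real[of 0 "min s 1"] s(1) by auto
      then show False using s(2)[of q] f0[of q] by auto
    qed
  qed
  have mom: "(\<integral>x. cayley x ^ k \<partial>\<nu>) = (\<integral>x. cayley x ^ k \<partial>\<mu>)" for k
  proof (cases k)
    case 0 then show ?thesis using N.prob_space Mu.prob_space by simp
  next
    case (Suc j) then show ?thesis using a0[of j] by (simp add: a_def)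
  qed
  have eqd: "distr \<nu> borel cayley = distr \<mu> borel cayley"
  proof (rule Levy_uniqueness)
    show "char (distr \<nu> borel cayley) = char (distr \<mu> borel cayley)"
      using char_cayley[OF \<nu>(1)] char_cayley[OF \<mu>(1)] mom by (simp add: fun_eq_iff)
  qed (auto intro: N.real_distribution_distr Mu.real_distribution_distr)
  have recover: "distr (distr \<rho> borel cayley) borel (\<lambda>v. 1 / v - 1) = \<rho>"
    if \<rho>: "real_distribution \<rho>" "AE x in \<rho>. 0 \<le> x" for \<rho>
  proof -
    interpret R: real_distribution \<rho> by (rule \<rho>)
    have "distr (distr \<rho> borel cayley) borel (\<lambda>v. 1 / v - 1) = distr \<rho> borel ((\<lambda>v. 1 / v - 1) \<circ> cayley)"
      by (rule distr_distr) auto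
    also have "\<dots> = distr \<rho> borel (\<lambda>x. x)"
    proof (rule distr_cong_AE)
      show "AE x in \<rho>. ((\<lambda>v. 1 / v - 1) \<circ> cayley) x = x"
        using \<rho>(2) by eventually_elim (simp add: cayley_def)
    qed auto
    also have "\<dots> = \<rho>" by (rule distr_id2) simp
    finally show ?thesis .
  qed
  have "\<nu> = distr (distr \<nu> borel cayley) borel (\<lambda>v. 1 / v - 1)" by (rule recover[OF \<nu>, symmetric])
  also have "\<dots> = \<mu>" unfolding eqd by (rule recover[OF \<mu>])
  finally show ?thesis .
qed

text \<open>Both sides are holomorphic off \<open>[0, \<infinity>)\<close> and agree at the negative rationals.\<close>
theorem marchenko_pastur_equation:
  assumes \<mu>: "real_distribution \<mu>" "AE x in \<mu>. 0 \<le> x" and H: "real_distribution H" "AE t in H. t \<in> {0..c}"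
    and c: "c \<ge> 0" and y: "y > 0"
    and m_def: "\<And>q. m q = (\<integral>x. 1 / (x + q) \<partial>\<mu>)"
    and b0: "\<And>q. q \<in> \<rat> \<Longrightarrow> q > 0 \<Longrightarrow> 0 \<le> 1 - y + y * q * m q"
    and me: "\<And>q. q \<in> \<rat> \<Longrightarrow> q > 0 \<Longrightarrow> m q = (\<integral>t. 1 / ((1 - y + y * q * m q) * t + q) \<partial>H)"
    and z0: "Im z0 > 0"
  shows "stieltjes \<mu> z0 = (\<integral>t. 1 / (complex_of_real t * (1 - complex_of_real y - complex_of_real y * z0 * stieltjes \<mu> z0) - z0) \<partial>H)"
proof -
  interpret Mu: real_distribution \<mu> by (rule \<mu>)
  interpret H: real_distribution H by (rule H)
  \<comment> \<open>The slit plane contains the upper half-plane and the negative axis in one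
    connected domain.\<close>
  define S where "S = - complex_of_real ` {0..}"
  have Sop: "open S" unfolding S_def by (intro open_Compl closed_slot_right)
  have Scon: "connected S" unfolding S_def
    by (intro starlike_imp_connected starlike_slotted_complex_plane_right)
  have ball: "\<exists>d>0. cball z d \<subseteq> S \<and> (\<forall>x\<ge>0. \<forall>w\<in>cball z d. d \<le> norm (complex_of_real x - w))" if z: "z \<in> S" for z
  proof -
    obtain e where e: "e > 0" "ball z e \<subseteq> S" using Sop z by (meson open_contains_ball)
    have x: "e \<le> norm (complex_of_real x - z)" if "x \<ge> 0" for x
    proof (rule ccontr)
      assume "\<not> e \<le> norm (complex_of_real x - z)"
      then have "complex_of_real x \<in> S" using e by (auto simp: dist_norm norm_minus_commute)
      then show False using that by (auto simp: S_def)
    qed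
    have "e / 2 \<le> norm (complex_of_real x - w)" if "x \<ge> 0" "w \<in> cball z (e / 2)" for x w
      using x[OF that(1)] that(2) norm_triangle_ineq[of "complex_of_real x - w" "w - z"]
      by (simp add: dist_norm norm_minus_commute)
    then show ?thesis using e by (intro exI[of _ "e / 2"]) auto
  qed
  define s where "s z = stieltjes \<mu> z" for z
  have shol: "s holomorphic_on S"
    unfolding s_def stieltjes_def
  proof (rule holomorphic_integral[where A = "{0..}"])
    show "(\<lambda>z. 1 / (complex_of_real t - z)) holomorphic_on S" if "t \<in> {0..}" for t
      by (intro holomorphic_intros) (use that in \<open>auto simp: S_def\<close>)
    fix z assume z: "z \<in> S"
    obtain d where d: "d > 0" "cball z d \<subseteq> S" "\<And>x w. x \<ge> 0 \<Longrightarrow> w \<in> cball z d \<Longrightarrow> d \<le> norm (complex_of_real x - w)"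
      using ball[OF z] by blast
    show "\<exists>r>0. \<exists>B. cball z r \<subseteq> S \<and> (\<forall>t\<in>{0..}. \<forall>w\<in>cball z r. norm (1 / (complex_of_real t - w)) \<le> B)"
    proof (intro exI conjI ballI)
      fix t :: real and w assume "t \<in> {0..}" "w \<in> cball z d"
      then have "d \<le> norm (complex_of_real t - w)" using d(3) by simp
      then show "norm (1 / (complex_of_real t - w)) \<le> 1 / d"
        using d(1) by (simp add: norm_divide frac_le)
    qed (use d in auto)
  qed (use \<mu> Sop Mu.prob_space_axioms in auto)
  define bb where "bb z = 1 - complex_of_real y - complex_of_real y * z * s z" for z
  have bhol: "bb holomorphic_on S" unfolding bb_def[abs_def] by (intro holomorphic_intros shol)
  have sreal: "s (- complex_of_real q) = complex_of_real (m q)" for q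
  proof -
    have "s (- complex_of_real q) = (\<integral>x. complex_of_real (1 / (x + q)) \<partial>\<mu>)"
      unfolding s_def stieltjes_def by (intro Bochner_Integration.integral_cong refl) simp
    then show ?thesis by (simp add: m_def del: of_real_divide)
  qed
  have breal: "bb (- complex_of_real q) = complex_of_real (1 - y + y * q * m q)" for q
    by (simp add: bb_def sreal)
  have negS: "- complex_of_real q \<in> S" if "q > 0" for q
  proof -
    have "- complex_of_real q \<noteq> complex_of_real x" if "x \<ge> 0" for x
    proof
      assume "- complex_of_real q = complex_of_real x"
      then have "complex_of_real (- q) = complex_of_real x" by simp
      then have "- q = x" by (simp only: of_real_eq_iff)
      then show False using that \<open>q > 0\<close> by simp
    qed
    then show ?thesis by (auto simp: S_def)
  qed
  \<comment> \<open>Nonnegativity extends from rational to all positive \<open>q\<close> by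
    continuity of \<open>bb\<close>. It is needed at every point of the negative axis for the
    denominators not to vanish there.\<close>
  have bnn: "0 \<le> 1 - y + y * q * m q" if q: "q > 0" for q
  proof -
    have "\<exists>r. r \<in> \<rat> \<and> q < r \<and> r < q + 1 / (real n + 1)" for n
      using Rats_dense_in_real[of q "q + 1 / (real n + 1)"] by auto
    then obtain r where r: "\<And>n. r n \<in> \<rat>" "\<And>n. q < r n" "\<And>n. r n < q + 1 / (real n + 1)" by metis
    have "(\<lambda>n. q + 1 / (real n + 1)) \<longlonglongrightarrow> q" by real_asymp
    then have rq: "r \<longlonglongrightarrow> q"
      by (rule tendsto_sandwich[rotated 2, OF tendsto_const]) (use r in \<open>auto intro!: always_eventually less_imp_le\<close>)
    have "isCont bb (- complex_of_real q)"
      using holomorphic_on_imp_continuous_on[OF bhol] Sop negS[OF q] by (simp add: continuous_on_eq_continuous_at)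
    moreover have "(\<lambda>n. - complex_of_real (r n)) \<longlonglongrightarrow> - complex_of_real q" by (intro tendsto_intros rq)
    ultimately have "(\<lambda>n. bb (- complex_of_real (r n))) \<longlonglongrightarrow> bb (- complex_of_real q)"
      by (rule isCont_tendsto_compose)
    then have "(\<lambda>n. 1 - y + y * r n * m (r n)) \<longlonglongrightarrow> 1 - y + y * q * m q"
      unfolding breal by (simp only: tendsto_of_real_iff)
    then show ?thesis by (rule LIMSEQ_le_const) (use b0[OF r(1)] q r(2) in \<open>auto intro: less_trans\<close>)
  qed
  define den where "den t z = complex_of_real t * bb z - z" for t z
  \<comment> \<open>On the negative axis the denominator is positive by \<open>bnn\<close>. Off the
    real axis its imaginary part is \<open>- (t * y * K + 1) * Im z\<close> with
    \<open>K \<ge> 0\<close>, hence nonzero.\<close>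
  have den_nz: "den t z \<noteq> 0" if t: "t \<ge> 0" and z: "z \<in> S" for t z
  proof (cases "Im z = 0")
    case True
    define q where "q = - Re z"
    have zq: "z = - complex_of_real q" using True by (simp add: q_def complex_eq_iff)
    have "q > 0"
    proof (rule ccontr)
      assume "\<not> q > 0"
      then have "z \<in> complex_of_real ` {0..}" by (intro image_eqI[of _ _ "- q"]) (simp_all add: zq)
      then show False using z by (simp add: S_def)
    qed
    then have "t * (1 - y + y * q * m q) + q > 0" using bnn t by (intro add_nonneg_pos mult_nonneg_nonneg) auto
    moreover have "den t z = complex_of_real (t * (1 - y + y * q * m q) + q)"
      unfolding den_def zq breal by simp
    ultimately show ?thesis by (simp only: of_real_eq_0_iff)
  next
    case False
    obtain d where d: "d > 0" "\<And>x. x \<ge> 0 \<Longrightarrow> d \<le> norm (complex_of_real x - z)"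
      using ball[OF z] by (metis centre_in_cball less_imp_le)
    have nz: "complex_of_real x - z \<noteq> 0" for x using False by (auto simp: complex_eq_iff)
    have int: "integrable \<mu> (\<lambda>x. 1 / (complex_of_real x - z))"
    proof (rule Mu.integrable_const_bound[where B = "1 / d"])
      show "AE x in \<mu>. norm (1 / (complex_of_real x - z)) \<le> 1 / d"
        using \<mu>(2) by eventually_elim (use d in \<open>simp add: norm_divide frac_le\<close>)
    qed simp
    define K where "K = (\<integral>x. x / (norm (complex_of_real x - z))\<^sup>2 \<partial>\<mu>)"
    have "z * s z = (\<integral>x. z * (1 / (complex_of_real x - z)) \<partial>\<mu>)"
      unfolding s_def stieltjes_def by (rule integral_mult_right_zero[symmetric])
    then have "Im (z * s z) = (\<integral>x. Im (z * (1 / (complex_of_real x - z))) \<partial>\<mu>)"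
      using integral_Im[OF integrable_mult_right[OF int], of z] by simp
    also have "\<dots> = (\<integral>x. Im z * (x / (norm (complex_of_real x - z))\<^sup>2) \<partial>\<mu>)"
    proof (intro Bochner_Integration.integral_cong refl)
      fix x
      have "z * (1 / (complex_of_real x - z)) = z * cnj (complex_of_real x - z) / complex_of_real ((norm (complex_of_real x - z))\<^sup>2)"
      proof -
        have "z * (1 / w) = z * cnj w / (w * cnj w)" if "w \<noteq> 0" for w using that by simp
        from this[OF nz[of x]] show ?thesis by (simp only: complex_norm_square)
      qed
      also have "Im \<dots> = Im (z * cnj (complex_of_real x - z)) / (norm (complex_of_real x - z))\<^sup>2"
        by (rule Im_divide_of_real)
      also have "Im (z * cnj (complex_of_real x - z)) = Im z * x" by (simp add: algebra_simps)
      finally show "Im (z * (1 / (complex_of_real x - z))) = Im z * (x / (norm (complex_of_real x - z))\<^sup>2)" by simp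
    qed
    also have "\<dots> = Im z * K" unfolding K_def by (rule integral_mult_right_zero)
    finally have I: "Im (z * s z) = Im z * K" .
    have K: "K \<ge> 0" unfolding K_def using \<mu>(2) by (intro integral_nonneg_AE) (auto elim!: eventually_mono)
    have "Im (bb z) = - (y * Im (z * s z))" by (simp add: bb_def mult.assoc)
    then have "Im (den t z) = - (t * y * K + 1) * Im z" unfolding den_def I by (simp add: algebra_simps)
    moreover have "t * y * K + 1 > 0" using t y K by (intro add_nonneg_pos mult_nonneg_nonneg) auto
    ultimately show ?thesis using False by auto
  qed
  define R where "R z = (\<integral>t. 1 / den t z \<partial>H)" for z
  have Rhol: "R holomorphic_on S"
    unfolding R_def[abs_def]
  proof (rule holomorphic_integral[where A = "{0..c}"])
    show "(\<lambda>z. 1 / den t z) holomorphic_on S" if "t \<in> {0..c}" for t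
      unfolding den_def[abs_def] by (intro holomorphic_intros bhol) (use den_nz that in \<open>auto simp: den_def\<close>)
    show "(\<lambda>t. 1 / den t z) \<in> borel_measurable H" for z unfolding den_def by measurable
    fix z assume z: "z \<in> S"
    obtain d where d: "d > 0" "cball z d \<subseteq> S" using ball[OF z] by blast
    \<comment> \<open>Compactness of the support of \<open>H\<close> enters here: the modulus of the
      denominator attains a positive minimum over the support and a closed disc.\<close>
    have cb: "continuous_on ({0..c} \<times> cball z d) (\<lambda>tw. norm (den (fst tw) (snd tw)))"
      unfolding den_def
      by (intro continuous_intros continuous_on_compose2[OF holomorphic_on_imp_continuous_on[OF bhol]]) (use d in auto)
    have "compact ({0..c} \<times> cball z d)" by (intro compact_Times compact_Icc compact_cball)
    moreover have "{0..c} \<times> cball z d \<noteq> {}" using c d by auto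
    ultimately obtain tw where tw: "tw \<in> {0..c} \<times> cball z d"
      and low: "\<And>u. u \<in> {0..c} \<times> cball z d \<Longrightarrow> norm (den (fst tw) (snd tw)) \<le> norm (den (fst u) (snd u))"
      using continuous_attains_inf[OF _ _ cb] by blast
    define e where "e = norm (den (fst tw) (snd tw))"
    have e: "e > 0" unfolding e_def using tw d den_nz[of "fst tw" "snd tw"] by auto
    have "norm (1 / den t w) \<le> 1 / e" if "t \<in> {0..c}" "w \<in> cball z d" for t w
      using low[of "(t, w)"] that e by (auto simp: norm_divide e_def[symmetric] intro!: divide_left_mono mult_pos_pos)
    then show "\<exists>r>0. \<exists>B. cball z r \<subseteq> S \<and> (\<forall>t\<in>{0..c}. \<forall>w\<in>cball z r. norm (1 / den t w) \<le> B)"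
      using d by blast
  qed (use H Sop H.prob_space_axioms in auto)
  have zero: "s w - R w = 0" if "w \<in> (\<lambda>q. - complex_of_real q) ` {q \<in> \<rat>. q > 0}" for w
  proof -
    obtain q where q: "q \<in> \<rat>" "q > 0" and w: "w = - complex_of_real q" using \<open>w \<in> _\<close> by auto
    have "R w = (\<integral>t. complex_of_real (1 / ((1 - y + y * q * m q) * t + q)) \<partial>H)"
      unfolding R_def den_def w breal
      by (intro Bochner_Integration.integral_cong refl) (simp add: mult.commute)
    also have "\<dots> = complex_of_real (m q)"
      using me[OF q] by (simp del: of_real_divide)
    finally show ?thesis by (simp add: w sreal)
  qed
  have lim: "- complex_of_real 1 islimpt (\<lambda>q. - complex_of_real q) ` {q \<in> \<rat>. q > 0}"
    unfolding islimpt_approachable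
  proof (intro allI impI)
    fix e :: real assume "e > 0"
    then obtain q where q: "q \<in> \<rat>" "1 < q" "q < 1 + e" using Rats_dense_in_real[of 1 "1 + e"] by auto
    have "dist (- complex_of_real q) (- complex_of_real 1) = \<bar>1 - q\<bar>"
      unfolding dist_norm by (metis norm_of_real of_real_diff minus_diff_minus minus_diff_eq)
    then show "\<exists>x'\<in>(\<lambda>q. - complex_of_real q) ` {q \<in> \<rat>. q > 0}. x' \<noteq> - complex_of_real 1 \<and> dist x' (- complex_of_real 1) < e"
      using q by (intro bexI[of _ "- complex_of_real q"]) auto
  qed
  have z0S: "z0 \<in> S" using z0 by (auto simp: S_def)
  have "s z0 - R z0 = 0"
  proof (rule analytic_continuation[of "\<lambda>z. s z - R z" S _ "- complex_of_real 1" z0])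
    show "(\<lambda>z. s z - R z) holomorphic_on S" by (intro holomorphic_intros shol Rhol)
    show "(\<lambda>q. - complex_of_real q) ` {q \<in> \<rat>. q > 0} \<subseteq> S" using negS by auto
    show "- complex_of_real 1 \<in> S" by (rule negS) simp
  qed (use Sop Scon lim zero z0S in auto)
  then show ?thesis by (simp add: R_def den_def bb_def s_def)
qed

section \<open>Almost sure convergence\<close>

text \<open>The convergent half of Borel-Cantelli for each threshold \<open>1 / (k + 1)\<close>,
  followed by a countable intersection. The joint behaviour for different \<open>n\<close> does not
  enter, as suits a triangular array.\<close>

lemma (in prob_space) exponential_tail_imp_AE_tendsto_0:
  fixes Z :: "nat \<Rightarrow> 'a \<Rightarrow> real"
  assumes [measurable]: "\<And>n. Z n \<in> borel_measurable M"
    and tail: "\<And>\<epsilon>. \<epsilon> > 0 \<Longrightarrow> \<exists>c>0. \<exists>K. \<forall>\<^sub>F n in sequentially. prob {x \<in> space M. \<epsilon> \<le> \<bar>Z n x\<bar>} \<le> K * exp (- c * real n)"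
  shows "AE x in M. (\<lambda>n. Z n x) \<longlonglongrightarrow> 0"
proof -
  have "AE x in M. \<forall>\<^sub>F n in sequentially. \<bar>Z n x\<bar> < inverse (real (Suc k))" for k
  proof -
    let ?e = "inverse (real (Suc k))"
    let ?A = "\<lambda>n. {x \<in> space M. ?e \<le> \<bar>Z n x\<bar>}"
    obtain c K where c: "c > 0" and K: "\<forall>\<^sub>F n in sequentially. prob (?A n) \<le> K * exp (- c * real n)"
      using tail[of ?e] by auto
    have "summable (\<lambda>n. K * exp (- c) ^ n)" using c by (intro summable_mult summable_geometric) auto
    moreover have "exp (- c) ^ n = exp (- c * real n)" for n by (simp add: exp_of_nat_mult[symmetric] mult.commute)
    ultimately have "summable (\<lambda>n. K * exp (- c * real n))" by simp
    then have "summable (\<lambda>n. prob (?A n))"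
      by (rule summable_comparison_test_ev[rotated]) (use K in eventually_elim, simp)
    then have "AE x in M. \<forall>\<^sub>F n in sequentially. x \<in> space M - ?A n"
      by (intro borel_cantelli_AE1) (auto simp: emeasure_eq_measure)
    then show ?thesis by (auto elim!: eventually_mono)
  qed
  then have "AE x in M. \<forall>k. \<forall>\<^sub>F n in sequentially. \<bar>Z n x\<bar> < inverse (real (Suc k))"
    by (simp add: AE_all_countable)
  then show ?thesis
  proof eventually_elim
    case (elim x)
    show ?case
    proof (rule tendstoI)
      fix e :: real assume "e > 0"
      then obtain k where "inverse (real (Suc k)) < e" using reals_Archimedean by blast
      with elim[rule_format, of k] show "\<forall>\<^sub>F n in sequentially. dist (Z n x) 0 < e"
        by (auto elim!: eventually_mono)
    qed
  qed
qed

text \<open>Being Gaussian depends only on the law, so it passes to the coordinates under the image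
  measure.\<close>

lemma gaussian_vec_distr:
  assumes "gaussian_vec M p S X"
  shows "gaussian_vec (distr M (Pi\<^sub>M {..<p} (\<lambda>_. borel)) (\<lambda>\<omega>. restrict (\<lambda>j. X j \<omega>) {..<p})) p S (\<lambda>j x. x j)"
proof -
  have X: "X j \<in> borel_measurable M" if "j < p" for j using assms that by (simp add: gaussian_vec_def)
  let ?R = "\<lambda>\<omega>. restrict (\<lambda>j. X j \<omega>) {..<p}"
  let ?D = "distr M (Pi\<^sub>M {..<p} (\<lambda>_. borel)) ?R"
  have R: "?R \<in> M \<rightarrow>\<^sub>M Pi\<^sub>M {..<p} (\<lambda>_. borel)" using X by (intro measurable_restrict) simp
  have comp: "(\<lambda>x. x j) \<in> borel_measurable (Pi\<^sub>M {..<p} (\<lambda>_. borel :: real measure))" if "j < p" for j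
    using that by (intro measurable_component_singleton) simp
  have lm: "(\<lambda>x. \<Sum>j<p. a j * x j) \<in> borel_measurable (Pi\<^sub>M {..<p} (\<lambda>_. borel :: real measure))" for a
    using comp by (intro borel_measurable_sum borel_measurable_times) auto
  have ls: "(\<Sum>j<p. a j * ?R \<omega> j) = (\<Sum>j<p. a j * X j \<omega>)" for a \<omega> by (intro sum.cong) auto
  show ?thesis
    unfolding gaussian_vec_def Let_def
  proof (intro conjI allI impI)
    show "(\<lambda>x. x j) \<in> borel_measurable ?D" if "j < p" for j using comp[OF that] by simp
    fix a :: "nat \<Rightarrow> real"
    let ?v = "\<Sum>i<p. \<Sum>j<p. a i * S i j * a j"
    have dd: "distr ?D lborel (\<lambda>x. \<Sum>j<p. a j * x j) = distr M lborel (\<lambda>\<omega>. \<Sum>j<p. a j * X j \<omega>)"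
      using distr_distr[of "\<lambda>x. \<Sum>j<p. a j * x j" "Pi\<^sub>M {..<p} (\<lambda>_. borel :: real measure)" lborel ?R M] lm[of a] R
      by (simp add: o_def ls)
    have ae: "(AE x in ?D. (\<Sum>j<p. a j * x j) = 0) \<longleftrightarrow> (AE \<omega> in M. (\<Sum>j<p. a j * X j \<omega>) = 0)"
    proof (subst AE_distr_iff[OF R])
      show "{x \<in> space (Pi\<^sub>M {..<p} (\<lambda>_. borel)). (\<Sum>j<p. a j * x j) = 0} \<in> sets (Pi\<^sub>M {..<p} (\<lambda>_. borel :: real measure))"
        using lm[of a] by measurable
    qed (simp add: ls)
    have m1: "(\<lambda>x. \<Sum>j<p. a j * x j) \<in> borel_measurable ?D" using lm[of a] by simp
    show "(?v > 0 \<and> distributed ?D lborel (\<lambda>x. \<Sum>j<p. a j * x j) (\<lambda>x. ennreal (normal_density 0 (sqrt ?v) x)))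
        \<or> (?v = 0 \<and> (AE x in ?D. (\<Sum>j<p. a j * x j) = 0))"
      using assms unfolding gaussian_vec_def Let_def ae
      using dd m1 by (auto simp: distributed_def)
  qed
qed

lemma rank_error_cong:
  assumes "\<And>k j. k < n \<Longrightarrow> j < p \<Longrightarrow> x k j = x' k j"
  shows "rank_error n p x = rank_error n p x'"
proof -
  have r: "rank_of n x i j = rank_of n x' i j" if "i < n" "j < p" for i j
    unfolding rank_of_eq using assms that by (intro arg_cong2[of _ _ _ _ "(+)"] sum.cong refl) auto
  show ?thesis unfolding rank_error_def
    by (intro arg_cong2[of _ _ _ _ "(/)"] sum.cong refl)
      (use assms in \<open>auto simp: rank_mat_def r grades_def grade_def\<close>)
qed

lemma rank_error_nonneg: "0 \<le> rank_error n p x"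
  by (simp add: rank_error_def sum_nonneg)

lemma res_grades_cong:
  assumes "\<And>k j. k < n \<Longrightarrow> j < p \<Longrightarrow> x k j = x' k j"
  shows "res p (cov n (grades x)) l = res p (cov n (grades x')) l"
  by (rule res_cong) (use assms in \<open>auto simp: cov_def grades_def grade_def\<close>)

definition eigs :: "nat \<Rightarrow> (nat \<Rightarrow> nat \<Rightarrow> real) \<Rightarrow> real list" where
  "eigs p A = (SOME es. length es = p \<and> cpoly p A = (\<Prod>e\<leftarrow>es. [:- e, 1:]) \<and> (\<forall>e\<in>set es. 0 \<le> e))"

lemma eigs:
  assumes "psd p A"
  shows "length (eigs p A) = p" "cpoly p A = (\<Prod>e\<leftarrow>eigs p A. [:- e, 1:])" "\<forall>e\<in>set (eigs p A). 0 \<le> e"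
proof -
  have "\<exists>es. length es = p \<and> cpoly p A = (\<Prod>e\<leftarrow>es. [:- e, 1:]) \<and> (\<forall>e\<in>set es. 0 \<le> e)"
    using psd_eigenvalues[OF assms] by metis
  from someI_ex[OF this] show "length (eigs p A) = p" "cpoly p A = (\<Prod>e\<leftarrow>eigs p A. [:- e, 1:])" "\<forall>e\<in>set (eigs p A). 0 \<le> e"
    unfolding eigs_def[symmetric] by blast+
qed

section \<open>The triangular array on the given probability space\<close>

locale spearman_array = prob_space M for M :: "'w measure" +
  fixes p :: "nat \<Rightarrow> nat"
    and \<Sigma> :: "nat \<Rightarrow> nat \<Rightarrow> nat \<Rightarrow> real"
    and X :: "nat \<Rightarrow> nat \<Rightarrow> nat \<Rightarrow> 'w \<Rightarrow> real"
    and y C :: real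
    and H :: "real measure"
  assumes sym: "\<And>n i j. i < p n \<Longrightarrow> j < p n \<Longrightarrow> \<Sigma> n i j = \<Sigma> n j i"
    and diag: "\<And>n i. i < p n \<Longrightarrow> \<Sigma> n i i = 1"
    and gauss: "\<And>n k. k < n \<Longrightarrow> gaussian_vec M (p n) (\<Sigma> n) (X n k)"
    and indep: "\<And>n. indep_vars (\<lambda>_. Pi\<^sub>M {..<p n} (\<lambda>_. borel))
                   (\<lambda>k \<omega>. restrict (\<lambda>j. X n k j \<omega>) {..<p n}) {..<n}"
    and ratio: "(\<lambda>n. real (p n) / real n) \<longlonglongrightarrow> y" and y: "y > 0"
    and norm: "\<And>n. spec_norm_le (p n) (\<Sigma> n) C"
    and H: "real_distribution H"
    and esdH: "weak_conv (\<lambda>n. esd (p n) (\<lambda>i j. 6 / pi * arcsin (\<Sigma> n i j / 2))) (cdf H)"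
begin

text \<open>The finitely many other indices are degenerate (an empty spectrum, or no rank scaling), and the sequences
  below take placeholder values there.\<close>
definition good :: "nat \<Rightarrow> bool" where "good n \<longleftrightarrow> p n > 0 \<and> n \<ge> 2"

lemma ratio_lower: "\<forall>\<^sub>F n in sequentially. y / 2 * real n \<le> real (p n)"
proof -
  have "\<forall>\<^sub>F n in sequentially. y / 2 < real (p n) / real n"
    using ratio y by (intro order_tendstoD) auto
  with eventually_gt_at_top[of 0] show ?thesis
    by eventually_elim (simp add: field_simps)
qed

lemma eventually_good: "\<forall>\<^sub>F n in sequentially. good n"
  using ratio_lower eventually_ge_at_top[of 2]
proof eventually_elim
  case (elim n)
  then have "0 < y / 2 * real n" using y by simp
  then show ?case using elim by (auto simp: good_def intro: gr0I)
qed

definition "obs n k \<omega> = restrict (\<lambda>j. X n k j \<omega>) {..<p n}"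

lemma obs_measurable: "k < n \<Longrightarrow> obs n k \<in> M \<rightarrow>\<^sub>M Pi\<^sub>M {..<p n} (\<lambda>_. borel)"
  unfolding obs_def[abs_def] using gauss[of k n] by (intro measurable_restrict) (simp add: gaussian_vec_def)

text \<open>The law of row \<open>k\<close>; indices \<open>k \<ge> n\<close> only have to give some probability space.\<close>
definition "N n k = distr M (Pi\<^sub>M {..<p n} (\<lambda>_. borel)) (obs n (if k < n then k else 0))"

lemma sample:
  assumes g: "good n"
  shows "gaussian_sample (N n) (p n) n (\<Sigma> n) C"
proof (rule gaussian_sample.intro)
  from g have n: "n > 0" and p: "p n > 0" by (auto simp: good_def)
  show "p n > 0" "n > 0" by fact+
  show "prob_space (N n k)" for k
    unfolding N_def by (rule prob_space_distr) (use obs_measurable n in auto)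
  show "sets (N n k) = sets (Pi\<^sub>M {..<p n} (\<lambda>_. borel))" for k by (simp add: N_def)
  fix k assume k: "k < n"
  interpret K: prob_space "N n k" unfolding N_def by (rule prob_space_distr) (use obs_measurable n in auto)
  show "gaussian_vector (N n k) (p n) (\<Sigma> n) (\<lambda>j x. x j) C"
  proof (intro gaussian_vector.intro gaussian_vector_axioms.intro K.prob_space_axioms)
    show "gaussian_vec (N n k) (p n) (\<Sigma> n) (\<lambda>j x. x j)"
      using gaussian_vec_distr[OF gauss[OF k]] k by (simp add: N_def obs_def[abs_def])
  qed (use sym diag norm in auto)
qed

definition "sample_map n \<omega> = (\<lambda>k\<in>{..<n}. obs n k \<omega>)"

lemma sample_map_apply: "k < n \<Longrightarrow> j < p n \<Longrightarrow> sample_map n \<omega> k j = X n k j \<omega>"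
  by (simp add: sample_map_def obs_def)

text \<open>Independence of the rows says that their joint law is the product measure; the estimates
  proved there thereby become statements about the given array.\<close>

lemma sample_map_distr:
  assumes "good n"
  shows "sample_map n \<in> M \<rightarrow>\<^sub>M Pi\<^sub>M {..<n} (N n)" "distr M (Pi\<^sub>M {..<n} (N n)) (sample_map n) = Pi\<^sub>M {..<n} (N n)"
proof -
  have n: "n > 0" using assms by (auto simp: good_def)
  let ?B = "Pi\<^sub>M {..<p n} (\<lambda>_. borel :: real measure)"
  have ne: "{..<n} \<noteq> {}" using n by auto
  have sets: "sets (Pi\<^sub>M {..<n} (N n)) = sets (Pi\<^sub>M {..<n} (\<lambda>_. ?B))"
    by (rule sets_PiM_cong) (simp_all add: N_def)
  have "sample_map n \<in> M \<rightarrow>\<^sub>M Pi\<^sub>M {..<n} (\<lambda>_. ?B)"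
    unfolding sample_map_def[abs_def] by (intro measurable_restrict obs_measurable) simp
  then show "sample_map n \<in> M \<rightarrow>\<^sub>M Pi\<^sub>M {..<n} (N n)"
    using measurable_cong_sets[OF refl sets, of M] by simp
  have "distr M (Pi\<^sub>M {..<n} (\<lambda>_. ?B)) (sample_map n) = Pi\<^sub>M {..<n} (\<lambda>k. distr M ?B (obs n k))"
    using indep_vars_iff_distr_eq_PiM'[OF ne, of "obs n" "\<lambda>_. ?B"] obs_measurable indep[of n]
    unfolding sample_map_def[abs_def] obs_def[abs_def] by simp
  moreover have "Pi\<^sub>M {..<n} (\<lambda>k. distr M ?B (obs n k)) = Pi\<^sub>M {..<n} (N n)"
    by (rule PiM_cong) (simp_all add: N_def)
  moreover have "distr M (Pi\<^sub>M {..<n} (N n)) (sample_map n) = distr M (Pi\<^sub>M {..<n} (\<lambda>_. ?B)) (sample_map n)"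
    by (rule distr_cong) (simp_all add: sets)
  ultimately show "distr M (Pi\<^sub>M {..<n} (N n)) (sample_map n) = Pi\<^sub>M {..<n} (N n)" by simp
qed

lemma prob_sample_map:
  assumes g: "good n" and [measurable]: "f \<in> borel_measurable (Pi\<^sub>M {..<n} (N n))"
  shows "prob {\<omega> \<in> space M. e \<le> f (sample_map n \<omega>)} = measure (Pi\<^sub>M {..<n} (N n)) {x \<in> space (Pi\<^sub>M {..<n} (N n)). e \<le> (f x :: real)}"
proof -
  let ?P = "Pi\<^sub>M {..<n} (N n)"
  have "measure ?P {x \<in> space ?P. e \<le> f x} = measure (distr M ?P (sample_map n)) {x \<in> space ?P. e \<le> f x}"
    by (simp only: sample_map_distr(2)[OF g])
  also have "\<dots> = prob (sample_map n -` {x \<in> space ?P. e \<le> f x} \<inter> space M)"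
    by (rule measure_distr[OF sample_map_distr(1)[OF g]]) measurable
  also have "sample_map n -` {x \<in> space ?P. e \<le> f x} \<inter> space M = {\<omega> \<in> space M. e \<le> f (sample_map n \<omega>)}"
    using measurable_space[OF sample_map_distr(1)[OF g]] by auto
  finally show ?thesis by simp
qed

abbreviation "data n \<omega> \<equiv> \<lambda>k j. X n k j \<omega>"

definition "grade_trace n l \<omega> = tr (p n) (res (p n) (cov n (grades (data n \<omega>))) l)"
definition "mean n l = (\<integral>x. tr (p n) (res (p n) (cov n (grades x)) l) \<partial>Pi\<^sub>M {..<n} (N n))"
definition "trace_dev l n \<omega> = (if good n then (grade_trace n l \<omega> - mean n l) / real (p n) else 0)"
definition "rank_dev n \<omega> = (if good n then rank_error n (p n) (data n \<omega>) else 0)"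

lemma grade_trace_Zmap: "grade_trace n l \<omega> = tr (p n) (res (p n) (cov n (grades (sample_map n \<omega>))) l)"
  unfolding grade_trace_def by (subst res_grades_cong[of n "p n" "data n \<omega>" "sample_map n \<omega>"]) (simp_all add: sample_map_apply)

lemma rank_error_sample_map: "rank_error n (p n) (data n \<omega>) = rank_error n (p n) (sample_map n \<omega>)"
  by (rule rank_error_cong) (simp add: sample_map_apply)

lemma AE_trace_dev:
  assumes l: "l > 0"
  shows "AE \<omega> in M. (\<lambda>n. trace_dev l n \<omega>) \<longlonglongrightarrow> 0"
proof (rule exponential_tail_imp_AE_tendsto_0)
  have R: "gaussian_resolvent (N n) (p n) n (\<Sigma> n) C l" if "good n" for n
    using sample[OF that] l by (simp add: gaussian_resolvent_def gaussian_resolvent_axioms_def)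
  have tm: "(\<lambda>x. tr (p n) (res (p n) (cov n (grades x)) l)) \<in> borel_measurable (Pi\<^sub>M {..<n} (N n))" if "good n" for n
    using bm_measurable[OF gaussian_resolvent.bm_tr[OF R[OF that]]] unfolding gaussian_resolvent.Q_def[OF R[OF that]] .
  show "trace_dev l n \<in> borel_measurable M" for n
  proof (cases "good n")
    case True
    have [measurable]: "grade_trace n l \<in> borel_measurable M"
      unfolding grade_trace_Zmap[abs_def] by (rule measurable_compose[OF sample_map_distr(1)[OF True] tm[OF True]])
    show ?thesis using True unfolding trace_dev_def[abs_def] by simp
  qed (simp add: trace_dev_def[abs_def])
  fix \<epsilon> :: real assume e: "\<epsilon> > 0"
  \<comment> \<open>Eventually \<open>p n \<ge> y / 2 * n\<close>, and inserting this into the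
    exponent \<open>2 * (\<epsilon> * p)\<^sup>2 * l\<^sup>2 / n\<close> of \<open>tr_tail\<close>
    gives \<open>c * n\<close>.\<close>
  define c where "c = \<epsilon>\<^sup>2 * l\<^sup>2 * y\<^sup>2 / 2"
  have c: "c > 0" using e l y by (simp add: c_def)
  have "\<forall>\<^sub>F n in sequentially. prob {x \<in> space M. \<epsilon> \<le> \<bar>trace_dev l n x\<bar>} \<le> 2 * exp (- c * real n)"
    using eventually_good ratio_lower
  proof eventually_elim
    case (elim n)
    interpret R: gaussian_resolvent "N n" "p n" n "\<Sigma> n" C l by (rule R[OF elim(1)])
    have p: "real (p n) > 0" using R.p by simp
    have tmean: "R.tmean = mean n l" by (simp add: R.tmean_def R.Q_def mean_def)
    note [measurable] = tm[OF elim(1)]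
    have "{x \<in> space M. \<epsilon> \<le> \<bar>trace_dev l n x\<bar>}
       = {\<omega> \<in> space M. \<epsilon> * real (p n) \<le> \<bar>tr (p n) (res (p n) (cov n (grades (sample_map n \<omega>))) l) - mean n l\<bar>}"
      using elim(1) p by (simp add: trace_dev_def grade_trace_Zmap abs_divide pos_le_divide_eq)
    then have "prob {x \<in> space M. \<epsilon> \<le> \<bar>trace_dev l n x\<bar>}
      = measure (Pi\<^sub>M {..<n} (N n)) {x \<in> space (Pi\<^sub>M {..<n} (N n)). \<epsilon> * real (p n) \<le> \<bar>tr (p n) (R.Q x) - R.tmean\<bar>}"
      using prob_sample_map[OF elim(1), of "\<lambda>x. \<bar>tr (p n) (res (p n) (cov n (grades x)) l) - mean n l\<bar>" "\<epsilon> * real (p n)"]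
      by (simp add: R.Q_def tmean)
    also have "\<dots> \<le> 2 * exp (- 2 * (\<epsilon> * real (p n))\<^sup>2 * l\<^sup>2 / real n)"
      by (rule R.tr_tail) (use e p in simp)
    also have "\<dots> \<le> 2 * exp (- c * real n)"
    proof -
      have "(y / 2 * real n)\<^sup>2 \<le> (real (p n))\<^sup>2" using elim(2) y by (intro power_mono) auto
      then have "2 * \<epsilon>\<^sup>2 * l\<^sup>2 / real n * (y / 2 * real n)\<^sup>2 \<le> 2 * \<epsilon>\<^sup>2 * l\<^sup>2 / real n * (real (p n))\<^sup>2"
        by (rule mult_left_mono) simp
      moreover have "2 * \<epsilon>\<^sup>2 * l\<^sup>2 / real n * (y / 2 * real n)\<^sup>2 = c * real n"
        using R.n by (simp add: c_def power2_eq_square)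
      moreover have "2 * \<epsilon>\<^sup>2 * l\<^sup>2 / real n * (real (p n))\<^sup>2 = 2 * (\<epsilon> * real (p n))\<^sup>2 * l\<^sup>2 / real n"
        by (simp add: power_mult_distrib mult_ac)
      ultimately have "c * real n \<le> 2 * (\<epsilon> * real (p n))\<^sup>2 * l\<^sup>2 / real n" by metis
      then show ?thesis by simp
    qed
    finally show ?case .
  qed
  then show "\<exists>c>0. \<exists>K. \<forall>\<^sub>F n in sequentially. prob {x \<in> space M. \<epsilon> \<le> \<bar>trace_dev l n x\<bar>} \<le> K * exp (- c * real n)"
    using c by blast
qed

lemma AE_rank_dev: "AE \<omega> in M. (\<lambda>n. rank_dev n \<omega>) \<longlonglongrightarrow> 0"
proof (rule exponential_tail_imp_AE_tendsto_0)
  have rm: "rank_error n (p n) \<in> borel_measurable (Pi\<^sub>M {..<n} (N n))" if "good n" for n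
    by (rule bm_measurable[OF gaussian_sample.bm_rank_error[OF sample[OF that]]])
  show "rank_dev n \<in> borel_measurable M" for n
  proof (cases "good n")
    case True
    show ?thesis using True unfolding rank_dev_def[abs_def] rank_error_sample_map
      using measurable_compose[OF sample_map_distr(1)[OF True] rm[OF True]] by simp
  qed (simp add: rank_dev_def[abs_def])
  fix \<epsilon> :: real assume e: "\<epsilon> > 0"
  \<comment> \<open>Half of \<epsilon> absorbs the mean \<open>48 / n\<close>; the other half is the
    deviation.\<close>
  define c where "c = (\<epsilon> / 2)\<^sup>2 / 968"
  have c: "c > 0" using e by (simp add: c_def)
  have "(\<lambda>n. 48 / real n) \<longlonglongrightarrow> 0" by real_asymp
  then have "\<forall>\<^sub>F n in sequentially. 48 / real n < \<epsilon> / 2" using e by (intro order_tendstoD) auto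
  with eventually_good
  have "\<forall>\<^sub>F n in sequentially. prob {x \<in> space M. \<epsilon> \<le> \<bar>rank_dev n x\<bar>} \<le> 1 * exp (- c * real n)"
  proof eventually_elim
    case (elim n)
    interpret R: gaussian_sample "N n" "p n" n "\<Sigma> n" C by (rule sample[OF elim(1)])
    have n2: "n \<ge> 2" using elim(1) by (simp add: good_def)
    note [measurable] = rm[OF elim(1)]
    have "{x \<in> space M. \<epsilon> \<le> \<bar>rank_dev n x\<bar>} = {\<omega> \<in> space M. \<epsilon> \<le> rank_error n (p n) (sample_map n \<omega>)}"
      using elim(1) by (simp add: rank_dev_def rank_error_sample_map rank_error_nonneg)
    then have "prob {x \<in> space M. \<epsilon> \<le> \<bar>rank_dev n x\<bar>}
      = measure (Pi\<^sub>M {..<n} (N n)) {x \<in> space (Pi\<^sub>M {..<n} (N n)). \<epsilon> \<le> rank_error n (p n) x}"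
      using prob_sample_map[OF elim(1) rm[OF elim(1)]] by simp
    also have "\<dots> \<le> measure (Pi\<^sub>M {..<n} (N n)) {x \<in> space (Pi\<^sub>M {..<n} (N n)). \<epsilon> / 2 + 48 / real n \<le> rank_error n (p n) x}"
      using elim(2) by (intro R.PS.finite_measure_mono) auto
    also have "\<dots> \<le> exp (- (\<epsilon> / 2)\<^sup>2 * real n / 968)"
      by (rule R.rank_error_tail[OF n2]) (use e in simp)
    also have "\<dots> = 1 * exp (- c * real n)" by (simp add: c_def)
    finally show ?case .
  qed
  then show "\<exists>c>0. \<exists>K. \<forall>\<^sub>F n in sequentially. prob {x \<in> space M. \<epsilon> \<le> \<bar>rank_dev n x\<bar>} \<le> K * exp (- c * real n)"
    using c by blast
qed

definition "esd_arcsin n = emp (if good n then eigs (p n) (arcsin_cov (\<Sigma> n)) else [0])"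

lemma esd_arcsin_real_distribution: "real_distribution (esd_arcsin n)"
  unfolding esd_arcsin_def by (rule real_distribution_emp)

lemma esd_arcsin_weak: "weak_conv_m esd_arcsin H"
  unfolding weak_conv_m_def weak_conv_def
proof (intro allI impI)
  fix x assume "isCont (cdf H) x"
  then have "(\<lambda>n. esd (p n) (arcsin_cov (\<Sigma> n)) x) \<longlonglongrightarrow> cdf H x"
    using esdH by (simp add: weak_conv_def arcsin_cov_def[abs_def])
  moreover have "\<forall>\<^sub>F n in sequentially. esd (p n) (arcsin_cov (\<Sigma> n)) x = cdf (esd_arcsin n) x"
    using eventually_good
  proof eventually_elim
    case (elim n)
    interpret R: gaussian_sample "N n" "p n" n "\<Sigma> n" C by (rule sample[OF elim])
    show ?case using elim esd_eq_cdf[OF eigs(2,1)[OF R.T_psd] R.p] by (simp add: esd_arcsin_def)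
  qed
  ultimately show "(\<lambda>n. cdf (esd_arcsin n) x) \<longlonglongrightarrow> cdf H x" by (simp cong: tendsto_cong)
qed

text \<open>The bound \<open>C \<ge> 1\<close> comes from the unit diagonal and is known at good
  indices; the absolute value lets the same interval contain the placeholder point 0 at all
  others.\<close>

lemma esd_arcsin_support: "AE t in esd_arcsin n. t \<in> {0..12 * \<bar>C\<bar>}"
proof (cases "good n")
  case True
  interpret R: gaussian_sample "N n" "p n" n "\<Sigma> n" C by (rule sample[OF True])
  have "AE t in emp (eigs (p n) (arcsin_cov (\<Sigma> n))). t \<in> {0..12 * \<bar>C\<bar>}"
  proof (rule AE_emp)
    show "eigs (p n) (arcsin_cov (\<Sigma> n)) \<noteq> []" using eigs(1)[OF R.T_psd] R.p by auto
    fix e assume e: "e \<in> set (eigs (p n) (arcsin_cov (\<Sigma> n)))"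
    have "e \<le> 12 * C" by (rule eigenvalue_upper[OF eigs(2)[OF R.T_psd] e R.T_upper])
    then show "e \<in> {0..12 * \<bar>C\<bar>}" using eigs(3)[OF R.T_psd] e by auto
  qed simp
  then show ?thesis using True by (simp only: esd_arcsin_def if_True)
next
  case False
  have "AE t in emp [0]. t \<in> {0..12 * \<bar>C\<bar>}" by (rule AE_emp) auto
  then show ?thesis using False by (simp only: esd_arcsin_def if_False)
qed

lemma H_support: "AE t in H. t \<in> {0..12 * \<bar>C\<bar>}"
  by (rule weak_limit_support[OF esd_arcsin_real_distribution H esd_arcsin_weak _ esd_arcsin_support]) auto

section \<open>Limit of the expected traces\<close>

lemma error_tendsto_0:
  assumes l: "l > 0"
  shows "(\<lambda>n. 12 * C / (l\<^sup>2 * real (p n)) + 3 / l\<^sup>2 * (2 * ((12 * sqrt (C * real (p n)) + 12 * C) / (l * real n)) + 1 / sqrt (real n))) \<longlonglongrightarrow> 0"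
proof -
  have i: "(\<lambda>n. 1 / real n) \<longlonglongrightarrow> 0" and s: "(\<lambda>n. 1 / sqrt (real n)) \<longlonglongrightarrow> 0" by real_asymp+
  have pinv: "(\<lambda>n. 1 / real (p n)) \<longlonglongrightarrow> 0"
  proof -
    have "(\<lambda>n. inverse (real (p n) / real n) * (1 / real n)) \<longlonglongrightarrow> inverse y * 0"
      using y by (intro tendsto_mult tendsto_inverse ratio i) auto
    moreover have "\<forall>\<^sub>F n in sequentially. inverse (real (p n) / real n) * (1 / real n) = 1 / real (p n)"
      using eventually_gt_at_top[of 0] by eventually_elim (simp add: field_simps)
    ultimately have "(\<lambda>n. 1 / real (p n)) \<longlonglongrightarrow> inverse y * 0" by (rule Lim_transform_eventually)
    then show ?thesis by simp
  qed
  have sq: "(\<lambda>n. sqrt (C * real (p n)) / real n) \<longlonglongrightarrow> 0"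
  proof -
    have "(\<lambda>n. sqrt (C * (real (p n) / real n)) * (1 / sqrt (real n))) \<longlonglongrightarrow> sqrt (C * y) * 0"
      by (intro tendsto_intros ratio s)
    moreover have "sqrt (C * (real (p n) / real n)) * (1 / sqrt (real n)) = sqrt (C * real (p n)) / real n" for n
      by (simp add: real_sqrt_mult real_sqrt_divide)
    ultimately show ?thesis by simp
  qed
  have "(\<lambda>n. 12 * C / l\<^sup>2 * (1 / real (p n)) + 3 / l\<^sup>2 * (2 * (12 / l * (sqrt (C * real (p n)) / real n) + 12 * C / l * (1 / real n)) + 1 / sqrt (real n)))
     \<longlonglongrightarrow> 12 * C / l\<^sup>2 * 0 + 3 / l\<^sup>2 * (2 * (12 / l * 0 + 12 * C / l * 0) + 0)"
    by (intro tendsto_add tendsto_mult tendsto_const pinv sq i s)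
  then show ?thesis by (simp add: add_divide_distrib)
qed

text \<open>\<open>b n\<close> is an affine function of the expected normalised trace, and the
  deterministic equivalent expresses that trace through \<open>b n\<close> and the spectrum of the
  arcsine matrix. So \<open>b\<close> solves the limiting equation up to \<open>o(1)\<close>, as
  \<open>fixed_point_convergence\<close> asks.\<close>

lemma mean_limit:
  assumes l: "l > 0"
  shows "\<exists>m. (\<lambda>n. mean n l / real (p n)) \<longlonglongrightarrow> m \<and> 0 \<le> 1 - y + y * l * m
    \<and> m = (\<integral>t. 1 / ((1 - y + y * l * m) * t + l) \<partial>H)"
proof -
  define b where "b n = (if good n then 1 - real (p n) / real n + l / real n * mean n l else 0)" for n
  define \<kappa> where "\<kappa> n = real (p n) / real n" for n
  define I where "I n = (\<integral>t. 1 / (b n * t + l) \<partial>esd_arcsin n)" for n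
  have R: "gaussian_resolvent (N n) (p n) n (\<Sigma> n) C l" if "good n" for n
    using sample[OF that] l by (simp add: gaussian_resolvent_def gaussian_resolvent_axioms_def)
  have key: "b n \<in> {0<..1} \<and> \<bar>mean n l / real (p n) - I n\<bar> \<le> 12 * C / (l\<^sup>2 * real (p n)) + 3 / l\<^sup>2 * (2 * ((12 * sqrt (C * real (p n)) + 12 * C) / (l * real n)) + 1 / sqrt (real n))"
    if g: "good n" for n
  proof -
    interpret R: gaussian_resolvent "N n" "p n" n "\<Sigma> n" C l by (rule R[OF g])
    have tmean: "R.tmean = mean n l" by (simp add: R.tmean_def R.Q_def mean_def)
    have bn: "b n = R.b" using g by (simp add: b_def R.b_def tmean)
    have "I n = tr (p n) R.K / real (p n)"
      unfolding I_def bn R.K_def esd_arcsin_def using g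
      by (simp add: integral_emp_resolvent[OF R.T_psd l R.b_bounds(1) R.p eigs(2,3,1)[OF R.T_psd]])
    then show ?thesis using R.deterministic_equivalent R.b_bounds unfolding tmean R.\<delta>_def by (simp add: bn)
  qed
  have diff0: "(\<lambda>n. mean n l / real (p n) - I n) \<longlonglongrightarrow> 0"
  proof (rule Lim_null_comparison[OF _ error_tendsto_0[OF l]])
    show "\<forall>\<^sub>F n in sequentially. norm (mean n l / real (p n) - I n) \<le> 12 * C / (l\<^sup>2 * real (p n)) + 3 / l\<^sup>2 * (2 * ((12 * sqrt (C * real (p n)) + 12 * C) / (l * real n)) + 1 / sqrt (real n))"
      using eventually_good by eventually_elim (use key in auto)
  qed
  have b01: "b n \<in> {0..1}" for n using key[of n] by (cases "good n") (auto simp: b_def)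
  have k: "\<kappa> \<longlonglongrightarrow> y" unfolding \<kappa>_def by (rule ratio)
  have fp: "(\<lambda>n. b n - (1 - \<kappa> n + \<kappa> n * l * (\<integral>t. 1 / (b n * t + l) \<partial>esd_arcsin n))) \<longlonglongrightarrow> 0"
  proof -
    have "(\<lambda>n. \<kappa> n * l * (mean n l / real (p n) - I n)) \<longlonglongrightarrow> y * l * 0"
      by (intro tendsto_mult k tendsto_const diff0)
    moreover have "\<forall>\<^sub>F n in sequentially. \<kappa> n * l * (mean n l / real (p n) - I n) = b n - (1 - \<kappa> n + \<kappa> n * l * I n)"
      using eventually_good
    proof eventually_elim
      case (elim n)
      then have "\<kappa> n * l * (mean n l / real (p n)) = l / real n * mean n l" by (simp add: \<kappa>_def good_def)
      then show ?case using elim by (simp add: b_def \<kappa>_def[symmetric] right_diff_distrib)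
    qed
    ultimately have "(\<lambda>n. b n - (1 - \<kappa> n + \<kappa> n * l * I n)) \<longlonglongrightarrow> y * l * 0" by (rule Lim_transform_eventually)
    then show ?thesis by (simp add: I_def)
  qed
  obtain \<beta> where \<beta>: "\<beta> \<in> {0..1}" "b \<longlonglongrightarrow> \<beta>" "\<beta> = 1 - y + y * l * (\<integral>t. 1 / (\<beta> * t + l) \<partial>H)"
    "(\<lambda>n. \<integral>t. 1 / (b n * t + l) \<partial>esd_arcsin n) \<longlonglongrightarrow> (\<integral>t. 1 / (\<beta> * t + l) \<partial>H)"
    using fixed_point_convergence[OF esd_arcsin_real_distribution H esd_arcsin_weak esd_arcsin_support _ k y l b01 fp] by auto
  define m where "m = (\<integral>t. 1 / (\<beta> * t + l) \<partial>H)"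
  have "(\<lambda>n. (mean n l / real (p n) - I n) + I n) \<longlonglongrightarrow> 0 + m"
    using \<beta>(4) unfolding I_def[symmetric] m_def[symmetric] by (intro tendsto_add diff0)
  then have lim: "(\<lambda>n. mean n l / real (p n)) \<longlonglongrightarrow> m" by simp
  have \<beta>m: "1 - y + y * l * m = \<beta>" using \<beta>(3) by (simp only: m_def)
  have "(\<lambda>n. mean n l / real (p n)) \<longlonglongrightarrow> m \<and> 0 \<le> 1 - y + y * l * m
    \<and> m = (\<integral>t. 1 / ((1 - y + y * l * m) * t + l) \<partial>H)"
    unfolding \<beta>m using lim \<beta>(1) by (simp add: m_def)
  then show ?thesis by blast
qed

definition "mlim l = (SOME m. (\<lambda>n. mean n l / real (p n)) \<longlonglongrightarrow> m \<and> 0 \<le> 1 - y + y * l * m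
    \<and> m = (\<integral>t. 1 / ((1 - y + y * l * m) * t + l) \<partial>H))"

lemma mlim:
  assumes "l > 0"
  shows "(\<lambda>n. mean n l / real (p n)) \<longlonglongrightarrow> mlim l" "0 \<le> 1 - y + y * l * mlim l"
    "mlim l = (\<integral>t. 1 / ((1 - y + y * l * mlim l) * t + l) \<partial>H)"
proof -
  note * = someI_ex[OF mean_limit[OF assms], folded mlim_def]
  from * show "(\<lambda>n. mean n l / real (p n)) \<longlonglongrightarrow> mlim l" by (rule conjunct1)
  from * show "0 \<le> 1 - y + y * l * mlim l" by (rule conjunct1[OF conjunct2])
  from * show "mlim l = (\<integral>t. 1 / ((1 - y + y * l * mlim l) * t + l) \<partial>H)" by (rule conjunct2[OF conjunct2])
qed

definition "regular \<omega> \<longleftrightarrow> (\<forall>q\<in>{q \<in> \<rat>. q > 0}. (\<lambda>n. trace_dev q n \<omega>) \<longlonglongrightarrow> 0) \<and> (\<lambda>n. rank_dev n \<omega>) \<longlonglongrightarrow> 0"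

text \<open>Only rational \<open>q\<close> are involved, so countably many null sets are discarded.
  What follows is deterministic for each regular outcome.\<close>

lemma AE_regular: "AE \<omega> in M. regular \<omega>"
proof -
  have "countable {q :: real. q \<in> \<rat> \<and> q > 0}" by (rule countable_subset[OF _ countable_rat]) auto
  then have "AE \<omega> in M. \<forall>q\<in>{q \<in> \<rat>. q > 0}. (\<lambda>n. trace_dev q n \<omega>) \<longlonglongrightarrow> 0"
    by (subst AE_ball_countable) (auto intro: AE_trace_dev)
  then show ?thesis using AE_rank_dev by eventually_elim (simp add: regular_def)
qed

definition "esd_spearman n \<omega> = emp (if good n then eigs (p n) (spearman n (data n \<omega>)) else [0])"

lemma esd_spearman_real_distribution: "real_distribution (esd_spearman n \<omega>)"
  unfolding esd_spearman_def by (rule real_distribution_emp)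

lemma spearman_psd: "psd k (spearman n x)" unfolding spearman_cov by (rule cov_psd)

lemma esd_spearman_support: "AE x in esd_spearman n \<omega>. x \<in> {0..}"
proof (cases "good n")
  case True
  have "AE x in emp (eigs (p n) (spearman n (data n \<omega>))). x \<in> {0..}"
  proof (rule AE_emp)
    have "length (eigs (p n) (spearman n (data n \<omega>))) > 0" using eigs(1)[OF spearman_psd] True by (simp add: good_def)
    then show "eigs (p n) (spearman n (data n \<omega>)) \<noteq> []" by (rule length_greater_0_conv[THEN iffD1])
  qed (use eigs(3)[OF spearman_psd] in auto)
  then show ?thesis using True by (simp only: esd_spearman_def if_True)
next
  case False
  have "AE x in emp [0]. x \<in> {0..}" by (rule AE_emp) auto
  then show ?thesis using False by (simp only: esd_spearman_def if_False)
qed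

lemma esd_spearman_resolvent:
  assumes \<omega>: "regular \<omega>" and q: "q \<in> \<rat>" "q > 0"
  shows "(\<lambda>n. \<integral>x. 1 / (x + q) \<partial>esd_spearman n \<omega>) \<longlonglongrightarrow> mlim q"
proof -
  have d0: "(\<lambda>n. (\<integral>x. 1 / (x + q) \<partial>esd_spearman n \<omega>) - grade_trace n q \<omega> / real (p n)) \<longlonglongrightarrow> 0"
  proof (rule tendstoI)
    fix r :: real assume r: "r > 0"
    \<comment> \<open>Once the rank error is below \<open>e * e\<close>, the stability bound is at
      most \<open>(e + 3 * e) / q\<^sup>2 = r / 2\<close>.\<close>
    define e where "e = r * q\<^sup>2 / 8"
    have e: "e > 0" using r q by (simp add: e_def)
    have "\<forall>\<^sub>F n in sequentially. rank_dev n \<omega> < e * e"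
      using \<omega> e by (intro order_tendstoD[where y = 0]) (auto simp: regular_def)
    with eventually_good
    show "\<forall>\<^sub>F n in sequentially. dist ((\<integral>x. 1 / (x + q) \<partial>esd_spearman n \<omega>) - grade_trace n q \<omega> / real (p n)) 0 < r"
    proof eventually_elim
      case (elim n)
      then have n: "n > 0" "n \<ge> 2" and p: "p n > 0" by (auto simp: good_def)
      let ?w = "rank_mat n (data n \<omega>)" and ?u = "grades (data n \<omega>)"
      have one: "(0::real) < 1" by simp
      note sp = spearman_psd[of "p n" n "data n \<omega>"]
      have "(\<integral>x. 1 / (x + q) \<partial>esd_spearman n \<omega>) = tr (p n) (res (p n) (cov n ?w) q) / real (p n)"
        using integral_emp_resolvent[OF sp q(2) one p eigs(2)[OF sp] eigs(3)[OF sp] eigs(1)[OF sp]] elim(1)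
        by (simp add: esd_spearman_def spearman_cov)
      then have "\<bar>(\<integral>x. 1 / (x + q) \<partial>esd_spearman n \<omega>) - grade_trace n q \<omega> / real (p n)\<bar>
         = \<bar>tr (p n) (res (p n) (cov n ?w) q) - tr (p n) (res (p n) (cov n ?u) q)\<bar> / real (p n)"
        by (simp add: grade_trace_def diff_divide_distrib[symmetric] abs_divide)
      also have "\<dots> \<le> ((\<Sum>m<n. \<Sum>j<p n. (?w m j - ?u m j)\<^sup>2) / (real n * real (p n)) / e + 3 * e) / q\<^sup>2"
      proof (rule tr_res_cov_difference[OF q(2) n(1) p e])
        show "dot (p n) (?u m) (?u m) \<le> 3 * real (p n)" for m unfolding grades_def by (rule grade_norm)
        show "dot (p n) (?w m) (?w m) \<le> 3 * real (p n)" if "m < n" for m by (rule rank_mat_norm[OF that n(2)])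
      qed simp
      also have "\<dots> = (rank_dev n \<omega> / e + 3 * e) / q\<^sup>2" using elim(1) by (simp add: rank_dev_def rank_error_def)
      also have "\<dots> \<le> (e + 3 * e) / q\<^sup>2"
        using elim(2) e by (intro divide_right_mono add_right_mono) (simp_all add: divide_le_eq)
      also have "\<dots> = r / 2" using q by (simp add: e_def)
      also have "\<dots> < r" using r by simp
      finally show ?case by (simp add: dist_norm)
    qed
  qed
  have "(\<lambda>n. trace_dev q n \<omega> + mean n q / real (p n)) \<longlonglongrightarrow> 0 + mlim q"
    using \<omega> q by (intro tendsto_add mlim) (auto simp: regular_def)
  moreover have "\<forall>\<^sub>F n in sequentially. trace_dev q n \<omega> + mean n q / real (p n) = grade_trace n q \<omega> / real (p n)"
    using eventually_good by eventually_elim (simp add: trace_dev_def diff_divide_distrib)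
  ultimately have "(\<lambda>n. grade_trace n q \<omega> / real (p n)) \<longlonglongrightarrow> 0 + mlim q" by (rule Lim_transform_eventually)
  from tendsto_add[OF d0 this] show ?thesis by simp
qed

text \<open>Holds for every outcome: scaled ranks are bounded by \<open>sqrt 3\<close>, so every row
  has squared norm at most \<open>3 * p\<close>.\<close>

lemma esd_spearman_tight: "tight (\<lambda>n. esd_spearman n \<omega>)"
  unfolding tight_def
proof (intro conjI allI impI)
  show "real_distribution (esd_spearman n \<omega>)" for n by (rule esd_spearman_real_distribution)
  fix e :: real assume e: "e > 0"
  \<comment> \<open>Makes the tail bound \<open>6 / L\<close> equal to \<open>e / 2\<close>.\<close>
  define L where "L = 12 / e"
  have L: "L > 0" using e by (simp add: L_def)
  have "1 - e < measure (esd_spearman n \<omega>) {-1<..L}" for n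
  proof (cases "good n")
    case True
    then have n: "n > 0" "n \<ge> 2" and p: "p n > 0" by (auto simp: good_def)
    have "1 - 6 / L \<le> measure (emp (eigs (p n) (cov n (rank_mat n (data n \<omega>))))) {-1<..L}"
      by (rule emp_cov_tail[OF L n(1) p rank_mat_norm[OF _ n(2)] eigs(2,3,1)[OF cov_psd]])
    moreover have "6 / L < e" using e by (simp add: L_def)
    ultimately show ?thesis using True by (simp add: esd_spearman_def spearman_cov)
  next
    case False
    interpret R: real_distribution "emp [0]" by (rule real_distribution_emp)
    have "AE x in emp [0]. x \<in> {-1<..L}" by (rule AE_emp) (use L in auto)
    then have "measure (emp [0]) {-1<..L} = 1" by (subst R.prob_eq_1) auto
    then show ?thesis using False e by (simp add: esd_spearman_def)
  qed
  then show "\<exists>a b. a < b \<and> (\<forall>n. 1 - e < measure (esd_spearman n \<omega>) {a<..b})"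
    using L by (intro exI[of _ "-1"] exI[of _ L]) auto
qed

lemma esd_spearman_limit:
  assumes \<omega>: "regular \<omega>" and s: "strict_mono s" and \<nu>: "real_distribution \<nu>"
    and w: "weak_conv_m ((\<lambda>n. esd_spearman n \<omega>) \<circ> s) \<nu>"
  shows "AE x in \<nu>. 0 \<le> x" "\<And>q. q \<in> \<rat> \<Longrightarrow> q > 0 \<Longrightarrow> (\<integral>x. 1 / (x + q) \<partial>\<nu>) = mlim q"
proof -
  let ?F = "\<lambda>n. esd_spearman (s n) \<omega>"
  have w': "weak_conv_m ?F \<nu>" using w by (simp add: o_def)
  have "AE x in \<nu>. x \<in> {0..}"
    by (rule weak_limit_support[OF esd_spearman_real_distribution \<nu> w' _ esd_spearman_support]) auto
  then show sup: "AE x in \<nu>. 0 \<le> x" by simp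
  fix q :: real assume q: "q \<in> \<rat>" "q > 0"
  \<comment> \<open>The resolvent function made bounded and continuous on the line; it is unchanged
    on the half-line that carries the measures.\<close>
  define g where "g x = 1 / (max 0 x + q)" for x
  have gc: "isCont g x" for x unfolding g_def[abs_def] using q by (intro continuous_intros) (auto simp: max_def)
  have gb: "norm (g x) \<le> 1 / q" for x unfolding g_def using q by (auto simp: abs_divide intro!: divide_left_mono mult_pos_pos add_nonneg_pos)
  have [measurable]: "g \<in> borel_measurable borel" unfolding g_def[abs_def] by measurable
  have geq: "(\<integral>x. 1 / (x + q) \<partial>M') = integral\<^sup>L M' g" if M': "real_distribution M'" and AE: "AE x in M'. 0 \<le> x" for M'
  proof -
    interpret M': real_distribution M' by (rule M')
    show ?thesis
    proof (rule integral_cong_AE)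
      show "AE x in M'. 1 / (x + q) = g x" using AE by eventually_elim (simp add: g_def)
    qed measurable
  qed
  have "(\<lambda>n. integral\<^sup>L (?F n) g) \<longlonglongrightarrow> integral\<^sup>L \<nu> g"
    by (rule weak_conv_imp_integral_bdd_continuous_conv[OF esd_spearman_real_distribution \<nu> w' gc gb])
  moreover have "integral\<^sup>L (?F n) g = (\<integral>x. 1 / (x + q) \<partial>esd_spearman (s n) \<omega>)" for n
    using esd_spearman_support[of "s n" \<omega>] by (intro geq[symmetric] esd_spearman_real_distribution) simp
  moreover have "(\<lambda>n. \<integral>x. 1 / (x + q) \<partial>esd_spearman (s n) \<omega>) \<longlonglongrightarrow> mlim q"
    using LIMSEQ_subseq_LIMSEQ[OF esd_spearman_resolvent[OF \<omega> q] s] by (simp add: o_def)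
  ultimately have "integral\<^sup>L \<nu> g = mlim q" by (simp add: LIMSEQ_unique)
  then show "(\<integral>x. 1 / (x + q) \<partial>\<nu>) = mlim q" using geq[OF \<nu> sup] by simp
qed

text \<open>The limit law is extracted from a single regular outcome by tightness. Its resolvents
  are the deterministic numbers \<open>mlim q\<close>, shared by all subsequential limits of all
  regular outcomes, so every such limit coincides with it.\<close>

theorem spearman_limit:
  "\<exists>\<mu>. real_distribution \<mu> \<and>
     (AE \<omega> in M. weak_conv (\<lambda>n. esd (p n) (spearman n (data n \<omega>))) (cdf \<mu>)) \<and>
     (\<forall>z. Im z > 0 \<longrightarrow>
        stieltjes \<mu> z = (\<integral>t. 1 / (complex_of_real t *
            (1 - complex_of_real y - complex_of_real y * z * stieltjes \<mu> z) - z) \<partial>H))"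
proof -
  have "\<exists>\<omega>\<in>space M. regular \<omega>"
  proof (rule ccontr)
    assume "\<not> ?thesis"
    then have "AE \<omega> in M. False" using AE_regular AE_space[of M] by (auto elim: eventually_elim2)
    then show False using AE_False by simp
  qed
  then obtain \<omega>0 where \<omega>0: "regular \<omega>0" by blast
  have sid: "strict_mono (\<lambda>n::nat. n)" by (simp add: strict_mono_def)
  obtain r \<mu> where r: "strict_mono r" and \<mu>: "real_distribution \<mu>"
    and w: "weak_conv_m ((\<lambda>n. esd_spearman n \<omega>0) \<circ> (\<lambda>n. n) \<circ> r) \<mu>"
    using tight_imp_convergent_subsubsequence[OF esd_spearman_tight sid] by blast
  have lim: "AE x in \<mu>. 0 \<le> x" "\<And>q. q \<in> \<rat> \<Longrightarrow> q > 0 \<Longrightarrow> (\<integral>x. 1 / (x + q) \<partial>\<mu>) = mlim q"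
    using esd_spearman_limit[OF \<omega>0 r \<mu>] w by (simp_all add: o_def)
  have conv: "weak_conv (\<lambda>n. esd (p n) (spearman n (data n \<omega>))) (cdf \<mu>)" if \<omega>: "regular \<omega>" for \<omega>
  proof -
    have "weak_conv_m (\<lambda>n. esd_spearman n \<omega>) \<mu>"
    proof (rule tight_subseq_weak_converge[OF esd_spearman_real_distribution \<mu> esd_spearman_tight])
      fix s \<nu> assume s: "strict_mono (s :: nat \<Rightarrow> nat)" "real_distribution \<nu>" "weak_conv_m ((\<lambda>n. esd_spearman n \<omega>) \<circ> s) \<nu>"
      have "\<nu> = \<mu>"
        by (rule real_distribution_eq_of_resolvents[OF s(2) esd_spearman_limit(1)[OF \<omega> s] \<mu> lim(1)])
          (simp add: esd_spearman_limit(2)[OF \<omega> s] lim(2))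
      then show "weak_conv_m ((\<lambda>n. esd_spearman n \<omega>) \<circ> s) \<mu>" using s(3) by simp
    qed
    then have c: "(\<lambda>n. cdf (esd_spearman n \<omega>) x) \<longlonglongrightarrow> cdf \<mu> x" if "isCont (cdf \<mu>) x" for x
      using that by (simp add: weak_conv_m_def weak_conv_def)
    show ?thesis unfolding weak_conv_def
    proof (intro allI impI)
      fix x assume "isCont (cdf \<mu>) x"
      from c[OF this] have "(\<lambda>n. cdf (esd_spearman n \<omega>) x) \<longlonglongrightarrow> cdf \<mu> x" .
      moreover have "\<forall>\<^sub>F n in sequentially. cdf (esd_spearman n \<omega>) x = esd (p n) (spearman n (data n \<omega>)) x"
        using eventually_good
        by eventually_elim (simp add: esd_spearman_def good_def esd_eq_cdf[OF eigs(2,1)[OF spearman_psd]])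
      ultimately show "(\<lambda>n. esd (p n) (spearman n (data n \<omega>)) x) \<longlonglongrightarrow> cdf \<mu> x" by (simp cong: tendsto_cong)
    qed
  qed
  have "AE \<omega> in M. weak_conv (\<lambda>n. esd (p n) (spearman n (data n \<omega>))) (cdf \<mu>)"
    using AE_regular by eventually_elim (rule conv)
  moreover have "stieltjes \<mu> z = (\<integral>t. 1 / (complex_of_real t *
            (1 - complex_of_real y - complex_of_real y * z * stieltjes \<mu> z) - z) \<partial>H)" if "Im z > 0" for z
    by (rule marchenko_pastur_equation[OF \<mu> lim(1) H H_support _ y refl _ _ that])
      (use lim(2) mlim in auto)
  ultimately show ?thesis using \<mu> by (intro exI[of _ \<mu>] conjI) simp_all
qed

end

theorem theorem3:
  fixes M :: "'w measure"
    and p :: "nat \<Rightarrow> nat"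
    and \<Sigma> :: "nat \<Rightarrow> nat \<Rightarrow> nat \<Rightarrow> real"
    and X :: "nat \<Rightarrow> nat \<Rightarrow> nat \<Rightarrow> 'w \<Rightarrow> real"
    and y C :: real
    and H :: "real measure"
  assumes "prob_space M"
    and sym: "\<And>n i j. i < p n \<Longrightarrow> j < p n \<Longrightarrow> \<Sigma> n i j = \<Sigma> n j i"
    and diag: "\<And>n i. i < p n \<Longrightarrow> \<Sigma> n i i = 1"
    and gauss: "\<And>n k. k < n \<Longrightarrow> gaussian_vec M (p n) (\<Sigma> n) (X n k)"
    and indep: "\<And>n. prob_space.indep_vars M (\<lambda>_. Pi\<^sub>M {..<p n} (\<lambda>_. borel))
                   (\<lambda>k \<omega>. restrict (\<lambda>j. X n k j \<omega>) {..<p n}) {..<n}"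
    and ratio: "(\<lambda>n. real (p n) / real n) \<longlonglongrightarrow> y" and "y > 0"
    and norm: "\<And>n. spec_norm_le (p n) (\<Sigma> n) C"
    and "real_distribution H"
    and esdH: "weak_conv (\<lambda>n. esd (p n) (\<lambda>i j. 6 / pi * arcsin (\<Sigma> n i j / 2))) (cdf H)"
  shows "\<exists>\<mu>. real_distribution \<mu> \<and>
           (AE \<omega> in M. weak_conv (\<lambda>n. esd (p n) (spearman n (\<lambda>k j. X n k j \<omega>))) (cdf \<mu>)) \<and>
           (\<forall>z. Im z > 0 \<longrightarrow>
              stieltjes \<mu> z =
                (\<integral>t. 1 / (complex_of_real t *
                       (1 - complex_of_real y - complex_of_real y * z * stieltjes \<mu> z) - z) \<partial>H))"
proof -
  interpret prob_space M by (rule assms(1))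
  interpret spearman_array M p \<Sigma> X y C H
    by (intro spearman_array.intro spearman_array_axioms.intro; fact)
  show ?thesis by (rule spearman_limit)
qed

end
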